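(* Let $\mathbb F$ and $\mathcal D$ be skew fields and let $K$ be a finite simplicial flag complex. Let $G=\mathbf\Gamma^K$ be a graph product of discrete groups such that there is an agrarian map $\mathbb FG\to\mathcal D$. If $H_\bullet(\Gamma;\mathcal D)=0$ for each $\Gamma\in\mathbf\Gamma$, then for all $p$ \[ H_p^{\mathcal D}(\mathbf\Gamma^K)\cong\widetilde H_{p-1}(K;\mathcal D). \] In particular, $b_p^{\mathcal D}(G)=\widetilde b_{p-1}(K;\mathbb F)$.
   Context: For a simplicial complex $K$ with vertex set $\{1,\dots,m\}$ and groups $\mathbf\Gamma=\{\Gamma_1,\dots,\Gamma_m\}$, the graph product $\mathbf\Gamma^K$ is the quotient of the free product $\Gamma_1*\cdots*\Gamma_m$ by the relations $[\gamma_i,\gamma_j]=1$ for $\gamma_i\in\Gamma_i$, $\gamma_j\in\Gamma_j$ with $i,j$ adjacent in $K$. An agrarian map is an injective ring homomorphism $\mathbb FG\hookrightarrow\mathcal D$ into a skew field (agrarian embedding). $H_p^{\mathcal D}(G):=H_p(G;\mathcal D)$, $b_p^{\mathcal D}(G):=\dim_{\mathcal D}H_p^{\mathcal D}(G)$; the homology $H_\bullet(\Gamma;\mathcal D)$ uses the restriction of the map to $\mathbb F\Gamma\subseteq\mathbb FG$. $\widetilde H$, $\widetilde b$ denote reduced homology and its dimension (with $\widetilde H_{-1}(\varnothing)$ one-dimensional). *)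

theory Defs
  imports
    "HOL-Algebra.Algebra"
    "HOL-Algebra.Algebraic_Closure_Type"
    "HOL-Library.Poly_Mapping"
    "HOL-Library.Extended_Nat"
begin

section \<open>Left vector spaces over a skew field\<close>

text \<open>
  Vector spaces are records of type \<open>module\<close>, of which only the carrier, zero, addition and
  scalar multiplication matter. The locale \<open>module\<close> is not used, because it asks for commutative
  scalars.
\<close>

definition free_space :: "'x set \<Rightarrow> ('d::division_ring, 'x \<Rightarrow>\<^sub>0 'd) module" where
  "free_space S =
    \<lparr> carrier = {c. Poly_Mapping.keys c \<subseteq> S},
      monoid.mult = undefined, one = undefined,
      ring.zero = 0, add = (+),
      module.smult = (\<lambda>a. Poly_Mapping.map ((*) a)) \<rparr>"

definition lin_extend ::
    "('x \<Rightarrow> ('y \<Rightarrow>\<^sub>0 'd::division_ring)) \<Rightarrow> ('x \<Rightarrow>\<^sub>0 'd) \<Rightarrow> ('y \<Rightarrow>\<^sub>0 'd)" where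
  "lin_extend b c =
    (\<Sum>x\<in>Poly_Mapping.keys c. Poly_Mapping.map ((*) (Poly_Mapping.lookup c x)) (b x))"

text \<open>
  The union over the representatives makes scalar multiplication by zero return \<open>W\<close>,
  as in \<^const>\<open>rcoset_mult\<close>.
\<close>

definition quot_space :: "('d, 'v) module \<Rightarrow> 'v set \<Rightarrow> ('d, 'v set) module" where
  "quot_space V W =
    \<lparr> carrier = a_rcosets\<^bsub>V\<^esub> W,
      monoid.mult = undefined, one = undefined,
      ring.zero = W, add = (\<lambda>P Q. P <+>\<^bsub>V\<^esub> Q),
      module.smult = (\<lambda>a P. \<Union>x\<in>P. W +>\<^bsub>V\<^esub> (a \<odot>\<^bsub>V\<^esub> x)) \<rparr>"

definition vs_iso :: "('d, 'v) module \<Rightarrow> ('d, 'w) module \<Rightarrow> bool" where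
  "vs_iso V W \<longleftrightarrow>
    (\<exists>h. bij_betw h (carrier V) (carrier W) \<and>
         (\<forall>x\<in>carrier V. \<forall>y\<in>carrier V. h (x \<oplus>\<^bsub>V\<^esub> y) = h x \<oplus>\<^bsub>W\<^esub> h y) \<and>
         (\<forall>a. \<forall>x\<in>carrier V. h (a \<odot>\<^bsub>V\<^esub> x) = a \<odot>\<^bsub>W\<^esub> h x))"

definition vs_basis :: "('d::division_ring, 'v) module \<Rightarrow> 'v set \<Rightarrow> bool" where
  "vs_basis V B \<longleftrightarrow>
    B \<subseteq> carrier V \<and>
    (\<forall>A c. finite A \<and> A \<subseteq> B \<and> (\<Oplus>\<^bsub>V\<^esub> b\<in>A. c b \<odot>\<^bsub>V\<^esub> b) = \<zero>\<^bsub>V\<^esub> \<longrightarrow> (\<forall>b\<in>A. c b = 0)) \<and>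
    (\<forall>x\<in>carrier V. \<exists>A c. finite A \<and> A \<subseteq> B \<and> x = (\<Oplus>\<^bsub>V\<^esub> b\<in>A. c b \<odot>\<^bsub>V\<^esub> b))"

definition vs_dim :: "('d::division_ring, 'v) module \<Rightarrow> enat" where
  "vs_dim V =
    (if \<exists>B. finite B \<and> vs_basis V B
     then enat (card (SOME B. finite B \<and> vs_basis V B)) else \<infinity>)"

text \<open>Complexes are graded by all integers; the differential does not depend on the degree.\<close>

definition complex_homology ::
    "(int \<Rightarrow> ('d, 'v) module) \<Rightarrow> ('v \<Rightarrow> 'v) \<Rightarrow> int \<Rightarrow> ('d, 'v set) module" where
  "complex_homology C d n =
    quot_space ((C n)\<lparr>carrier := {c \<in> carrier (C n). d c = \<zero>\<^bsub>C (n - 1)\<^esub>}\<rparr>)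
      (d ` carrier (C (n + 1)))"


section \<open>Flag complexes and reduced simplicial homology\<close>

text \<open>The empty simplex belongs to every complex.\<close>

definition simplicial_complex :: "'v set \<Rightarrow> 'v set set \<Rightarrow> bool" where
  "simplicial_complex V K \<longleftrightarrow>
    (\<forall>\<sigma>\<in>K. finite \<sigma> \<and> \<sigma> \<subseteq> V) \<and> {} \<in> K \<and> (\<forall>v\<in>V. {v} \<in> K) \<and>
    (\<forall>\<sigma>\<in>K. \<forall>\<tau>. \<tau> \<subseteq> \<sigma> \<longrightarrow> \<tau> \<in> K)"

definition adjacent :: "'v set set \<Rightarrow> 'v \<Rightarrow> 'v \<Rightarrow> bool" where
  "adjacent K v w \<longleftrightarrow> v \<noteq> w \<and> {v, w} \<in> K"

definition flag :: "'v set \<Rightarrow> 'v set set \<Rightarrow> bool" where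
  "flag V K \<longleftrightarrow>
    (\<forall>\<sigma>. finite \<sigma> \<and> \<sigma> \<subseteq> V \<and> (\<forall>v\<in>\<sigma>. \<forall>w\<in>\<sigma>. v \<noteq> w \<longrightarrow> adjacent K v w) \<longrightarrow> \<sigma> \<in> K)"

text \<open>
  The augmented simplicial chain complex, simplices being oriented by the order of the vertices.
  The empty simplex has degree \<open>-1\<close>.
\<close>

definition simplicial_chains ::
    "'v set set \<Rightarrow> int \<Rightarrow> ('d::division_ring, 'v set \<Rightarrow>\<^sub>0 'd) module" where
  "simplicial_chains K q = free_space {\<sigma>\<in>K. int (card \<sigma>) = q + 1}"

definition simplex_boundary :: "'v::linorder set \<Rightarrow> ('v set \<Rightarrow>\<^sub>0 'd::division_ring)" where
  "simplex_boundary \<sigma> = (\<Sum>v\<in>\<sigma>. Poly_Mapping.single (\<sigma> - {v}) ((- 1) ^ card {w\<in>\<sigma>. w < v}))"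

definition reduced_simplicial_homology ::
    "'v::linorder set set \<Rightarrow> int \<Rightarrow> ('d::division_ring, ('v set \<Rightarrow>\<^sub>0 'd) set) module" where
  "reduced_simplicial_homology K =
    complex_homology (simplicial_chains K) (lin_extend simplex_boundary)"


section \<open>Group rings and agrarian maps\<close>

definition group_ring :: "('g, 'b) monoid_scheme \<Rightarrow> ('g \<Rightarrow>\<^sub>0 'f::ring_1) ring" where
  "group_ring G =
    \<lparr> carrier = {x. Poly_Mapping.keys x \<subseteq> carrier G},
      monoid.mult = (\<lambda>x y. \<Sum>g\<in>Poly_Mapping.keys x. \<Sum>h\<in>Poly_Mapping.keys y.
        Poly_Mapping.single (g \<otimes>\<^bsub>G\<^esub> h) (Poly_Mapping.lookup x g * Poly_Mapping.lookup y h)),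
      one = Poly_Mapping.single \<one>\<^bsub>G\<^esub> 1,
      ring.zero = 0, add = (+) \<rparr>"

definition group_ring_map :: "('g \<Rightarrow> 'h) \<Rightarrow> ('g \<Rightarrow>\<^sub>0 'f::ring_1) \<Rightarrow> ('h \<Rightarrow>\<^sub>0 'f)" where
  "group_ring_map f x =
    (\<Sum>g\<in>Poly_Mapping.keys x. Poly_Mapping.single (f g) (Poly_Mapping.lookup x g))"

definition agrarian_map ::
    "('g, 'b) monoid_scheme \<Rightarrow> (('g \<Rightarrow>\<^sub>0 'f::division_ring) \<Rightarrow> 'd::division_ring) \<Rightarrow> bool" where
  "agrarian_map G \<phi> \<longleftrightarrow>
    \<phi> \<in> ring_hom (group_ring G) ring_of_type_algebra \<and> inj_on \<phi> (carrier (group_ring G))"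


section \<open>Group homology with coefficients in a skew field\<close>

text \<open>
  For a ring homomorphism \<open>\<phi>\<close> from the group ring of \<open>G\<close> to \<open>'d\<close>, the skew field \<open>'d\<close> is a
  right module over the group ring, and the complex below is the tensor product over \<open>G\<close> of \<open>'d\<close>
  with the bar resolution:
  \<open>d (a [g1|...|gn]) = a \<phi>(g1) [g2|...|gn] + (\<Sum>i=1..<n. (-1)^i a [...|gi g(i+1)|...])
     + (-1)^n a [g1|...|g(n-1)]\<close>.
  It is a complex of left vector spaces over \<open>'d\<close>.
\<close>

definition bar_chains ::
    "('g, 'b) monoid_scheme \<Rightarrow> int \<Rightarrow> ('d::division_ring, 'g list \<Rightarrow>\<^sub>0 'd) module" where
  "bar_chains G n = free_space {gs. set gs \<subseteq> carrier G \<and> int (length gs) = n}"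

definition bar_boundary ::
    "('g, 'b) monoid_scheme \<Rightarrow> (('g \<Rightarrow>\<^sub>0 'f::ring_1) \<Rightarrow> 'd::division_ring) \<Rightarrow>
      'g list \<Rightarrow> ('g list \<Rightarrow>\<^sub>0 'd)" where
  "bar_boundary G \<phi> gs =
    (if gs = [] then 0
     else Poly_Mapping.single (tl gs) (\<phi> (Poly_Mapping.single (hd gs) 1))
       + (\<Sum>i = 1..<length gs. Poly_Mapping.single
            (take (i - 1) gs @ [gs ! (i - 1) \<otimes>\<^bsub>G\<^esub> gs ! i] @ drop (i + 1) gs) ((- 1) ^ i))
       + Poly_Mapping.single (butlast gs) ((- 1) ^ length gs))"

definition group_homology ::
    "('g, 'b) monoid_scheme \<Rightarrow> (('g \<Rightarrow>\<^sub>0 'f::ring_1) \<Rightarrow> 'd::division_ring) \<Rightarrow>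
      int \<Rightarrow> ('d, ('g list \<Rightarrow>\<^sub>0 'd) set) module" where
  "group_homology G \<phi> = complex_homology (bar_chains G) (lin_extend (bar_boundary G \<phi>))"



section \<open>Free products and graph products\<close>

definition fp_words :: "'i set \<Rightarrow> ('i \<Rightarrow> ('g, 'b) monoid_scheme) \<Rightarrow> ('i \<times> 'g) list set" where
  "fp_words I \<Gamma> = {ws. \<forall>(i, g)\<in>set ws. i \<in> I \<and> g \<in> carrier (\<Gamma> i)}"

inductive fp_step ::
    "'i set \<Rightarrow> ('i \<Rightarrow> ('g, 'b) monoid_scheme) \<Rightarrow> ('i \<times> 'g) list \<Rightarrow> ('i \<times> 'g) list \<Rightarrow> bool"
  for I \<Gamma> where
  fp_unit: "i \<in> I \<Longrightarrow> fp_step I \<Gamma> (u @ [(i, \<one>\<^bsub>\<Gamma> i\<^esub>)] @ v) (u @ v)"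
| fp_mult: "i \<in> I \<Longrightarrow> g \<in> carrier (\<Gamma> i) \<Longrightarrow> h \<in> carrier (\<Gamma> i) \<Longrightarrow>
    fp_step I \<Gamma> (u @ [(i, g), (i, h)] @ v) (u @ [(i, g \<otimes>\<^bsub>\<Gamma> i\<^esub> h)] @ v)"

definition fp_rel ::
    "'i set \<Rightarrow> ('i \<Rightarrow> ('g, 'b) monoid_scheme) \<Rightarrow> (('i \<times> 'g) list \<times> ('i \<times> 'g) list) set" where
  "fp_rel I \<Gamma> = {(u, v). u \<in> fp_words I \<Gamma> \<and> v \<in> fp_words I \<Gamma> \<and> equivclp (fp_step I \<Gamma>) u v}"

definition free_product ::
    "'i set \<Rightarrow> ('i \<Rightarrow> ('g, 'b) monoid_scheme) \<Rightarrow> ('i \<times> 'g) list set monoid" where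
  "free_product I \<Gamma> =
    \<lparr> carrier = fp_words I \<Gamma> // fp_rel I \<Gamma>,
      monoid.mult = (\<lambda>P Q. \<Union>u\<in>P. \<Union>v\<in>Q. fp_rel I \<Gamma> `` {u @ v}),
      one = fp_rel I \<Gamma> `` {[]} \<rparr>"

definition fp_incl ::
    "'i set \<Rightarrow> ('i \<Rightarrow> ('g, 'b) monoid_scheme) \<Rightarrow> 'i \<Rightarrow> 'g \<Rightarrow> ('i \<times> 'g) list set" where
  "fp_incl I \<Gamma> i g = fp_rel I \<Gamma> `` {[(i, g)]}"

definition normal_closure :: "('g, 'b) monoid_scheme \<Rightarrow> 'g set \<Rightarrow> 'g set" where
  "normal_closure G R = \<Inter>{N. N \<lhd> G \<and> R \<subseteq> N}"

definition gp_relators ::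
    "'i set \<Rightarrow> 'i set set \<Rightarrow> ('i \<Rightarrow> ('g, 'b) monoid_scheme) \<Rightarrow> ('i \<times> 'g) list set set" where
  "gp_relators V K \<Gamma> =
    {x \<otimes>\<^bsub>free_product V \<Gamma>\<^esub> y \<otimes>\<^bsub>free_product V \<Gamma>\<^esub> inv\<^bsub>free_product V \<Gamma>\<^esub> x
        \<otimes>\<^bsub>free_product V \<Gamma>\<^esub> inv\<^bsub>free_product V \<Gamma>\<^esub> y | x y.
      \<exists>i\<in>V. \<exists>j\<in>V. adjacent K i j \<and>
        x \<in> fp_incl V \<Gamma> i ` carrier (\<Gamma> i) \<and> y \<in> fp_incl V \<Gamma> j ` carrier (\<Gamma> j)}"

definition graph_product ::
    "'i set \<Rightarrow> 'i set set \<Rightarrow> ('i \<Rightarrow> ('g, 'b) monoid_scheme) \<Rightarrow> ('i \<times> 'g) list set set monoid" where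
  "graph_product V K \<Gamma> =
    free_product V \<Gamma> Mod normal_closure (free_product V \<Gamma>) (gp_relators V K \<Gamma>)"

definition gp_incl ::
    "'i set \<Rightarrow> 'i set set \<Rightarrow> ('i \<Rightarrow> ('g, 'b) monoid_scheme) \<Rightarrow> 'i \<Rightarrow> 'g \<Rightarrow>
      ('i \<times> 'g) list set set" where
  "gp_incl V K \<Gamma> i g =
    normal_closure (free_product V \<Gamma>) (gp_relators V K \<Gamma>) #>\<^bsub>free_product V \<Gamma>\<^esub> fp_incl V \<Gamma> i g"

text \<open>
  Along the canonical homomorphism from a vertex group to the graph product (which is injective),
  a map on the group ring of the graph product restricts to the group ring of the vertex group.
\<close>

definition vertex_restrict ::
    "'i set \<Rightarrow> 'i set set \<Rightarrow> ('i \<Rightarrow> ('g, 'b) monoid_scheme) \<Rightarrow>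
      ((('i \<times> 'g) list set set \<Rightarrow>\<^sub>0 'f::ring_1) \<Rightarrow> 'd) \<Rightarrow> 'i \<Rightarrow> ('g \<Rightarrow>\<^sub>0 'f) \<Rightarrow> 'd" where
  "vertex_restrict V K \<Gamma> \<phi> i = \<phi> \<circ> group_ring_map (gp_incl V K \<Gamma> i)"

end

theory Submission
  imports Defs
begin

text \<open>
  The homology of \<open>G\<close> with coefficients in \<open>'d\<close> is computed by the bar complex, whose basis consists
  of the lists over \<open>G\<close>. A simplex \<open>\<sigma>\<close> of \<open>K\<close> is a clique, so the subgroup \<open>sub \<sigma>\<close> of \<open>G\<close>
  generated by the vertex groups of \<open>\<sigma>\<close> is their direct product, and its bar complex is exact as
  soon as \<open>\<sigma> \<noteq> {}\<close>, because that of a single factor is. This permits choosing, by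
  recursion on the size of \<open>\<sigma>\<close>, a bar chain \<open>z\<^sub>\<sigma>\<close> over \<open>sub \<sigma>\<close> of degree \<open>card \<sigma>\<close> that
  starts with the empty list at \<open>\<sigma> = {}\<close> and satisfies \<open>bar z\<^sub>\<sigma> = z(\<partial> \<sigma>)\<close>: the right-hand side is
  a cycle, hence a boundary. The linear extension of \<open>z\<close> (below: \<open>simplex_chain\<close>) is a chain map from the
  augmented simplicial complex of \<open>K\<close>, shifted by one, to the bar complex of \<open>G\<close>. The theorem is
  that \<open>z\<close> is a quasi-isomorphism, that is, that its mapping cone is exact.

  Exactness of the cone is proved for the full subcomplex on every set \<open>W\<close> of vertices and the
  subgroup \<open>sub W\<close> at once (\<open>cone_cells_exact\<close>), by induction on the size of \<open>W\<close>. For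
  \<open>W = {}\<close> the group is trivial and there is an explicit contraction. If some vertex \<open>v\<close> of \<open>W\<close> is
  adjacent to all the others, then both halves of the cone are exact: the subcomplex is a
  simplicial cone by flagness, and \<open>sub W\<close> has the direct factor \<open>sub {v}\<close> with exact bar
  complex (\<open>direct_product_exact\<close>). Otherwise, let \<open>L\<close> be the set of neighbours of \<open>v\<close> in \<open>W\<close>,
  and put \<open>A = W - {v}\<close>, \<open>B = L \<union> {v}\<close>, so that \<open>A \<inter> B = L\<close>. All three are smaller than \<open>W\<close>. Every
  simplex on \<open>W\<close> lies in \<open>A\<close> or in \<open>B\<close>, and \<open>sub W\<close> is the amalgam of \<open>sub A\<close> and \<open>sub B\<close> over \<open>sub L\<close>.
  By Mayer-Vietoris the span of the cones of \<open>A\<close> and \<open>B\<close> is exact, and it is left to see that the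
  bar complex of \<open>sub W\<close> is exact relative to the sum of the bar complexes of \<open>sub A\<close> and \<open>sub B\<close>
  (\<open>amalgam_relative\<close>).

  The two group-theoretic steps are double complex arguments, carried out with one filtration lemma
  (\<open>exact_on_filtered\<close>) instead of spectral sequences. In homogeneous coordinates the bar complex of
  \<open>G\<close> is the complex of coinvariants of the nonempty tuples over \<open>G\<close>, and one enlarges
  these tuples by a second family of tuples on which \<open>G\<close> also acts. For an amalgam the second
  family consists of the tuples contained in a coset of \<open>A\<close> or of \<open>B\<close>; it is exact because
  the Bass-Serre graph, with vertices the cosets of \<open>A\<close> and of \<open>B\<close> and edges the cosets of \<open>A \<inter> B\<close>, is a
  tree. Connectedness of this graph is the fact that \<open>A\<close> and \<open>B\<close> generate. The absence of cycles is the
  existence of a derivation of \<open>sub W\<close> that assigns to \<open>g\<close> the path from \<open>A\<close> to \<open>gA\<close> (\<open>derivation_ex\<close>); it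
  comes from the universal property of the graph product, applied to a semidirect product. In this way no normal
  form for the elements of a graph product enters; the intersections of the subgroups \<open>sub W\<close> come
  from the retractions of \<open>G\<close> that kill the vertex groups outside a given set.

  For the equality of dimensions, the simplicial boundary has integral coefficients, so a family of
  cycles over \<open>'f\<close> that represents a basis of the reduced homology over \<open>'f\<close> still does so over
  \<open>'d\<close> (\<open>homology_basis_ext\<close>), and \<open>z\<close> carries it to a basis of the group homology.
\<close>

section \<open>Chains and their linear extensions\<close>

abbreviation smul :: "'d::division_ring \<Rightarrow> ('x \<Rightarrow>\<^sub>0 'd) \<Rightarrow> ('x \<Rightarrow>\<^sub>0 'd)" where
  "smul a \<equiv> Poly_Mapping.map ((*) a)"

abbreviation gen :: "'x \<Rightarrow> ('x \<Rightarrow>\<^sub>0 'd::division_ring)" where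
  "gen x \<equiv> Poly_Mapping.single x 1"

definition supported :: "'x set \<Rightarrow> ('x \<Rightarrow>\<^sub>0 'd::division_ring) set" where
  "supported S = {c. Poly_Mapping.keys c \<subseteq> S}"

definition push :: "('x \<Rightarrow> 'y) \<Rightarrow> ('x \<Rightarrow>\<^sub>0 'd::division_ring) \<Rightarrow> ('y \<Rightarrow>\<^sub>0 'd)" where
  "push f = lin_extend (\<lambda>x. gen (f x))"

definition restr :: "'x set \<Rightarrow> ('x \<Rightarrow>\<^sub>0 'd::division_ring) \<Rightarrow> ('x \<Rightarrow>\<^sub>0 'd)" where
  "restr S = lin_extend (\<lambda>x. if x \<in> S then gen x else 0)"

lemma lookup_smul [simp]: "Poly_Mapping.lookup (smul a c) x = a * Poly_Mapping.lookup c x"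
  by (simp add: Poly_Mapping.map.rep_eq when_def)

lemma smul_simps [simp]:
  "smul a 0 = 0" "smul 0 c = 0" "smul 1 c = c" "smul a (smul b c) = smul (a * b) c"
  "smul a (- c) = - smul a c" "smul (- 1) c = - c"
  "smul a (Poly_Mapping.single x b) = Poly_Mapping.single x (a * b)"
  by (rule poly_mapping_eqI; simp add: lookup_single when_def mult.assoc)+

lemma smul_lambda_simps [simp]:
  "Poly_Mapping.map (\<lambda>a. a) c = c" "Poly_Mapping.map (\<lambda>a. 0) c = 0"
  by (rule poly_mapping_eqI; simp add: Poly_Mapping.map.rep_eq when_def)+

lemma smul_distribs:
  "smul a (c + c') = smul a c + smul a c'" "smul a (c - c') = smul a c - smul a c'"
  "smul (a + b) c = smul a c + smul b c" "smul (a - b) c = smul a c - smul b c"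
  by (rule poly_mapping_eqI; simp add: lookup_add lookup_minus algebra_simps)+

lemma smul_uminus: "smul (- a) c = - smul a c"
  by (rule poly_mapping_eqI) simp

lemma smul_sum: "smul a (\<Sum>i\<in>I. f i) = (\<Sum>i\<in>I. smul a (f i))"
  by (induction I rule: infinite_finite_induct) (simp_all add: smul_distribs)

lemma lin_extend_superset:
  assumes "finite A" "Poly_Mapping.keys c \<subseteq> A"
  shows "lin_extend b c = (\<Sum>x\<in>A. smul (Poly_Mapping.lookup c x) (b x))"
  unfolding lin_extend_def using assms
  by (intro sum.mono_neutral_left) (auto simp: in_keys_iff)

lemma lin_extend_zero [simp]: "lin_extend b 0 = 0"
  by (simp add: lin_extend_def)

lemma lin_extend_single [simp]: "lin_extend b (Poly_Mapping.single x a) = smul a (b x)"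
  by (cases "a = 0") (auto simp: lin_extend_def)

lemma lin_extend_add: "lin_extend b (c + c') = lin_extend b c + lin_extend b c'"
proof -
  let ?A = "Poly_Mapping.keys c \<union> Poly_Mapping.keys c'"
  have "Poly_Mapping.keys (c + c') \<subseteq> ?A" by (rule keys_add)
  then have "lin_extend b (c + c') = (\<Sum>x\<in>?A. smul (Poly_Mapping.lookup (c + c') x) (b x))"
    by (intro lin_extend_superset) auto
  also have "\<dots> = lin_extend b c + lin_extend b c'"
    by (subst (1 2) lin_extend_superset[of ?A])
      (auto simp: lookup_add smul_distribs sum.distrib)
  finally show ?thesis .
qed

lemma lin_extend_smul: "lin_extend b (smul a c) = smul a (lin_extend b c)"
proof -
  have "Poly_Mapping.keys (smul a c) \<subseteq> Poly_Mapping.keys c" by (auto simp: in_keys_iff)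
  then have "lin_extend b (smul a c)
      = (\<Sum>x\<in>Poly_Mapping.keys c. smul (Poly_Mapping.lookup (smul a c) x) (b x))"
    by (intro lin_extend_superset) auto
  then show ?thesis by (simp add: lin_extend_def smul_sum)
qed

lemma lin_extend_uminus: "lin_extend b (- c) = - lin_extend b c"
  using lin_extend_smul[of b "- 1" c] by simp

lemma lin_extend_diff: "lin_extend b (c - c') = lin_extend b c - lin_extend b c'"
  using lin_extend_add[of b c "- c'"] by (simp add: lin_extend_uminus)

lemma lin_extend_sum: "lin_extend b (\<Sum>i\<in>I. f i) = (\<Sum>i\<in>I. lin_extend b (f i))"
  by (induction I rule: infinite_finite_induct) (simp_all add: lin_extend_add)

lemmas lin_extend_linear =
  lin_extend_add lin_extend_smul lin_extend_uminus lin_extend_diff lin_extend_sum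

lemma lin_extend_cong:
  assumes "\<And>x. x \<in> Poly_Mapping.keys c \<Longrightarrow> b x = b' x"
  shows "lin_extend b c = lin_extend b' c"
  unfolding lin_extend_def using assms by (intro sum.cong) auto

lemma lin_extend_compose:
  "lin_extend b (lin_extend b' c) = lin_extend (\<lambda>x. lin_extend b (b' x)) c"
  unfolding lin_extend_def[of b' c] lin_extend_def[of "\<lambda>x. lin_extend b (b' x)" c]
  by (simp add: lin_extend_linear)

lemma lin_extend_fun_add: "lin_extend (\<lambda>x. b x + b' x) c = lin_extend b c + lin_extend b' c"
  by (simp add: lin_extend_def smul_distribs sum.distrib)

lemma lin_extend_fun_uminus: "lin_extend (\<lambda>x. - b x) c = - lin_extend b c"
  by (simp add: lin_extend_def sum_negf)

lemma lin_extend_fun_diff: "lin_extend (\<lambda>x. b x - b' x) c = lin_extend b c - lin_extend b' c"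
  by (simp add: lin_extend_def smul_distribs sum_subtractf)

lemma lin_extend_fun_zero [simp]: "lin_extend (\<lambda>x. 0) c = 0"
  by (simp add: lin_extend_def)

lemma lin_extend_gen: "lin_extend gen c = c"
proof (rule poly_mapping_eqI)
  fix x
  show "Poly_Mapping.lookup (lin_extend gen c) x = Poly_Mapping.lookup c x"
    by (auto simp: lin_extend_def lookup_sum lookup_single when_def in_keys_iff)
qed

lemma supported_simps [simp]:
  "0 \<in> supported S"
  "Poly_Mapping.single x a \<in> supported S \<longleftrightarrow> a = 0 \<or> x \<in> S"
  "- c \<in> supported S \<longleftrightarrow> c \<in> supported S"
  by (auto simp: supported_def)

lemma supported_add: "c \<in> supported S \<Longrightarrow> c' \<in> supported S \<Longrightarrow> c + c' \<in> supported S"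
  using keys_add[of c c'] by (auto simp: supported_def)

lemma supported_diff: "c \<in> supported S \<Longrightarrow> c' \<in> supported S \<Longrightarrow> c - c' \<in> supported S"
  using supported_add[of c S "- c'"] by simp

lemma supported_smul: "c \<in> supported S \<Longrightarrow> smul a c \<in> supported S"
  by (auto simp: supported_def in_keys_iff)

lemma supported_sum: "(\<And>i. i \<in> I \<Longrightarrow> f i \<in> supported S) \<Longrightarrow> (\<Sum>i\<in>I. f i) \<in> supported S"
  by (induction I rule: infinite_finite_induct) (auto intro: supported_add)

lemma supported_lin_extend:
  assumes "c \<in> supported S" "\<And>x. x \<in> S \<Longrightarrow> b x \<in> supported T"
  shows "lin_extend b c \<in> supported T"
  unfolding lin_extend_def using assms
  by (intro supported_sum supported_smul) (auto simp: supported_def)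

lemma supported_mono: "c \<in> supported S \<Longrightarrow> S \<subseteq> T \<Longrightarrow> c \<in> supported T"
  by (auto simp: supported_def)

lemma lin_extend_cong_supported:
  assumes "c \<in> supported S" "\<And>x. x \<in> S \<Longrightarrow> b x = b' x"
  shows "lin_extend b c = lin_extend b' c"
  using assms by (intro lin_extend_cong) (auto simp: supported_def)

lemma lin_extend_eq_zero:
  assumes "c \<in> supported S" "\<And>x. x \<in> S \<Longrightarrow> b x = 0"
  shows "lin_extend b c = 0"
  using lin_extend_cong_supported[of c S b "\<lambda>x. 0"] assms by simp

lemma lin_extend_eq_self:
  assumes "c \<in> supported S" "\<And>x. x \<in> S \<Longrightarrow> b x = gen x"
  shows "lin_extend b c = c"
  using lin_extend_cong_supported[of c S b gen] assms by (simp add: lin_extend_gen)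

lemma supported_Int: "c \<in> supported S \<Longrightarrow> c \<in> supported T \<Longrightarrow> c \<in> supported (S \<inter> T)"
  by (auto simp: supported_def)

lemma supported_empty: "c \<in> supported {} \<longleftrightarrow> c = 0"
  by (auto simp: supported_def)

lemma push_simps [simp]:
  "push f 0 = 0" "push f (Poly_Mapping.single x a) = Poly_Mapping.single (f x) a"
  by (simp_all add: push_def)

lemma push_push: "push f (push g c) = push (\<lambda>x. f (g x)) c"
  by (simp add: push_def lin_extend_compose)

lemma lin_extend_push: "lin_extend b (push f c) = lin_extend (\<lambda>x. b (f x)) c"
  by (simp add: push_def lin_extend_compose)

lemmas push_linear = lin_extend_linear[where b = "\<lambda>x. gen (f x)" for f, folded push_def]

lemma push_lin_extend: "push f (lin_extend b c) = lin_extend (\<lambda>x. push f (b x)) c"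
  by (simp add: push_def lin_extend_compose)

lemma supported_push: "c \<in> supported S \<Longrightarrow> (\<And>x. x \<in> S \<Longrightarrow> f x \<in> T) \<Longrightarrow> push f c \<in> supported T"
  unfolding push_def by (rule supported_lin_extend) auto

lemma push_cong_supported:
  "c \<in> supported S \<Longrightarrow> (\<And>x. x \<in> S \<Longrightarrow> f x = g x) \<Longrightarrow> push f c = push g c"
  unfolding push_def by (rule lin_extend_cong_supported) auto

lemma push_ident: "c \<in> supported S \<Longrightarrow> (\<And>x. x \<in> S \<Longrightarrow> f x = x) \<Longrightarrow> push f c = c"
  unfolding push_def by (rule lin_extend_eq_self) auto

lemma push_inj_on_eq_0:
  assumes "inj_on f S" "c \<in> supported S" "push f c = 0"
  shows "c = 0"
proof -
  have "push (inv_into S f) (push f c) = c"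
    unfolding push_push by (rule push_ident[OF assms(2)]) (simp add: assms(1))
  then show ?thesis using assms(3) by simp
qed

lemma restr_simps [simp]:
  "restr S 0 = 0" "restr S (Poly_Mapping.single x a) = (if x \<in> S then Poly_Mapping.single x a else 0)"
  by (simp_all add: restr_def)

lemmas restr_linear = lin_extend_linear[where b = "\<lambda>x. if x \<in> S then gen x else 0" for S, folded restr_def]

lemma restr_lin_extend: "restr S (lin_extend b c) = lin_extend (\<lambda>x. restr S (b x)) c"
  by (simp add: restr_def lin_extend_compose)

lemma lin_extend_restr: "lin_extend b (restr S c) = lin_extend (\<lambda>x. if x \<in> S then b x else 0) c"
  unfolding restr_def lin_extend_compose by (rule lin_extend_cong) auto

lemma restr_ident: "c \<in> supported S \<Longrightarrow> restr S c = c"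
  unfolding restr_def by (rule lin_extend_eq_self) auto

lemma restr_eq_0: "c \<in> supported T \<Longrightarrow> S \<inter> T = {} \<Longrightarrow> restr S c = 0"
  unfolding restr_def by (rule lin_extend_eq_zero) auto

lemma supported_restr: "c \<in> supported T \<Longrightarrow> restr S c \<in> supported (S \<inter> T)"
  unfolding restr_def by (rule supported_lin_extend) auto

lemma supported_restr' [simp]: "restr S c \<in> supported S"
  using supported_restr[of c UNIV S] by (simp add: supported_def)

lemma supported_minus_restr: "c \<in> supported T \<Longrightarrow> c - restr S c \<in> supported (T - S)"
proof -
  assume "c \<in> supported T"
  then have "lin_extend (\<lambda>x. gen x - (if x \<in> S then gen x else 0)) c \<in> supported (T - S)"
    by (rule supported_lin_extend) auto
  then show ?thesis by (simp add: restr_def lin_extend_fun_diff lin_extend_gen)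
qed

lemma restr_eq_0_imp: "restr S c = 0 \<Longrightarrow> c \<in> supported T \<Longrightarrow> c \<in> supported (T - S)"
  using supported_minus_restr[of c T S] by simp

lemma sum_restr:
  assumes "finite I" "\<And>x. x \<in> Poly_Mapping.keys c \<Longrightarrow> f x \<in> I"
  shows "(\<Sum>i\<in>I. restr {x. f x = i} c) = c"
proof -
  have "(\<Sum>i\<in>I. restr {x. f x = i} c) = lin_extend (\<lambda>x. \<Sum>i\<in>I. if x \<in> {x. f x = i} then gen x else 0) c"
    unfolding restr_def lin_extend_def
    by (simp add: smul_sum sum.swap[of _ I])
  also have "\<dots> = lin_extend gen c"
    using assms by (intro lin_extend_cong) (simp add: sum.delta)
  finally show ?thesis by (simp add: lin_extend_gen)
qed


section \<open>Exactness of based complexes\<close>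

text \<open>
  A complex is given by a basis \<open>S\<close> and the boundaries \<open>b\<close> of its elements; exactness is that of the total
  complex, without a grading, so that joins and cones with their own shifts are
  covered as well.
\<close>

definition exact_on :: "('x \<Rightarrow> ('x \<Rightarrow>\<^sub>0 'd::division_ring)) \<Rightarrow> 'x set \<Rightarrow> bool" where
  "exact_on b S \<longleftrightarrow>
    (\<forall>c\<in>supported S. lin_extend b c = 0 \<longrightarrow> (\<exists>u\<in>supported S. c = lin_extend b u))"

lemma exact_onD:
  "exact_on b S \<Longrightarrow> c \<in> supported S \<Longrightarrow> lin_extend b c = 0 \<Longrightarrow> \<exists>u\<in>supported S. c = lin_extend b u"
  by (simp add: exact_on_def)

lemma exact_on_empty [simp]: "exact_on b {}"
  by (auto simp: exact_on_def supported_empty)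

lemma exact_on_contraction:
  assumes "\<And>x. x \<in> S \<Longrightarrow> s x \<in> supported S"
    and "\<And>x. x \<in> S \<Longrightarrow> lin_extend b (s x) + lin_extend s (b x) = gen x"
  shows "exact_on b S"
  unfolding exact_on_def
proof (intro ballI impI)
  fix c :: "'a \<Rightarrow>\<^sub>0 'b" assume c: "c \<in> supported S" "lin_extend b c = 0"
  have "lin_extend b (lin_extend s c) + lin_extend s (lin_extend b c)
      = lin_extend (\<lambda>x. lin_extend b (s x) + lin_extend s (b x)) c"
    by (simp add: lin_extend_compose lin_extend_fun_add)
  also have "\<dots> = c" using c assms(2) by (intro lin_extend_eq_self)
  finally have "c = lin_extend b (lin_extend s c)" using c(2) by simp
  then show "\<exists>u\<in>supported S. c = lin_extend b u"
    using supported_lin_extend[of c S s S] c assms(1) by blast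
qed

text \<open>
  An isomorphism of bases transports exactness even if it changes the differential by a global sign,
  as passing to a join with a fixed list does.
\<close>

lemma exact_on_image:
  assumes ex: "exact_on b S" and inj: "inj_on f S"
    and sgn: "e = 1 \<or> e = - 1"
    and bS: "\<And>x. x \<in> S \<Longrightarrow> b x \<in> supported S"
    and comm: "\<And>x. x \<in> S \<Longrightarrow> b' (f x) = smul e (push f (b x))"
  shows "exact_on b' (f ` S)"
  unfolding exact_on_def
proof (intro ballI impI)
  fix c assume c: "c \<in> supported (f ` S)" "lin_extend b' c = 0"
  define g where "g = inv_into S f"
  have gf: "g (f x) = x" if "x \<in> S" for x using that inj by (simp add: g_def)
  have ee: "e * e = 1" using sgn by auto
  have es: "e * a = a * e" for a using sgn by auto
  have push: "lin_extend b' (push f u) = smul e (push f (lin_extend b u))" if "u \<in> supported S" for u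
  proof -
    have "lin_extend b' (push f u) = lin_extend (\<lambda>x. smul e (push f (b x))) u"
      unfolding lin_extend_push using that comm by (intro lin_extend_cong_supported) auto
    also have "\<dots> = smul e (push f (lin_extend b u))"
      unfolding push_lin_extend by (simp add: lin_extend_def smul_sum es)
    finally show ?thesis .
  qed
  have gc: "push g c \<in> supported S" using c(1) by (rule supported_push) (auto simp: gf)
  have fg: "push f (push g c) = c"
    unfolding push_push using c(1) by (rule push_ident) (auto simp: gf)
  have "smul e (push f (lin_extend b (push g c))) = 0" using push[OF gc] fg c(2) by simp
  then have "smul (e * e) (push f (lin_extend b (push g c))) = 0"
    by (metis smul_simps(1,4))
  then have "push f (lin_extend b (push g c)) = 0" by (simp add: ee)
  moreover have "lin_extend b (push g c) \<in> supported S" using gc bS by (rule supported_lin_extend)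
  ultimately have "lin_extend b (push g c) = 0" using inj push_inj_on_eq_0 by blast
  then obtain u where u: "u \<in> supported S" "push g c = lin_extend b u"
    using exact_onD[OF ex gc] by blast
  have "c = lin_extend b' (push f (smul e u))"
    using push[of "smul e u"] u fg
    by (simp add: supported_smul lin_extend_smul push_linear ee)
  moreover have "push f (smul e u) \<in> supported (f ` S)"
    using u by (intro supported_push[of _ S]) (auto intro: supported_smul)
  ultimately show "\<exists>u\<in>supported (f ` S). c = lin_extend b' u" by blast
qed

text \<open>
  This replaces the spectral sequence of a filtered complex. The basis is divided into blocks by \<open>\<kappa>\<close>; \<open>b\<close> is
  the sum of a differential \<open>b_top\<close> inside the blocks and a part that lowers the rank of the block.
  For a cycle, the components in the blocks of top rank are cycles for \<open>b_top\<close>, hence \<open>b_top\<close>-boundaries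
  of some \<open>v\<close>; subtracting \<open>b v\<close> lowers the top rank, and chains have finite support.
\<close>

lemma exact_on_filtered:
  fixes \<kappa> :: "'x \<Rightarrow> 'k" and r :: "'k \<Rightarrow> nat"
  assumes bS: "\<And>x. x \<in> S \<Longrightarrow> b x \<in> supported S"
    and bb: "\<And>x. x \<in> S \<Longrightarrow> lin_extend b (b x) = 0"
    and b_top: "\<And>x. x \<in> S \<Longrightarrow> b_top x \<in> supported {y\<in>S. \<kappa> y = \<kappa> x}"
    and low: "\<And>x. x \<in> S \<Longrightarrow> b x - b_top x \<in> supported {y\<in>S. r (\<kappa> y) < r (\<kappa> x)}"
    and ex: "\<And>k. exact_on b_top {x\<in>S. \<kappa> x = k}"
  shows "exact_on b S"
proof -
  have "\<forall>c\<in>supported {x\<in>S. r (\<kappa> x) < n}. lin_extend b c = 0 \<longrightarrow> (\<exists>u\<in>supported S. c = lin_extend b u)" for n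
  proof (induction n)
    case 0
    have "\<exists>u\<in>supported S. 0 = lin_extend b u" by (rule bexI[of _ 0]) simp_all
    then show ?case by (simp add: supported_empty)
  next
    case (Suc n)
    show ?case
    proof (intro ballI impI)
      fix c assume c: "c \<in> supported {x\<in>S. r (\<kappa> x) < Suc n}" "lin_extend b c = 0"
      define I where "I = {k. r k = n} \<inter> \<kappa> ` Poly_Mapping.keys c"
      have finI: "finite I" by (simp add: I_def)
      have "\<exists>u\<in>supported {x\<in>S. \<kappa> x = k}. restr {x. \<kappa> x = k} c = lin_extend b_top u" if k: "r k = n" for k
      proof -
        have "lin_extend b_top (restr {x. \<kappa> x = k} c) = lin_extend (\<lambda>x. if \<kappa> x = k then b_top x else 0) c"
          unfolding lin_extend_restr by (rule lin_extend_cong) simp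
        also have "\<dots> = lin_extend (\<lambda>x. restr {x. \<kappa> x = k} (b x)) c"
        proof (rule lin_extend_cong_supported[OF c(1)])
          fix x assume x: "x \<in> {x\<in>S. r (\<kappa> x) < Suc n}"
          have "restr {x. \<kappa> x = k} (b x - b_top x) = 0"
            by (rule restr_eq_0[OF low]) (use x k in auto)
          moreover have "restr {x. \<kappa> x = k} (b_top x) = (if \<kappa> x = k then b_top x else 0)"
          proof (cases "\<kappa> x = k")
            case True
            then show ?thesis using b_top[of x] x by (auto intro!: restr_ident intro: supported_mono)
          next
            case False
            then show ?thesis using b_top[of x] x by (auto intro!: restr_eq_0)
          qed
          ultimately show "(if \<kappa> x = k then b_top x else 0) = restr {x. \<kappa> x = k} (b x)"
            by (simp add: restr_linear)
        qed
        also have "\<dots> = 0" using c(2) by (simp flip: restr_lin_extend)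
        finally have "lin_extend b_top (restr {x. \<kappa> x = k} c) = 0" .
        moreover have "restr {x. \<kappa> x = k} c \<in> supported {x\<in>S. \<kappa> x = k}"
          by (rule supported_mono[OF supported_restr[OF c(1)]]) auto
        ultimately show ?thesis by (intro exact_onD[OF ex])
      qed
      then obtain u where u: "\<And>k. r k = n \<Longrightarrow> u k \<in> supported {x\<in>S. \<kappa> x = k}"
        "\<And>k. r k = n \<Longrightarrow> restr {x. \<kappa> x = k} c = lin_extend b_top (u k)" by metis
      define v where "v = (\<Sum>k\<in>I. u k)"
      have vS: "v \<in> supported S" unfolding v_def using u(1)
        by (intro supported_sum) (auto simp: I_def intro: supported_mono)
      have top: "(\<Sum>k\<in>I. restr {x. \<kappa> x = k} c) = restr {x. r (\<kappa> x) = n} c"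
      proof -
        have "(\<Sum>k\<in>I. restr {x. \<kappa> x = k} c)
          = lin_extend (\<lambda>x. \<Sum>k\<in>I. if x \<in> {x. \<kappa> x = k} then gen x else 0) c"
          unfolding restr_def lin_extend_def by (simp add: smul_sum sum.swap[of _ I])
        also have "\<dots> = restr {x. r (\<kappa> x) = n} c" unfolding restr_def
          by (rule lin_extend_cong) (auto simp: sum.delta[OF finI] I_def)
        finally show ?thesis .
      qed
      have dec: "c - lin_extend b v = (c - restr {x. r (\<kappa> x) = n} c)
          - (\<Sum>k\<in>I. lin_extend (\<lambda>x. b x - b_top x) (u k))"
        using u(2) by (simp add: v_def lin_extend_sum lin_extend_fun_diff sum_subtractf
            flip: top) (simp add: I_def)
      have lows: "lin_extend (\<lambda>x. b x - b_top x) (u k) \<in> supported {x\<in>S. r (\<kappa> x) < n}" if "k \<in> I" for k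
        by (rule supported_lin_extend[OF u(1)])
          (use that low in \<open>auto simp: I_def intro: supported_mono\<close>)
      have rest: "c - restr {x. r (\<kappa> x) = n} c \<in> supported {x\<in>S. r (\<kappa> x) < n}"
        by (rule supported_mono[OF supported_minus_restr[OF c(1)]]) auto
      have "c - lin_extend b v \<in> supported {x\<in>S. r (\<kappa> x) < n}"
        unfolding dec by (rule supported_diff[OF rest supported_sum]) (rule lows)
      moreover have "lin_extend b (c - lin_extend b v) = 0"
        using c(2) lin_extend_eq_zero[OF vS bb] by (simp add: lin_extend_diff lin_extend_compose)
      ultimately obtain w where "w \<in> supported S" "c - lin_extend b v = lin_extend b w"
        using Suc by blast
      then show "\<exists>u\<in>supported S. c = lin_extend b u" using vS
        by (intro bexI[of _ "v + w"]) (auto simp: lin_extend_add supported_add algebra_simps)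
    qed
  qed
  note * = this
  show ?thesis unfolding exact_on_def
  proof (intro ballI impI)
    fix c :: "'x \<Rightarrow>\<^sub>0 'a" assume c: "c \<in> supported S" "lin_extend b c = 0"
    have "\<exists>n. \<forall>x\<in>Poly_Mapping.keys c. r (\<kappa> x) < n"
      using finite_nat_set_iff_bounded[of "(\<lambda>x. r (\<kappa> x)) ` Poly_Mapping.keys c"] by auto
    then obtain n where "c \<in> supported {x\<in>S. r (\<kappa> x) < n}" using c by (auto simp: supported_def)
    then show "\<exists>u\<in>supported S. c = lin_extend b u" using * c by blast
  qed
qed

text \<open>
  Mayer-Vietoris: a cycle is \<open>x + y\<close> with \<open>x\<close> in \<open>S\<close> and \<open>y\<close> in \<open>T\<close>, the common boundary of \<open>x\<close> and \<open>- y\<close> is a cycle in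
  the intersection, and correcting \<open>x\<close> and \<open>y\<close> by a chain there makes both of them cycles.
\<close>

lemma exact_on_union:
  assumes exS: "exact_on b S" and exT: "exact_on b T" and exI: "exact_on b (S \<inter> T)"
    and bS: "\<And>x. x \<in> S \<Longrightarrow> b x \<in> supported S" and bT: "\<And>x. x \<in> T \<Longrightarrow> b x \<in> supported T"
    and bb: "\<And>x. x \<in> S \<Longrightarrow> lin_extend b (b x) = 0"
  shows "exact_on b (S \<union> T)"
  unfolding exact_on_def
proof (intro ballI impI)
  fix c assume c: "c \<in> supported (S \<union> T)" "lin_extend b c = 0"
  define x where "x = restr S c"
  define y where "y = c - x"
  have x: "x \<in> supported S" by (simp add: x_def)
  have y: "y \<in> supported T" unfolding y_def x_def
    by (rule supported_mono[OF supported_minus_restr[OF c(1)]]) auto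
  have cxy: "c = x + y" by (simp add: y_def)
  have eq: "lin_extend b x = - lin_extend b y" using c(2) by (simp add: cxy lin_extend_add eq_neg_iff_add_eq_0)
  have "lin_extend b x \<in> supported (S \<inter> T)"
  proof (rule supported_Int)
    show "lin_extend b x \<in> supported S" using x bS by (rule supported_lin_extend)
    show "lin_extend b x \<in> supported T" unfolding eq using y bT by (simp add: supported_lin_extend)
  qed
  moreover have "lin_extend b (lin_extend b x) = 0"
    unfolding lin_extend_compose using x bb by (rule lin_extend_eq_zero)
  ultimately obtain z where z: "z \<in> supported (S \<inter> T)" "lin_extend b x = lin_extend b z"
    using exact_onD[OF exI] by blast
  have "x - z \<in> supported S" "y + z \<in> supported T"
    using x y z(1) by (auto intro!: supported_diff supported_add intro: supported_mono)
  moreover have "lin_extend b (x - z) = 0" "lin_extend b (y + z) = 0"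
    by (simp_all add: lin_extend_diff lin_extend_add eq flip: z(2))
  ultimately obtain u v where u: "u \<in> supported S" "x - z = lin_extend b u"
    and v: "v \<in> supported T" "y + z = lin_extend b v"
    using exact_onD[OF exS] exact_onD[OF exT] by blast
  have "c = (x - z) + (y + z)" by (simp add: cxy)
  also have "\<dots> = lin_extend b (u + v)" by (simp add: u v lin_extend_add)
  finally show "\<exists>u\<in>supported (S \<union> T). c = lin_extend b u"
    using u v by (intro bexI[of _ "u + v"]) (auto intro!: supported_add intro: supported_mono)
qed

lemma exact_on_if_relative:
  assumes exT: "exact_on b T" and TS: "T \<subseteq> S"
    and bb: "\<And>x. x \<in> S \<Longrightarrow> lin_extend b (b x) = 0"
    and rel: "\<And>c. c \<in> supported S \<Longrightarrow> lin_extend b c = 0 \<Longrightarrow>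
      \<exists>u\<in>supported S. c - lin_extend b u \<in> supported T"
  shows "exact_on b S"
  unfolding exact_on_def
proof (intro ballI impI)
  fix c assume c: "c \<in> supported S" "lin_extend b c = 0"
  then obtain u where u: "u \<in> supported S" "c - lin_extend b u \<in> supported T" using rel by blast
  have "lin_extend b (c - lin_extend b u) = 0"
    using c(2) lin_extend_eq_zero[OF u(1) bb] by (simp add: lin_extend_diff lin_extend_compose)
  then obtain v where v: "v \<in> supported T" "c - lin_extend b u = lin_extend b v"
    using exact_onD[OF exT u(2)] by blast
  then show "\<exists>u\<in>supported S. c = lin_extend b u" using u TS
    by (intro bexI[of _ "u + v"]) (auto simp: lin_extend_add algebra_simps intro: supported_add supported_mono)
qed

text \<open>
  If \<open>b\<close> is homogeneous, the homogeneous components of a cycle are cycles.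
\<close>

lemma exact_on_graded:
  fixes deg :: "'x \<Rightarrow> nat"
  assumes hom: "\<And>x y. x \<in> S \<Longrightarrow> y \<in> Poly_Mapping.keys (b x) \<Longrightarrow> deg x = Suc (deg y)"
    and ex: "\<And>n c. c \<in> supported {x\<in>S. deg x = n} \<Longrightarrow> lin_extend b c = 0 \<Longrightarrow>
      \<exists>u\<in>supported S. c = lin_extend b u"
  shows "exact_on b S"
  unfolding exact_on_def
proof (intro ballI impI)
  fix c assume c: "c \<in> supported S" "lin_extend b c = 0"
  have part: "\<exists>u\<in>supported S. restr {x. deg x = n} c = lin_extend b u" for n
  proof (rule ex)
    show "restr {x. deg x = n} c \<in> supported {x\<in>S. deg x = n}"
      by (rule supported_mono[OF supported_restr[OF c(1)]]) auto
    have "lin_extend b (restr {x. deg x = n} c) = restr {y. Suc (deg y) = n} (lin_extend b c)"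
      unfolding lin_extend_restr restr_lin_extend
    proof (rule lin_extend_cong_supported[OF c(1)])
      fix x assume x: "x \<in> S"
      show "(if x \<in> {x. deg x = n} then b x else 0) = restr {y. Suc (deg y) = n} (b x)"
      proof (cases "deg x = n")
        case True
        have "b x \<in> supported {y. Suc (deg y) = n}" using hom[OF x] True by (auto simp: supported_def)
        then show ?thesis using True by (simp add: restr_ident)
      next
        case False
        have "b x \<in> supported {y. Suc (deg y) = deg x}" using hom[OF x] by (auto simp: supported_def)
        then have "restr {y. Suc (deg y) = n} (b x) = 0"
          by (rule restr_eq_0) (use False in auto)
        then show ?thesis using False by simp
      qed
    qed
    then show "lin_extend b (restr {x. deg x = n} c) = 0" using c(2) by simp
  qed
  then obtain u where u: "\<And>n. u n \<in> supported S" "\<And>n. restr {x. deg x = n} c = lin_extend b (u n)"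
    by metis
  let ?I = "deg ` Poly_Mapping.keys c"
  have "c = (\<Sum>n\<in>?I. restr {x. deg x = n} c)" by (subst sum_restr) auto
  also have "\<dots> = lin_extend b (\<Sum>n\<in>?I. u n)" using u(2) by (simp add: lin_extend_sum)
  finally show "\<exists>u\<in>supported S. c = lin_extend b u" using u(1)
    by (intro bexI[of _ "\<Sum>n\<in>?I. u n"]) (auto intro: supported_sum)
qed

lemma exact_on_cong:
  assumes "exact_on b S" "\<And>x. x \<in> S \<Longrightarrow> b x = b' x"
  shows "exact_on b' S"
proof -
  have "lin_extend b c = lin_extend b' c" if "c \<in> supported S" for c
    using that assms(2) by (rule lin_extend_cong_supported)
  then show ?thesis using assms(1) unfolding exact_on_def by auto
qed

text \<open>
  In a short exact sequence of complexes, the subcomplex is exact if the total complex and the quotient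
  are: a cycle of \<open>T\<close> bounds some \<open>u\<close> in \<open>S\<close>, the image of \<open>u\<close> in the quotient is a cycle, hence a boundary, and
  \<open>u\<close> can be corrected to lie in \<open>T\<close>.
\<close>

lemma exact_on_sub:
  assumes exS: "exact_on b S" and TS: "T \<subseteq> S"
    and bS: "\<And>x. x \<in> S \<Longrightarrow> b x \<in> supported S" and bT: "\<And>x. x \<in> T \<Longrightarrow> b x \<in> supported T"
    and bb: "\<And>x. x \<in> S \<Longrightarrow> lin_extend b (b x) = 0"
    and exQ: "exact_on (\<lambda>x. restr (S - T) (b x)) (S - T)"
  shows "exact_on b T"
  unfolding exact_on_def
proof (intro ballI impI)
  fix c assume c: "c \<in> supported T" "lin_extend b c = 0"
  let ?r = "restr (S - T)" and ?q = "\<lambda>x. restr (S - T) (b x)"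
  have q: "lin_extend ?q (?r z) = ?r (lin_extend b z)" if z: "z \<in> supported S" for z
    unfolding lin_extend_restr restr_lin_extend using z
  proof (rule lin_extend_cong_supported)
    fix x assume x: "x \<in> S"
    have "?r (b x) = 0" if "x \<in> T" using bT[OF that] by (rule restr_eq_0) auto
    then show "(if x \<in> S - T then ?q x else 0) = ?r (b x)" using x by auto
  qed
  obtain u where u: "u \<in> supported S" "c = lin_extend b u"
    using exact_onD[OF exS supported_mono[OF c(1) TS] c(2)] by blast
  have "lin_extend ?q (?r u) = ?r c" using q[OF u(1)] u(2) by simp
  also have "\<dots> = 0" using c(1) by (rule restr_eq_0) auto
  finally have "lin_extend ?q (?r u) = 0" .
  then obtain v where v: "v \<in> supported (S - T)" "?r u = lin_extend ?q v"
    using exact_onD[OF exQ supported_restr'] by blast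
  have vS: "v \<in> supported S" using v(1) by (rule supported_mono) auto
  have "?r (u - lin_extend b v) = 0"
    using q[OF vS] restr_ident[OF v(1)] v(2) by (simp add: restr_linear)
  moreover have bv: "lin_extend b v \<in> supported S" using vS bS by (rule supported_lin_extend)
  ultimately have "u - lin_extend b v \<in> supported T"
    using supported_mono[OF restr_eq_0_imp[OF _ supported_diff[OF u(1) bv]], of "S - T" T] by auto
  moreover have "c = lin_extend b (u - lin_extend b v)"
    using u(2) lin_extend_eq_zero[OF vS bb] by (simp add: lin_extend_diff lin_extend_compose)
  ultimately show "\<exists>u\<in>supported T. c = lin_extend b u" by blast
qed


section \<open>The boundary of a list\<close>

text \<open>
  The boundary of a full simplex, augmented: the list \<open>[]\<close> has degree \<open>-1\<close>. The recursion is
  that of a cone with apex \<open>x\<close>, which makes the identities below inductions with one step.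
\<close>

fun list_bd :: "'u list \<Rightarrow> ('u list \<Rightarrow>\<^sub>0 'd::division_ring)" where
  "list_bd [] = 0"
| "list_bd (x # xs) = gen xs - push ((#) x) (list_bd xs)"

lemma list_bd_list_bd: "lin_extend list_bd (list_bd xs) = 0"
proof (induction xs)
  case (Cons x xs)
  have "lin_extend list_bd (push ((#) x) c) = c - push ((#) x) (lin_extend list_bd c)" for c :: "'a list \<Rightarrow>\<^sub>0 'b"
    by (simp add: lin_extend_push lin_extend_fun_diff lin_extend_gen push_lin_extend)
  then show ?case using Cons by (simp add: lin_extend_diff)
qed simp

lemma list_bd_map: "list_bd (map f xs) = push (map f) (list_bd xs)"
  by (induction xs) (simp_all add: push_linear push_push)

lemma list_bd_append:
  "list_bd (xs @ ys) = push (\<lambda>zs. zs @ ys) (list_bd xs) + smul ((- 1) ^ length xs) (push ((@) xs) (list_bd ys))"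
proof (induction xs)
  case Nil
  then show ?case by (simp add: push_ident[of _ UNIV] supported_def)
next
  case (Cons x xs)
  have 1: "push ((#) x) (smul a (push ((@) xs) c)) = smul a (push ((@) (x # xs)) c)" for a and c :: "'a list \<Rightarrow>\<^sub>0 'b"
    by (simp add: push_linear push_push) (simp add: push_def)
  have 2: "smul ((- 1) ^ length (x # xs)) c = - smul ((- 1) ^ length xs) c" for c :: "'a list \<Rightarrow>\<^sub>0 'b"
    by (rule poly_mapping_eqI) simp
  have 3: "push ((#) x) (list_bd (xs @ ys)) = push (\<lambda>zs. x # zs @ ys) (list_bd xs :: _ \<Rightarrow>\<^sub>0 'b)
      + smul ((- 1) ^ length xs) (push ((@) (x # xs)) (list_bd ys))"
    by (simp only: Cons push_linear(1) 1 push_push)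
  have 4: "push (\<lambda>zs. zs @ ys) (list_bd (x # xs)) = gen (xs @ ys) - push (\<lambda>zs. x # zs @ ys) (list_bd xs :: _ \<Rightarrow>\<^sub>0 'b)"
    by (simp add: push_linear push_push)
  show ?case unfolding 4 2 using 3 by (simp only: append_Cons list_bd.simps) (simp add: algebra_simps)
qed

lemma list_bd_supported:
  "(list_bd xs :: _ \<Rightarrow>\<^sub>0 'd::division_ring) \<in> supported {ys. Suc (length ys) = length xs \<and> set ys \<subseteq> set xs}"
proof (induction xs)
  case (Cons x xs)
  have "push ((#) x) (list_bd xs :: _ \<Rightarrow>\<^sub>0 'd) \<in> supported {ys. Suc (length ys) = length (x # xs) \<and> set ys \<subseteq> set (x # xs)}"
    using Cons by (rule supported_push) auto
  then show ?case by (auto intro!: supported_diff)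
qed simp

text \<open>
  Linear maps act on coefficients from the left, and \<open>'d\<close> need not be commutative. An operator commutes with the
  twisted group actions below only if its matrix entries commute with all scalars; those that occur have integral
  entries.
\<close>

definition central :: "('x \<Rightarrow>\<^sub>0 'd::division_ring) \<Rightarrow> bool" where
  "central c \<longleftrightarrow> (\<forall>a x. a * Poly_Mapping.lookup c x = Poly_Mapping.lookup c x * a)"

lemma central_simps [simp]: "central 0" "central (gen x)" "central (- gen x)"
  by (auto simp: central_def lookup_single when_def)

lemma central_diff: "central c \<Longrightarrow> central c' \<Longrightarrow> central (c - c')"
  by (simp add: central_def lookup_minus algebra_simps)

lemma central_lin_extend:
  assumes "central c" "\<And>x. central (b x)"
  shows "central (lin_extend b c)"
proof -
  have "a * (Poly_Mapping.lookup c x * Poly_Mapping.lookup (b x) y)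
      = Poly_Mapping.lookup c x * Poly_Mapping.lookup (b x) y * a" for a x y
    using assms unfolding central_def by (metis mult.assoc)
  then show ?thesis
    by (simp add: central_def lin_extend_def lookup_sum sum_distrib_left sum_distrib_right)
qed

lemma central_push: "central c \<Longrightarrow> central (push f c)"
  unfolding push_def by (rule central_lin_extend) auto

lemma central_restr: "central c \<Longrightarrow> central (restr S c)"
  unfolding restr_def by (rule central_lin_extend) auto

lemma central_list_bd: "central (list_bd xs)"
  by (induction xs) (auto intro: central_diff central_push)

lemma lin_extend_smul_central:
  assumes "central c"
  shows "lin_extend (\<lambda>x. smul a (b x)) c = smul a (lin_extend b c)"
  using assms unfolding central_def by (simp add: lin_extend_def smul_sum)

text \<open>
  The alternating sum of the lists \<open>[f x0, ..., f xi, g xi, ..., g xn]\<close>, which triangulates the homotopy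
  between the two simplicial maps.
\<close>

fun prism :: "('u \<Rightarrow> 'w) \<Rightarrow> ('u \<Rightarrow> 'w) \<Rightarrow> 'u list \<Rightarrow> ('w list \<Rightarrow>\<^sub>0 'd::division_ring)" where
  "prism f g [] = 0"
| "prism f g (x # xs) = gen (f x # g x # map g xs) - push ((#) (f x)) (prism f g xs)"

lemma prism_homotopy:
  fixes f g :: "'u \<Rightarrow> 'w"
  shows "lin_extend list_bd (prism f g xs) + lin_extend (prism f g) (list_bd xs) = (gen (map g xs) - gen (map f xs) :: 'w list \<Rightarrow>\<^sub>0 'd::division_ring)"
proof (induction xs)
  case (Cons x xs)
  have 1: "lin_extend list_bd (push ((#) (f x)) c) = c - push ((#) (f x)) (lin_extend list_bd c)" for c :: "'w list \<Rightarrow>\<^sub>0 'd"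
    by (simp add: lin_extend_push lin_extend_fun_diff lin_extend_gen push_lin_extend)
  have 2: "lin_extend (prism f g) (push ((#) x) c)
    = push (\<lambda>xs. f x # g x # map g xs) c - push ((#) (f x)) (lin_extend (prism f g) c)" for c :: "'u list \<Rightarrow>\<^sub>0 'd"
    by (simp add: lin_extend_push lin_extend_fun_diff push_lin_extend) (simp add: push_def)
  have 3: "lin_extend (prism f g) (list_bd xs :: _ \<Rightarrow>\<^sub>0 'd) = gen (map g xs) - gen (map f xs) - lin_extend list_bd (prism f g xs)"
    using Cons by (simp add: eq_diff_eq add.commute)
  show ?case
    by (simp add: lin_extend_linear 1 2 3 push_linear list_bd_map push_push)
qed simp

lemma prism_map: "prism f g (map h xs) = prism (f \<circ> h) (g \<circ> h) xs"
  by (induction xs) (simp_all add: o_def)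

lemma push_map_prism: "push (map h) (prism f g xs) = prism (h \<circ> f) (h \<circ> g) xs"
proof (induction xs)
  case (Cons x xs)
  have "push (map h) (push ((#) (f x)) c) = push ((#) (h (f x))) (push (map h) c)" for c :: "'c list \<Rightarrow>\<^sub>0 'b"
    by (simp add: push_push)
  then show ?case using Cons by (simp add: push_linear o_def)
qed simp

lemma central_prism: "central (prism f g xs)"
  by (induction xs) (auto intro!: central_diff central_push)

text \<open>
  The head of the original list survives at the head of all terms. This is what keeps the prism compatible with a
  normalisation of tuples by their first entry.
\<close>

lemma prism_supported:
  "(prism f g xs :: _ \<Rightarrow>\<^sub>0 'd::division_ring) \<in> supported {map f ys @ map g zs | ys zs. ys \<noteq> [] \<and> zs \<noteq> [] \<and> set ys \<subseteq> set xs \<and> set zs \<subseteq> set xs \<and>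
     hd ys = hd xs}"
proof (induction xs)
  case (Cons x xs)
  have "push ((#) (f x)) (prism f g xs :: _ \<Rightarrow>\<^sub>0 'd) \<in> supported {map f ys @ map g zs | ys zs. ys \<noteq> [] \<and> zs \<noteq> [] \<and>
     set ys \<subseteq> set (x # xs) \<and> set zs \<subseteq> set (x # xs) \<and> hd ys = hd (x # xs)}"
    using Cons
  proof (rule supported_push, safe)
    fix ys zs assume "ys \<noteq> []" "zs \<noteq> []" "set ys \<subseteq> set xs" "set zs \<subseteq> set xs" "hd ys = hd xs"
    then show "\<exists>ysa zsa. f x # map f ys @ map g zs = map f ysa @ map g zsa \<and> ysa \<noteq> [] \<and> zsa \<noteq> [] \<and>
        set ysa \<subseteq> set (x # xs) \<and> set zsa \<subseteq> set (x # xs) \<and> hd ysa = hd (x # xs)"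
      by (intro exI[of _ "x # ys"] exI[of _ zs]) auto
  qed
  moreover have "f x # g x # map g xs \<in> {map f ys @ map g zs | ys zs. ys \<noteq> [] \<and> zs \<noteq> [] \<and>
     set ys \<subseteq> set (x # xs) \<and> set zs \<subseteq> set (x # xs) \<and> hd ys = hd (x # xs)}"
    by (intro CollectI exI[of _ "[x]"] exI[of _ "x # xs"]) auto
  ultimately show ?case unfolding prism.simps by (intro supported_diff) (simp_all only: supported_simps simp_thms)
qed simp


section \<open>Coinvariants\<close>

text \<open>
  A multiplicative character makes \<open>'d\<close> a right module over \<open>G\<close>. For a ring homomorphism from the group ring
  to \<open>'d\<close>, the character is its restriction to the group elements.
\<close>

locale twist = group G for G :: "('g, 'b) monoid_scheme" (structure) +
  fixes \<chi> :: "'g \<Rightarrow> 'd::division_ring"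
  assumes chi_one: "\<chi> \<one> = 1"
    and chi_mult: "\<And>g h. g \<in> carrier G \<Longrightarrow> h \<in> carrier G \<Longrightarrow> \<chi> (g \<otimes> h) = \<chi> g * \<chi> h"
begin

text \<open>
  The equivariant map \<open>\<theta>\<close> to \<open>G\<close> trivialises the action: each orbit contains exactly one element
  with \<open>\<theta> x = \<one>\<close>.
\<close>

definition free_action :: "('g \<Rightarrow> 'x \<Rightarrow> 'x) \<Rightarrow> 'x set \<Rightarrow> ('x \<Rightarrow> 'g) \<Rightarrow> bool" where
  "free_action act U \<theta> \<longleftrightarrow>
    (\<forall>x\<in>U. \<theta> x \<in> carrier G \<and> act \<one> x = x) \<and>
    (\<forall>g\<in>carrier G. \<forall>x\<in>U. act g x \<in> U \<and> \<theta> (act g x) = g \<otimes> \<theta> x \<and>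
      (\<forall>h\<in>carrier G. act g (act h x) = act (g \<otimes> h) x))"

text \<open>
  In the coinvariants \<open>'d \<otimes>\<^sub>G Z[U]\<close> one has \<open>a \<otimes> g x = a \<chi>(g) \<otimes> x\<close>. Therefore the orbit
  representatives form a basis, and \<open>nrm\<close> expresses the class of \<open>x\<close> in it.
\<close>

definition nrm :: "('g \<Rightarrow> 'x \<Rightarrow> 'x) \<Rightarrow> ('x \<Rightarrow> 'g) \<Rightarrow> 'x \<Rightarrow> ('x \<Rightarrow>\<^sub>0 'd)" where
  "nrm act \<theta> x = Poly_Mapping.single (act (inv (\<theta> x)) x) (\<chi> (\<theta> x))"

definition equivariant :: "('g \<Rightarrow> 'x \<Rightarrow> 'x) \<Rightarrow> 'x set \<Rightarrow> ('g \<Rightarrow> 'y \<Rightarrow> 'y) \<Rightarrow> 'y set \<Rightarrow> ('x \<Rightarrow> ('y \<Rightarrow>\<^sub>0 'd)) \<Rightarrow> bool" where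
  "equivariant act U act' Y T \<longleftrightarrow>
    (\<forall>x\<in>U. T x \<in> supported Y \<and> central (T x) \<and> (\<forall>g\<in>carrier G. T (act g x) = push (act' g) (T x)))"

lemma chi_inv: "g \<in> carrier G \<Longrightarrow> \<chi> g * \<chi> (inv g) = 1"
  by (metis chi_mult chi_one inv_closed r_inv)

lemma nrm_supported:
  assumes "free_action act U \<theta>" "x \<in> U"
  shows "nrm act \<theta> x \<in> supported {x\<in>U. \<theta> x = \<one>}"
  using assms by (auto simp: nrm_def free_action_def)

lemma nrm_ident:
  assumes "free_action act U \<theta>" "x \<in> U" "\<theta> x = \<one>"
  shows "nrm act \<theta> x = gen x"
  using assms by (auto simp: nrm_def free_action_def chi_one)

lemma nrm_ident_supported:
  assumes "free_action act U \<theta>" "c \<in> supported {x\<in>U. \<theta> x = \<one>}"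
  shows "lin_extend (nrm act \<theta>) c = c"
  using assms(2) by (rule lin_extend_eq_self) (use nrm_ident[OF assms(1)] in auto)

text \<open>
  An equivariant operator descends to the coinvariants: it may be applied to a chain or to its normal form
  with the same result. The scalar \<open>\<chi> (inv g)\<close> has to move past the coefficients of \<open>T x\<close>, which is why
  these are central.
\<close>

lemma nrm_equivariant_nrm:
  assumes U: "free_action act U \<theta>" and Y: "free_action act' Y \<theta>'"
    and T: "equivariant act U act' Y T" and x: "x \<in> U"
  shows "lin_extend (nrm act' \<theta>') (lin_extend T (nrm act \<theta> x)) = lin_extend (nrm act' \<theta>') (T x)"
proof -
  define g where "g = \<theta> x"
  have g: "g \<in> carrier G" using U x by (auto simp: free_action_def g_def)
  have Tx: "T x \<in> supported Y" "central (T x)" "T (act (inv g) x) = push (act' (inv g)) (T x)"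
    using T x g by (auto simp: equivariant_def)
  have n: "nrm act' \<theta>' (act' (inv g) y) = smul (\<chi> (inv g)) (nrm act' \<theta>' y)" if y: "y \<in> Y" for y
  proof -
    have t: "\<theta>' y \<in> carrier G" "\<theta>' (act' (inv g) y) = inv g \<otimes> \<theta>' y"
      "act' (inv (\<theta>' y) \<otimes> g) (act' (inv g) y) = act' (inv (\<theta>' y) \<otimes> g \<otimes> inv g) y"
      using Y y g by (auto simp: free_action_def)
    then show ?thesis using g by (simp add: nrm_def inv_mult_group chi_mult m_assoc)
  qed
  have "lin_extend (nrm act' \<theta>') (lin_extend T (nrm act \<theta> x))
    = smul (\<chi> g) (lin_extend (\<lambda>y. nrm act' \<theta>' (act' (inv g) y)) (T x))"
    by (simp add: nrm_def[of act] Tx lin_extend_smul lin_extend_push flip: g_def)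
  also have "lin_extend (\<lambda>y. nrm act' \<theta>' (act' (inv g) y)) (T x)
    = lin_extend (\<lambda>y. smul (\<chi> (inv g)) (nrm act' \<theta>' y)) (T x)"
    using Tx(1) n by (rule lin_extend_cong_supported)
  also have "\<dots> = smul (\<chi> (inv g)) (lin_extend (nrm act' \<theta>') (T x))"
    using Tx(2) by (rule lin_extend_smul_central)
  finally show ?thesis using g by (simp add: chi_inv)
qed

lemma nrm_equivariant_nrm_chain:
  assumes "free_action act U \<theta>" "free_action act' Y \<theta>'" "equivariant act U act' Y T" "c \<in> supported U"
  shows "lin_extend (nrm act' \<theta>') (lin_extend T (lin_extend (nrm act \<theta>) c)) = lin_extend (nrm act' \<theta>') (lin_extend T c)"
  unfolding lin_extend_compose using assms(4)
  by (rule lin_extend_cong_supported)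
    (use nrm_equivariant_nrm[OF assms(1-3)] in \<open>simp add: lin_extend_compose\<close>)

lemma equivariant_gen: "free_action act U \<theta> \<Longrightarrow> equivariant act U act U gen"
  by (simp add: equivariant_def)

lemma nrm_nrm_chain:
  assumes "free_action act U \<theta>" "free_action act U \<theta>'" "c \<in> supported U"
  shows "lin_extend (nrm act \<theta>') (lin_extend (nrm act \<theta>) c) = lin_extend (nrm act \<theta>') c"
  using nrm_equivariant_nrm_chain[OF assms(1,2) equivariant_gen[OF assms(1)] assms(3)]
  by (simp add: lin_extend_gen)

text \<open>
  The differential that \<open>b\<close> induces on the coinvariants, in the basis of orbit representatives.
\<close>

definition codiff :: "('g \<Rightarrow> 'x \<Rightarrow> 'x) \<Rightarrow> ('x \<Rightarrow> 'g) \<Rightarrow> ('x \<Rightarrow> ('x \<Rightarrow>\<^sub>0 'd)) \<Rightarrow> 'x \<Rightarrow> ('x \<Rightarrow>\<^sub>0 'd)" where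
  "codiff act \<theta> b x = lin_extend (nrm act \<theta>) (b x)"

lemma lin_extend_codiff:
  "lin_extend (codiff act \<theta> b) c = lin_extend (nrm act \<theta>) (lin_extend b c)"
  by (simp add: codiff_def[abs_def] lin_extend_compose)

lemma codiff_supported:
  assumes "free_action act U \<theta>" "equivariant act U act U b" "x \<in> U"
  shows "codiff act \<theta> b x \<in> supported {x\<in>U. \<theta> x = \<one>}"
  unfolding codiff_def
  using assms nrm_supported[OF assms(1)]
  by (intro supported_lin_extend[of "b x" U]) (auto simp: equivariant_def)

lemma codiff_codiff:
  assumes "free_action act U \<theta>" "equivariant act U act U b" "x \<in> U" "lin_extend b (b x) = 0"
  shows "lin_extend (codiff act \<theta> b) (codiff act \<theta> b x) = 0"
  unfolding lin_extend_codiff using assms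
  by (simp add: codiff_def, subst nrm_equivariant_nrm_chain[OF assms(1,1,2)])
    (auto simp: equivariant_def)

text \<open>
  Exactness is a property of the coinvariants, hence does not depend on the choice of representatives: the two
  normalisations are mutually inverse chain isomorphisms.
\<close>

lemma codiff_exact_change:
  assumes U: "free_action act U \<theta>" "free_action act U \<theta>'" and b: "equivariant act U act U b"
    and ex: "exact_on (codiff act \<theta> b) {x\<in>U. \<theta> x = \<one>}"
  shows "exact_on (codiff act \<theta>' b) {x\<in>U. \<theta>' x = \<one>}"
  unfolding exact_on_def
proof (intro ballI impI)
  fix c assume c: "c \<in> supported {x\<in>U. \<theta>' x = \<one>}" "lin_extend (codiff act \<theta>' b) c = 0"
  let ?n = "lin_extend (nrm act \<theta>)" and ?n' = "lin_extend (nrm act \<theta>')"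
  have cX: "c \<in> supported U" by (rule supported_mono[OF c(1)]) auto
  have bX: "lin_extend b u \<in> supported U" if "u \<in> supported U" for u
    using that b by (intro supported_lin_extend[of u U]) (auto simp: equivariant_def)
  have nc: "?n c \<in> supported {x\<in>U. \<theta> x = \<one>}"
    using cX nrm_supported[OF U(1)] by (rule supported_lin_extend)
  have "lin_extend (codiff act \<theta> b) (?n c) = ?n (lin_extend b c)"
    unfolding lin_extend_codiff using nrm_equivariant_nrm_chain[OF U(1,1) b cX] .
  also have "\<dots> = ?n (?n' (lin_extend b c))" using nrm_nrm_chain[OF U(2,1) bX[OF cX]] by simp
  also have "\<dots> = 0" using c(2) by (simp add: lin_extend_codiff)
  finally obtain u where u: "u \<in> supported {x\<in>U. \<theta> x = \<one>}" "?n c = lin_extend (codiff act \<theta> b) u"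
    using exact_onD[OF ex nc] by blast
  have uX: "u \<in> supported U" by (rule supported_mono[OF u(1)]) auto
  have "c = ?n' c" using nrm_ident_supported[OF U(2) c(1)] by simp
  also have "\<dots> = ?n' (?n c)" using nrm_nrm_chain[OF U(1,2) cX] by simp
  also have "\<dots> = ?n' (lin_extend b u)" unfolding u(2) lin_extend_codiff
    using nrm_nrm_chain[OF U bX[OF uX]] .
  also have "\<dots> = lin_extend (codiff act \<theta>' b) (?n' u)" unfolding lin_extend_codiff
    using nrm_equivariant_nrm_chain[OF U(2,2) b uX] by simp
  finally have "c = lin_extend (codiff act \<theta>' b) (?n' u)" .
  moreover have "?n' u \<in> supported {x\<in>U. \<theta>' x = \<one>}"
    using uX nrm_supported[OF U(2)] by (rule supported_lin_extend)
  ultimately show "\<exists>u\<in>supported {x\<in>U. \<theta>' x = \<one>}. c = lin_extend (codiff act \<theta>' b) u" by blast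
qed

end

lemma twist_subgroup:
  assumes "twist G \<chi>" "subgroup H G"
  shows "twist (G\<lparr>carrier := H\<rparr>) \<chi>"
proof -
  interpret twist G \<chi> by fact
  show ?thesis
    using subgroup.subgroup_is_group[OF assms(2) is_group] chi_one chi_mult subgroup.subset[OF assms(2)]
    by (auto simp: twist_def twist_axioms_def)
qed


section \<open>Homogeneous and inhomogeneous bar complexes\<close>

text \<open>
  The boundary without augmentation, so that the group acts freely on the basis of the complex.
\<close>

definition tuple_bd :: "'u list \<Rightarrow> ('u list \<Rightarrow>\<^sub>0 'd::division_ring)" where
  "tuple_bd xs = restr {ys. ys \<noteq> []} (list_bd xs)"

lemma restr_map_push: "(\<And>x. f x \<in> S \<longleftrightarrow> x \<in> S') \<Longrightarrow> restr S (push f c) = push f (restr S' c)"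
  by (simp add: restr_def push_def lin_extend_compose) (rule lin_extend_cong, simp)

lemma tuple_bd_map: "tuple_bd (map f xs) = push (map f) (tuple_bd xs)"
  unfolding tuple_bd_def list_bd_map by (rule restr_map_push) simp

lemma central_tuple_bd: "central (tuple_bd xs)"
  by (simp add: tuple_bd_def central_list_bd central_restr)

lemma tuple_bd_supported: "tuple_bd xs \<in> supported {ys. ys \<noteq> [] \<and> Suc (length ys) = length xs \<and> set ys \<subseteq> set xs}"
  unfolding tuple_bd_def by (rule supported_mono[OF supported_restr[OF list_bd_supported]]) auto

lemma tuple_bd_eq: "length xs \<noteq> 1 \<Longrightarrow> tuple_bd xs = list_bd xs"
  unfolding tuple_bd_def
  by (rule restr_ident, rule supported_mono[OF list_bd_supported]) auto

lemma tuple_bd_tuple_bd: "lin_extend tuple_bd (tuple_bd xs) = 0"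
proof -
  have "lin_extend tuple_bd (tuple_bd xs) = lin_extend (\<lambda>x. if x \<noteq> [] then tuple_bd x else 0) (list_bd xs)"
    unfolding tuple_bd_def[of xs] lin_extend_restr by simp
  also have "\<dots> = lin_extend tuple_bd (list_bd xs)"
    by (rule lin_extend_cong) (auto simp: tuple_bd_def)
  also have "\<dots> = 0"
    unfolding tuple_bd_def[abs_def] restr_lin_extend[symmetric] by (simp add: list_bd_list_bd)
  finally show ?thesis .
qed

context twist
begin

abbreviation tact :: "'g \<Rightarrow> 'g list \<Rightarrow> 'g list" where "tact g \<equiv> map ((\<otimes>) g)"

definition tuples :: "'g set \<Rightarrow> 'g list set" where
  "tuples H = {xs. xs \<noteq> [] \<and> set xs \<subseteq> H}"

text \<open>
  The representatives of the orbits of \<open>H\<close> on nonempty tuples, normalised by their first entry.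
\<close>

definition ntuples :: "'g set \<Rightarrow> 'g list set" where
  "ntuples H = {xs\<in>tuples H. hd xs = \<one>}"

abbreviation tuple_codiff :: "'g list \<Rightarrow> ('g list \<Rightarrow>\<^sub>0 'd)" where
  "tuple_codiff \<equiv> codiff tact hd tuple_bd"

lemma map_mult_mult: "g \<in> carrier G \<Longrightarrow> h \<in> carrier G \<Longrightarrow> set xs \<subseteq> carrier G \<Longrightarrow>
    map ((\<otimes>) g) (map ((\<otimes>) h) xs) = map ((\<otimes>) (g \<otimes> h)) xs"
  by (auto simp: m_assoc)

lemma map_mult_one: "set xs \<subseteq> carrier G \<Longrightarrow> map ((\<otimes>) \<one>) xs = xs"
  by (rule map_idI) auto

lemma free_action_tuples: "free_action tact (tuples (carrier G)) hd"
  unfolding free_action_def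
  by (auto simp: tuples_def hd_map subset_iff m_assoc intro!: map_idI)

lemma tuple_bd_closed: "xs \<in> tuples H \<Longrightarrow> tuple_bd xs \<in> supported (tuples H)"
  by (rule supported_mono[OF tuple_bd_supported]) (auto simp: tuples_def)

lemma equivariant_tuple_bd: "equivariant tact (tuples (carrier G)) tact (tuples (carrier G)) tuple_bd"
  by (simp add: equivariant_def tuple_bd_closed central_tuple_bd tuple_bd_map)

lemma tuple_codiff_subgroup:
  assumes "subgroup H G" "xs \<in> tuples H"
  shows "tuple_codiff xs \<in> supported (ntuples H)"
proof -
  have "nrm tact hd ys \<in> supported (ntuples H)" if "ys \<in> tuples H" for ys
  proof -
    have "ys \<noteq> []" "set ys \<subseteq> H" "hd ys \<in> H" using that by (auto simp: tuples_def)
    moreover have "inv (hd ys) \<otimes> y \<in> H" if "y \<in> H" for y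
      using that \<open>hd ys \<in> H\<close> assms(1) by (simp add: subgroup.m_closed subgroup.m_inv_closed)
    moreover have "hd ys \<in> carrier G" using \<open>hd ys \<in> H\<close> subgroup.subset[OF assms(1)] by auto
    ultimately show ?thesis by (auto simp: nrm_def ntuples_def tuples_def hd_map)
  qed
  then show ?thesis unfolding codiff_def
    using tuple_bd_closed[OF assms(2)] by (rule supported_lin_extend[rotated])
qed

text \<open>
  The passage from bar notation to homogeneous coordinates:
  \<open>[g1, ..., gn]\<close> becomes \<open>[g, g g1, ..., g g1 ... gn]\<close>.
\<close>

fun partial_products :: "'g \<Rightarrow> 'g list \<Rightarrow> 'g list" where
  "partial_products g [] = [g]"
| "partial_products g (x # xs) = g # partial_products (g \<otimes> x) xs"

lemma hd_partial_products [simp]: "hd (partial_products g xs) = g" "partial_products g xs \<noteq> []"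
  by (cases xs; simp)+

lemma partial_products_mult: "g \<in> carrier G \<Longrightarrow> h \<in> carrier G \<Longrightarrow> set xs \<subseteq> carrier G \<Longrightarrow>
   partial_products (g \<otimes> h) xs = map ((\<otimes>) g) (partial_products h xs)"
  by (induction xs arbitrary: h) (auto simp: m_assoc)

lemma bij_partial_products:
  assumes H: "subgroup H G"
  shows "bij_betw (partial_products \<one>) (lists H) (ntuples H)"
proof -
  have inj: "xs = ys" if "partial_products g xs = partial_products g ys" "set xs \<subseteq> carrier G" "set ys \<subseteq> carrier G"
    "g \<in> carrier G" for g xs ys
    using that
  proof (induction xs arbitrary: g ys)
    case Nil
    then show ?case by (cases ys) (auto simp: hd_partial_products(2)[THEN not_sym])
  next
    case (Cons x xs)
    then obtain y zs where ys: "ys = y # zs" by (cases ys) auto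
    have eq: "partial_products (g \<otimes> x) xs = partial_products (g \<otimes> y) zs" using Cons ys by simp
    then have "g \<otimes> x = g \<otimes> y" by (metis hd_partial_products(1))
    then have "x = y" using Cons ys by simp
    then show ?case using Cons ys eq by auto
  qed
  have into: "set (partial_products g xs) \<subseteq> H" if "g \<in> H" "set xs \<subseteq> H" for g xs
    using that by (induction xs arbitrary: g) (auto simp: subgroup.m_closed[OF H])
  have onto: "\<exists>xs\<in>lists H. t = partial_products (hd t) xs" if "t \<noteq> []" "set t \<subseteq> H" for t
    using that
  proof (induction t)
    case (Cons g t)
    show ?case
    proof (cases "t = []")
      case False
      then obtain xs where xs: "xs \<in> lists H" "t = partial_products (hd t) xs" using Cons by auto
      have "hd t \<in> H" "g \<in> H" using Cons False by auto
      then have "g \<otimes> (inv g \<otimes> hd t) = hd t" "inv g \<otimes> hd t \<in> H"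
        using H by (auto simp: subgroup.m_closed subgroup.m_inv_closed inv_solve_left subgroup.mem_carrier m_assoc[symmetric])
      then show ?thesis using xs by (intro bexI[of _ "(inv g \<otimes> hd t) # xs"]) auto
    qed (auto intro!: bexI[of _ "[]"])
  qed auto
  show ?thesis unfolding bij_betw_def
  proof
    show "inj_on (partial_products \<one>) (lists H)"
      using inj subgroup.subset[OF H] by (intro inj_onI) (auto simp: in_lists_conv_set subset_iff)
    show "partial_products \<one> ` lists H = ntuples H"
    proof (rule subset_antisym; rule subsetI)
      fix t assume "t \<in> ntuples H"
      then show "t \<in> partial_products \<one> ` lists H" using onto[of t] by (auto simp: ntuples_def tuples_def)
    next
      fix t assume "t \<in> partial_products \<one> ` lists H"
      then show "t \<in> ntuples H" using into[of \<one>] subgroup.one_closed[OF H]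
        by (auto simp: ntuples_def tuples_def in_lists_conv_set subset_iff)
    qed
  qed
qed

text \<open>
  All faces of \<open>[g1|...|gn]\<close> except the zeroth, which is the only one that involves the coefficients.
\<close>

fun bar_rest :: "'g list \<Rightarrow> ('g list \<Rightarrow>\<^sub>0 'd)" where
  "bar_rest [] = 0"
| "bar_rest [x] = - gen []"
| "bar_rest (x # y # xs) = - gen ((x \<otimes> y) # xs) - push ((#) x) (bar_rest (y # xs))"

text \<open>
  Omitting an entry of the sequence of partial products multiplies two neighbouring bar entries; omitting the
  last one drops the last bar entry. Only omitting the first one changes the base point \<open>g\<close>, and \<open>nrm\<close> turns
  this into the factor \<open>\<chi> x\<close> of the zeroth face of the bar boundary.
\<close>

lemma list_bd_partial_products:
  assumes "g \<in> carrier G" "set (x # xs) \<subseteq> carrier G"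
  shows "list_bd (partial_products g (x # xs)) = gen (partial_products (g \<otimes> x) xs) + push (partial_products g) (bar_rest (x # xs))"
  using assms
proof (induction xs arbitrary: g x)
  case (Cons y ys)
  have a: "list_bd (partial_products (g \<otimes> x) (y # ys))
    = gen (partial_products (g \<otimes> x \<otimes> y) ys) + push (partial_products (g \<otimes> x)) (bar_rest (y # ys))"
    using Cons by auto
  have b: "list_bd (partial_products g (x # y # ys))
    = gen (partial_products (g \<otimes> x) (y # ys)) - push ((#) g) (list_bd (partial_products (g \<otimes> x) (y # ys)))"
    by simp
  have c: "push (partial_products g) (bar_rest (x # y # ys)) = - gen (g # partial_products (g \<otimes> x \<otimes> y) ys)
    - push ((#) g) (push (partial_products (g \<otimes> x)) (bar_rest (y # ys)))"
    using Cons.prems by (simp add: push_linear push_push m_assoc)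
  show ?case unfolding b a c push_linear by (simp add: algebra_simps)
qed (simp add: push_linear)

lemma bar_rest_eq:
  "x # xs \<noteq> [] \<Longrightarrow> bar_rest (x # xs) = (\<Sum>i = 1..<length (x # xs). Poly_Mapping.single
            (take (i - 1) (x # xs) @ [(x # xs) ! (i - 1) \<otimes> (x # xs) ! i] @ drop (i + 1) (x # xs)) ((- 1) ^ i))
       + Poly_Mapping.single (butlast (x # xs)) ((- 1) ^ length (x # xs))"
proof (induction xs arbitrary: x)
  case (Cons y ys)
  let ?F = "\<lambda>zs i. Poly_Mapping.single
            (take (i - 1) zs @ [zs ! (i - 1) \<otimes> zs ! i] @ drop (i + 1) zs) ((- 1) ^ i)"
  have "(\<Sum>i = 1..<length (x # y # ys). ?F (x # y # ys) i) =
     ?F (x # y # ys) 1 + (\<Sum>i = Suc 1..<Suc (length (y # ys)). ?F (x # y # ys) i)"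
    by (subst sum.atLeast_Suc_lessThan) auto
  also have "(\<Sum>i = Suc 1..<Suc (length (y # ys)). ?F (x # y # ys) i)
    = (\<Sum>i = 1..<length (y # ys). ?F (x # y # ys) (Suc i))"
    by (rule sum.shift_bounds_Suc_ivl)
  also have "\<dots> = (\<Sum>i = 1..<length (y # ys). - push ((#) x) (?F (y # ys) i))"
  proof (rule sum.cong)
    fix i assume "i \<in> {1..<length (y # ys)}"
    then obtain j where "i = Suc j" by (cases i) auto
    then show "?F (x # y # ys) (Suc i) = - push ((#) x) (?F (y # ys) i)"
      by (simp add: single_uminus push_linear)
  qed simp
  finally have *: "(\<Sum>i = 1..<length (x # y # ys). ?F (x # y # ys) i) =
     ?F (x # y # ys) 1 + (\<Sum>i = 1..<length (y # ys). - push ((#) x) (?F (y # ys) i))" .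
  show ?case unfolding * bar_rest.simps Cons[simplified list.distinct]
    using Cons by (simp add: push_linear sum_negf single_uminus)
qed (simp add: single_uminus)

lemma bar_boundary_Cons:
  "bar_boundary G \<phi> (x # xs) = Poly_Mapping.single xs (\<phi> (gen x)) + bar_rest (x # xs)"
  unfolding bar_boundary_def using bar_rest_eq[of x xs] by (simp add: add.assoc)

lemma bar_rest_supported:
  assumes "subgroup H G" "set xs \<subseteq> H"
  shows "bar_rest xs \<in> supported {ys. set ys \<subseteq> H \<and> Suc (length ys) = length xs}"
  using assms(2)
proof (induction xs rule: bar_rest.induct)
  case (3 x y xs)
  have "push ((#) x) (bar_rest (y # xs)) \<in> supported {ys. set ys \<subseteq> H \<and> Suc (length ys) = length (x # y # xs)}"
    using 3 by (intro supported_push[OF "3.IH"]) auto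
  then show ?case using 3 assms(1)
    by (auto intro!: supported_diff simp: subgroup.m_closed)
qed auto

lemma bar_boundary_supported:
  fixes \<phi> :: "('g \<Rightarrow>\<^sub>0 'f::division_ring) \<Rightarrow> 'd"
  assumes "subgroup H G" "set xs \<subseteq> H"
  shows "bar_boundary G \<phi> xs \<in> supported {ys. set ys \<subseteq> H \<and> Suc (length ys) = length xs}"
proof (cases xs)
  case Nil
  then show ?thesis by (simp add: bar_boundary_def)
next
  case (Cons x ys)
  then show ?thesis using assms bar_rest_supported[OF assms]
    by (auto simp: bar_boundary_Cons intro!: supported_add)
qed

lemma push_bar_boundary:
  assumes chi: "\<And>g. g \<in> carrier G \<Longrightarrow> \<phi> (gen g) = \<chi> g" and xs: "set xs \<subseteq> carrier G"
  shows "push (partial_products \<one>) (bar_boundary G \<phi> xs) = tuple_codiff (partial_products \<one> xs)"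
proof (cases xs)
  case Nil
  then show ?thesis by (simp add: bar_boundary_def codiff_def tuple_bd_def)
next
  case (Cons x ys)
  have x: "x \<in> carrier G" "set ys \<subseteq> carrier G" using xs Cons by auto
  have len: "length (partial_products g zs) = Suc (length zs)" for g zs
    by (induction zs arbitrary: g) auto
  have n1: "nrm tact hd (partial_products x ys) = Poly_Mapping.single (partial_products \<one> ys) (\<chi> x)"
    using x partial_products_mult[of "inv x" x ys] by (simp add: nrm_def)
  have "push (partial_products \<one>) (bar_rest (x # ys)) \<in> supported {zs\<in>tuples (carrier G). hd zs = \<one>}"
    using bij_partial_products[OF subgroup_self]
    by (intro supported_push[OF bar_rest_supported[OF subgroup_self]])
      (use xs Cons in \<open>auto simp: bij_betw_def ntuples_def in_lists_conv_set subset_iff\<close>)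
  then have n2: "lin_extend (nrm tact hd) (push (partial_products \<one>) (bar_rest (x # ys)))
    = push (partial_products \<one>) (bar_rest (x # ys))"
    by (rule nrm_ident_supported[OF free_action_tuples])
  have "tuple_codiff (partial_products \<one> xs) = lin_extend (nrm tact hd) (list_bd (partial_products \<one> (x # ys)))"
    by (simp add: codiff_def tuple_bd_eq Cons len del: list_bd.simps)
  also have "\<dots> = Poly_Mapping.single (partial_products \<one> ys) (\<chi> x) + push (partial_products \<one>) (bar_rest (x # ys))"
    using xs Cons x by (subst list_bd_partial_products) (simp_all add: lin_extend_add n1 n2)
  finally show ?thesis using x by (simp add: Cons bar_boundary_Cons push_linear chi)
qed

text \<open>
  The bridge between the bar complex and the coinvariants of tuples. It is stated for a subgroup \<open>H\<close> inside \<open>G\<close>, as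
  subgroups are compared within the complex of \<open>G\<close>.
\<close>

lemma exact_bar_iff:
  assumes chi: "\<And>g. g \<in> carrier G \<Longrightarrow> \<phi> (gen g) = \<chi> g" and H: "subgroup H G"
  shows "exact_on (bar_boundary G \<phi>) (lists H) \<longleftrightarrow> exact_on tuple_codiff (ntuples H)"
proof
  let ?f = "partial_products \<one>"
  have bij: "bij_betw ?f (lists H) (ntuples H)" by (rule bij_partial_products[OF H])
  have HG: "H \<subseteq> carrier G" using H by (rule subgroup.subset)
  have sup: "bar_boundary G \<phi> xs \<in> supported (lists H)" if "xs \<in> lists H" for xs
    by (rule supported_mono[OF bar_boundary_supported[OF H]])
      (use that in \<open>auto simp: in_lists_conv_set\<close>)
  have comm: "push ?f (bar_boundary G \<phi> xs) = tuple_codiff (?f xs)" if "xs \<in> lists H" for xs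
    using that HG by (intro push_bar_boundary[OF chi]) (auto simp: in_lists_conv_set)
  {
    assume ex: "exact_on (bar_boundary G \<phi>) (lists H)"
    have "exact_on tuple_codiff (?f ` lists H)"
      by (rule exact_on_image[where e = 1, OF ex]) (use bij sup comm in \<open>auto simp: bij_betw_def\<close>)
    then show "exact_on tuple_codiff (ntuples H)" using bij by (simp add: bij_betw_def)
  next
    assume ex: "exact_on tuple_codiff (ntuples H)"
    let ?g = "inv_into (lists H) ?f"
    have bij': "bij_betw ?g (ntuples H) (lists H)" using bij by (rule bij_betw_inv_into)
    have gf: "?g (?f xs) = xs" if "xs \<in> lists H" for xs
      using bij that by (simp add: bij_betw_inv_into_left)
    have "exact_on (bar_boundary G \<phi>) (?g ` ntuples H)"
    proof (rule exact_on_image[where e = 1, OF ex])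
      fix t assume t: "t \<in> ntuples H"
      show "tuple_codiff t \<in> supported (ntuples H)"
        using t by (intro tuple_codiff_subgroup[OF H]) (simp add: ntuples_def)
      have gt: "?g t \<in> lists H" using bij' t by (auto simp: bij_betw_def)
      have "push ?g (tuple_codiff t) = push ?g (push ?f (bar_boundary G \<phi> (?g t)))"
        using comm[OF gt] bij t by (simp add: bij_betw_inv_into_right)
      also have "\<dots> = bar_boundary G \<phi> (?g t)"
        unfolding push_push using sup[OF gt] gf by (rule push_ident)
      finally show "bar_boundary G \<phi> (?g t) = smul 1 (push ?g (tuple_codiff t))" by simp
    qed (use bij' in \<open>auto simp: bij_betw_def\<close>)
    then show "exact_on (bar_boundary G \<phi>) (lists H)" using bij' by (simp add: bij_betw_def)
  }
qed

end

section \<open>Joins\<close>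

text \<open>
  A simplex of a join, written as a list over a disjoint sum with all the left vertices first.
\<close>

definition join_list :: "'u list \<Rightarrow> 'w list \<Rightarrow> ('u + 'w) list" where
  "join_list xs ys = map Inl xs @ map Inr ys"

definition lefts :: "('u + 'w) list \<Rightarrow> 'u list" where "lefts zs = map projl (filter isl zs)"
definition rights :: "('u + 'w) list \<Rightarrow> 'w list" where "rights zs = map projr (filter (\<lambda>z. \<not> isl z) zs)"

lemma lefts_rights_join [simp]: "lefts (join_list xs ys) = xs" "rights (join_list xs ys) = ys"
  by (simp_all add: join_list_def lefts_def rights_def filter_map o_def)

lemma join_eq_iff [simp]: "join_list xs ys = join_list xs' ys' \<longleftrightarrow> xs = xs' \<and> ys = ys'"
  by (metis lefts_rights_join)

lemma join_eq_Nil [simp]: "join_list xs ys = [] \<longleftrightarrow> xs = [] \<and> ys = []"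
  by (simp add: join_list_def)

lemma list_bd_join:
  "list_bd (join_list xs ys) = push (\<lambda>xs'. join_list xs' ys) (list_bd xs)
     + smul ((- 1) ^ length xs) (push (join_list xs) (list_bd ys))"
  unfolding join_list_def by (simp add: list_bd_append list_bd_map push_push join_list_def[abs_def])

lemma restr_push_supported:
  assumes "c \<in> supported T" "\<And>x. x \<in> T \<Longrightarrow> f x \<in> S \<longleftrightarrow> x \<in> S'"
  shows "restr S (push f c) = push f (restr S' c)"
  unfolding restr_def push_def lin_extend_compose
  using assms(1) by (rule lin_extend_cong_supported) (simp add: assms(2))

section \<open>Amalgams\<close>

context twist
begin

text \<open>
  The simplices whose vertices lie in a common left coset of \<open>H\<close>. They form the disjoint union of the full simplices on the
  cosets, except that the empty list is shared.
\<close>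

definition coset_lists :: "'g set \<Rightarrow> 'g list set" where
  "coset_lists H = {xs. set xs \<subseteq> carrier G \<and> (\<forall>x\<in>set xs. \<forall>y\<in>set xs. inv x \<otimes> y \<in> H)}"

lemma coset_lists_subset: "xs \<in> coset_lists H \<Longrightarrow> set ys \<subseteq> set xs \<Longrightarrow> ys \<in> coset_lists H"
  by (auto simp: coset_lists_def)

lemma coset_lists_Int: "coset_lists A \<inter> coset_lists B = coset_lists (A \<inter> B)"
  by (auto simp: coset_lists_def)

lemma coset_lists_list_bd:
  "xs \<in> coset_lists H \<Longrightarrow> list_bd xs \<in> supported {ys\<in>coset_lists H. Suc (length ys) = length xs}"
  by (rule supported_mono[OF list_bd_supported]) (auto intro: coset_lists_subset)

lemma coset_lists_map:
  assumes "g \<in> carrier G" "set xs \<subseteq> carrier G"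
  shows "map ((\<otimes>) g) xs \<in> coset_lists H \<longleftrightarrow> xs \<in> coset_lists H"
proof -
  have "inv (g \<otimes> x) \<otimes> (g \<otimes> y) = inv x \<otimes> y" if "x \<in> set xs" "y \<in> set xs" for x y
  proof -
    have "x \<in> carrier G" "y \<in> carrier G" using that assms by auto
    then have "inv (g \<otimes> x) \<otimes> (g \<otimes> y) = inv x \<otimes> (inv g \<otimes> g) \<otimes> y"
      using assms(1) by (simp only: inv_mult_group m_assoc inv_closed m_closed)
    then show ?thesis using assms(1) \<open>x \<in> carrier G\<close> by simp
  qed
  then show ?thesis using assms by (auto simp: coset_lists_def)
qed

lemma coset_eqI:
  assumes "subgroup H G" "x \<in> carrier G" "y \<in> carrier G" "inv x \<otimes> y \<in> H"
  shows "x <# H = y <# H"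
proof (rule l_repr_independence[OF _ assms(2,1)])
  have "y = x \<otimes> (inv x \<otimes> y)" using assms by (simp add: m_assoc[symmetric])
  then show "y \<in> x <# H" using assms(4) unfolding l_coset_def by blast
qed

lemma coset_rep:
  assumes H: "subgroup H G" and x: "x \<in> carrier G"
  defines "r \<equiv> SOME y. y \<in> x <# H"
  shows "r \<in> carrier G" "inv r \<otimes> x \<in> H" "inv x \<otimes> r \<in> H"
proof -
  have "x \<otimes> \<one> \<in> x <# H" using subgroup.one_closed[OF H] unfolding l_coset_def by blast
  then have "r \<in> x <# H" unfolding r_def by (rule someI)
  then obtain h where h: "h \<in> H" "r = x \<otimes> h" unfolding l_coset_def by blast
  have hG: "h \<in> carrier G" using h(1) H by (rule subgroup.mem_carrier[rotated])
  show "r \<in> carrier G" using h hG x by simp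
  have "inv r \<otimes> x = inv h" using h hG x by (simp add: inv_mult_group m_assoc)
  then show "inv r \<otimes> x \<in> H" using h(1) H by (simp add: subgroup.m_inv_closed)
  have "inv x \<otimes> r = h" using h hG x by (simp add: m_assoc[symmetric])
  then show "inv x \<otimes> r \<in> H" using h(1) by simp
qed

text \<open>
  Each coset spans a full simplex, so coning off at a representative of the coset contracts everything but the
  degree of the single vertices. There the obstruction is the total coefficient over each coset, since the cosets are different
  components; this is the case \<open>n = 1\<close>.
\<close>

lemma coset_lists_bound:
  fixes c :: "'g list \<Rightarrow>\<^sub>0 'd"
  assumes H: "subgroup H G" and c: "c \<in> supported {xs\<in>coset_lists H. length xs = n}" and n: "n > 0"
    and cyc: "if n = 1 then push (\<lambda>xs. hd xs <# H) c = 0 else lin_extend list_bd c = 0"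
  shows "\<exists>u\<in>supported (coset_lists H). c = lin_extend list_bd u"
proof -
  define rep where "rep = (\<lambda>x. SOME y. y \<in> x <# H)"
  define s where "s = (\<lambda>xs. gen (rep (hd xs) # xs) :: 'g list \<Rightarrow>\<^sub>0 'd)"
  have rep: "rep x \<in> carrier G" "inv (rep x) \<otimes> x \<in> H" "inv x \<otimes> rep x \<in> H" if "x \<in> carrier G" for x
    using coset_rep[OF H that] unfolding rep_def by auto
  have rep_eq: "rep x = rep y" if "x \<in> carrier G" "y \<in> carrier G" "inv x \<otimes> y \<in> H" for x y
    unfolding rep_def using coset_eqI[OF H that] by simp
  have sS: "s xs \<in> supported (coset_lists H)" if mem: "xs \<in> coset_lists H" "xs \<noteq> []" for xs
  proof -
    obtain x ys where xs: "xs = x # ys" using mem(2) by (cases xs) auto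
    have x: "x \<in> carrier G" using mem xs by (auto simp: coset_lists_def)
    have y: "inv (rep x) \<otimes> y \<in> H" "inv y \<otimes> rep x \<in> H" if "y \<in> set xs" for y
    proof -
      have y: "y \<in> carrier G" "inv x \<otimes> y \<in> H" using that \<open>xs \<in> coset_lists H\<close> xs
        by (auto simp: coset_lists_def)
      then have "rep x = rep y" using rep_eq x by blast
      then show "inv (rep x) \<otimes> y \<in> H" "inv y \<otimes> rep x \<in> H" using rep[OF y(1)] by auto
    qed
    show ?thesis using mem rep[OF x] y subgroup.one_closed[OF H] xs
      by (auto simp: s_def coset_lists_def)
  qed
  have htpy: "lin_extend list_bd (s xs) + lin_extend s (list_bd xs) = gen xs"
    if len: "xs \<in> coset_lists H" "length xs \<ge> 2" for xs
  proof -
    obtain x ys where xs: "xs = x # ys" using len(2) by (cases xs) auto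
    have "lin_extend s (list_bd xs) = lin_extend (\<lambda>ys. gen (rep x # ys)) (list_bd xs)"
    proof (rule lin_extend_cong_supported[OF list_bd_supported])
      fix ys assume ys: "ys \<in> {ys. Suc (length ys) = length xs \<and> set ys \<subseteq> set xs}"
      then have "ys \<noteq> []" using that(2) by auto
      then have "hd ys \<in> set xs" using ys hd_in_set by blast
      then have "rep x = rep (hd ys)"
        using that(1) unfolding xs by (intro rep_eq) (auto simp: coset_lists_def)
      then show "s ys = gen (rep x # ys)" by (simp add: s_def)
    qed
    also have "\<dots> = gen xs - lin_extend list_bd (s xs)"
      by (simp add: s_def xs push_def)
    finally show ?thesis by simp
  qed
  have "c = lin_extend list_bd (lin_extend s c)"
  proof (cases "n = 1")
    case False
    have "lin_extend list_bd (lin_extend s c) + lin_extend s (lin_extend list_bd c)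
      = lin_extend (\<lambda>xs. lin_extend list_bd (s xs) + lin_extend s (list_bd xs)) c"
      by (simp add: lin_extend_compose lin_extend_fun_add)
    also have "\<dots> = c" using c by (rule lin_extend_eq_self) (use n False htpy in auto)
    finally show ?thesis using cyc False by simp
  next
    case True
    have "lin_extend list_bd (lin_extend s c) = lin_extend (\<lambda>xs. gen xs - gen [rep (hd xs)]) c"
      unfolding lin_extend_compose using c
    proof (rule lin_extend_cong_supported)
      fix xs assume "xs \<in> {xs \<in> coset_lists H. length xs = n}"
      then obtain x where "xs = [x]" using True by (auto simp: length_Suc_conv)
      then show "lin_extend list_bd (s xs) = gen xs - gen [rep (hd xs)]"
        by (simp add: s_def push_linear)
    qed
    also have "\<dots> = c - push (\<lambda>Z. [SOME y. y \<in> Z]) (push (\<lambda>xs. hd xs <# H) c)"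
      by (simp only: lin_extend_fun_diff lin_extend_gen push_push) (simp add: push_def rep_def)
    finally show ?thesis using cyc True by simp
  qed
  moreover have "lin_extend s c \<in> supported (coset_lists H)"
    using c by (rule supported_lin_extend) (use n sS in auto)
  ultimately show ?thesis by blast
qed

text \<open>
  The Bass-Serre graph of the pair has the cosets of \<open>A\<close> and \<open>B\<close> as vertices, and the coset \<open>x(A \<inter> B)\<close> is an edge that
  joins \<open>xA\<close> to \<open>xB\<close>. The condition says that this graph has no cycle with coefficients in \<open>'d\<close>: \<open>e\<close>
  induces a chain of edges, and its boundary vanishes when its sums over the cosets of \<open>A\<close> and of \<open>B\<close> do.
\<close>

definition tree_like :: "'g set \<Rightarrow> 'g set \<Rightarrow> bool" where
  "tree_like A B \<longleftrightarrow> (\<forall>e\<in>supported (carrier G) :: ('g \<Rightarrow>\<^sub>0 'd) set.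
     push (\<lambda>x. x <# A) e = 0 \<longrightarrow> push (\<lambda>x. x <# B) e = 0 \<longrightarrow> push (\<lambda>x. x <# (A \<inter> B)) e = 0)"

text \<open>
  The simplicial complex of the subsets of cosets of \<open>A\<close> or \<open>B\<close> is homotopy equivalent to the Bass-Serre
  graph. Vertices are connected since \<open>A\<close> and \<open>B\<close> generate \<open>G\<close>; in higher degrees one splits a cycle \<open>c\<close>
  into a part in the cosets of \<open>A\<close> and a part in those of \<open>B\<close>. Their common boundary \<open>e\<close> consists of simplices in
  cosets of \<open>A \<inter> B\<close>, and it bounds there: by coning off if its degree is positive, and by the absence
  of cycles in the graph if it is a chain of vertices.
\<close>

lemma coset_union_exact:
  assumes A: "subgroup A G" and B: "subgroup B G" and gen: "generate G (A \<union> B) = carrier G"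
    and tree: "tree_like A B"
  shows "exact_on (list_bd :: _ \<Rightarrow> 'g list \<Rightarrow>\<^sub>0 'd) (coset_lists A \<union> coset_lists B)"
    (is "exact_on _ ?F")
proof (rule exact_on_graded[where deg = length])
  fix xs ys :: "'g list"
  assume "ys \<in> Poly_Mapping.keys (list_bd xs :: _ \<Rightarrow>\<^sub>0 'd)"
  then show "length xs = Suc (length ys)" using list_bd_supported[of xs] by (auto simp: supported_def)
next
  fix n and c :: "'g list \<Rightarrow>\<^sub>0 'd"
  assume c: "c \<in> supported {x\<in>?F. length x = n}" "lin_extend list_bd c = 0"
  have sgC: "subgroup (A \<inter> B) G" using A B by (rule subgroups_Inter_pair)
  have AG: "A \<subseteq> carrier G" "B \<subseteq> carrier G" using A B by (auto dest: subgroup.subset)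
  consider "n = 0" | "n = 1" | "n \<ge> 2" by linarith
  then show "\<exists>u\<in>supported ?F. c = lin_extend list_bd u"
  proof cases
    case 1
    let ?u = "push (\<lambda>xs. [\<one>]) c"
    have "lin_extend list_bd ?u = c"
      unfolding lin_extend_push using c(1) by (rule lin_extend_eq_self) (use 1 in \<open>auto simp: push_def\<close>)
    moreover have "?u \<in> supported ?F"
      by (rule supported_push[of _ UNIV]) (auto simp: supported_def coset_lists_def subgroup.one_closed[OF A])
    ultimately show ?thesis by (metis)
  next
    case 2
    let ?P = "\<lambda>k. \<forall>h\<in>carrier G. \<exists>w\<in>supported ?F. gen [h \<otimes> k] - gen [h] = lin_extend list_bd (w :: _ \<Rightarrow>\<^sub>0 'd)"
    have edge: "?P k" if k: "k \<in> A \<union> B" for k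
    proof
      fix h assume h: "h \<in> carrier G"
      have kG: "k \<in> carrier G" using k AG by auto
      have "inv h \<otimes> (h \<otimes> k) = k" "inv (h \<otimes> k) \<otimes> h = inv k"
        "inv h \<otimes> h = \<one>"
        using h kG by (simp_all add: m_assoc[symmetric] inv_mult_group) (simp add: m_assoc)
      moreover have "inv (h \<otimes> k) \<otimes> (h \<otimes> k) = \<one>" using h kG by (intro l_inv m_closed)
      ultimately
      have "[h, h \<otimes> k] \<in> ?F" using k h kG A B
        by (auto simp: coset_lists_def subgroup.m_inv_closed subgroup.one_closed)
      then show "\<exists>w\<in>supported ?F. gen [h \<otimes> k] - gen [h] = lin_extend list_bd (w :: _ \<Rightarrow>\<^sub>0 'd)"
        by (intro bexI[of _ "gen [h, h \<otimes> k]"]) (auto simp: push_linear)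
    qed
    have "?P k" if "k \<in> generate G (A \<union> B)" for k using that
    proof (induction k rule: generate.induct)
      case one
      show ?case
      proof
        fix h assume "h \<in> carrier G"
        then show "\<exists>w\<in>supported ?F. gen [h \<otimes> \<one>] - gen [h] = lin_extend list_bd (w :: _ \<Rightarrow>\<^sub>0 'd)"
          by (intro bexI[of _ 0]) auto
      qed
    next
      case (incl h)
      then show ?case by (rule edge)
    next
      case (inv h)
      then show ?case using A B by (intro edge) (auto simp: subgroup.m_inv_closed)
    next
      case (eng k k')
      show ?case
      proof
        fix h assume h: "h \<in> carrier G"
        have kk: "k \<in> carrier G" "k' \<in> carrier G" using eng gen by auto
        obtain w where w: "w \<in> supported ?F" "gen [h \<otimes> k] - gen [h] = lin_extend list_bd (w :: _ \<Rightarrow>\<^sub>0 'd)"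
          using eng(3) h by blast
        obtain w' where w': "w' \<in> supported ?F" "gen [h \<otimes> k \<otimes> k'] - gen [h \<otimes> k] = lin_extend list_bd (w' :: _ \<Rightarrow>\<^sub>0 'd)"
          using eng(4) h kk by blast
        have "gen [h \<otimes> (k \<otimes> k')] - gen [h] = lin_extend list_bd (w' + w)"
          using h kk by (simp add: lin_extend_add m_assoc flip: w(2) w'(2))
        then show "\<exists>w\<in>supported ?F. gen [h \<otimes> (k \<otimes> k')] - gen [h] = lin_extend list_bd (w :: _ \<Rightarrow>\<^sub>0 'd)"
          using w(1) w'(1) supported_add by blast
      qed
    qed
    then have "\<exists>w\<in>supported ?F. gen [\<one> \<otimes> k] - gen [\<one>] = lin_extend list_bd (w :: _ \<Rightarrow>\<^sub>0 'd)" if "k \<in> carrier G" for k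
      using that gen by blast
    then have "\<exists>w\<in>supported ?F. gen [k] - gen [\<one>] = lin_extend list_bd (w :: _ \<Rightarrow>\<^sub>0 'd)" if "k \<in> carrier G" for k
      using that by fastforce
    then obtain w where w: "\<And>k. k \<in> carrier G \<Longrightarrow> w k \<in> supported ?F"
      "\<And>k. k \<in> carrier G \<Longrightarrow> gen [k] - gen [\<one>] = lin_extend list_bd (w k :: _ \<Rightarrow>\<^sub>0 'd)"
      by metis
    let ?u = "lin_extend (\<lambda>xs. w (hd xs)) c"
    have c': "c \<in> supported {[k] | k. k \<in> carrier G}"
      using c(1) by (rule supported_mono) (auto simp: 2 length_Suc_conv coset_lists_def)
    have "lin_extend list_bd ?u = lin_extend (\<lambda>xs. gen xs - push (\<lambda>ys. [\<one>]) (list_bd xs)) c"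
      unfolding lin_extend_compose using c'
    proof (rule lin_extend_cong_supported)
      fix xs assume "xs \<in> {[k] | k. k \<in> carrier G}"
      then show "lin_extend list_bd (w (hd xs)) = gen xs - push (\<lambda>ys. [\<one>]) (list_bd xs)"
        by (auto simp: push_linear simp flip: w(2))
    qed
    also have "\<dots> = c"
      using c(2) by (simp add: lin_extend_fun_diff lin_extend_gen flip: push_lin_extend)
    finally have "c = lin_extend list_bd ?u" by simp
    moreover have "?u \<in> supported ?F"
      using c' by (rule supported_lin_extend) (use w(1) in auto)
    ultimately show ?thesis by blast
  next
    case 3
    define a where "a = restr (coset_lists A) c"
    define b where "b = c - a"
    have a: "a \<in> supported {xs\<in>coset_lists A. length xs = n}"
      unfolding a_def by (rule supported_mono[OF supported_restr[OF c(1)]]) auto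
    have b: "b \<in> supported {xs\<in>coset_lists B. length xs = n}"
      unfolding a_def b_def by (rule supported_mono[OF supported_minus_restr[OF c(1)]]) auto
    have bd: "lin_extend list_bd x \<in> supported {xs\<in>coset_lists H. length xs = n - 1}"
      if "x \<in> supported {xs\<in>coset_lists H. length xs = n}" for H and x :: "'g list \<Rightarrow>\<^sub>0 'd"
      using that by (rule supported_lin_extend, intro supported_mono[OF coset_lists_list_bd]) (use 3 in auto)
    have collapse: "push (\<lambda>xs. hd xs <# H) (lin_extend list_bd x) = 0"
      if "x \<in> supported {xs\<in>coset_lists H. length xs = 2}" "subgroup H G" for H and x :: "'g list \<Rightarrow>\<^sub>0 'd"
      unfolding push_lin_extend using that(1)
    proof (rule lin_extend_eq_zero)
      fix xs assume xs: "xs \<in> {xs\<in>coset_lists H. length xs = 2}"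
      then obtain x y where xy: "xs = [x, y]" by (auto simp: length_Suc_conv numeral_2_eq_2)
      have "x <# H = y <# H" using xs xy that(2) by (intro coset_eqI) (auto simp: coset_lists_def)
      then show "push (\<lambda>xs. hd xs <# H) (list_bd xs :: _ \<Rightarrow>\<^sub>0 'd) = 0" by (simp add: xy push_linear)
    qed
    define e where "e = lin_extend list_bd a"
    have eb: "e = - lin_extend list_bd b"
      using c(2) by (simp add: e_def b_def lin_extend_diff)
    have e: "e \<in> supported {xs\<in>coset_lists (A \<inter> B). length xs = n - 1}"
      by (rule supported_mono[OF supported_Int[of _ "{xs\<in>coset_lists A. length xs = n - 1}" "{xs\<in>coset_lists B. length xs = n - 1}"]])
        (use bd[OF a] bd[OF b] in \<open>auto simp: eb simp flip: coset_lists_Int e_def\<close>)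
    have "\<exists>f\<in>supported (coset_lists (A \<inter> B)). e = lin_extend list_bd f"
    proof (rule coset_lists_bound[OF sgC e])
      show "0 < n - 1" using 3 by simp
      show "if n - 1 = 1 then push (\<lambda>xs. hd xs <# (A \<inter> B)) e = 0 else lin_extend list_bd e = 0"
      proof (cases "n = 2")
        case True
        have "push (\<lambda>xs. hd xs <# A) e = 0" using collapse[of a A] a A True by (simp add: e_def)
        moreover have "push (\<lambda>xs. hd xs <# B) e = 0" using collapse[of b B] b B True
          by (simp add: eb push_linear)
        moreover have "push hd e \<in> supported (carrier G)"
          using e by (rule supported_push) (use True in \<open>auto simp: coset_lists_def length_Suc_conv\<close>)
        ultimately have "push (\<lambda>x. x <# (A \<inter> B)) (push hd e) = 0"
          using tree[unfolded tree_like_def, rule_format, of "push hd e"] by (simp add: push_push)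
        then show ?thesis using True by (simp add: push_push)
      next
        case False
        have "lin_extend list_bd e = 0"
          unfolding e_def lin_extend_compose using a by (rule lin_extend_eq_zero) (rule list_bd_list_bd)
        moreover have "n - 1 \<noteq> 1" using False 3 by linarith
        ultimately show ?thesis by simp
      qed
    qed
    then obtain f where f: "f \<in> supported (coset_lists (A \<inter> B))" "e = lin_extend list_bd f" by blast
    let ?f = "restr {xs. length xs = n} f"
    have fn: "?f \<in> supported {xs\<in>coset_lists (A \<inter> B). length xs = n}"
      by (rule supported_mono[OF supported_restr[OF f(1)]]) auto
    have "lin_extend list_bd ?f = restr {xs. length xs = n - 1} (lin_extend list_bd f)"
      unfolding lin_extend_restr restr_lin_extend
    proof (rule lin_extend_cong)
      fix xs :: "'g list"
      show "(if xs \<in> {xs. length xs = n} then list_bd xs else 0) = restr {xs. length xs = n - 1} (list_bd xs :: _ \<Rightarrow>\<^sub>0 'd)"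
      proof (cases "length xs = n")
        case True
        then have "(list_bd xs :: _ \<Rightarrow>\<^sub>0 'd) \<in> supported {xs. length xs = n - 1}"
          by (intro supported_mono[OF list_bd_supported]) auto
        then show ?thesis using True by (simp add: restr_ident)
      next
        case False
        have "restr {xs. length xs = n - 1} (list_bd xs :: _ \<Rightarrow>\<^sub>0 'd) = 0"
          using list_bd_supported by (rule restr_eq_0) (use False 3 in auto)
        then show ?thesis using False by simp
      qed
    qed
    then have ef: "e = lin_extend list_bd ?f"
    proof -
      have "restr {xs. length xs = n - 1} e = e"
        by (rule restr_ident[OF supported_mono[OF e]]) auto
      then show "lin_extend list_bd ?f = restr {xs. length xs = n - 1} (lin_extend list_bd f)
        \<Longrightarrow> e = lin_extend list_bd ?f" using f(2) by simp
    qed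
    have fA: "?f \<in> supported {xs\<in>coset_lists A. length xs = n}" "?f \<in> supported {xs\<in>coset_lists B. length xs = n}"
      using fn by (auto intro: supported_mono simp flip: coset_lists_Int)
    have "\<exists>u\<in>supported (coset_lists A). a - ?f = lin_extend list_bd u"
      by (rule coset_lists_bound[OF A supported_diff[OF a fA(1)]])
        (use 3 ef in \<open>auto simp: lin_extend_diff e_def\<close>)
    then obtain u where u: "u \<in> supported (coset_lists A)" "a - ?f = lin_extend list_bd u" by blast
    have "\<exists>v\<in>supported (coset_lists B). b + ?f = lin_extend list_bd v"
      by (rule coset_lists_bound[OF B supported_add[OF b fA(2)]])
        (use 3 eb in \<open>auto simp: lin_extend_add simp flip: ef\<close>)
    then obtain v where v: "v \<in> supported (coset_lists B)" "b + ?f = lin_extend list_bd v" by blast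
    have "c = (a - ?f) + (b + ?f)" by (simp add: b_def)
    also have "\<dots> = lin_extend list_bd (u + v)" by (simp only: u v lin_extend_add)
    finally have "c = lin_extend list_bd (u + v)" .
    moreover have "u + v \<in> supported ?F"
      using u(1) v(1) by (intro supported_add) (auto intro: supported_mono)
    ultimately show ?thesis by blast
  qed
qed


definition untag :: "'u + 'u \<Rightarrow> 'u" where "untag = case_sum id id"

lemma untag_simps [simp]: "untag (Inl x) = x" "untag (Inr x) = x"
  by (simp_all add: untag_def)

lemma map_untag_join [simp]: "map untag (join_list xs ys) = xs @ ys"
  by (simp add: join_list_def o_def)

text \<open>
  The relative homology of the amalgam is the homology of the coinvariants of the joins \<open>k * h\<close> with \<open>k\<close> a
  nonempty tuple over \<open>G\<close> and \<open>h\<close> in the exact complex of \<open>coset_union_exact\<close>. Filtered by \<open>k\<close>, these joins form an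
  exact complex. Given \<open>y\<close> whose boundary \<open>e\<close> lies in the sum of the two subcomplexes, all tuples of \<open>e\<close> lie in
  \<open>A\<close> or in \<open>B\<close>, so \<open>e\<close> can be moved by a prism from the left to the right side of the join, where it
  becomes invisible. Hence \<open>y * [] + prism e\<close> is a cycle, and bounds. Forgetting the distinction of
  the two sides turns the bounding chain into one for \<open>y\<close>, up to terms whose tuples lie
  in \<open>A\<close> or \<open>B\<close>.
\<close>

lemma amalgam_relative:
  assumes A: "subgroup A G" and B: "subgroup B G" and gen: "generate G (A \<union> B) = carrier G"
    and tree: "tree_like A B"
    and y: "y \<in> supported (ntuples (carrier G))"
    and dy: "lin_extend tuple_codiff y \<in> supported (ntuples A \<union> ntuples B)"
  shows "\<exists>u\<in>supported (ntuples (carrier G)). y - lin_extend tuple_codiff u \<in> supported (ntuples A \<union> ntuples B)"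
proof -
  let ?F = "coset_lists A \<union> coset_lists B"
  let ?S = "ntuples A \<union> ntuples B"
  let ?T = "tuples (carrier G)"
  (* The double complex: pairs of a nonempty tuple k and a possibly empty list h of ?F, with the
     diagonal action. The pairs with h = [] span the bar complex of G as a subcomplex. *)
  define J where "J = {join_list k h | k h. k \<in> ?T \<and> h \<in> ?F}"
  define act where "act = (\<lambda>g. map (map_sum ((\<otimes>) g) ((\<otimes>) g)) :: ('g + 'g) list \<Rightarrow> ('g + 'g) list)"
  define \<theta> where "\<theta> = (\<lambda>l :: ('g + 'g) list. untag (hd l))"
  define bJ where "bJ = (\<lambda>l. restr J (list_bd l) :: ('g + 'g) list \<Rightarrow>\<^sub>0 'd)"
  have AG: "A \<subseteq> carrier G" "B \<subseteq> carrier G" using A B by (auto dest: subgroup.subset)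
  have F_set: "set h \<subseteq> carrier G" if "h \<in> ?F" for h using that by (auto simp: coset_lists_def)
  have F_sub: "h' \<in> ?F" if "h \<in> ?F" "set h' \<subseteq> set h" for h h' using that coset_lists_subset by blast
  have F_bd: "list_bd h \<in> supported ?F" if "h \<in> ?F" for h
    by (rule supported_mono[OF list_bd_supported]) (use that F_sub in blast)
  have F_act: "map ((\<otimes>) g) h \<in> ?F \<longleftrightarrow> h \<in> ?F" if "g \<in> carrier G" "set h \<subseteq> carrier G" for g h
    using coset_lists_map[OF that] by blast
  have T_act: "map ((\<otimes>) g) k \<in> ?T \<longleftrightarrow> k \<in> ?T" if "g \<in> carrier G" "set k \<subseteq> carrier G" for g k
    using that by (auto simp: tuples_def)
  have T_set: "set k \<subseteq> carrier G" "k \<noteq> []" if "k \<in> ?T" for k using that by (auto simp: tuples_def)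
  have act_join [simp]: "act g (join_list k h) = join_list (map ((\<otimes>) g) k) (map ((\<otimes>) g) h)" for g k h
    by (simp add: act_def join_list_def)
  have J_join [simp]: "join_list k h \<in> J \<longleftrightarrow> k \<in> ?T \<and> h \<in> ?F" for k h
    by (auto simp: J_def)
  have \<theta>_join [simp]: "\<theta> (join_list k h) = hd k" if "k \<noteq> []" for k h
    using that by (simp add: \<theta>_def join_list_def hd_append hd_map)
  have freeJ: "free_action act J \<theta>"
    unfolding free_action_def
  proof (intro conjI ballI)
    fix l assume "l \<in> J"
    then obtain k h where l: "l = join_list k h" "k \<in> ?T" "h \<in> ?F" by (auto simp: J_def)
    note kh = T_set[OF l(2)] F_set[OF l(3)]
    have hdk: "hd k \<in> carrier G" using kh by (auto simp: subset_iff)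
    show "\<theta> l \<in> carrier G" using hdk kh by (simp add: l)
    show "act \<one> l = l" unfolding l act_join using kh by (simp only: map_mult_one)
    fix g assume g: "g \<in> carrier G"
    show "act g l \<in> J" unfolding l(1) act_join J_join
      using F_act[OF g kh(3)] T_act[OF g kh(1)] l(2,3) by blast
    show "\<theta> (act g l) = g \<otimes> \<theta> l" using g kh l by (simp add: hd_map)
    fix g' assume g': "g' \<in> carrier G"
    show "act g (act g' l) = act (g \<otimes> g') l" unfolding l act_join using g g' kh by (simp only: map_mult_mult)
  qed
  have bd_join: "list_bd (join_list k h) \<in> supported {join_list k' h' | k' h'. set k' \<subseteq> carrier G \<and> h' \<in> ?F}"
    if "k \<in> ?T" "h \<in> ?F" for k h
    unfolding list_bd_join
  proof (intro supported_add supported_smul)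
    show "push (\<lambda>k'. join_list k' h) (list_bd k) \<in> supported {join_list k' h' | k' h'. set k' \<subseteq> carrier G \<and> h' \<in> ?F}"
      using list_bd_supported by (rule supported_push) (use T_set[OF that(1)] that(2) in auto)
    show "push (join_list k) (list_bd h) \<in> supported {join_list k' h' | k' h'. set k' \<subseteq> carrier G \<and> h' \<in> ?F}"
      using F_bd[OF that(2)] by (rule supported_push) (use T_set[OF that(1)] in auto)
  qed
  have bJ_join: "bJ (join_list k h) = push (\<lambda>k'. join_list k' h) (tuple_bd k) + smul ((- 1) ^ length k) (push (join_list k) (list_bd h))"
    if "k \<in> ?T" "h \<in> ?F" for k h
  proof -
    have "restr J (push (\<lambda>k'. join_list k' h) (list_bd k)) = push (\<lambda>k'. join_list k' h) (tuple_bd k :: _ \<Rightarrow>\<^sub>0 'd)"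
      unfolding tuple_bd_def using list_bd_supported
      by (rule restr_push_supported) (use that in \<open>auto simp: tuples_def\<close>)
    moreover have "restr J (push (join_list k) (list_bd h)) = push (join_list k) (list_bd h :: _ \<Rightarrow>\<^sub>0 'd)"
      by (rule restr_ident[OF supported_push[OF F_bd[OF that(2)]]]) (use that in auto)
    ultimately show ?thesis by (simp add: bJ_def list_bd_join restr_linear)
  qed
  have equivJ: "equivariant act J act J bJ"
    unfolding equivariant_def
  proof (intro conjI ballI)
    fix l assume "l \<in> J"
    then obtain k h where l: "l = join_list k h" "k \<in> ?T" "h \<in> ?F" by (auto simp: J_def)
    show "bJ l \<in> supported J" by (simp add: bJ_def)
    show "central (bJ l)" by (simp add: bJ_def central_restr central_list_bd)
    fix g assume g: "g \<in> carrier G"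
    show "bJ (act g l) = push (act g) (bJ l)"
      unfolding bJ_def act_def list_bd_map
    proof (rule restr_push_supported[OF bd_join[OF l(2,3), folded l(1)]], clarify)
      fix k' h' assume *: "set k' \<subseteq> carrier G" "h' \<in> ?F"
      show "map (map_sum ((\<otimes>) g) ((\<otimes>) g)) (join_list k' h') \<in> J \<longleftrightarrow> join_list k' h' \<in> J"
        using g * F_set[OF *(2)] F_act T_act unfolding act_join[unfolded act_def] J_join by blast
    qed
  qed
  have bJbJ: "lin_extend bJ (bJ l) = 0" if lJ: "l \<in> J" for l
  proof -
    obtain k h where l: "l = join_list k h" "k \<in> ?T" "h \<in> ?F" using lJ by (auto simp: J_def)
    have "bJ l = restr J (list_bd l)" by (simp add: bJ_def)
    then have "lin_extend bJ (bJ l) = lin_extend (\<lambda>z. if z \<in> J then bJ z else 0) (list_bd l)"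
      by (simp add: lin_extend_restr)
    also have "\<dots> = lin_extend bJ (list_bd l)" using bd_join[OF l(2,3), folded l(1)]
    proof (rule lin_extend_cong_supported)
      fix z assume "z \<in> {join_list k' h' | k' h'. set k' \<subseteq> carrier G \<and> h' \<in> ?F}"
      then obtain k' h' where z: "z = join_list k' h'" "set k' \<subseteq> carrier G" "h' \<in> ?F" by blast
      have "bJ (join_list [] h') = 0"
      proof -
        have "push (join_list []) (list_bd h') \<in> supported {join_list [] l | l. True}"
          by (rule supported_push[OF list_bd_supported]) auto
        then have "restr J (push (join_list []) (list_bd h')) = 0"
          by (rule restr_eq_0) (auto simp: J_def tuples_def)
        then show ?thesis by (simp add: bJ_def list_bd_join)
      qed
      then show "(if z \<in> J then bJ z else 0) = bJ z" using z by (auto simp: tuples_def)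
    qed
    also have "\<dots> = 0" unfolding bJ_def restr_lin_extend[symmetric] by (simp add: list_bd_list_bd)
    finally show ?thesis .
  qed
  (* Each block consists of the joins with a fixed left part k, and is a shifted copy of the exact complex
     of ?F; the faces that omit an entry of k lower the rank. *)
  have exact_J: "exact_on (codiff act \<theta> bJ) {l\<in>J. \<theta> l = \<one>}"
  proof (rule exact_on_filtered[where \<kappa> = lefts and r = length
        and b_top = "\<lambda>l. smul ((- 1) ^ length (lefts l)) (push (join_list (lefts l)) (list_bd (rights l)))"])
    fix l assume "l \<in> {l\<in>J. \<theta> l = \<one>}"
    then obtain k h where l: "l = join_list k h" "k \<in> ?T" "h \<in> ?F" "hd k = \<one>" "l \<in> J"
      by (auto simp: J_def tuples_def)
    show "codiff act \<theta> bJ l \<in> supported {l\<in>J. \<theta> l = \<one>}"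
      using codiff_supported[OF freeJ equivJ l(5)] .
    show "lin_extend (codiff act \<theta> bJ) (codiff act \<theta> bJ l) = 0"
      using codiff_codiff[OF freeJ equivJ l(5) bJbJ[OF l(5)]] .
    have k: "k \<noteq> []" using l(2) T_set by simp
    let ?b0 = "smul ((- 1) ^ length (lefts l)) (push (join_list (lefts l)) (list_bd (rights l))) :: _ \<Rightarrow>\<^sub>0 'd"
    have hp: "push (join_list k) (list_bd h :: _ \<Rightarrow>\<^sub>0 'd) \<in> supported {l'\<in>{l\<in>J. \<theta> l = \<one>}. lefts l' = k}"
      using F_bd[OF l(3)] by (rule supported_push) (use l k in auto)
    then show "?b0 \<in> supported {l'\<in>{l\<in>J. \<theta> l = \<one>}. lefts l' = lefts l}"
      unfolding l(1) lefts_rights_join by (rule supported_smul)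
    have "lin_extend (nrm act \<theta>) (push (join_list k) (list_bd h)) = push (join_list k) (list_bd h)"
      by (rule nrm_ident_supported[OF freeJ supported_mono[OF hp]]) auto
    then have "codiff act \<theta> bJ l - ?b0 = lin_extend (nrm act \<theta>) (push (\<lambda>k'. join_list k' h) (tuple_bd k))"
      unfolding codiff_def l(1) bJ_join[OF l(2,3)] by (simp add: lin_extend_linear)
    also have "\<dots> \<in> supported {l'\<in>{l\<in>J. \<theta> l = \<one>}. length (lefts l') < length (lefts l)}"
      unfolding lin_extend_push using tuple_bd_supported
    proof (rule supported_lin_extend)
      fix k' assume k': "k' \<in> {ys. ys \<noteq> [] \<and> Suc (length ys) = length k \<and> set ys \<subseteq> set k}"
      then have J': "join_list k' h \<in> J" using l T_set[OF l(2)] by (auto simp: tuples_def)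
      have "nrm act \<theta> (join_list k' h) \<in> supported {l\<in>J. \<theta> l = \<one>}" using nrm_supported[OF freeJ J'] .
      moreover have "nrm act \<theta> (join_list k' h) \<in> supported {l'. length (lefts l') < length (lefts l)}"
        using k' by (auto simp: nrm_def l(1))
      ultimately show "nrm act \<theta> (join_list k' h) \<in> supported {l'\<in>{l\<in>J. \<theta> l = \<one>}. length (lefts l') < length (lefts l)}"
        by (rule supported_mono[OF supported_Int]) auto
    qed
    finally show "codiff act \<theta> bJ l - ?b0 \<in> supported {l'\<in>{l\<in>J. \<theta> l = \<one>}. length (lefts l') < length (lefts l)}" .
  next
    fix k :: "'g list"
    let ?b = "\<lambda>l. smul ((- 1) ^ length (lefts l)) (push (join_list (lefts l)) (list_bd (rights l) :: 'g list \<Rightarrow>\<^sub>0 'd))"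
    show "exact_on ?b {l\<in>{l\<in>J. \<theta> l = \<one>}. lefts l = k}"
    proof (cases "k \<in> ?T \<and> hd k = \<one>")
      case True
      then have k: "k \<noteq> []" by (simp add: tuples_def)
      have "exact_on ?b (join_list k ` ?F)"
      proof (rule exact_on_image[OF coset_union_exact[OF A B gen tree]])
        show "inj_on (join_list k) ?F" by (auto intro: inj_onI)
        show "(- 1 :: 'd) ^ length k = 1 \<or> (- 1 :: 'd) ^ length k = - 1" by (cases "even (length k)") auto
      qed (use F_bd in auto)
      moreover have "join_list k ` ?F = {l\<in>{l\<in>J. \<theta> l = \<one>}. lefts l = k}"
        using True k by (auto simp: J_def)
      ultimately show ?thesis by simp
    next
      case False
      have "{l\<in>{l\<in>J. \<theta> l = \<one>}. lefts l = k} = {}"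
        using False by (auto simp: J_def tuples_def)
      then show ?thesis by (simp only: exact_on_empty)
    qed
  qed
  define e where "e = lin_extend tuple_codiff y"
  have nil_F: "[] \<in> ?F" by (simp add: coset_lists_def)
  define F' where "F' = {h\<in>?F. h \<noteq> []}"
  have F'T: "F' \<subseteq> ?T" using F_set by (auto simp: F'_def tuples_def)
  have free_F': "free_action tact F' hd"
    unfolding free_action_def
  proof (intro conjI ballI)
    fix h assume h: "h \<in> F'"
    then have hT: "h \<in> ?T" "set h \<subseteq> carrier G" "h \<in> ?F" using F'T T_set by (auto simp: F'_def)
    note * = free_action_tuples[unfolded free_action_def]
    show "hd h \<in> carrier G" "tact \<one> h = h" using * hT(1) by blast+
    fix g assume g: "g \<in> carrier G"
    show "tact g h \<in> F'" using F_act[OF g hT(2)] hT(3) h by (simp add: F'_def)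
    show "hd (tact g h) = g \<otimes> hd h" using * hT(1) g by blast
    fix g' assume "g' \<in> carrier G"
    then show "tact g (tact g' h) = tact (g \<otimes> g') h" using * hT(1) g by blast
  qed
  have ntuples_coset: "ntuples H \<subseteq> {h\<in>coset_lists H. h \<noteq> [] \<and> hd h = \<one>}" if "subgroup H G" for H
  proof
    fix h assume h: "h \<in> ntuples H"
    then have "inv x \<otimes> y \<in> H" if "x \<in> set h" "y \<in> set h" for x y
      using that \<open>subgroup H G\<close> by (auto simp: ntuples_def tuples_def intro!: subgroup.m_closed subgroup.m_inv_closed)
    then show "h \<in> {h\<in>coset_lists H. h \<noteq> [] \<and> hd h = \<one>}"
      using h subgroup.subset[OF that] by (auto simp: ntuples_def tuples_def coset_lists_def)
  qed
  (* A list in a coset of A that starts with the unit lies in A, since the coset then is A itself. *)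
  have SF: "?S \<subseteq> {h\<in>F'. hd h = \<one>}"
    using ntuples_coset[OF A] ntuples_coset[OF B] by (auto simp: F'_def)
  have coset_ntuples: "h \<in> ntuples H" if "h \<in> coset_lists H" "h \<noteq> []" "hd h = \<one>" for h H
  proof -
    have "\<one> \<in> set h" using that(2,3) by (metis hd_in_set)
    then have "inv \<one> \<otimes> x \<in> H" "x \<in> carrier G" if "x \<in> set h" for x
      using that \<open>h \<in> coset_lists H\<close> by (auto simp: coset_lists_def)
    then show ?thesis using that by (auto simp: ntuples_def tuples_def)
  qed
  have FS: "{h\<in>F'. hd h = \<one>} \<subseteq> ?S" using coset_ntuples by (auto simp: F'_def)
  have e: "e \<in> supported {h\<in>F'. hd h = \<one>}" using dy SF unfolding e_def by (rule supported_mono)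
  have yT: "y \<in> supported ?T" using y by (rule supported_mono) (auto simp: ntuples_def)
  have de: "lin_extend tuple_codiff e = 0"
    unfolding e_def lin_extend_compose using yT
    by (rule lin_extend_eq_zero)
      (rule codiff_codiff[OF free_action_tuples equivariant_tuple_bd _ tuple_bd_tuple_bd])
  let ?P = "prism Inl Inr :: 'g list \<Rightarrow> ('g + 'g) list \<Rightarrow>\<^sub>0 'd"
  let ?n = "lin_extend (nrm act \<theta>)" and ?m = "lin_extend (nrm tact hd)"
  have P_supp: "?P h \<in> supported {join_list k l | k l. k \<noteq> [] \<and> l \<noteq> [] \<and> set k \<subseteq> set h \<and> set l \<subseteq> set h \<and> hd k = hd h}" for h
    using prism_supported[of Inl Inr h] by (simp add: join_list_def)
  have P_J: "?P h \<in> supported J" if "h \<in> ?F" for h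
  proof (rule supported_mono[OF P_supp], clarify)
    fix k l assume "k \<noteq> []" "set k \<subseteq> set h" "set l \<subseteq> set h"
    then show "join_list k l \<in> J" unfolding J_join
      using F_sub[OF that] F_set[OF that] by (simp add: tuples_def del: Un_iff)
  qed
  have equivP: "equivariant tact F' act J ?P"
    unfolding equivariant_def
  proof (intro conjI ballI)
    fix h g assume "h \<in> F'" "g \<in> carrier G"
    show "?P (tact g h) = push (act g) (?P h)"
      unfolding act_def prism_map push_map_prism by (simp add: o_def)
  qed (use P_J in \<open>auto simp: F'_def central_prism\<close>)
  (* The prism of h runs from the join (h, []) to the join ([], h); the latter is not in J. So the boundary of
     the prism of e cancels that of y, up to the prism of the boundary of e, which vanishes. *)
  define w where "w = push (\<lambda>l. join_list l []) y + lin_extend ?P e"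
  have w: "w \<in> supported {l\<in>J. \<theta> l = \<one>}"
    unfolding w_def
  proof (rule supported_add)
    show "push (\<lambda>l. join_list l []) y \<in> supported {l\<in>J. \<theta> l = \<one>}"
      using y nil_F by (intro supported_push[OF y]) (auto simp: ntuples_def tuples_def)
    show "lin_extend ?P e \<in> supported {l\<in>J. \<theta> l = \<one>}"
      using e
    proof (rule supported_lin_extend)
      fix h assume h: "h \<in> {h\<in>F'. hd h = \<one>}"
      show "?P h \<in> supported {l\<in>J. \<theta> l = \<one>}"
        by (rule supported_mono[OF supported_Int[OF P_supp P_J]]) (use h in \<open>auto simp: F'_def\<close>)
    qed
  qed
  have dw1: "lin_extend (codiff act \<theta> bJ) (push (\<lambda>l. join_list l []) y) = push (\<lambda>l. join_list l []) e"
    unfolding e_def push_lin_extend lin_extend_push using yT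
  proof (rule lin_extend_cong_supported)
    fix k assume k: "k \<in> ?T"
    have "codiff act \<theta> bJ (join_list k []) = ?n (push (\<lambda>k'. join_list k' []) (tuple_bd k))"
      unfolding codiff_def using bJ_join[OF k nil_F] by simp
    also have "\<dots> = push (\<lambda>l. join_list l []) (?m (tuple_bd k))"
      unfolding lin_extend_push push_lin_extend using tuple_bd_closed[OF k]
    proof (rule lin_extend_cong_supported)
      fix k' assume "k' \<in> ?T"
      then have "k' \<noteq> []" by (simp add: tuples_def)
      then show "nrm act \<theta> (join_list k' []) = push (\<lambda>l. join_list l []) (nrm tact hd k')"
        using act_join[of _ k' "[]"] \<theta>_join[of k' "[]"] by (simp add: nrm_def del: act_join \<theta>_join)
    qed
    finally show "codiff act \<theta> bJ (join_list k []) = push (\<lambda>l. join_list l []) (tuple_codiff k)"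
      by (simp add: codiff_def)
  qed
  have dw2: "lin_extend (codiff act \<theta> bJ) (lin_extend ?P e) = - push (\<lambda>l. join_list l []) e"
  proof -
    have F'e: "e \<in> supported F'" using e by (rule supported_mono) auto
    have "lin_extend bJ (lin_extend ?P e) = lin_extend (\<lambda>h. - gen (join_list h []) - lin_extend ?P (tuple_bd h)) e"
      unfolding lin_extend_compose using F'e
    proof (rule lin_extend_cong_supported)
      fix h assume h: "h \<in> F'"
      have "lin_extend bJ (?P h) = restr J (lin_extend list_bd (?P h))"
        by (simp add: bJ_def[abs_def] restr_lin_extend)
      also have "lin_extend list_bd (?P h) = gen (join_list [] h) - gen (join_list h []) - lin_extend ?P (list_bd h)"
        using prism_homotopy[of Inl Inr h, where 'd = 'd] by (simp add: join_list_def algebra_simps)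
      also have "lin_extend ?P (list_bd h) = lin_extend ?P (tuple_bd h)"
        unfolding tuple_bd_def lin_extend_restr by (rule lin_extend_cong) auto
      also have "restr J (gen (join_list [] h) - gen (join_list h []) - lin_extend ?P (tuple_bd h))
        = - gen (join_list h []) - restr J (lin_extend ?P (tuple_bd h))"
        using h F_set[of h] nil_F J_join[of "[]" h] J_join[of h "[]"] by (simp add: restr_linear F'_def tuples_def del: J_join)
      also have "restr J (lin_extend ?P (tuple_bd h)) = lin_extend ?P (tuple_bd h)"
      proof (rule restr_ident, rule supported_lin_extend[OF tuple_bd_supported])
        fix h' assume "h' \<in> {ys. ys \<noteq> [] \<and> Suc (length ys) = length h \<and> set ys \<subseteq> set h}"
        then show "?P h' \<in> supported J" using h F_sub by (intro P_J) (auto simp: F'_def)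
      qed
      finally show "lin_extend bJ (?P h) = - gen (join_list h []) - lin_extend ?P (tuple_bd h)" .
    qed
    also have "\<dots> = - push (\<lambda>l. join_list l []) e - lin_extend ?P (lin_extend tuple_bd e)"
      by (simp add: lin_extend_fun_diff lin_extend_fun_uminus lin_extend_compose push_def)
    finally have 1: "lin_extend bJ (lin_extend ?P e) = \<dots>" .
    have bde: "lin_extend tuple_bd e \<in> supported F'"
      using F'e by (rule supported_lin_extend, intro supported_mono[OF tuple_bd_supported])
        (use F_sub in \<open>auto simp: F'_def\<close>)
    have "?n (lin_extend ?P (lin_extend tuple_bd e)) = ?n (lin_extend ?P (?m (lin_extend tuple_bd e)))"
      using nrm_equivariant_nrm_chain[OF free_F' freeJ equivP bde] by simp
    also have "?m (lin_extend tuple_bd e) = 0" using de by (simp add: lin_extend_codiff)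
    finally have 2: "?n (lin_extend ?P (lin_extend tuple_bd e)) = 0" by simp
    have "push (\<lambda>l. join_list l []) e \<in> supported {l\<in>J. \<theta> l = \<one>}"
      using e F_set nil_F J_join[of _ "[]"] \<theta>_join[of _ "[]"] F'T by (intro supported_push[OF e]) (auto simp: F'_def simp del: J_join \<theta>_join)
    then have 3: "?n (push (\<lambda>l. join_list l []) e) = push (\<lambda>l. join_list l []) e"
      by (rule nrm_ident_supported[OF freeJ])
    show ?thesis unfolding lin_extend_codiff 1 by (simp add: lin_extend_linear 2 3)
  qed
  have "lin_extend (codiff act \<theta> bJ) w = 0"
    unfolding w_def by (simp add: lin_extend_add dw1 dw2)
  then obtain u where u: "u \<in> supported {l\<in>J. \<theta> l = \<one>}" "w = lin_extend (codiff act \<theta> bJ) u"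
    using exact_onD[OF exact_J w] by blast
  (* Forgetting the tags commutes with the boundaries except for the faces of the form ([], h) left out in J;
     these are lists in a coset of A or B. *)
  let ?\<Phi> = "push (map untag) :: (('g + 'g) list \<Rightarrow>\<^sub>0 'd) \<Rightarrow> _"
  have uJ: "u \<in> supported J" using u(1) by (rule supported_mono) auto
  have \<Phi>u: "?\<Phi> u \<in> supported (ntuples (carrier G))"
    using u(1)
  proof (rule supported_push)
    fix l assume "l \<in> {l\<in>J. \<theta> l = \<one>}"
    then obtain k h where "l = join_list k h" "k \<in> ?T" "h \<in> ?F" "hd k = \<one>" by (auto simp: J_def tuples_def)
    then show "map untag l \<in> ntuples (carrier G)" using F_set[of h] by (auto simp: ntuples_def tuples_def)
  qed
  have equiv\<Phi>: "equivariant act J tact ?T (\<lambda>l. gen (map untag l))"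
    unfolding equivariant_def
  proof (intro conjI ballI)
    fix l assume "l \<in> J"
    then obtain k h where l: "l = join_list k h" "k \<in> ?T" "h \<in> ?F" by (auto simp: J_def)
    show "gen (map untag l) \<in> supported ?T" using l F_set[of h] by (auto simp: tuples_def)
    show "gen (map untag (act g l)) = push (tact g) (gen (map untag l))" for g by (simp add: l(1))
  qed simp
  have nF': "?m c \<in> supported ?S" if "c \<in> supported F'" for c
    using that
  proof (rule supported_lin_extend)
    fix h assume "h \<in> F'"
    then show "nrm tact hd h \<in> supported ?S"
      by (rule supported_mono[OF nrm_supported[OF free_F'] FS])
  qed
  have "lin_extend tuple_codiff (?\<Phi> u) - ?\<Phi> w \<in> supported ?S"
  proof -
    let ?d = "\<lambda>l. tuple_bd (map untag l) - push (map untag) (bJ l)"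
    have "lin_extend ?d u \<in> supported F'"
      using uJ
    proof (rule supported_lin_extend)
      fix l assume "l \<in> J"
      then obtain k h where l: "l = join_list k h" "k \<in> ?T" "h \<in> ?F" by (auto simp: J_def)
      note bd = bd_join[OF l(2,3), folded l(1)]
      have "tuple_bd (map untag l) = push (map untag) (restr {l. l \<noteq> []} (list_bd l) :: _ \<Rightarrow>\<^sub>0 'd)"
        unfolding tuple_bd_map by (simp add: tuple_bd_def)
      moreover have "restr {l. l \<noteq> []} (list_bd l) - bJ l \<in> supported {join_list [] h' | h'. h' \<in> F'}"
      proof -
        have "restr {l. l \<noteq> []} (list_bd l) - bJ l
          = lin_extend (\<lambda>z. (if z \<in> {l. l \<noteq> []} then gen z else 0) - (if z \<in> J then gen z else 0)) (list_bd l)"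
          by (simp add: bJ_def restr_def lin_extend_fun_diff)
        also have "\<dots> \<in> supported {join_list [] h' | h'. h' \<in> F'}"
          using bd
        proof (rule supported_lin_extend)
          fix z assume "z \<in> {join_list k' h' | k' h'. set k' \<subseteq> carrier G \<and> h' \<in> ?F}"
          then obtain k' h' where z: "z = join_list k' h'" "set k' \<subseteq> carrier G" "h' \<in> ?F" by blast
          show "(if z \<in> {l. l \<noteq> []} then gen z else 0) - (if z \<in> J then gen z else 0) \<in> supported {join_list [] h' | h'. h' \<in> F'}"
          proof (cases "k' = []")
            case True
            then show ?thesis using z J_join[of "[]" h'] by (auto simp: F'_def tuples_def simp del: J_join)
          next
            case False
            then have "z \<in> J" using z by (simp add: tuples_def)
            moreover have "z \<noteq> []" using z False by simp
            ultimately show ?thesis by simp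
          qed
        qed
        finally show ?thesis .
      qed
      then have "push (map untag) (restr {l. l \<noteq> []} (list_bd l) - bJ l) \<in> supported F'"
        by (rule supported_push) (auto simp: o_def)
      ultimately show "?d l \<in> supported F'" by (simp add: push_linear)
    qed
    then have *: "?m (lin_extend ?d u) \<in> supported ?S" by (rule nF')
    have "?m (?\<Phi> (lin_extend bJ u)) = ?m (?\<Phi> (?n (lin_extend bJ u)))"
      using nrm_equivariant_nrm_chain[OF freeJ free_action_tuples equiv\<Phi>, of "lin_extend bJ u"]
        supported_lin_extend[OF uJ, of bJ J]
      by (simp add: bJ_def push_def)
    also have "\<dots> = ?m (?\<Phi> w)" by (simp add: u(2) lin_extend_codiff)
    also have "\<dots> = ?\<Phi> w"
    proof (rule nrm_ident_supported[OF free_action_tuples])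
      show "?\<Phi> w \<in> supported {x\<in>?T. hd x = \<one>}"
        using w
      proof (rule supported_push)
        fix l assume "l \<in> {l\<in>J. \<theta> l = \<one>}"
        then obtain k h where "l = join_list k h" "k \<in> ?T" "h \<in> ?F" "hd k = \<one>" by (auto simp: J_def tuples_def)
        then show "map untag l \<in> {x\<in>?T. hd x = \<one>}" using F_set[of h] by (auto simp: tuples_def)
      qed
    qed
    finally have "?m (?\<Phi> (lin_extend bJ u)) = ?\<Phi> w" .
    moreover have "lin_extend tuple_codiff (?\<Phi> u) = ?m (lin_extend (\<lambda>l. tuple_bd (map untag l)) u)"
      by (subst lin_extend_codiff) (simp only: lin_extend_push)
    ultimately have "?m (lin_extend ?d u) = lin_extend tuple_codiff (?\<Phi> u) - ?\<Phi> w"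
      by (simp only: lin_extend_fun_diff lin_extend_diff push_lin_extend)
    then show ?thesis using * by simp
  qed
  moreover have "?\<Phi> w = y + ?\<Phi> (lin_extend ?P e)"
    unfolding w_def push_linear push_push by (simp add: o_def push_ident[of y UNIV] supported_def)
  moreover have "?\<Phi> (lin_extend ?P e) \<in> supported ?S"
    unfolding push_lin_extend using e
  proof (rule supported_lin_extend)
    fix h assume h: "h \<in> {h\<in>F'. hd h = \<one>}"
    show "?\<Phi> (?P h) \<in> supported ?S"
      using P_supp
    proof (rule supported_push)
      fix l assume "l \<in> {join_list k l | k l. k \<noteq> [] \<and> l \<noteq> [] \<and> set k \<subseteq> set h \<and> set l \<subseteq> set h \<and> hd k = hd h}"
      then obtain k l' where l: "l = join_list k l'" "k \<noteq> []" "set k \<subseteq> set h" "set l' \<subseteq> set h" "hd k = hd h" by blast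
      have "k @ l' \<in> ?F" by (rule F_sub[of h]) (use h l in \<open>auto simp: F'_def\<close>)
      then have "k @ l' \<in> {h\<in>F'. hd h = \<one>}" using l h by (simp add: F'_def)
      then show "map untag l \<in> ?S" using FS l(1) by (simp add: subset_iff del: Un_iff)
    qed
  qed
  ultimately have "y - lin_extend tuple_codiff (?\<Phi> u) \<in> supported ?S"
    using supported_diff[of "- ?\<Phi> (lin_extend ?P e)" ?S "lin_extend tuple_codiff (?\<Phi> u) - ?\<Phi> w"]
    by (simp add: algebra_simps)
  then show ?thesis using \<Phi>u by blast
qed

end

section \<open>Direct products\<close>

definition join_family :: "'u list set \<Rightarrow> 'w list set \<Rightarrow> ('u + 'w) list set" where
  "join_family P Q = {join_list k h | k h. k \<in> P \<and> h \<in> Q}"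

lemma join_family_iff [simp]: "join_list k h \<in> join_family P Q \<longleftrightarrow> k \<in> P \<and> h \<in> Q"
  by (auto simp: join_family_def)

context twist
begin

lemma lists_exact:
  assumes "a \<in> C"
  shows "exact_on (list_bd :: _ \<Rightarrow> 'u list \<Rightarrow>\<^sub>0 'd) (lists C)"
proof (rule exact_on_contraction[where s = "\<lambda>xs. gen (a # xs)"])
  fix xs :: "'u list"
  show "lin_extend list_bd (gen (a # xs)) + lin_extend (\<lambda>xs. gen (a # xs)) (list_bd xs) = (gen xs :: _ \<Rightarrow>\<^sub>0 'd)"
    by (simp add: push_def)
qed (use assms in auto)

text \<open>
  The homology of \<open>G = C \<times> N\<close> vanishes if that of \<open>N\<close> does. Instead of a spectral sequence, consider the joins of a
  tuple \<open>k\<close> over \<open>C\<close>, on which \<open>G\<close> acts through its projection, with a nonempty tuple \<open>h\<close> over \<open>G\<close>. If \<open>k\<close> may be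
  empty, the complex is exact, since for fixed \<open>h\<close> the lists \<open>k\<close> form a full simplex. If \<open>k\<close> must be nonempty, fixing
  the normalised \<open>k\<close> leaves the stabiliser \<open>N\<close> acting on the tuples \<open>h\<close> over \<open>G\<close>, and this complex is homotopy
  equivalent to that of \<open>N\<close>. The second complex is the quotient of the first by the joins with \<open>k = []\<close>,
  which form the bar complex of \<open>G\<close>.
\<close>

lemma direct_product_exact:
  assumes C: "subgroup C G" and N: "subgroup N G"
    and pC: "pC \<in> hom G G" "pC ` carrier G \<subseteq> C" "\<And>c. c \<in> C \<Longrightarrow> pC c = c"
    and pN: "pN \<in> hom G G" "pN ` carrier G \<subseteq> N" "\<And>n. n \<in> N \<Longrightarrow> pN n = n"
    and comm: "\<And>c n. c \<in> C \<Longrightarrow> n \<in> N \<Longrightarrow> c \<otimes> n = n \<otimes> c"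
    and decomp: "\<And>g. g \<in> carrier G \<Longrightarrow> g = pC g \<otimes> pN g"
    and exN: "exact_on tuple_codiff (ntuples N)"
  shows "exact_on tuple_codiff (ntuples (carrier G))"
proof -
  interpret N: twist "G\<lparr>carrier := N\<rparr>" \<chi> by (rule twist_subgroup[OF twist_axioms N])
  let ?T = "tuples (carrier G)"
  have NG: "N \<subseteq> carrier G" and CG: "C \<subseteq> carrier G" using N C by (auto dest: subgroup.subset)
  have pm: "pC (g \<otimes> h) = pC g \<otimes> pC h" "pN (g \<otimes> h) = pN g \<otimes> pN h" if "g \<in> carrier G" "h \<in> carrier G" for g h
    using that pC(1) pN(1) by (auto simp: hom_def)
  have pin: "pC g \<in> C" "pN g \<in> N" "pC g \<in> carrier G" "pN g \<in> carrier G" if "g \<in> carrier G" for g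
    using that pC(2) pN(2) CG NG by auto
  have pCN: "pC n = \<one>" if "n \<in> N" for n
  proof -
    have n: "n \<in> carrier G" using that NG by auto
    have "pC n \<otimes> n = \<one> \<otimes> n" using decomp[OF n] pN(3)[OF that] n by simp
    then show ?thesis using n pin[OF n] by (simp only: r_cancel one_closed)
  qed
  have pN1: "pN \<one> = \<one>" by (rule pN(3)) (rule subgroup.one_closed[OF N])
  have inv_N: "inv\<^bsub>G\<lparr>carrier := N\<rparr>\<^esub> n = inv n" if "n \<in> N" for n
    using m_inv_consistent[OF N that] .
  have T_D: "h \<noteq> []" "set h \<subseteq> carrier G" "hd h \<in> carrier G" if "h \<in> ?T" for h
    using that by (auto simp: tuples_def)
  (* The coinvariants under N of the tuples over G, normalised by the N-component of the first entry. The
     projection of tuples to N is N-equivariant, and the prism between it and the identity shows that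
     this complex is exact together with that of N. *)
  let ?\<theta>N = "\<lambda>h. pN (hd h)"
  let ?L = "N.codiff tact ?\<theta>N tuple_bd"
  let ?LB = "{h\<in>?T. ?\<theta>N h = \<one>}"
  let ?nL = "lin_extend (N.nrm tact ?\<theta>N)"
  have tact_T: "tact g h \<in> ?T" if "g \<in> carrier G" "h \<in> ?T" for g h
    using that by (auto simp: tuples_def)
  have freeL: "N.free_action tact ?T ?\<theta>N"
    unfolding N.free_action_def
  proof (intro conjI ballI)
    fix h assume h: "h \<in> ?T"
    note hD = T_D[OF h]
    show "?\<theta>N h \<in> carrier (G\<lparr>carrier := N\<rparr>)" using pin hD by simp
    show "tact \<one>\<^bsub>G\<lparr>carrier := N\<rparr>\<^esub> h = h" using map_mult_one[OF hD(2)] by simp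
    fix g assume "g \<in> carrier (G\<lparr>carrier := N\<rparr>)"
    then have g: "g \<in> N" "g \<in> carrier G" using NG by auto
    show "tact g h \<in> ?T" using tact_T g h by blast
    show "?\<theta>N (tact g h) = g \<otimes>\<^bsub>G\<lparr>carrier := N\<rparr>\<^esub> ?\<theta>N h"
      using pm g hD pN(3) by (simp add: hd_map)
    fix g' assume "g' \<in> carrier (G\<lparr>carrier := N\<rparr>)"
    then show "tact g (tact g' h) = tact (g \<otimes>\<^bsub>G\<lparr>carrier := N\<rparr>\<^esub> g') h"
      using map_mult_mult[of g g' h] g hD NG by auto
  qed
  have NT: "tuples N \<subseteq> ?T" using NG by (auto simp: tuples_def)
  have freeN: "N.free_action tact (tuples N) hd"
    using N.free_action_tuples by (simp add: N.tuples_def tuples_def)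
  have equiv_bd: "N.equivariant tact ?T tact ?T tuple_bd"
    unfolding N.equivariant_def by (simp add: tuple_bd_closed central_tuple_bd tuple_bd_map)
  have nL_N: "?nL c = lin_extend (nrm tact hd) c" if "c \<in> supported (tuples N)" for c
    using that
  proof (rule lin_extend_cong_supported)
    fix h assume "h \<in> tuples N"
    then have "hd h \<in> N" by (auto simp: tuples_def)
    then show "N.nrm tact ?\<theta>N h = nrm tact hd h" by (simp add: N.nrm_def nrm_def pN(3) inv_N)
  qed
  have m_N: "lin_extend (N.nrm tact hd) c = lin_extend (nrm tact hd) c" if "c \<in> supported (tuples N)" for c
    using that
  proof (rule lin_extend_cong_supported)
    fix h assume "h \<in> tuples N"
    then have "hd h \<in> N" by (auto simp: tuples_def)
    then show "N.nrm tact hd h = nrm tact hd h" by (simp add: N.nrm_def nrm_def inv_N)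
  qed
  have one_N: "\<one>\<^bsub>G\<lparr>carrier := N\<rparr>\<^esub> = \<one>" by simp
  have exL: "exact_on ?L ?LB"
    unfolding exact_on_def
  proof (intro ballI impI)
    fix c assume c: "c \<in> supported ?LB" "lin_extend ?L c = 0"
    have cT: "c \<in> supported ?T" using c(1) by (rule supported_mono) auto
    have bc: "lin_extend tuple_bd c \<in> supported ?T"
      using cT tuple_bd_closed by (rule supported_lin_extend)
    have c0: "?nL (lin_extend tuple_bd c) = 0" using c(2) by (simp add: N.lin_extend_codiff)
    let ?\<rho> = "push (map pN) :: ('g list \<Rightarrow>\<^sub>0 'd) \<Rightarrow> _"
    have equiv_\<rho>: "N.equivariant tact ?T tact (tuples N) (\<lambda>h. gen (map pN h))"
      unfolding N.equivariant_def
    proof (intro conjI ballI)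
      fix h assume h: "h \<in> ?T"
      show "gen (map pN h) \<in> supported (tuples N)" using h pin by (auto simp: tuples_def)
      fix g assume "g \<in> carrier (G\<lparr>carrier := N\<rparr>)"
      then have g: "g \<in> N" "g \<in> carrier G" using NG by auto
      have "map pN (tact g h) = tact g (map pN h)"
        using pm(2)[OF g(2)] pN(3)[OF g(1)] T_D(2)[OF h] by (auto simp: subset_iff)
      then show "gen (map pN (tact g h)) = push (tact g) (gen (map pN h))" by (simp del: map_map)
    qed simp
    have \<rho>c: "?\<rho> c \<in> supported (ntuples N)"
      using c(1) by (rule supported_push) (use pin in \<open>auto simp: ntuples_def tuples_def hd_map\<close>)
    have \<rho>cN: "?\<rho> c \<in> supported (tuples N)" using \<rho>c by (rule supported_mono) (auto simp: ntuples_def)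
    have \<rho>bc: "?\<rho> (lin_extend tuple_bd c) \<in> supported (tuples N)"
      using bc by (rule supported_push) (use pin in \<open>auto simp: tuples_def\<close>)
    have "lin_extend tuple_codiff (?\<rho> c) = lin_extend (nrm tact hd) (?\<rho> (lin_extend tuple_bd c))"
      by (subst lin_extend_codiff) (simp add: push_lin_extend lin_extend_push tuple_bd_map)
    also have "\<dots> = lin_extend (N.nrm tact hd) (?\<rho> (lin_extend tuple_bd c))" using m_N[OF \<rho>bc] by simp
    also have "\<dots> = lin_extend (N.nrm tact hd) (?\<rho> (?nL (lin_extend tuple_bd c)))"
      using N.nrm_equivariant_nrm_chain[OF freeL freeN equiv_\<rho> bc] by (simp add: push_def)
    finally have "lin_extend tuple_codiff (?\<rho> c) = 0" by (simp add: c0)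
    then obtain w where w: "w \<in> supported (ntuples N)" "?\<rho> c = lin_extend tuple_codiff w"
      using exact_onD[OF exN \<rho>c] by blast
    have wN: "w \<in> supported (tuples N)" using w(1) by (rule supported_mono) (auto simp: ntuples_def)
    have Lw: "lin_extend ?L w = lin_extend tuple_codiff w"
      unfolding N.lin_extend_codiff lin_extend_codiff
      by (rule nL_N[OF supported_lin_extend[OF wN tuple_bd_closed]])
    let ?P = "prism pN (\<lambda>x. x) :: 'g list \<Rightarrow> 'g list \<Rightarrow>\<^sub>0 'd"
    have P_supp: "?P h \<in> supported {map pN ys @ zs | ys zs. ys \<noteq> [] \<and> zs \<noteq> [] \<and> set ys \<subseteq> set h \<and> set zs \<subseteq> set h \<and> hd ys = hd h}" for h
      using prism_supported[of pN "\<lambda>x. x" h] by simp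
    have P_T: "?P h \<in> supported ?T" if "h \<in> ?T" for h
    proof (rule supported_mono[OF P_supp], clarify)
      fix ys zs assume *: "ys \<noteq> []" "set ys \<subseteq> set h" "set zs \<subseteq> set h"
      have "pN y \<in> carrier G" if "y \<in> set ys" for y using that * pin T_D(2)[OF \<open>h \<in> ?T\<close>] by blast
      moreover have "z \<in> carrier G" if "z \<in> set zs" for z using that * T_D(2)[OF \<open>h \<in> ?T\<close>] by blast
      ultimately show "map pN ys @ zs \<in> ?T" using *(1) by (auto simp: tuples_def)
    qed
    have equiv_P: "N.equivariant tact ?T tact ?T ?P"
      unfolding N.equivariant_def
    proof (intro conjI ballI)
      fix h assume h: "h \<in> ?T"
      show "?P h \<in> supported ?T" by (rule P_T[OF h])
      show "central (?P h)" by (rule central_prism)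
      fix g assume "g \<in> carrier (G\<lparr>carrier := N\<rparr>)"
      then have g: "g \<in> N" "g \<in> carrier G" using NG by auto
      have "set h \<subseteq> carrier G" using T_D[OF h] by simp
      then show "?P (tact g h) = push (tact g) (?P h)"
        unfolding prism_map push_map_prism
        by (induction h) (use pm(2)[OF g(2)] pN(3)[OF g(1)] in \<open>auto simp: o_def\<close>)
    qed
    have Pc: "lin_extend ?P c \<in> supported ?LB"
      using c(1)
    proof (rule supported_lin_extend)
      fix h assume h: "h \<in> ?LB"
      show "?P h \<in> supported ?LB"
      proof (rule supported_mono[OF supported_Int[OF P_supp P_T]])
        show "h \<in> ?T" using h by simp
        show "{map pN ys @ zs | ys zs. ys \<noteq> [] \<and> zs \<noteq> [] \<and> set ys \<subseteq> set h \<and> set zs \<subseteq> set h \<and> hd ys = hd h} \<inter> ?T \<subseteq> ?LB"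
          using h pN1 by (auto simp: hd_map)
      qed
    qed
    have "lin_extend tuple_bd (lin_extend ?P c) + lin_extend ?P (lin_extend tuple_bd c)
      = lin_extend (\<lambda>h. lin_extend tuple_bd (?P h) + lin_extend ?P (tuple_bd h)) c"
      by (simp add: lin_extend_compose lin_extend_fun_add)
    also have "\<dots> = lin_extend (\<lambda>h. gen h - gen (map pN h)) c"
    proof (rule lin_extend_cong)
      fix h
      have "lin_extend tuple_bd (?P h) = lin_extend list_bd (?P h)"
        by (rule lin_extend_cong_supported[OF P_supp], rule tuple_bd_eq) (auto simp: length_Suc_conv append_eq_Cons_conv)
      moreover have "lin_extend ?P (tuple_bd h) = lin_extend ?P (list_bd h)"
        unfolding tuple_bd_def lin_extend_restr by (rule lin_extend_cong) auto
      ultimately show "lin_extend tuple_bd (?P h) + lin_extend ?P (tuple_bd h) = gen h - gen (map pN h)"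
        using prism_homotopy[of pN "\<lambda>x. x" h, where 'd = 'd] by simp
    qed
    also have "\<dots> = c - ?\<rho> c" by (simp add: lin_extend_fun_diff lin_extend_gen push_def)
    finally have htpy: "lin_extend tuple_bd (lin_extend ?P c) + lin_extend ?P (lin_extend tuple_bd c) = c - ?\<rho> c" .
    have "?nL (lin_extend ?P (lin_extend tuple_bd c)) = ?nL (lin_extend ?P (?nL (lin_extend tuple_bd c)))"
      using N.nrm_equivariant_nrm_chain[OF freeL freeL equiv_P bc] by simp
    then have 0: "?nL (lin_extend ?P (lin_extend tuple_bd c)) = 0" by (simp add: c0)
    have "?nL c = c" using N.nrm_ident_supported[OF freeL, unfolded one_N] c(1) by blast
    moreover have "?nL (?\<rho> c) = ?\<rho> c"
      unfolding nL_N[OF \<rho>cN] using \<rho>c NG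
      by (intro nrm_ident_supported[OF free_action_tuples], elim supported_mono) (auto simp: ntuples_def tuples_def)
    ultimately have "c - ?\<rho> c = ?nL (c - ?\<rho> c)" by (simp add: lin_extend_diff)
    also have "\<dots> = ?nL (lin_extend tuple_bd (lin_extend ?P c))"
      unfolding htpy[symmetric] by (simp add: lin_extend_add 0)
    also have "\<dots> = lin_extend ?L (lin_extend ?P c)" by (simp only: N.lin_extend_codiff)
    finally have "c = ?\<rho> c + lin_extend ?L (lin_extend ?P c)" by (simp only: diff_eq_eq add.commute)
    also have "?\<rho> c = lin_extend ?L w" by (simp only: Lw w(2))
    finally have "c = lin_extend ?L (w + lin_extend ?P c)" by (simp only: lin_extend_add)
    moreover have "w \<in> supported ?LB"
      using w(1) by (rule supported_mono) (use NG pN1 in \<open>auto simp: ntuples_def tuples_def\<close>)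
    ultimately show "\<exists>u\<in>supported ?LB. c = lin_extend ?L u" using Pc supported_add by blast
  qed
  (* J contains the joins with arbitrary k, J' those with nonempty k. On J the action is normalised by the head of
     the right part, \<theta>'. On J' there is a second normalisation \<theta>, which makes the head of k trivial first
     and then uses the remaining freedom, that of N, on h. *)
  define act where "act = (\<lambda>g. map (map_sum ((\<otimes>) (pC g)) ((\<otimes>) g)) :: ('g + 'g) list \<Rightarrow> ('g + 'g) list)"
  define J where "J = join_family (lists C) ?T"
  define J' where "J' = join_family (tuples C) ?T"
  define \<theta> where "\<theta> = (\<lambda>l :: ('g + 'g) list. hd (lefts l) \<otimes> pN (hd (rights l)))"
  define \<theta>' where "\<theta>' = (\<lambda>l :: ('g + 'g) list. hd (rights l))"
  have C_act: "map ((\<otimes>) c) k \<in> lists C" if "c \<in> C" "k \<in> lists C" for c k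
    using that subgroup.m_closed[OF C] by auto
  have C_tup: "k \<in> lists C" if "k \<in> tuples C" for k using that by (auto simp: tuples_def)
  have C_set: "set k \<subseteq> carrier G" if "k \<in> lists C" for k using that CG by auto
  have act_join [simp]: "act g (join_list k h) = join_list (map ((\<otimes>) (pC g)) k) (tact g h)" for g k h
    by (simp add: act_def join_list_def)
  have actJ: "act \<one> l = l \<and> (\<forall>g\<in>carrier G. act g l \<in> J \<and> (\<forall>h\<in>carrier G. act g (act h l) = act (g \<otimes> h) l))"
    if "l \<in> J" for l
  proof -
    obtain k h where l: "l = join_list k h" "k \<in> lists C" "h \<in> ?T" using \<open>l \<in> J\<close> by (auto simp: J_def join_family_def)
    note k = C_set[OF l(2)] and h = T_D[OF l(3)]
    have "pC \<one> = \<one>" by (rule pC(3)) (rule subgroup.one_closed[OF C])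
    then have "act \<one> l = l" unfolding l(1) act_join using map_mult_one[OF k] map_mult_one[OF h(2)] by simp
    moreover have "act g l \<in> J" if "g \<in> carrier G" for g
      using that l C_act[OF pin(1)[OF that] l(2)] tact_T[OF that l(3)] by (simp add: J_def)
    moreover have "act g (act g' l) = act (g \<otimes> g') l" if "g \<in> carrier G" "g' \<in> carrier G" for g g'
      unfolding l(1) act_join pm(1)[OF that] using that pin k h by (simp only: map_mult_mult)
    ultimately show ?thesis by blast
  qed
  have J'J: "J' \<subseteq> J" using C_tup by (auto simp: J_def J'_def join_family_def)
  have actJ': "act g l \<in> J' \<longleftrightarrow> l \<in> J'" if "l \<in> J" "g \<in> carrier G" for g l
  proof -
    obtain k h where l: "l = join_list k h" "k \<in> lists C" "h \<in> ?T" using \<open>l \<in> J\<close> by (auto simp: J_def join_family_def)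
    have "map ((\<otimes>) (pC g)) k \<in> tuples C \<longleftrightarrow> k \<in> tuples C"
      using C_act[OF pin(1)[OF that(2)] l(2)] l(2) by (auto simp: tuples_def)
    then show ?thesis using tact_T[OF that(2) l(3)] l(3) unfolding l(1) act_join J'_def join_family_iff by simp
  qed
  have free': "free_action act J \<theta>'"
    unfolding free_action_def
  proof (intro conjI ballI)
    fix l assume lJ: "l \<in> J"
    obtain k h where l: "l = join_list k h" "k \<in> lists C" "h \<in> ?T" using lJ by (auto simp: J_def join_family_def)
    show "\<theta>' l \<in> carrier G" using T_D[OF l(3)] by (simp add: \<theta>'_def l(1))
    show "act \<one> l = l" using actJ lJ by blast
    fix g assume g: "g \<in> carrier G"
    show "act g l \<in> J" using actJ lJ g by blast
    show "\<theta>' (act g l) = g \<otimes> \<theta>' l" unfolding l(1) act_join \<theta>'_def using T_D[OF l(3)] by (simp add: hd_map)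
    fix g' assume "g' \<in> carrier G"
    then show "act g (act g' l) = act (g \<otimes> g') l" using actJ lJ g by blast
  qed
  have free'J': "free_action act J' \<theta>'"
    using free' J'J actJ' unfolding free_action_def by (simp add: subset_iff)
  have freeJ': "free_action act J' \<theta>"
    unfolding free_action_def
  proof (intro conjI ballI)
    fix l assume lJ: "l \<in> J'"
    then have lJ2: "l \<in> J" using J'J by auto
    obtain k h where l: "l = join_list k h" "k \<in> tuples C" "h \<in> ?T" using lJ by (auto simp: J'_def join_family_def)
    have k: "k \<noteq> []" "hd k \<in> C" using l(2) by (auto simp: tuples_def)
    then have k: "k \<noteq> []" "hd k \<in> C" "hd k \<in> carrier G" using CG by auto
    note h = T_D[OF l(3)]
    show "\<theta> l \<in> carrier G" using k h pin by (simp add: \<theta>_def l(1))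
    show "act \<one> l = l" using actJ lJ2 by blast
    fix g assume g: "g \<in> carrier G"
    show "act g l \<in> J'" using actJ' lJ2 lJ g by blast
    have "\<theta> (act g l) = (pC g \<otimes> hd k) \<otimes> (pN g \<otimes> pN (hd h))"
      unfolding l(1) act_join \<theta>_def using k h g pm by (simp add: hd_map)
    also have "\<dots> = pC g \<otimes> (hd k \<otimes> pN g) \<otimes> pN (hd h)" using k h g pin by (simp add: m_assoc)
    also have "hd k \<otimes> pN g = pN g \<otimes> hd k" using comm k pin g by blast
    also have "pC g \<otimes> (pN g \<otimes> hd k) \<otimes> pN (hd h) = (pC g \<otimes> pN g) \<otimes> (hd k \<otimes> pN (hd h))" using k h g pin by (simp add: m_assoc)
    also have "\<dots> = g \<otimes> \<theta> l" using decomp[OF g] by (simp add: \<theta>_def l(1))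
    finally show "\<theta> (act g l) = g \<otimes> \<theta> l" .
    fix g' assume "g' \<in> carrier G"
    then show "act g (act g' l) = act (g \<otimes> g') l" using actJ lJ2 g by blast
  qed
  have bd_lists: "list_bd k \<in> supported (lists C)" if "k \<in> lists C" for k
    by (rule supported_mono[OF list_bd_supported]) (use that in \<open>auto simp: in_lists_conv_set subset_iff\<close>)
  let ?all = "join_family (lists C) (lists (carrier G))"
  have bd_all: "list_bd l \<in> supported ?all" if lJ: "l \<in> J" for l
  proof -
    obtain k h where l: "l = join_list k h" "k \<in> lists C" "h \<in> ?T" using lJ by (auto simp: J_def join_family_def)
    have hG: "h \<in> lists (carrier G)" using T_D[OF l(3)] by auto
    have "push (\<lambda>k'. join_list k' h) (list_bd k) \<in> supported ?all"
      using bd_lists[OF l(2)] by (rule supported_push) (simp add: hG del: in_lists_conv_set)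
    moreover have "push (join_list k) (list_bd h) \<in> supported ?all"
      using list_bd_supported by (rule supported_push) (use l(2) T_D[OF l(3)] in auto)
    ultimately show ?thesis unfolding l(1) list_bd_join by (intro supported_add supported_smul)
  qed
  define b where "b = (\<lambda>l. restr J (list_bd l) :: ('g + 'g) list \<Rightarrow>\<^sub>0 'd)"
  define b' where "b' = (\<lambda>l. restr J' (list_bd l) :: ('g + 'g) list \<Rightarrow>\<^sub>0 'd)"
  have b_join: "b (join_list k h) = push (\<lambda>k'. join_list k' h) (list_bd k) + smul ((- 1) ^ length k) (push (join_list k) (tuple_bd h))"
    if "k \<in> lists C" "h \<in> ?T" for k h
  proof -
    have "restr J (push (\<lambda>k'. join_list k' h) (list_bd k)) = push (\<lambda>k'. join_list k' h) (list_bd k :: _ \<Rightarrow>\<^sub>0 'd)"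
      by (rule restr_ident[OF supported_push[OF bd_lists[OF that(1)]]]) (use that in \<open>simp add: J_def del: in_lists_conv_set\<close>)
    moreover have "restr J (push (join_list k) (list_bd h)) = push (join_list k) (tuple_bd h :: _ \<Rightarrow>\<^sub>0 'd)"
      unfolding tuple_bd_def using list_bd_supported
      by (rule restr_push_supported) (use that in \<open>auto simp: J_def tuples_def\<close>)
    ultimately show ?thesis by (simp add: b_def list_bd_join restr_linear)
  qed
  have b'_join: "b' (join_list k h) = push (\<lambda>k'. join_list k' h) (tuple_bd k) + smul ((- 1) ^ length k) (push (join_list k) (tuple_bd h))"
    if "k \<in> tuples C" "h \<in> ?T" for k h
  proof -
    have "restr J' (push (\<lambda>k'. join_list k' h) (list_bd k)) = push (\<lambda>k'. join_list k' h) (tuple_bd k :: _ \<Rightarrow>\<^sub>0 'd)"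
      unfolding tuple_bd_def using list_bd_supported
      by (rule restr_push_supported) (use that in \<open>auto simp: J'_def tuples_def\<close>)
    moreover have "restr J' (push (join_list k) (list_bd h)) = push (join_list k) (tuple_bd h :: _ \<Rightarrow>\<^sub>0 'd)"
      unfolding tuple_bd_def using list_bd_supported
      by (rule restr_push_supported) (use that in \<open>auto simp: J'_def tuples_def\<close>)
    ultimately show ?thesis by (simp add: b'_def list_bd_join restr_linear)
  qed
  have act_iff: "act g z \<in> join_family P Q \<longleftrightarrow> z \<in> join_family P Q"
    if asm: "z \<in> ?all" "g \<in> carrier G" "P = lists C \<or> P = tuples C" "Q = ?T" for g z P Q
  proof -
    obtain k h where z: "z = join_list k h" "k \<in> lists C" "h \<in> lists (carrier G)" using asm(1) by (auto simp: join_family_def)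
    have "map ((\<otimes>) (pC g)) k \<in> P \<longleftrightarrow> k \<in> P"
      using asm(3) C_act[OF pin(1)[OF asm(2)] z(2)] z(2) by (auto simp: tuples_def)
    moreover have "tact g h \<in> Q \<longleftrightarrow> h \<in> Q" using z(3) asm(2,4) by (auto simp: tuples_def)
    ultimately show ?thesis unfolding z(1) act_join join_family_iff by simp
  qed
  have equiv: "equivariant act J act J b"
    unfolding equivariant_def
  proof (intro conjI ballI)
    fix l assume l: "l \<in> J"
    show "b l \<in> supported J" "central (b l)" by (simp_all add: b_def central_restr central_list_bd)
    fix g assume g: "g \<in> carrier G"
    have "restr J (push (act g) (list_bd l)) = push (act g) (restr J (list_bd l) :: _ \<Rightarrow>\<^sub>0 'd)"
      using bd_all[OF l] by (rule restr_push_supported) (use act_iff g in \<open>simp add: J_def\<close>)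
    then show "b (act g l) = push (act g) (b l)" by (simp add: b_def act_def list_bd_map)
  qed
  have equiv': "equivariant act J' act J' b'"
    unfolding equivariant_def
  proof (intro conjI ballI)
    fix l assume l: "l \<in> J'"
    then have lJ: "l \<in> J" using J'J by auto
    show "b' l \<in> supported J'" "central (b' l)" by (simp_all add: b'_def central_restr central_list_bd)
    fix g assume g: "g \<in> carrier G"
    have "restr J' (push (act g) (list_bd l)) = push (act g) (restr J' (list_bd l) :: _ \<Rightarrow>\<^sub>0 'd)"
      using bd_all[OF lJ] by (rule restr_push_supported) (use act_iff g in \<open>simp add: J'_def\<close>)
    then show "b' (act g l) = push (act g) (b' l)" by (simp add: b'_def act_def list_bd_map)
  qed
  have bb: "lin_extend b (b l) = 0" if l: "l \<in> J" for l
  proof -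
    have "b l = restr J (list_bd l)" by (simp add: b_def)
    then have "lin_extend b (b l) = lin_extend (\<lambda>z. if z \<in> J then b z else 0) (list_bd l)"
      by (simp add: lin_extend_restr)
    also have "\<dots> = lin_extend b (list_bd l)" using bd_all[OF l]
    proof (rule lin_extend_cong_supported)
      fix z assume "z \<in> ?all"
      then obtain k h where z: "z = join_list k h" "k \<in> lists C" "h \<in> lists (carrier G)" by (auto simp: join_family_def)
      show "(if z \<in> J then b z else 0) = b z"
      proof (cases "h = []")
        case True
        have "push (\<lambda>k'. join_list k' []) (list_bd k :: _ \<Rightarrow>\<^sub>0 'd) \<in> supported {join_list k' [] | k'. True}"
          by (rule supported_push[OF list_bd_supported]) auto
        then have "restr J (push (\<lambda>k'. join_list k' []) (list_bd k :: _ \<Rightarrow>\<^sub>0 'd)) = 0"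
          by (rule restr_eq_0) (auto simp: J_def tuples_def)
        then show ?thesis using True by (simp add: b_def list_bd_join z(1))
      next
        case False
        then show ?thesis using z by (simp add: J_def tuples_def lists_eq_set del: in_lists_conv_set)
      qed
    qed
    also have "\<dots> = 0" unfolding b_def restr_lin_extend[symmetric] by (simp add: list_bd_list_bd)
    finally show ?thesis .
  qed
  have b'b': "lin_extend b' (b' l) = 0" if l: "l \<in> J'" for l
  proof -
    have lJ: "l \<in> J" using l J'J by auto
    have "b' l = restr J' (list_bd l)" by (simp add: b'_def)
    then have "lin_extend b' (b' l) = lin_extend (\<lambda>z. if z \<in> J' then b' z else 0) (list_bd l)"
      by (simp add: lin_extend_restr)
    also have "\<dots> = lin_extend b' (list_bd l)" using bd_all[OF lJ]
    proof (rule lin_extend_cong_supported)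
      fix z assume "z \<in> ?all"
      then obtain k h where z: "z = join_list k h" "k \<in> lists C" "h \<in> lists (carrier G)" by (auto simp: join_family_def)
      have A: "restr J' (push (\<lambda>k'. join_list k' []) (list_bd k)) = (0 :: _ \<Rightarrow>\<^sub>0 'd)" for k
      proof -
        have "push (\<lambda>k'. join_list k' []) (list_bd k :: _ \<Rightarrow>\<^sub>0 'd) \<in> supported {join_list k' [] | k'. True}"
          by (rule supported_push[OF list_bd_supported]) auto
        then show ?thesis by (rule restr_eq_0) (auto simp: J'_def tuples_def)
      qed
      have B: "restr J' (push (join_list []) (list_bd h)) = (0 :: _ \<Rightarrow>\<^sub>0 'd)" for h
      proof -
        have "push (join_list []) (list_bd h :: _ \<Rightarrow>\<^sub>0 'd) \<in> supported {join_list [] h' | h'. True}"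
          by (rule supported_push[OF list_bd_supported]) auto
        then show ?thesis by (rule restr_eq_0) (auto simp: J'_def tuples_def)
      qed
      show "(if z \<in> J' then b' z else 0) = b' z"
      proof (cases "h = [] \<or> k = []")
        case True
        then show ?thesis using A B by (auto simp: b'_def list_bd_join z(1) restr_linear)
      next
        case False
        then show ?thesis using z by (simp add: J'_def tuples_def lists_eq_set del: in_lists_conv_set)
      qed
    qed
    also have "\<dots> = 0" unfolding b'_def restr_lin_extend[symmetric] by (simp add: list_bd_list_bd)
    finally show ?thesis .
  qed
  have sgn: "(- 1 :: 'd) ^ n = 1 \<or> (- 1 :: 'd) ^ n = - 1" for n by (cases "even n") auto
  have CN: "c = \<one> \<and> n = \<one>" if "c \<in> C" "n \<in> N" "c \<otimes> n = \<one>" for c n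
  proof -
    have G: "c \<in> carrier G" "n \<in> carrier G" using that CG NG by auto
    have "pC (c \<otimes> n) = c" using pm(1)[OF G] pC(3)[OF that(1)] pCN[OF that(2)] G by simp
    then have "c = \<one>" using that(3) pC(3) subgroup.one_closed[OF C] by simp
    then show ?thesis using that(3) G by simp
  qed
  have J'0: "l \<in> J' \<and> \<theta> l = \<one> \<longleftrightarrow> (\<exists>k h. l = join_list k h \<and> k \<in> tuples C \<and> hd k = \<one> \<and> h \<in> ?LB)" for l
  proof
    assume l: "l \<in> J' \<and> \<theta> l = \<one>"
    then obtain k h where kh: "l = join_list k h" "k \<in> tuples C" "h \<in> ?T" by (auto simp: J'_def join_family_def)
    have "hd k \<in> C" using kh(2) by (auto simp: tuples_def)
    moreover have "pN (hd h) \<in> N" using pin T_D[OF kh(3)] by blast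
    moreover have "hd k \<otimes> pN (hd h) = \<one>" using l by (simp add: kh(1) \<theta>_def)
    ultimately show "\<exists>k h. l = join_list k h \<and> k \<in> tuples C \<and> hd k = \<one> \<and> h \<in> ?LB"
      using CN[of "hd k" "pN (hd h)"] kh by blast
  next
    assume "\<exists>k h. l = join_list k h \<and> k \<in> tuples C \<and> hd k = \<one> \<and> h \<in> ?LB"
    then show "l \<in> J' \<and> \<theta> l = \<one>" by (auto simp: J'_def \<theta>_def)
  qed
  (* With the normalisation \<theta>, removing the head of h needs a correction by an element of N only, which fixes k.
     So the blocks with fixed k are copies of the complex ?L. *)
  have exJ': "exact_on (codiff act \<theta> b') {l\<in>J'. \<theta> l = \<one>}"
  proof (rule exact_on_filtered[where \<kappa> = lefts and r = length
        and b_top = "\<lambda>l. smul ((- 1) ^ length (lefts l)) (push (join_list (lefts l)) (?L (rights l)))"])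
    fix l assume "l \<in> {l\<in>J'. \<theta> l = \<one>}"
    then obtain k h where l: "l = join_list k h" "k \<in> tuples C" "hd k = \<one>" "h \<in> ?LB" "l \<in> J'"
      using J'0[of l] by blast
    have hT: "h \<in> ?T" using l(4) by simp
    show "codiff act \<theta> b' l \<in> supported {l\<in>J'. \<theta> l = \<one>}"
      using codiff_supported[OF freeJ' equiv' l(5)] .
    show "lin_extend (codiff act \<theta> b') (codiff act \<theta> b' l) = 0"
      using codiff_codiff[OF freeJ' equiv' l(5) b'b'[OF l(5)]] .
    let ?top = "smul ((- 1) ^ length (lefts l)) (push (join_list (lefts l)) (?L (rights l)))"
    have Lh: "?L h \<in> supported ?LB"
      using N.codiff_supported[OF freeL equiv_bd hT] by simp
    have hp: "push (join_list k) (?L h) \<in> supported {l'\<in>{l\<in>J'. \<theta> l = \<one>}. lefts l' = k}"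
      using Lh
    proof (rule supported_push)
      fix h' assume "h' \<in> ?LB"
      then have "join_list k h' \<in> J' \<and> \<theta> (join_list k h') = \<one>" using J'0 l by blast
      then show "join_list k h' \<in> {l'\<in>{l\<in>J'. \<theta> l = \<one>}. lefts l' = k}" by simp
    qed
    then show "?top \<in> supported {l'\<in>{l\<in>J'. \<theta> l = \<one>}. lefts l' = lefts l}"
      unfolding l(1) lefts_rights_join by (rule supported_smul)
    have "lin_extend (nrm act \<theta>) (push (join_list k) (tuple_bd h)) = push (join_list k) (?L h)"
      unfolding lin_extend_push N.codiff_def push_lin_extend using tuple_bd_closed[OF hT]
    proof (rule lin_extend_cong_supported)
      fix h' assume h': "h' \<in> ?T"
      let ?n = "pN (hd h')"
      have n: "?n \<in> N" "?n \<in> carrier G" "inv ?n \<in> N" using pin T_D[OF h'] subgroup.m_inv_closed[OF N] by blast+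
      have "\<theta> (join_list k h') = ?n" using n by (simp add: \<theta>_def l(3))
      moreover have "act (inv ?n) (join_list k h') = join_list k (tact (inv ?n) h')"
        unfolding act_join pCN[OF n(3)] using C_tup[OF l(2)] C_set by (simp only: map_mult_one)
      ultimately show "nrm act \<theta> (join_list k h') = push (join_list k) (N.nrm tact ?\<theta>N h')"
        by (simp add: nrm_def N.nrm_def inv_N[OF n(1)] del: act_join)
    qed
    then have "codiff act \<theta> b' l - ?top = lin_extend (nrm act \<theta>) (push (\<lambda>k'. join_list k' h) (tuple_bd k))"
      unfolding codiff_def l(1) b'_join[OF l(2) hT] by (simp add: lin_extend_linear)
    also have "\<dots> \<in> supported {l'\<in>{l\<in>J'. \<theta> l = \<one>}. length (lefts l') < length (lefts l)}"
      unfolding lin_extend_push using tuple_bd_supported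
    proof (rule supported_lin_extend)
      fix k' assume k': "k' \<in> {ys. ys \<noteq> [] \<and> Suc (length ys) = length k \<and> set ys \<subseteq> set k}"
      then have J'': "join_list k' h \<in> J'" using l hT by (auto simp: J'_def tuples_def)
      have "nrm act \<theta> (join_list k' h) \<in> supported {l\<in>J'. \<theta> l = \<one>}" using nrm_supported[OF freeJ' J''] .
      moreover have "nrm act \<theta> (join_list k' h) \<in> supported {l'. length (lefts l') < length (lefts l)}"
        using k' by (auto simp: nrm_def l(1))
      ultimately show "nrm act \<theta> (join_list k' h) \<in> supported {l'\<in>{l\<in>J'. \<theta> l = \<one>}. length (lefts l') < length (lefts l)}"
        by (rule supported_mono[OF supported_Int]) auto
    qed
    finally show "codiff act \<theta> b' l - ?top \<in> supported {l'\<in>{l\<in>J'. \<theta> l = \<one>}. length (lefts l') < length (lefts l)}" .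
  next
    fix k :: "'g list"
    let ?b = "\<lambda>l. smul ((- 1) ^ length (lefts l)) (push (join_list (lefts l)) (?L (rights l)))"
    have eq: "{l\<in>{l\<in>J'. \<theta> l = \<one>}. lefts l = k} = (if k \<in> tuples C \<and> hd k = \<one> then join_list k ` ?LB else {})"
    proof -
      have "l \<in> {l\<in>{l\<in>J'. \<theta> l = \<one>}. lefts l = k} \<longleftrightarrow> l \<in> (if k \<in> tuples C \<and> hd k = \<one> then join_list k ` ?LB else {})" for l
        using J'0[of l] by (auto simp del: mem_Collect_eq)
      then show ?thesis by blast
    qed
    have "exact_on ?b (join_list k ` ?LB)"
    proof (rule exact_on_image[OF exL _ sgn[of "length k"]])
      show "inj_on (join_list k) ?LB" by (auto intro: inj_onI)
      fix h assume "h \<in> ?LB"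
      then show "?L h \<in> supported ?LB" using N.codiff_supported[OF freeL equiv_bd] by simp
    qed simp
    then show "exact_on ?b {l\<in>{l\<in>J'. \<theta> l = \<one>}. lefts l = k}" unfolding eq by simp
  qed
  have J0: "l \<in> J \<and> \<theta>' l = \<one> \<longleftrightarrow> (\<exists>k h. l = join_list k h \<and> k \<in> lists C \<and> h \<in> ntuples (carrier G))" for l
    unfolding J_def join_family_def \<theta>'_def ntuples_def by (auto simp del: in_lists_conv_set)
  have oneC: "\<one> \<in> C" by (rule subgroup.one_closed[OF C])
  (* With the normalisation \<theta>', removing an entry of k does not disturb h, and the blocks have fixed h. *)
  have exJ: "exact_on (codiff act \<theta>' b) {l\<in>J. \<theta>' l = \<one>}"
  proof (rule exact_on_filtered[where \<kappa> = rights and r = length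
        and b_top = "\<lambda>l. push (\<lambda>k'. join_list k' (rights l)) (list_bd (lefts l))"])
    fix l assume "l \<in> {l\<in>J. \<theta>' l = \<one>}"
    then obtain k h where l: "l = join_list k h" "k \<in> lists C" "h \<in> ntuples (carrier G)" "l \<in> J"
      using J0[of l] by blast
    have hT: "h \<in> ?T" using l(3) by (simp add: ntuples_def)
    show "codiff act \<theta>' b l \<in> supported {l\<in>J. \<theta>' l = \<one>}"
      using codiff_supported[OF free' equiv l(4)] .
    show "lin_extend (codiff act \<theta>' b) (codiff act \<theta>' b l) = 0"
      using codiff_codiff[OF free' equiv l(4) bb[OF l(4)]] .
    let ?top = "push (\<lambda>k'. join_list k' (rights l)) (list_bd (lefts l)) :: _ \<Rightarrow>\<^sub>0 'd"
    have hp: "push (\<lambda>k'. join_list k' h) (list_bd k :: _ \<Rightarrow>\<^sub>0 'd) \<in> supported {l'\<in>{l\<in>J. \<theta>' l = \<one>}. rights l' = h}"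
      using bd_lists[OF l(2)]
    proof (rule supported_push)
      fix k' assume "k' \<in> lists C"
      then have "join_list k' h \<in> J \<and> \<theta>' (join_list k' h) = \<one>" using J0 l by blast
      then show "join_list k' h \<in> {l'\<in>{l\<in>J. \<theta>' l = \<one>}. rights l' = h}" by simp
    qed
    then show "?top \<in> supported {l'\<in>{l\<in>J. \<theta>' l = \<one>}. rights l' = rights l}"
      unfolding l(1) lefts_rights_join .
    have "lin_extend (nrm act \<theta>') (push (\<lambda>k'. join_list k' h) (list_bd k)) = push (\<lambda>k'. join_list k' h) (list_bd k)"
      by (rule nrm_ident_supported[OF free' supported_mono[OF hp]]) auto
    then have "codiff act \<theta>' b l - ?top = smul ((- 1) ^ length k) (lin_extend (nrm act \<theta>') (push (join_list k) (tuple_bd h)))"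
      unfolding codiff_def l(1) b_join[OF l(2) hT] by (simp add: lin_extend_linear)
    also have "\<dots> \<in> supported {l'\<in>{l\<in>J. \<theta>' l = \<one>}. length (rights l') < length (rights l)}"
      unfolding lin_extend_push
    proof (rule supported_smul, rule supported_lin_extend[OF tuple_bd_supported])
      fix h' assume h': "h' \<in> {ys. ys \<noteq> [] \<and> Suc (length ys) = length h \<and> set ys \<subseteq> set h}"
      then have J'': "join_list k h' \<in> J" using l T_D[OF hT] by (auto simp: J_def tuples_def)
      have "nrm act \<theta>' (join_list k h') \<in> supported {l\<in>J. \<theta>' l = \<one>}" using nrm_supported[OF free' J''] .
      moreover have "nrm act \<theta>' (join_list k h') \<in> supported {l'. length (rights l') < length (rights l)}"
        using h' by (auto simp: nrm_def l(1))
      ultimately show "nrm act \<theta>' (join_list k h') \<in> supported {l'\<in>{l\<in>J. \<theta>' l = \<one>}. length (rights l') < length (rights l)}"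
        by (rule supported_mono[OF supported_Int]) auto
    qed
    finally show "codiff act \<theta>' b l - ?top \<in> supported {l'\<in>{l\<in>J. \<theta>' l = \<one>}. length (rights l') < length (rights l)}" .
  next
    fix h :: "'g list"
    let ?b = "\<lambda>l. push (\<lambda>k'. join_list k' (rights l)) (list_bd (lefts l)) :: _ \<Rightarrow>\<^sub>0 'd"
    have eq: "{l\<in>{l\<in>J. \<theta>' l = \<one>}. rights l = h} = (if h \<in> ntuples (carrier G) then (\<lambda>k. join_list k h) ` lists C else {})"
    proof -
      have "l \<in> {l\<in>{l\<in>J. \<theta>' l = \<one>}. rights l = h} \<longleftrightarrow> l \<in> (if h \<in> ntuples (carrier G) then (\<lambda>k. join_list k h) ` lists C else {})" for l
        using J0[of l] by (auto simp del: in_lists_conv_set)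
      then show ?thesis by blast
    qed
    have "exact_on ?b ((\<lambda>k. join_list k h) ` lists C)"
    proof (rule exact_on_image[where e = 1, OF lists_exact[OF oneC]])
      show "inj_on (\<lambda>k. join_list k h) (lists C)" by (auto intro: inj_onI)
    qed (use bd_lists in auto)
    then show "exact_on ?b {l\<in>{l\<in>J. \<theta>' l = \<one>}. rights l = h}" unfolding eq by simp
  qed
  (* The short exact sequence needs a common normalisation for J and J'. *)
  have exJ'': "exact_on (codiff act \<theta>' b') {l\<in>J'. \<theta>' l = \<one>}"
    by (rule codiff_exact_change[OF freeJ' free'J' equiv' exJ'])
  let ?S = "{l\<in>J. \<theta>' l = \<one>}" and ?N = "join_list [] ` ntuples (carrier G) :: ('g + 'g) list set"
  have diff: "?S - ?N = {l\<in>J'. \<theta>' l = \<one>}"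
  proof -
    have eq: "l \<in> ?N \<longleftrightarrow> l \<notin> J'" if lS: "l \<in> ?S" for l
    proof -
      obtain k h where l: "l = join_list k h" "k \<in> lists C" "h \<in> ntuples (carrier G)" using J0[of l] lS by blast
      have "l \<in> J' \<longleftrightarrow> k \<noteq> []" using l by (auto simp: J'_def tuples_def ntuples_def)
      moreover have "l \<in> ?N \<longleftrightarrow> k = []" using l by auto
      ultimately show ?thesis by blast
    qed
    show ?thesis using eq J'J by blast
  qed
  have d_nil: "codiff act \<theta>' b (join_list [] h) = push (join_list []) (tuple_codiff h)" if "h \<in> ntuples (carrier G)" for h
  proof -
    have hT: "h \<in> ?T" using that by (simp add: ntuples_def)
    have "codiff act \<theta>' b (join_list [] h) = lin_extend (nrm act \<theta>') (push (join_list []) (tuple_bd h))"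
      unfolding codiff_def using b_join[OF _ hT, of "[]"] by simp
    also have "\<dots> = push (join_list []) (tuple_codiff h)"
      unfolding lin_extend_push codiff_def push_lin_extend
      by (rule lin_extend_cong) (simp add: nrm_def \<theta>'_def)
    finally show ?thesis .
  qed
  have tcod: "tuple_codiff h \<in> supported (ntuples (carrier G))" if "h \<in> ntuples (carrier G)" for h
    using that by (intro tuple_codiff_subgroup[OF subgroup_self]) (simp add: ntuples_def)
  have exT: "exact_on (codiff act \<theta>' b) ?N"
  proof (rule exact_on_sub[OF exJ])
    show "?N \<subseteq> ?S" using J0 by (force simp: J_def \<theta>'_def ntuples_def)
    fix l
    show "codiff act \<theta>' b l \<in> supported ?S" if "l \<in> ?S"
      using codiff_supported[OF free' equiv] that by blast
    show "lin_extend (codiff act \<theta>' b) (codiff act \<theta>' b l) = 0" if "l \<in> ?S"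
      using codiff_codiff[OF free' equiv _ bb] that by blast
    show "codiff act \<theta>' b l \<in> supported ?N" if lN: "l \<in> ?N"
    proof -
      obtain h where h: "l = join_list [] h" "h \<in> ntuples (carrier G)" using lN by blast
      show ?thesis unfolding h(1) d_nil[OF h(2)] using tcod[OF h(2)] by (rule supported_push) blast
    qed
    show "exact_on (\<lambda>l. restr (?S - ?N) (codiff act \<theta>' b l)) (?S - ?N)"
      unfolding diff
    proof (rule exact_on_cong[OF exJ''])
      fix l assume "l \<in> {l\<in>J'. \<theta>' l = \<one>}"
      then have l: "l \<in> J'" "l \<in> J" using J'J by auto
      have b'b: "b' l = restr J' (b l)"
      proof -
        have "restr J' (restr J c) = restr J' c" for c :: "('g + 'g) list \<Rightarrow>\<^sub>0 'd"
          unfolding restr_def lin_extend_compose by (rule lin_extend_cong) (use J'J in auto)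
        then show ?thesis by (simp add: b_def b'_def)
      qed
      have bl: "b l \<in> supported J" by (simp add: b_def)
      show "codiff act \<theta>' b' l = restr {l\<in>J'. \<theta>' l = \<one>} (codiff act \<theta>' b l)"
        unfolding codiff_def b'b lin_extend_restr restr_lin_extend using bl
      proof (rule lin_extend_cong_supported)
        fix z assume z: "z \<in> J"
        show "(if z \<in> J' then nrm act \<theta>' z else 0) = restr {l\<in>J'. \<theta>' l = \<one>} (nrm act \<theta>' z)"
        proof (cases "z \<in> J'")
          case True
          then show ?thesis using nrm_supported[OF free'J' True] by (simp add: restr_ident)
        next
          case False
          have "inv (\<theta>' z) \<in> carrier G" using free' z by (simp add: free_action_def)
          then have "act (inv (\<theta>' z)) z \<notin> J'" using actJ'[OF z] False by blast
          then show ?thesis using False by (simp add: nrm_def)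
        qed
      qed
    qed
  qed
  have "exact_on tuple_codiff (rights ` ?N)"
  proof (rule exact_on_image[where e = 1, OF exT])
    show "inj_on rights ?N" by (auto intro: inj_onI)
    fix l assume "l \<in> ?N"
    then obtain h where h: "l = join_list [] h" "h \<in> ntuples (carrier G)" by blast
    show "codiff act \<theta>' b l \<in> supported ?N"
      unfolding h(1) d_nil[OF h(2)] using tcod[OF h(2)] by (rule supported_push) blast
    show "tuple_codiff (rights l) = smul 1 (push rights (codiff act \<theta>' b l))"
      unfolding h(1) d_nil[OF h(2)] by (simp add: push_push push_ident[of _ UNIV] supported_def)
  qed simp
  moreover have "rights ` ?N = ntuples (carrier G)" by (simp add: image_image)
  ultimately show ?thesis by simp
qed

end

section \<open>Free products\<close>

locale group_family =
  fixes I :: "'i set" and \<Gamma> :: "'i \<Rightarrow> ('g, 'b) monoid_scheme"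
  assumes family: "\<And>i. i \<in> I \<Longrightarrow> group (\<Gamma> i)"
begin

lemma fp_step_words: "fp_step I \<Gamma> u v \<Longrightarrow> u \<in> fp_words I \<Gamma> \<longleftrightarrow> v \<in> fp_words I \<Gamma>"
proof (induction rule: fp_step.induct)
  case (fp_unit i u v)
  then interpret group "\<Gamma> i" by (rule family)
  show ?case using fp_unit by (auto simp: fp_words_def)
next
  case (fp_mult i g h u v)
  then interpret group "\<Gamma> i" by (intro family)
  show ?case using fp_mult by (auto simp: fp_words_def)
qed

lemma equivclp_words: "equivclp (fp_step I \<Gamma>) u v \<Longrightarrow> u \<in> fp_words I \<Gamma> \<longleftrightarrow> v \<in> fp_words I \<Gamma>"
  by (induction rule: equivclp_induct) (use fp_step_words in blast)+

lemma fp_step_context: "fp_step I \<Gamma> u v \<Longrightarrow> fp_step I \<Gamma> (a @ u @ b) (a @ v @ b)"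
proof (induction rule: fp_step.induct)
  case (fp_unit i u v)
  then show ?case using fp_step.fp_unit[of i I \<Gamma> "a @ u" "v @ b"] by simp
next
  case (fp_mult i g h u v)
  then show ?case using fp_step.fp_mult[of i I g \<Gamma> h "a @ u" "v @ b"] by simp
qed

lemma equivclp_context: "equivclp (fp_step I \<Gamma>) u v \<Longrightarrow> equivclp (fp_step I \<Gamma>) (a @ u @ b) (a @ v @ b)"
proof (induction rule: equivclp_induct)
  case (step y z)
  then show ?case by (meson equivclp_into_equivclp fp_step_context)
qed simp

lemma equiv_fp_rel: "equiv (fp_words I \<Gamma>) (fp_rel I \<Gamma>)"
proof (rule equivI)
  show "sym (fp_rel I \<Gamma>)" by (auto simp: sym_def fp_rel_def intro: equivclp_sym)
  show "trans (fp_rel I \<Gamma>)" by (auto simp: trans_def fp_rel_def intro: equivclp_trans)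
qed (auto simp: fp_rel_def refl_on_def)

abbreviation cls :: "('i \<times> 'g) list \<Rightarrow> ('i \<times> 'g) list set" where
  "cls u \<equiv> fp_rel I \<Gamma> `` {u}"

lemma cls_eq_iff:
  "u \<in> fp_words I \<Gamma> \<Longrightarrow> v \<in> fp_words I \<Gamma> \<Longrightarrow> cls u = cls v \<longleftrightarrow> equivclp (fp_step I \<Gamma>) u v"
  using eq_equiv_class_iff[OF equiv_fp_rel] by (auto simp: fp_rel_def)

lemma words_append [simp]: "u @ v \<in> fp_words I \<Gamma> \<longleftrightarrow> u \<in> fp_words I \<Gamma> \<and> v \<in> fp_words I \<Gamma>"
  by (auto simp: fp_words_def)

lemma words_simps [simp]:
  "[] \<in> fp_words I \<Gamma>" "(i, g) # u \<in> fp_words I \<Gamma> \<longleftrightarrow> i \<in> I \<and> g \<in> carrier (\<Gamma> i) \<and> u \<in> fp_words I \<Gamma>"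
  by (auto simp: fp_words_def)

lemma carrier_free_product: "carrier (free_product I \<Gamma>) = cls ` fp_words I \<Gamma>"
  by (auto simp: free_product_def quotient_def)

lemma mult_free_product:
  "P \<otimes>\<^bsub>free_product I \<Gamma>\<^esub> Q = (\<Union>u\<in>P. \<Union>v\<in>Q. cls (u @ v))"
  by (simp only: free_product_def monoid.simps)

lemma cls_mult:
  assumes "u \<in> fp_words I \<Gamma>" "v \<in> fp_words I \<Gamma>"
  shows "cls u \<otimes>\<^bsub>free_product I \<Gamma>\<^esub> cls v = cls (u @ v)"
proof -
  have same: "cls (u' @ v') = cls (u @ v)" if "u' \<in> cls u" "v' \<in> cls v" for u' v'
  proof -
    have 1: "equivclp (fp_step I \<Gamma>) u u'" "equivclp (fp_step I \<Gamma>) v v'" "u' \<in> fp_words I \<Gamma>" "v' \<in> fp_words I \<Gamma>"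
      using that by (auto simp: fp_rel_def)
    have "equivclp (fp_step I \<Gamma>) (u @ v) (u' @ v)" using equivclp_context[OF 1(1), of "[]" v] by simp
    also have "equivclp (fp_step I \<Gamma>) (u' @ v) (u' @ v')" using equivclp_context[OF 1(2), of u' "[]"] by simp
    finally show ?thesis using assms 1 by (subst cls_eq_iff) (auto intro: equivclp_sym)
  qed
  have "(\<Union>x\<in>A. \<Union>y\<in>B. f x y) = c" if "a \<in> A" "b \<in> B" "\<And>x y. x \<in> A \<Longrightarrow> y \<in> B \<Longrightarrow> f x y = c"
    for A B :: "('i \<times> 'g) list set" and a b c and f :: "_ \<Rightarrow> _ \<Rightarrow> ('i \<times> 'g) list set"
    using that by blast
  note * = this
  have "u \<in> cls u" "v \<in> cls v" using assms by (auto simp: fp_rel_def)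
  then have "(\<Union>u'\<in>cls u. \<Union>v'\<in>cls v. cls (u' @ v')) = cls (u @ v)" by (rule *) (rule same)
  then show ?thesis by (simp only: mult_free_product)
qed

lemma one_free_product: "\<one>\<^bsub>free_product I \<Gamma>\<^esub> = cls []"
  by (simp add: free_product_def)

lemma group_free_product: "group (free_product I \<Gamma>)"
proof (rule groupI)
  fix P assume "P \<in> carrier (free_product I \<Gamma>)"
  then obtain u where u: "u \<in> fp_words I \<Gamma>" "P = cls u" by (auto simp: carrier_free_product)
  have "\<exists>v\<in>fp_words I \<Gamma>. equivclp (fp_step I \<Gamma>) (v @ u) []" using u(1)
  proof (induction u)
    case (Cons a u)
    obtain i g where a: "a = (i, g)" by (cases a)
    have ig: "i \<in> I" "g \<in> carrier (\<Gamma> i)" using Cons.prems a by auto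
    then interpret group "\<Gamma> i" by (intro family)
    obtain v where v: "v \<in> fp_words I \<Gamma>" "equivclp (fp_step I \<Gamma>) (v @ u) []" using Cons a by auto
    have s1: "fp_step I \<Gamma> (v @ [(i, inv\<^bsub>\<Gamma> i\<^esub> g), (i, g)] @ u) (v @ [(i, inv\<^bsub>\<Gamma> i\<^esub> g \<otimes>\<^bsub>\<Gamma> i\<^esub> g)] @ u)"
      using ig by (intro fp_step.fp_mult) auto
    have s2: "fp_step I \<Gamma> (v @ [(i, \<one>\<^bsub>\<Gamma> i\<^esub>)] @ u) (v @ u)" using ig by (intro fp_step.fp_unit)
    have "equivclp (fp_step I \<Gamma>) (v @ [(i, inv\<^bsub>\<Gamma> i\<^esub> g), (i, g)] @ u) (v @ u)"
    proof -
      have "fp_step I \<Gamma> (v @ [(i, inv\<^bsub>\<Gamma> i\<^esub> g), (i, g)] @ u) (v @ [(i, \<one>\<^bsub>\<Gamma> i\<^esub>)] @ u)" using s1 ig by simp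
      then show ?thesis
        by (rule equivclp_into_equivclp[OF equivclp_into_equivclp[OF equivclp_refl disjI1] disjI1]) (rule s2)
    qed
    then have "equivclp (fp_step I \<Gamma>) ((v @ [(i, inv\<^bsub>\<Gamma> i\<^esub> g)]) @ a # u) []"
      using equivclp_trans[OF _ v(2)] a by simp
    then show ?case using v(1) ig by (intro bexI[of _ "v @ [(i, inv\<^bsub>\<Gamma> i\<^esub> g)]"]) auto
  qed (auto intro!: bexI[of _ "[]"])
  then obtain v where v: "v \<in> fp_words I \<Gamma>" "equivclp (fp_step I \<Gamma>) (v @ u) []" by blast
  show "\<exists>Q\<in>carrier (free_product I \<Gamma>). Q \<otimes>\<^bsub>free_product I \<Gamma>\<^esub> P = \<one>\<^bsub>free_product I \<Gamma>\<^esub>"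
    using u v by (intro bexI[of _ "cls v"]) (auto simp: carrier_free_product cls_mult one_free_product cls_eq_iff)
qed (auto simp: carrier_free_product cls_mult one_free_product)

lemma fp_incl_hom:
  assumes "i \<in> I"
  shows "fp_incl I \<Gamma> i \<in> hom (\<Gamma> i) (free_product I \<Gamma>)"
proof (rule homI)
  interpret group "\<Gamma> i" by (rule family[OF assms])
  fix g h assume gh: "g \<in> carrier (\<Gamma> i)" "h \<in> carrier (\<Gamma> i)"
  show "fp_incl I \<Gamma> i g \<in> carrier (free_product I \<Gamma>)"
    using gh assms by (auto simp: fp_incl_def carrier_free_product)
  have "fp_step I \<Gamma> [(i, g), (i, h)] [(i, g \<otimes>\<^bsub>\<Gamma> i\<^esub> h)]"
    using fp_step.fp_mult[of i I g \<Gamma> h "[]" "[]"] assms gh by simp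
  then have "cls [(i, g \<otimes>\<^bsub>\<Gamma> i\<^esub> h)] = cls [(i, g), (i, h)]"
    using assms gh by (subst cls_eq_iff) (auto intro: equivclp_sym)
  then show "fp_incl I \<Gamma> i (g \<otimes>\<^bsub>\<Gamma> i\<^esub> h) = fp_incl I \<Gamma> i g \<otimes>\<^bsub>free_product I \<Gamma>\<^esub> fp_incl I \<Gamma> i h"
    using assms gh by (simp add: fp_incl_def cls_mult)
qed

text \<open>
  The homomorphism evaluates words; evaluation is invariant under the elementary reductions, hence well defined on
  their classes.
\<close>

lemma free_product_universal:
  assumes H: "group H" and f: "\<And>i. i \<in> I \<Longrightarrow> f i \<in> hom (\<Gamma> i) H"
  shows "\<exists>h\<in>hom (free_product I \<Gamma>) H. \<forall>i\<in>I. \<forall>g\<in>carrier (\<Gamma> i). h (fp_incl I \<Gamma> i g) = f i g"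
proof -
  interpret H: group H by fact
  define ev where "ev = (\<lambda>u. foldr (\<lambda>(i, g) x. f i g \<otimes>\<^bsub>H\<^esub> x) u \<one>\<^bsub>H\<^esub>)"
  have fc: "f i g \<in> carrier H" if "i \<in> I" "g \<in> carrier (\<Gamma> i)" for i g
    using f[OF that(1)] that(2) by (auto simp: hom_def)
  have ev_Cons: "ev ((i, g) # u) = f i g \<otimes>\<^bsub>H\<^esub> ev u" "ev [] = \<one>\<^bsub>H\<^esub>" for i g u by (simp_all add: ev_def)
  have ev_closed: "ev u \<in> carrier H" if "u \<in> fp_words I \<Gamma>" for u
    using that by (induction u) (auto simp: ev_Cons fc)
  have ev_append: "ev (u @ v) = ev u \<otimes>\<^bsub>H\<^esub> ev v" if "u \<in> fp_words I \<Gamma>" "v \<in> fp_words I \<Gamma>" for u v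
    using that(1) by (induction u) (auto simp: ev_Cons fc ev_closed that(2) H.m_assoc)
  have ev_step: "ev u = ev v" if "fp_step I \<Gamma> u v" "u \<in> fp_words I \<Gamma>" for u v
    using that
  proof (induction rule: fp_step.induct)
    case (fp_unit i u v)
    then interpret group "\<Gamma> i" by (intro family)
    have "f i \<one>\<^bsub>\<Gamma> i\<^esub> = \<one>\<^bsub>H\<^esub>" by (rule hom_one[OF f]) (use fp_unit is_group H in auto)
    then show ?case using fp_unit by (simp add: ev_append ev_Cons ev_closed)
  next
    case (fp_mult i g h u v)
    have "f i (g \<otimes>\<^bsub>\<Gamma> i\<^esub> h) = f i g \<otimes>\<^bsub>H\<^esub> f i h" using f[OF fp_mult(1)] fp_mult by (simp add: hom_def)
    moreover have "g \<otimes>\<^bsub>\<Gamma> i\<^esub> h \<in> carrier (\<Gamma> i)"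
      using family[OF fp_mult(1)] fp_mult by (simp add: group.is_monoid monoid.m_closed)
    ultimately show ?case using fp_mult by (simp add: ev_append ev_Cons ev_closed fc H.m_assoc)
  qed
  have ev_equiv: "ev u = ev v" if "equivclp (fp_step I \<Gamma>) u v" "u \<in> fp_words I \<Gamma>" for u v
    using that
  proof (induction rule: equivclp_induct)
    case (step y z)
    have "y \<in> fp_words I \<Gamma>" "z \<in> fp_words I \<Gamma>"
      using step equivclp_words[OF step(1)] fp_step_words by blast+
    then have "ev y = ev z" using step(2) ev_step by metis
    then show ?case using step by simp
  qed simp
  define h where "h = (\<lambda>P. ev (SOME u. u \<in> P))"
  have h: "h (cls u) = ev u" if u: "u \<in> fp_words I \<Gamma>" for u
  proof -
    have "u \<in> cls u" using u by (auto simp: fp_rel_def)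
    then have "(SOME v. v \<in> cls u) \<in> cls u" by (rule someI)
    then have "equivclp (fp_step I \<Gamma>) u (SOME v. v \<in> cls u)" by (auto simp: fp_rel_def)
    then show ?thesis using ev_equiv[OF _ u] by (simp add: h_def)
  qed
  have "h \<in> hom (free_product I \<Gamma>) H"
    by (rule homI) (auto simp: carrier_free_product cls_mult h ev_closed ev_append)
  moreover have "h (fp_incl I \<Gamma> i g) = f i g" if "i \<in> I" "g \<in> carrier (\<Gamma> i)" for i g
    using that fc by (simp add: fp_incl_def h ev_Cons)
  ultimately show ?thesis by blast
qed

lemma free_product_generated:
  assumes S: "subgroup S (free_product I \<Gamma>)" and incl: "\<And>i g. i \<in> I \<Longrightarrow> g \<in> carrier (\<Gamma> i) \<Longrightarrow> fp_incl I \<Gamma> i g \<in> S"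
  shows "S = carrier (free_product I \<Gamma>)"
proof -
  have "cls u \<in> S" if "u \<in> fp_words I \<Gamma>" for u
    using that
  proof (induction u)
    case Nil
    then show ?case using subgroup.one_closed[OF S] by (simp add: one_free_product)
  next
    case (Cons a u)
    obtain i g where a: "a = (i, g)" by (cases a)
    have "cls [(i, g)] \<in> S" using incl[of i g] Cons a by (auto simp: fp_incl_def)
    moreover have "cls u \<in> S" using Cons a by auto
    ultimately have "cls [(i, g)] \<otimes>\<^bsub>free_product I \<Gamma>\<^esub> cls u \<in> S" using subgroup.m_closed[OF S] by blast
    then show ?case using Cons a by (subst (asm) cls_mult) auto
  qed
  then show ?thesis using subgroup.subset[OF S] by (auto simp: carrier_free_product)
qed

end


section \<open>Graph products\<close>

lemma (in group) normal_closure_normal: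
  assumes R: "R \<subseteq> carrier G"
  shows "normal_closure G R \<lhd> G"
proof -
  have ne: "carrier G \<in> {N. N \<lhd> G \<and> R \<subseteq> N}"
    using R subgroup_self by (auto simp: normal_inv_iff)
  have "subgroup (normal_closure G R) G"
    unfolding normal_closure_def
    by (rule subgroups_Inter) (use ne in \<open>auto dest: normal_imp_subgroup\<close>)
  moreover have "x \<otimes> h \<otimes> inv x \<in> normal_closure G R" if "x \<in> carrier G" "h \<in> normal_closure G R" for x h
    using that by (auto simp: normal_closure_def normal.inv_op_closed2)
  ultimately show ?thesis by (simp add: normal_inv_iff)
qed

locale graph_product_family = group_family V \<Gamma> for V :: "'i set" and \<Gamma> :: "'i \<Rightarrow> ('g, 'b) monoid_scheme" +
  fixes K :: "'i set set"
begin

abbreviation "F \<equiv> free_product V \<Gamma>"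
abbreviation "N \<equiv> normal_closure F (gp_relators V K \<Gamma>)"
abbreviation "GP \<equiv> graph_product V K \<Gamma>"
abbreviation "\<iota> \<equiv> gp_incl V K \<Gamma>"

sublocale F: group F by (rule group_free_product)

lemma fp_incl_closed: "i \<in> V \<Longrightarrow> g \<in> carrier (\<Gamma> i) \<Longrightarrow> fp_incl V \<Gamma> i g \<in> carrier F"
  using fp_incl_hom by (auto simp: hom_def)

lemma relators_closed: "gp_relators V K \<Gamma> \<subseteq> carrier F"
  by (auto simp: gp_relators_def fp_incl_closed)

lemma N_normal: "N \<lhd> F"
  by (rule F.normal_closure_normal[OF relators_closed])

lemma relators_N: "gp_relators V K \<Gamma> \<subseteq> N"
  by (auto simp: normal_closure_def)

sublocale normal N F by (rule N_normal)

sublocale Q: group GP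
  unfolding graph_product_def by (rule factorgroup_is_group)

lemma incl_hom: "i \<in> V \<Longrightarrow> \<iota> i \<in> hom (\<Gamma> i) GP"
  using hom_compose[OF fp_incl_hom r_coset_hom_Mod, of i]
  by (simp add: gp_incl_def[abs_def] graph_product_def o_def)

lemma incl_closed: "i \<in> V \<Longrightarrow> g \<in> carrier (\<Gamma> i) \<Longrightarrow> \<iota> i g \<in> carrier GP"
  using incl_hom by (auto simp: hom_def)

lemma incl_group_hom: "i \<in> V \<Longrightarrow> group_hom (\<Gamma> i) GP (\<iota> i)"
  using incl_hom family Q.is_group by (auto simp: group_hom_def group_hom_axioms_def)

lemma incl_commute:
  assumes ij: "i \<in> V" "j \<in> V" "adjacent K i j" and gh: "g \<in> carrier (\<Gamma> i)" "h \<in> carrier (\<Gamma> j)"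
  shows "\<iota> i g \<otimes>\<^bsub>GP\<^esub> \<iota> j h = \<iota> j h \<otimes>\<^bsub>GP\<^esub> \<iota> i g"
proof -
  let ?x = "fp_incl V \<Gamma> i g" and ?y = "fp_incl V \<Gamma> j h"
  have xy: "?x \<in> carrier F" "?y \<in> carrier F" using assms fp_incl_closed by auto
  have c: "?x \<otimes>\<^bsub>F\<^esub> ?y \<otimes>\<^bsub>F\<^esub> inv\<^bsub>F\<^esub> ?x \<otimes>\<^bsub>F\<^esub> inv\<^bsub>F\<^esub> ?y \<in> N"
    using assms relators_N unfolding gp_relators_def by blast
  have eq: "?x \<otimes>\<^bsub>F\<^esub> ?y = (?x \<otimes>\<^bsub>F\<^esub> ?y \<otimes>\<^bsub>F\<^esub> inv\<^bsub>F\<^esub> ?x \<otimes>\<^bsub>F\<^esub> inv\<^bsub>F\<^esub> ?y) \<otimes>\<^bsub>F\<^esub> (?y \<otimes>\<^bsub>F\<^esub> ?x)"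
  proof -
    have "inv\<^bsub>F\<^esub> ?y \<otimes>\<^bsub>F\<^esub> (?y \<otimes>\<^bsub>F\<^esub> ?x) = ?x" using xy by (simp add: F.m_assoc[symmetric])
    then show ?thesis using xy by (simp add: F.m_assoc)
  qed
  have "N #>\<^bsub>F\<^esub> (n \<otimes>\<^bsub>F\<^esub> z) = N #>\<^bsub>F\<^esub> z" if n: "n \<in> N" and z: "z \<in> carrier F" for n z
    using F.coset_mult_assoc[OF subset mem_carrier[OF n] z] F.coset_join2[OF mem_carrier[OF n] subgroup_axioms n] by simp
  from this[OF c] have "N #>\<^bsub>F\<^esub> (?x \<otimes>\<^bsub>F\<^esub> ?y) = N #>\<^bsub>F\<^esub> (?y \<otimes>\<^bsub>F\<^esub> ?x)"
    using arg_cong[OF eq, of "\<lambda>z. N #>\<^bsub>F\<^esub> z"] xy by (simp only: F.m_closed)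
  then show ?thesis using xy by (simp add: gp_incl_def graph_product_def rcos_sum)
qed

text \<open>
  The commutators that define the graph product lie in the kernel of the map induced on the free product, which
  is normal and hence contains their normal closure. This property carries all that is proved about
  graph products below.
\<close>

lemma graph_product_universal:
  assumes H: "group H" and f: "\<And>i. i \<in> V \<Longrightarrow> f i \<in> hom (\<Gamma> i) H"
    and comm: "\<And>i j g h. i \<in> V \<Longrightarrow> j \<in> V \<Longrightarrow> adjacent K i j \<Longrightarrow> g \<in> carrier (\<Gamma> i) \<Longrightarrow> h \<in> carrier (\<Gamma> j) \<Longrightarrow>
      f i g \<otimes>\<^bsub>H\<^esub> f j h = f j h \<otimes>\<^bsub>H\<^esub> f i g"
  obtains h where "h \<in> hom GP H" "\<And>i g. i \<in> V \<Longrightarrow> g \<in> carrier (\<Gamma> i) \<Longrightarrow> h (\<iota> i g) = f i g"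
proof -
  interpret H: group H by fact
  obtain k where k: "k \<in> hom F H" "\<And>i g. i \<in> V \<Longrightarrow> g \<in> carrier (\<Gamma> i) \<Longrightarrow> k (fp_incl V \<Gamma> i g) = f i g"
    using free_product_universal[OF H f] by blast
  interpret k: group_hom F H k using k(1) by unfold_locales
  have fc: "f i g \<in> carrier H" if "i \<in> V" "g \<in> carrier (\<Gamma> i)" for i g
    using f[OF that(1)] that(2) by (auto simp: hom_def)
  have "gp_relators V K \<Gamma> \<subseteq> kernel F H k"
  proof
    fix r assume r: "r \<in> gp_relators V K \<Gamma>"
    then obtain i j g h where ij: "i \<in> V" "j \<in> V" "adjacent K i j" "g \<in> carrier (\<Gamma> i)" "h \<in> carrier (\<Gamma> j)"
      and r_eq: "r = fp_incl V \<Gamma> i g \<otimes>\<^bsub>F\<^esub> fp_incl V \<Gamma> j h \<otimes>\<^bsub>F\<^esub> inv\<^bsub>F\<^esub> fp_incl V \<Gamma> i g \<otimes>\<^bsub>F\<^esub> inv\<^bsub>F\<^esub> fp_incl V \<Gamma> j h"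
      unfolding gp_relators_def by blast
    have "k r = f i g \<otimes>\<^bsub>H\<^esub> f j h \<otimes>\<^bsub>H\<^esub> inv\<^bsub>H\<^esub> f i g \<otimes>\<^bsub>H\<^esub> inv\<^bsub>H\<^esub> f j h"
      using ij fp_incl_closed by (simp add: r_eq k(2))
    also have "f i g \<otimes>\<^bsub>H\<^esub> f j h = f j h \<otimes>\<^bsub>H\<^esub> f i g" using comm ij by blast
    also have "f j h \<otimes>\<^bsub>H\<^esub> f i g \<otimes>\<^bsub>H\<^esub> inv\<^bsub>H\<^esub> f i g \<otimes>\<^bsub>H\<^esub> inv\<^bsub>H\<^esub> f j h = \<one>\<^bsub>H\<^esub>"
      using fc ij by (simp add: H.m_assoc)
    finally show "r \<in> kernel F H k" using r relators_closed by (auto simp: kernel_def)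
  qed
  then have N_ker: "N \<subseteq> kernel F H k" using k.normal_kernel by (auto simp: normal_closure_def)
  have "k x = k y" if xy: "x \<in> carrier F" "y \<in> carrier F" "N #>\<^bsub>F\<^esub> x = N #>\<^bsub>F\<^esub> y" for x y
  proof -
    have "x \<in> N #>\<^bsub>F\<^esub> y" using xy F.rcos_self[OF xy(1) subgroup_axioms] by simp
    then obtain n where "n \<in> N" "x = n \<otimes>\<^bsub>F\<^esub> y" by (auto simp: r_coset_def)
    then show ?thesis using N_ker xy by (auto simp: kernel_def)
  qed
  then obtain h where h: "h \<in> hom (F Mod N) H" "\<And>x. x \<in> carrier F \<Longrightarrow> h (N #>\<^bsub>F\<^esub> x) = k x"
    using FactGroup_universal[OF k(1) N_normal] by blast
  show ?thesis
  proof
    show "h \<in> hom GP H" using h(1) by (simp add: graph_product_def)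
    show "h (\<iota> i g) = f i g" if "i \<in> V" "g \<in> carrier (\<Gamma> i)" for i g
      using that h(2) k(2) fp_incl_closed by (simp add: gp_incl_def)
  qed
qed

definition gens :: "'i set \<Rightarrow> ('i \<times> 'g) list set set set" where
  "gens W = (\<Union>i\<in>W \<inter> V. \<iota> i ` carrier (\<Gamma> i))"

text \<open>
  The subgroup generated by the vertex groups of \<open>W\<close>. It is isomorphic to the graph product over the full subcomplex on
  \<open>W\<close>; working inside one ambient group makes inclusions of bar complexes literal.
\<close>

definition sub :: "'i set \<Rightarrow> ('i \<times> 'g) list set set set" where
  "sub W = generate GP (gens W)"

lemma gens_closed: "gens W \<subseteq> carrier GP"
  by (auto simp: gens_def incl_closed)

lemma subgroup_sub: "subgroup (sub W) GP"
  unfolding sub_def by (rule Q.generate_is_subgroup[OF gens_closed])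

lemma sub_mono: "W \<subseteq> U \<Longrightarrow> sub W \<subseteq> sub U"
  unfolding sub_def by (rule Q.mono_generate) (auto simp: gens_def)

lemma incl_sub: "i \<in> W \<Longrightarrow> i \<in> V \<Longrightarrow> g \<in> carrier (\<Gamma> i) \<Longrightarrow> \<iota> i g \<in> sub W"
  unfolding sub_def by (rule generate.incl) (auto simp: gens_def)

lemma inv_gens: "x \<in> gens W \<Longrightarrow> inv\<^bsub>GP\<^esub> x \<in> gens W"
proof -
  assume "x \<in> gens W"
  then obtain i g where ig: "i \<in> W" "i \<in> V" "g \<in> carrier (\<Gamma> i)" "x = \<iota> i g" by (auto simp: gens_def)
  interpret h: group_hom "\<Gamma> i" GP "\<iota> i" by (rule incl_group_hom[OF ig(2)])
  have "inv\<^bsub>GP\<^esub> x = \<iota> i (inv\<^bsub>\<Gamma> i\<^esub> g)" using ig by simp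
  then show ?thesis unfolding gens_def using ig
    by (intro UN_I[of i] image_eqI[of _ _ "inv\<^bsub>\<Gamma> i\<^esub> g"]) auto
qed

lemma sub_induct [consumes 1, case_names one gen mult]:
  assumes "x \<in> sub W" "P \<one>\<^bsub>GP\<^esub>" "\<And>i g. i \<in> W \<Longrightarrow> i \<in> V \<Longrightarrow> g \<in> carrier (\<Gamma> i) \<Longrightarrow> P (\<iota> i g)"
    "\<And>x y. x \<in> sub W \<Longrightarrow> y \<in> sub W \<Longrightarrow> P x \<Longrightarrow> P y \<Longrightarrow> P (x \<otimes>\<^bsub>GP\<^esub> y)"
  shows "P x"
  using assms(1) unfolding sub_def
proof (induction rule: generate.induct)
  case (inv h)
  then show ?case using assms(3) inv_gens[OF inv] by (auto simp: gens_def)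
qed (use assms in \<open>auto simp: gens_def sub_def\<close>)

lemma sub_carrier: "sub V = carrier GP"
proof -
  let ?S = "{x\<in>carrier F. N #>\<^bsub>F\<^esub> x \<in> sub V}"
  have hom: "group_hom F GP (\<lambda>x. N #>\<^bsub>F\<^esub> x)"
    using r_coset_hom_Mod Q.is_group F.is_group by (auto simp: group_hom_def group_hom_axioms_def graph_product_def)
  interpret c: group_hom F GP "\<lambda>x. N #>\<^bsub>F\<^esub> x" by (rule hom)
  have "subgroup ?S F"
    by (rule F.subgroupI)
      (use c.hom_one subgroup.one_closed[OF subgroup_sub] subgroup.m_closed[OF subgroup_sub] subgroup.m_inv_closed[OF subgroup_sub]
        c.hom_mult c.hom_inv in \<open>auto intro!: exI[of _ "\<one>\<^bsub>F\<^esub>"]\<close>)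
  then have "?S = carrier F"
    by (rule free_product_generated) (use incl_sub fp_incl_closed in \<open>auto simp: gp_incl_def\<close>)
  then have "carrier GP \<subseteq> sub V" by (auto simp: graph_product_def carrier_FactGroup)
  then show ?thesis using subgroup.subset[OF subgroup_sub] by auto
qed

lemma retraction_ex:
  "\<exists>r\<in>hom GP GP. \<forall>i\<in>V. \<forall>g\<in>carrier (\<Gamma> i). r (\<iota> i g) = (if i \<in> W then \<iota> i g else \<one>\<^bsub>GP\<^esub>)"
proof -
  let ?f = "\<lambda>i g. if i \<in> W then \<iota> i g else \<one>\<^bsub>GP\<^esub>"
  show ?thesis
  proof (rule graph_product_universal[OF Q.is_group, of ?f])
    show "?f i \<in> hom (\<Gamma> i) GP" if "i \<in> V" for i
      using incl_hom[OF that] by (auto simp: hom_def)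
    show "?f i g \<otimes>\<^bsub>GP\<^esub> ?f j h = ?f j h \<otimes>\<^bsub>GP\<^esub> ?f i g"
      if "i \<in> V" "j \<in> V" "adjacent K i j" "g \<in> carrier (\<Gamma> i)" "h \<in> carrier (\<Gamma> j)" for i j g h
      using incl_commute[OF that] incl_closed[OF that(1,4)] incl_closed[OF that(2,5)] by simp
    fix h assume "h \<in> hom GP GP" "\<And>i g. i \<in> V \<Longrightarrow> g \<in> carrier (\<Gamma> i) \<Longrightarrow> h (\<iota> i g) = ?f i g"
    then show ?thesis by blast
  qed
qed

definition ret :: "'i set \<Rightarrow> ('i \<times> 'g) list set set \<Rightarrow> ('i \<times> 'g) list set set" where
  "ret W = (SOME r. r \<in> hom GP GP \<and> (\<forall>i\<in>V. \<forall>g\<in>carrier (\<Gamma> i). r (\<iota> i g) = (if i \<in> W then \<iota> i g else \<one>\<^bsub>GP\<^esub>)))"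

lemma ret_hom: "ret W \<in> hom GP GP"
  and ret_incl: "\<And>i g. i \<in> V \<Longrightarrow> g \<in> carrier (\<Gamma> i) \<Longrightarrow> ret W (\<iota> i g) = (if i \<in> W then \<iota> i g else \<one>\<^bsub>GP\<^esub>)"
  using someI_ex[of "\<lambda>r. r \<in> hom GP GP \<and> (\<forall>i\<in>V. \<forall>g\<in>carrier (\<Gamma> i). r (\<iota> i g) = (if i \<in> W then \<iota> i g else \<one>\<^bsub>GP\<^esub>))"]
    retraction_ex[of W] unfolding ret_def by blast+

lemma ret_mult: "x \<in> sub U \<Longrightarrow> y \<in> sub U \<Longrightarrow> ret W (x \<otimes>\<^bsub>GP\<^esub> y) = ret W x \<otimes>\<^bsub>GP\<^esub> ret W y"
  using hom_mult[OF ret_hom] subgroup.mem_carrier[OF subgroup_sub] by blast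

lemma ret_one: "ret W \<one>\<^bsub>GP\<^esub> = \<one>\<^bsub>GP\<^esub>"
  by (rule hom_one[OF ret_hom]) (rule Q.is_group)+

lemma ret_sub: "x \<in> sub U \<Longrightarrow> ret W x \<in> sub (U \<inter> W)"
proof (induction rule: sub_induct)
  case one
  then show ?case using subgroup.one_closed[OF subgroup_sub] by (simp add: ret_one)
next
  case (gen i g)
  then show ?case using subgroup.one_closed[OF subgroup_sub] by (auto simp: ret_incl intro: incl_sub)
next
  case (mult x y)
  then show ?case using subgroup.m_closed[OF subgroup_sub] by (simp add: ret_mult)
qed

lemma ret_ident: "x \<in> sub W \<Longrightarrow> ret W x = x"
  by (induction rule: sub_induct) (auto simp: ret_one ret_incl ret_mult)

text \<open>
  An element of both subgroups is fixed by the retraction to \<open>U\<close>, which maps \<open>sub W\<close> into \<open>sub (W \<inter> U)\<close>.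
\<close>

lemma sub_Int: "sub W \<inter> sub U = sub (W \<inter> U)"
proof
  show "sub W \<inter> sub U \<subseteq> sub (W \<inter> U)"
  proof
    fix x assume "x \<in> sub W \<inter> sub U"
    then have "ret U x \<in> sub (W \<inter> U)" "ret U x = x" using ret_sub[of x W U] ret_ident[of x U] by simp_all
    then show "x \<in> sub (W \<inter> U)" by simp
  qed
qed (use sub_mono in auto)

text \<open>
  A vertex group is a retract of the graph product: map all the other vertex groups to the unit.
\<close>

lemma incl_inj: "i \<in> V \<Longrightarrow> inj_on (\<iota> i) (carrier (\<Gamma> i))"
proof -
  assume i: "i \<in> V"
  interpret Gi: group "\<Gamma> i" by (rule family[OF i])
  let ?f = "\<lambda>j g. if j = i then g else \<one>\<^bsub>\<Gamma> i\<^esub>"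
  show ?thesis
  proof (rule graph_product_universal[OF Gi.is_group, of ?f])
    show "?f j \<in> hom (\<Gamma> j) (\<Gamma> i)" if "j \<in> V" for j by (auto simp: hom_def)
    show "?f j g \<otimes>\<^bsub>\<Gamma> i\<^esub> ?f k h = ?f k h \<otimes>\<^bsub>\<Gamma> i\<^esub> ?f j g"
      if "j \<in> V" "k \<in> V" "adjacent K j k" "g \<in> carrier (\<Gamma> j)" "h \<in> carrier (\<Gamma> k)" for j k g h
      using that by (auto simp: adjacent_def)
    fix h assume "h \<in> hom GP (\<Gamma> i)" "\<And>j g. j \<in> V \<Longrightarrow> g \<in> carrier (\<Gamma> j) \<Longrightarrow> h (\<iota> j g) = ?f j g"
    then have "h (\<iota> i g) = g" if "g \<in> carrier (\<Gamma> i)" for g using i that by simp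
    then show ?thesis by (rule inj_on_inverseI)
  qed
qed

lemma sub_singleton: "i \<in> V \<Longrightarrow> sub {i} = \<iota> i ` carrier (\<Gamma> i)"
proof -
  assume i: "i \<in> V"
  interpret h: group_hom "\<Gamma> i" GP "\<iota> i" by (rule incl_group_hom[OF i])
  have sg: "subgroup (\<iota> i ` carrier (\<Gamma> i)) GP" by (rule h.img_is_subgroup)
  have "x \<in> \<iota> i ` carrier (\<Gamma> i)" if "x \<in> sub {i}" for x
    using that by (induction rule: sub_induct) (use subgroup.one_closed[OF sg] subgroup.m_closed[OF sg] in auto)
  then show ?thesis using incl_sub[of i "{i}"] i by auto
qed

lemma sub_empty: "sub {} = {\<one>\<^bsub>GP\<^esub>}"
proof -
  have "x = \<one>\<^bsub>GP\<^esub>" if "x \<in> sub {}" for x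
    using that by (induction rule: sub_induct) auto
  moreover have "\<one>\<^bsub>GP\<^esub> \<in> sub {}" by (rule subgroup.one_closed[OF subgroup_sub])
  ultimately show ?thesis by blast
qed

lemma sub_commute:
  assumes v: "v \<in> V" and U: "\<And>w. w \<in> U \<Longrightarrow> w \<in> V \<Longrightarrow> adjacent K v w"
    and x: "x \<in> sub {v}" and y: "y \<in> sub U"
  shows "y \<otimes>\<^bsub>GP\<^esub> x = x \<otimes>\<^bsub>GP\<^esub> y"
  using y
proof (induction rule: sub_induct)
  case one
  then show ?case using subgroup.mem_carrier[OF subgroup_sub x] by simp
next
  case (gen i g)
  obtain h where "h \<in> carrier (\<Gamma> v)" "x = \<iota> v h" using x sub_singleton[OF v] by auto
  then show ?case using incl_commute[of v i h g] U gen v by simp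
next
  case (mult y z)
  have "x \<in> carrier GP" "y \<in> carrier GP" "z \<in> carrier GP"
    using subgroup.mem_carrier[OF subgroup_sub] x mult by auto
  note G = this
  have "(y \<otimes>\<^bsub>GP\<^esub> z) \<otimes>\<^bsub>GP\<^esub> x = y \<otimes>\<^bsub>GP\<^esub> (z \<otimes>\<^bsub>GP\<^esub> x)" by (rule Q.m_assoc[OF G(2,3,1)])
  also have "z \<otimes>\<^bsub>GP\<^esub> x = x \<otimes>\<^bsub>GP\<^esub> z" by (rule mult(4))
  also have "y \<otimes>\<^bsub>GP\<^esub> (x \<otimes>\<^bsub>GP\<^esub> z) = (y \<otimes>\<^bsub>GP\<^esub> x) \<otimes>\<^bsub>GP\<^esub> z" by (rule Q.m_assoc[OF G(2,1,3), symmetric])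
  also have "y \<otimes>\<^bsub>GP\<^esub> x = x \<otimes>\<^bsub>GP\<^esub> y" by (rule mult(3))
  also have "(x \<otimes>\<^bsub>GP\<^esub> y) \<otimes>\<^bsub>GP\<^esub> z = x \<otimes>\<^bsub>GP\<^esub> (y \<otimes>\<^bsub>GP\<^esub> z)" by (rule Q.m_assoc[OF G])
  finally show ?case .
qed


text \<open>
  The semidirect product of the chains on subsets of \<open>G\<close>, with the action by left translation, and \<open>G\<close>. Only chains on
  cosets are of interest, but the set of all subsets is closed under translation without any argument.
\<close>

lemma group_semidirect:
  defines "S \<equiv> \<lparr> carrier = {(m, g). m \<in> (supported (Pow (carrier GP)) :: (_ \<Rightarrow>\<^sub>0 'd::division_ring) set) \<and> g \<in> carrier GP},
    monoid.mult = (\<lambda>(m, g) (m', g'). (m + push (\<lambda>Z. g <#\<^bsub>GP\<^esub> Z) m', g \<otimes>\<^bsub>GP\<^esub> g')), one = (0, \<one>\<^bsub>GP\<^esub>) \<rparr>"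
  shows "group S"
proof -
  let ?M = "supported (Pow (carrier GP)) :: (_ \<Rightarrow>\<^sub>0 'd) set"
  have act_closed: "push (\<lambda>Z. g <#\<^bsub>GP\<^esub> Z) m \<in> ?M" if "g \<in> carrier GP" "m \<in> ?M" for g m
    using that(2) by (rule supported_push) (use that Q.l_coset_subset_G in auto)
  have act_act: "push (\<lambda>Z. g <#\<^bsub>GP\<^esub> Z) (push (\<lambda>Z. h <#\<^bsub>GP\<^esub> Z) m) = push (\<lambda>Z. (g \<otimes>\<^bsub>GP\<^esub> h) <#\<^bsub>GP\<^esub> Z) m"
    if "g \<in> carrier GP" "h \<in> carrier GP" "m \<in> ?M" for g h m
    unfolding push_push using that(3) by (rule push_cong_supported) (use that Q.lcos_m_assoc in auto)
  have act_one: "push (\<lambda>Z. \<one>\<^bsub>GP\<^esub> <#\<^bsub>GP\<^esub> Z) m = m" if "m \<in> ?M" for m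
    using that by (rule push_ident) (use Q.lcos_mult_one in auto)
  show ?thesis
  proof (rule groupI)
    show "\<one>\<^bsub>S\<^esub> \<in> carrier S" by (simp add: S_def)
    fix x assume x: "x \<in> carrier S"
    obtain m g where mg: "x = (m, g)" "m \<in> ?M" "g \<in> carrier GP" using x by (auto simp: S_def)
    show "\<one>\<^bsub>S\<^esub> \<otimes>\<^bsub>S\<^esub> x = x" using mg by (simp add: S_def act_one)
    show "\<exists>y\<in>carrier S. y \<otimes>\<^bsub>S\<^esub> x = \<one>\<^bsub>S\<^esub>"
      using mg act_closed[of "inv\<^bsub>GP\<^esub> g" m]
      by (intro bexI[of _ "(- push (\<lambda>Z. inv\<^bsub>GP\<^esub> g <#\<^bsub>GP\<^esub> Z) m, inv\<^bsub>GP\<^esub> g)"]) (simp_all add: S_def)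
    fix y assume y: "y \<in> carrier S"
    obtain n h where nh: "y = (n, h)" "n \<in> ?M" "h \<in> carrier GP" using y by (auto simp: S_def)
    show "x \<otimes>\<^bsub>S\<^esub> y \<in> carrier S" using mg nh act_closed by (simp add: S_def supported_add)
    fix z assume z: "z \<in> carrier S"
    obtain l k where lk: "z = (l, k)" "l \<in> ?M" "k \<in> carrier GP" using z by (auto simp: S_def)
    show "x \<otimes>\<^bsub>S\<^esub> y \<otimes>\<^bsub>S\<^esub> z = x \<otimes>\<^bsub>S\<^esub> (y \<otimes>\<^bsub>S\<^esub> z)"
      using mg nh lk by (simp add: S_def push_linear act_act Q.m_assoc add.assoc)
  qed
qed

text \<open>
  A derivation \<open>q\<close> is the same as a homomorphism \<open>x \<mapsto> (q x, x)\<close> to the semidirect product, so the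
  universal property reduces its existence to the generators. There the only relations to check are those between
  \<open>v\<close> and a neighbour \<open>w\<close>. They hold since the group of \<open>w\<close> lies in \<open>sub L\<close>, so that it commutes with the group of \<open>v\<close>
  and fixes the coset \<open>sub L\<close>. Vertices outside \<open>W\<close> are mapped to the unit.
\<close>

lemma derivation_ex:
  fixes W :: "'i set"
  assumes v: "v \<in> V"
  defines "L \<equiv> {w\<in>W. adjacent K v w}"
  shows "\<exists>q :: _ \<Rightarrow> (('i \<times> 'g) list set set set \<Rightarrow>\<^sub>0 'd::division_ring).
    (\<forall>x\<in>sub W. \<forall>y\<in>sub W. q (x \<otimes>\<^bsub>GP\<^esub> y) = q x + push (\<lambda>Z. x <#\<^bsub>GP\<^esub> Z) (q y)) \<and>
    (\<forall>i\<in>W \<inter> V. \<forall>g\<in>carrier (\<Gamma> i). q (\<iota> i g) = (if i = v then gen (sub L) - gen (\<iota> i g <#\<^bsub>GP\<^esub> sub L) else 0))"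
proof -
  let ?M = "supported (Pow (carrier GP)) :: (_ \<Rightarrow>\<^sub>0 'd) set"
  define S :: "((('i \<times> 'g) list set set set \<Rightarrow>\<^sub>0 'd) \<times> ('i \<times> 'g) list set set) monoid" where "S = \<lparr> carrier = {(m, g). m \<in> ?M \<and> g \<in> carrier GP},
    monoid.mult = (\<lambda>(m, g) (m', g'). (m + push (\<lambda>Z. g <#\<^bsub>GP\<^esub> Z) m', g \<otimes>\<^bsub>GP\<^esub> g')), one = (0, \<one>\<^bsub>GP\<^esub>) \<rparr>"
  have S: "group S" unfolding S_def by (rule group_semidirect)
  have carrS: "(m, g) \<in> carrier S \<longleftrightarrow> m \<in> ?M \<and> g \<in> carrier GP" for m g by (simp add: S_def)
  have multS: "(m, g) \<otimes>\<^bsub>S\<^esub> (m', g') = (m + push (\<lambda>Z. g <#\<^bsub>GP\<^esub> Z) m', g \<otimes>\<^bsub>GP\<^esub> g')" for m g m' g' by (simp add: S_def)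
  have oneS: "\<one>\<^bsub>S\<^esub> = (0, \<one>\<^bsub>GP\<^esub>)" by (simp add: S_def)
  have LG: "sub L \<subseteq> carrier GP" by (rule subgroup.subset[OF subgroup_sub])
  let ?D = "\<lambda>g. gen (sub L) - gen (g <#\<^bsub>GP\<^esub> sub L) :: _ \<Rightarrow>\<^sub>0 'd"
  let ?f = "\<lambda>i g. if i \<in> W then ((if i = v then ?D (\<iota> i g) else 0), \<iota> i g) else (0, \<one>\<^bsub>GP\<^esub>)"
  have DM: "?D g \<in> ?M" if "g \<in> carrier GP" for g
    using LG Q.l_coset_subset_G[OF LG that] by (auto intro!: supported_diff)
  have stab: "y <#\<^bsub>GP\<^esub> sub L = sub L" if "y \<in> sub L" for y
    using that LG subgroup_sub by (intro Q.coset_join3) auto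
  have hom: "?f i \<in> hom (\<Gamma> i) S" if i: "i \<in> V" for i
  proof (rule homI)
    interpret h: group_hom "\<Gamma> i" GP "\<iota> i" by (rule incl_group_hom[OF i])
    fix g assume g: "g \<in> carrier (\<Gamma> i)"
    show "?f i g \<in> carrier S" using DM[OF incl_closed[OF i g]] incl_closed[OF i g] by (auto simp: carrS)
    fix h assume h: "h \<in> carrier (\<Gamma> i)"
    show "?f i (g \<otimes>\<^bsub>\<Gamma> i\<^esub> h) = ?f i g \<otimes>\<^bsub>S\<^esub> ?f i h"
    proof -
      have eq: "\<iota> i (g \<otimes>\<^bsub>\<Gamma> i\<^esub> h) = \<iota> i g \<otimes>\<^bsub>GP\<^esub> \<iota> i h" using g h by simp
      have lc: "\<iota> i g <#\<^bsub>GP\<^esub> (\<iota> i h <#\<^bsub>GP\<^esub> sub L) = (\<iota> i g \<otimes>\<^bsub>GP\<^esub> \<iota> i h) <#\<^bsub>GP\<^esub> sub L"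
        by (rule Q.lcos_m_assoc[OF LG incl_closed[OF i g] incl_closed[OF i h]])
      show ?thesis unfolding eq using lc by (auto simp: multS push_linear)
    qed
  qed
  have comm: "?f i g \<otimes>\<^bsub>S\<^esub> ?f j h = ?f j h \<otimes>\<^bsub>S\<^esub> ?f i g"
    if ij: "i \<in> V" "j \<in> V" "adjacent K i j" and gh: "g \<in> carrier (\<Gamma> i)" "h \<in> carrier (\<Gamma> j)" for i j g h
  proof -
    have closed: "\<iota> i g \<in> carrier GP" "\<iota> j h \<in> carrier GP" using ij gh incl_closed by auto
    have ne: "i \<noteq> j" using ij by (simp add: adjacent_def)
    have c: "\<iota> i g \<otimes>\<^bsub>GP\<^esub> \<iota> j h = \<iota> j h \<otimes>\<^bsub>GP\<^esub> \<iota> i g" by (rule incl_commute[OF ij gh])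
    have one_v: "?D x = push (\<lambda>Z. y <#\<^bsub>GP\<^esub> Z) (?D x)"
      if "x \<in> carrier GP" "y \<in> sub L" "y \<otimes>\<^bsub>GP\<^esub> x = x \<otimes>\<^bsub>GP\<^esub> y" for x y
    proof -
      have y: "y \<in> carrier GP" using that LG by auto
      have "y <#\<^bsub>GP\<^esub> (x <#\<^bsub>GP\<^esub> sub L) = x <#\<^bsub>GP\<^esub> (y <#\<^bsub>GP\<^esub> sub L)"
        using Q.lcos_m_assoc[OF LG] that y by simp
      then show ?thesis using stab[OF that(2)] by (simp add: push_linear)
    qed
    have inL: "\<iota> k x \<in> sub L" if "k \<in> V" "k \<in> W" "adjacent K v k" "x \<in> carrier (\<Gamma> k)" for k x
      using that by (intro incl_sub) (auto simp: L_def)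
    show ?thesis
    proof (cases "i \<in> W \<and> j \<in> W")
      case True
      consider "i = v" | "j = v" | "i \<noteq> v" "j \<noteq> v" by blast
      then show ?thesis
      proof cases
        case 1
        then have "\<iota> j h \<in> sub L" using inL ij True gh by auto
        then show ?thesis using True 1 ne one_v[OF closed(1), of "\<iota> j h"] c by (simp add: multS)
      next
        case 2
        then have "\<iota> i g \<in> sub L" using inL[of i g] ij True gh by (auto simp: adjacent_def insert_commute)
        then show ?thesis using True 2 ne one_v[OF closed(2), of "\<iota> i g"] c by (simp add: multS)
      next
        case 3
        then show ?thesis using True c by (simp add: multS)
      qed
    next
      case False
      have act_one: "push (\<lambda>Z. \<one>\<^bsub>GP\<^esub> <#\<^bsub>GP\<^esub> Z) m = m" if "m \<in> ?M" for m
        using that by (rule push_ident) (use Q.lcos_mult_one in auto)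
      show ?thesis using False closed DM act_one by (auto simp: multS)
    qed
  qed
  obtain \<Theta> where \<Theta>: "\<Theta> \<in> hom GP S" "\<And>i g. i \<in> V \<Longrightarrow> g \<in> carrier (\<Gamma> i) \<Longrightarrow> \<Theta> (\<iota> i g) = ?f i g"
  proof (rule graph_product_universal[OF S hom comm])
    fix h assume "h \<in> hom GP S" "\<And>i g. i \<in> V \<Longrightarrow> g \<in> carrier (\<Gamma> i) \<Longrightarrow> h (\<iota> i g) = ?f i g"
    then show thesis by (rule that)
  qed
  interpret \<Theta>: group_hom GP S \<Theta>
    using \<Theta>(1) S Q.is_group by (simp add: group_hom_def group_hom_axioms_def)
  have snd: "snd (\<Theta> x) = x" if "x \<in> sub W" for x
    using that
  proof (induction rule: sub_induct)
    case (mult x y)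
    have "x \<in> carrier GP" "y \<in> carrier GP" using mult subgroup.mem_carrier[OF subgroup_sub] by auto
    then have "\<Theta> (x \<otimes>\<^bsub>GP\<^esub> y) = \<Theta> x \<otimes>\<^bsub>S\<^esub> \<Theta> y" by simp
    also have "\<dots> = (fst (\<Theta> x), snd (\<Theta> x)) \<otimes>\<^bsub>S\<^esub> (fst (\<Theta> y), snd (\<Theta> y))" by simp
    also have "snd \<dots> = x \<otimes>\<^bsub>GP\<^esub> y" unfolding multS using mult by simp
    finally show ?case .
  qed (use \<Theta>(2) \<Theta>.hom_one oneS in auto)
  show ?thesis
  proof (intro exI[of _ "\<lambda>x. fst (\<Theta> x)"] conjI ballI)
    fix x y assume xy: "x \<in> sub W" "y \<in> sub W"
    then have "\<Theta> (x \<otimes>\<^bsub>GP\<^esub> y) = \<Theta> x \<otimes>\<^bsub>S\<^esub> \<Theta> y"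
      using subgroup.mem_carrier[OF subgroup_sub] by (intro \<Theta>.hom_mult) auto
    also have "\<dots> = (fst (\<Theta> x), snd (\<Theta> x)) \<otimes>\<^bsub>S\<^esub> (fst (\<Theta> y), snd (\<Theta> y))" by simp
    also have "fst \<dots> = fst (\<Theta> x) + push (\<lambda>Z. x <#\<^bsub>GP\<^esub> Z) (fst (\<Theta> y))"
      unfolding multS using snd xy by simp
    finally show "fst (\<Theta> (x \<otimes>\<^bsub>GP\<^esub> y)) = fst (\<Theta> x) + push (\<lambda>Z. x <#\<^bsub>GP\<^esub> Z) (fst (\<Theta> y))" .
  next
    fix i g assume "i \<in> W \<inter> V" "g \<in> carrier (\<Gamma> i)"
    then show "fst (\<Theta> (\<iota> i g)) = (if i = v then gen (sub L) - gen (\<iota> i g <#\<^bsub>GP\<^esub> sub L) else 0)"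
      using \<Theta>(2)[of i g] by auto
  qed
qed

text \<open>
  Write \<open>C\<close> for \<open>sub L = A \<inter> B\<close>. The derivation takes the value \<open>0\<close> on \<open>A\<close> and \<open>[C] - [bC]\<close> at \<open>b \<in> B\<close>. So \<open>q g\<close> depends
  only on the coset \<open>gA\<close>, and \<open>q g + [gC]\<close> only on \<open>gB\<close>: they are the paths in the Bass-Serre graph from the base vertex \<open>A\<close>
  to \<open>gA\<close> and to \<open>gB\<close>. An edge is thus the difference of a function of its one end and a function of its
  other end, and a chain of edges without boundary is zero.
\<close>

lemma tree_like_sub:
  fixes \<chi> :: "_ \<Rightarrow> 'd::division_ring"
  assumes v: "v \<in> V" "v \<in> W" and tw: "twist (GP\<lparr>carrier := sub W\<rparr>) \<chi>"
  defines "L \<equiv> {w\<in>W. adjacent K v w}"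
  shows "twist.tree_like TYPE('d) (GP\<lparr>carrier := sub W\<rparr>) (sub (W - {v})) (sub (insert v L))"
proof -
  let ?A = "sub (W - {v})" and ?B = "sub (insert v L)" and ?C = "sub L"
  interpret tw: twist "GP\<lparr>carrier := sub W\<rparr>" \<chi> by (rule tw)
  have LW: "L \<subseteq> W - {v}" by (auto simp: L_def adjacent_def)
  have BW: "?B \<subseteq> sub W" "?A \<subseteq> sub W" using LW v by (auto intro!: sub_mono)
  have int: "?A \<inter> ?B = ?C"
    unfolding sub_Int using LW by (intro arg_cong[where f = sub]) auto
  obtain q :: "_ \<Rightarrow> (('i \<times> 'g) list set set set \<Rightarrow>\<^sub>0 'd)" where
    q_mult: "\<And>x y. x \<in> sub W \<Longrightarrow> y \<in> sub W \<Longrightarrow> q (x \<otimes>\<^bsub>GP\<^esub> y) = q x + push (\<lambda>Z. x <#\<^bsub>GP\<^esub> Z) (q y)"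
    and q_incl: "\<And>i g. i \<in> W \<Longrightarrow> i \<in> V \<Longrightarrow> g \<in> carrier (\<Gamma> i) \<Longrightarrow>
      q (\<iota> i g) = (if i = v then gen ?C - gen (\<iota> i g <#\<^bsub>GP\<^esub> ?C) else 0)"
    using derivation_ex[OF v(1), of W, folded L_def] by blast
  have one: "\<one>\<^bsub>GP\<^esub> \<in> sub U" for U by (rule subgroup.one_closed[OF subgroup_sub])
  have LG: "?C \<subseteq> carrier GP" by (rule subgroup.subset[OF subgroup_sub])
  have inG: "x \<in> carrier GP" if "x \<in> sub U" for x U using that subgroup.mem_carrier[OF subgroup_sub] by blast
  have q_one: "q \<one>\<^bsub>GP\<^esub> = 0"
  proof -
    have "q \<one>\<^bsub>GP\<^esub> = q (\<iota> v \<one>\<^bsub>\<Gamma> v\<^esub>)"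
      using group_hom.hom_one[OF incl_group_hom[OF v(1)]] by simp
    also have "\<dots> = gen ?C - gen (\<one>\<^bsub>GP\<^esub> <#\<^bsub>GP\<^esub> ?C)"
      using q_incl[of v "\<one>\<^bsub>\<Gamma> v\<^esub>"] v group_hom.hom_one[OF incl_group_hom[OF v(1)]]
        monoid.one_closed[OF group.is_monoid[OF family[OF v(1)]]] by simp
    finally show ?thesis using Q.lcos_mult_one[OF LG] by simp
  qed
  have q_A: "q a = 0" if "a \<in> ?A" for a
    using that
  proof (induction rule: sub_induct)
    case (mult x y)
    then show ?case using q_mult[of x y] BW by auto
  qed (use q_one q_incl in auto)
  have q_B: "q b = gen ?C - gen (b <#\<^bsub>GP\<^esub> ?C)" if "b \<in> ?B" for b
    using that
  proof (induction rule: sub_induct)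
    case one
    then show ?case using q_one Q.lcos_mult_one[OF LG] by simp
  next
    case (gen i g)
    show ?case
    proof (cases "i = v")
      case True
      then show ?thesis using q_incl gen v by simp
    next
      case False
      then have "i \<in> L" using gen by simp
      then have iC: "\<iota> i g \<in> ?C" using incl_sub gen by blast
      have "\<iota> i g <#\<^bsub>GP\<^esub> ?C = ?C" using iC inG[OF iC] subgroup_sub by (intro Q.coset_join3) auto
      then show ?thesis using q_incl[of i g] gen False \<open>i \<in> L\<close> LW by auto
    qed
  next
    case (mult x y)
    have "x \<in> sub W" "y \<in> sub W" using mult BW by auto
    then have "q (x \<otimes>\<^bsub>GP\<^esub> y) = q x + push (\<lambda>Z. x <#\<^bsub>GP\<^esub> Z) (q y)" by (rule q_mult)
    then show ?case using mult Q.lcos_m_assoc[OF LG inG[OF mult(1)] inG[OF mult(2)]]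
      by (simp add: push_linear)
  qed
  have cos: "x <#\<^bsub>GP\<lparr>carrier := sub W\<rparr>\<^esub> H = x <#\<^bsub>GP\<^esub> H" for x H by (simp add: l_coset_def)
  define qA where "qA = (\<lambda>Z. q (SOME y. y \<in> Z))"
  define qB where "qB = (\<lambda>Z. q (SOME y. y \<in> Z) + gen ((SOME y. y \<in> Z) <#\<^bsub>GP\<^esub> ?C))"
  have some: "\<exists>h\<in>H. (SOME y. y \<in> x <#\<^bsub>GP\<^esub> H) = x \<otimes>\<^bsub>GP\<^esub> h" if "\<one>\<^bsub>GP\<^esub> \<in> H" for x H
  proof -
    have "x \<otimes>\<^bsub>GP\<^esub> \<one>\<^bsub>GP\<^esub> \<in> x <#\<^bsub>GP\<^esub> H" using that by (auto simp: l_coset_def)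
    then have "(SOME y. y \<in> x <#\<^bsub>GP\<^esub> H) \<in> x <#\<^bsub>GP\<^esub> H" by (rule someI)
    then show ?thesis by (auto simp: l_coset_def)
  qed
  have qA: "qA (x <#\<^bsub>GP\<^esub> ?A) = q x" if x: "x \<in> sub W" for x
  proof -
    obtain a where a: "a \<in> ?A" "(SOME y. y \<in> x <#\<^bsub>GP\<^esub> ?A) = x \<otimes>\<^bsub>GP\<^esub> a" using some[OF one] by blast
    then show ?thesis using q_mult[OF x subsetD[OF BW(2) a(1)]] q_A[OF a(1)] by (simp add: qA_def)
  qed
  have qB: "qB (x <#\<^bsub>GP\<^esub> ?B) = q x + gen (x <#\<^bsub>GP\<^esub> ?C)" if x: "x \<in> sub W" for x
  proof -
    obtain b where b: "b \<in> ?B" "(SOME y. y \<in> x <#\<^bsub>GP\<^esub> ?B) = x \<otimes>\<^bsub>GP\<^esub> b" using some[OF one] by blast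
    have "q (x \<otimes>\<^bsub>GP\<^esub> b) = q x + push (\<lambda>Z. x <#\<^bsub>GP\<^esub> Z) (gen ?C - gen (b <#\<^bsub>GP\<^esub> ?C))"
      using q_mult[OF x, of b] q_B[OF b(1)] subsetD[OF BW(1) b(1)] by simp
    then show ?thesis using Q.lcos_m_assoc[OF LG inG[OF x] inG[OF b(1)]]
      by (simp add: qB_def b(2) push_linear)
  qed
  show ?thesis
    unfolding tw.tree_like_def
  proof (intro ballI impI)
    fix e assume e: "e \<in> (supported (carrier (GP\<lparr>carrier := sub W\<rparr>)) :: (_ \<Rightarrow>\<^sub>0 'd) set)"
      "push (\<lambda>x. x <#\<^bsub>GP\<lparr>carrier := sub W\<rparr>\<^esub> ?A) e = 0" "push (\<lambda>x. x <#\<^bsub>GP\<lparr>carrier := sub W\<rparr>\<^esub> ?B) e = 0"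
    have eW: "e \<in> supported (sub W)" using e(1) by simp
    have "push (\<lambda>x. x <#\<^bsub>GP\<^esub> ?C) e = lin_extend (\<lambda>x. qB (x <#\<^bsub>GP\<^esub> ?B) - qA (x <#\<^bsub>GP\<^esub> ?A)) e"
      unfolding push_def using eW by (rule lin_extend_cong_supported) (simp add: qA qB)
    also have "\<dots> = lin_extend qB (push (\<lambda>x. x <#\<^bsub>GP\<^esub> ?B) e) - lin_extend qA (push (\<lambda>x. x <#\<^bsub>GP\<^esub> ?A) e)"
      by (simp only: lin_extend_push lin_extend_fun_diff)
    also have "\<dots> = 0" using e(2,3) by (simp add: cos)
    finally show "push (\<lambda>x. x <#\<^bsub>GP\<lparr>carrier := sub W\<rparr>\<^esub> (?A \<inter> ?B)) e = 0" by (simp add: cos int)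
  qed
qed

end

section \<open>Subquotients of free spaces\<close>

text \<open>
  More unknowns than equations, over a skew field. Coefficients stand on the right of the unknowns, matching left vector
  spaces.
\<close>

lemma homogeneous_system:
  fixes m :: "'j \<Rightarrow> 'i \<Rightarrow> 'd::division_ring"
  assumes "finite I" "finite J" "card I < card J"
  shows "\<exists>c. (\<exists>j\<in>J. c j \<noteq> 0) \<and> (\<forall>i\<in>I. (\<Sum>j\<in>J. c j * m j i) = 0)"
  using assms
proof (induction I arbitrary: J m rule: finite_induct)
  case empty
  then obtain j where "j \<in> J" by (metis card_gt_0_iff card.empty ex_in_conv)
  then show ?case by (intro exI[of _ "\<lambda>_. 1"]) auto
next
  case (insert i I)
  show ?case
  proof (cases "\<forall>j\<in>J. m j i = 0")
    case True
    have "card I < card J" using insert by simp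
    then obtain c where "\<exists>j\<in>J. c j \<noteq> 0" "\<forall>i\<in>I. (\<Sum>j\<in>J. c j * m j i) = 0"
      using insert.IH[OF insert.prems(1), of m] by blast
    then show ?thesis using True by (intro exI[of _ c]) auto
  next
    case False
    then obtain k where k: "k \<in> J" "m k i \<noteq> 0" by blast
    let ?J = "J - {k}"
    define m' where "m' = (\<lambda>j l. m j l - m j i * inverse (m k i) * m k l)"
    have "card I < card ?J" using insert k by simp
    then obtain c where c: "\<exists>j\<in>?J. c j \<noteq> 0" "\<forall>l\<in>I. (\<Sum>j\<in>?J. c j * m' j l) = 0"
      using insert.IH[of ?J m'] insert.prems(1) by blast
    define s where "s = - (\<Sum>j\<in>?J. c j * m j i) * inverse (m k i)"
    have sum: "(\<Sum>j\<in>J. (c(k := s)) j * m j l) = s * m k l + (\<Sum>j\<in>?J. c j * m j l)" for l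
      using k insert by (subst sum.remove[OF _ k(1)]) (auto intro!: sum.cong)
    have "(\<Sum>j\<in>?J. c j * m' j l) = s * m k l + (\<Sum>j\<in>?J. c j * m j l)" for l
      by (simp add: m'_def s_def algebra_simps sum_subtractf sum_distrib_right sum_negf mult.assoc)
    moreover have "s * m k i + (\<Sum>j\<in>?J. c j * m j i) = 0"
      using k by (simp add: s_def mult.assoc)
    ultimately show ?thesis using c sum
      by (intro exI[of _ "c(k := s)"]) (auto intro!: bexI)
  qed
qed

text \<open>
  Homology spaces, as cycles modulo boundaries inside a free space. Working with representatives avoids sums in the
  quotient.
\<close>

locale subquotient =
  fixes Z B :: "('x \<Rightarrow>\<^sub>0 'd::division_ring) set"
  assumes Z_add: "\<And>x y. x \<in> Z \<Longrightarrow> y \<in> Z \<Longrightarrow> x + y \<in> Z" and Z_smul: "\<And>a x. x \<in> Z \<Longrightarrow> smul a x \<in> Z"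
    and B_add: "\<And>x y. x \<in> B \<Longrightarrow> y \<in> B \<Longrightarrow> x + y \<in> B" and B_smul: "\<And>a x. x \<in> B \<Longrightarrow> smul a x \<in> B"
    and B_zero: "0 \<in> B" and B_Z: "B \<subseteq> Z"
begin

definition ambient :: "('d, 'x \<Rightarrow>\<^sub>0 'd) module" where
  "ambient = \<lparr> carrier = Z, monoid.mult = undefined, one = undefined,
      ring.zero = 0, add = (+), module.smult = smul \<rparr>"

definition Q :: "('d, ('x \<Rightarrow>\<^sub>0 'd) set) module" where
  "Q = quot_space ambient B"

definition cl :: "('x \<Rightarrow>\<^sub>0 'd) \<Rightarrow> ('x \<Rightarrow>\<^sub>0 'd) set" where
  "cl z = (\<lambda>b. b + z) ` B"

lemma Z_zero: "0 \<in> Z" using B_zero B_Z by auto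
lemma Z_diff: "x \<in> Z \<Longrightarrow> y \<in> Z \<Longrightarrow> x - y \<in> Z" using Z_add[of x "- y"] Z_smul[of y "- 1"] by simp
lemma B_uminus: "x \<in> B \<Longrightarrow> - x \<in> B" using B_smul[of x "- 1"] by simp
lemma B_diff: "x \<in> B \<Longrightarrow> y \<in> B \<Longrightarrow> x - y \<in> B" using B_add[of x "- y"] B_uminus[of y] by simp
lemma Z_sum: "(\<And>i. i \<in> A \<Longrightarrow> f i \<in> Z) \<Longrightarrow> (\<Sum>i\<in>A. f i) \<in> Z"
  by (induction A rule: infinite_finite_induct) (auto simp: Z_zero Z_add)
lemma B_sum: "(\<And>i. i \<in> A \<Longrightarrow> f i \<in> B) \<Longrightarrow> (\<Sum>i\<in>A. f i) \<in> B"
  by (induction A rule: infinite_finite_induct) (auto simp: B_zero B_add)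

lemma mem_cl: "x \<in> cl z \<longleftrightarrow> x - z \<in> B"
proof
  assume "x - z \<in> B"
  then have "(x - z) + z \<in> cl z" unfolding cl_def by (rule imageI)
  then show "x \<in> cl z" by simp
qed (auto simp: cl_def)

lemma cl_eq_iff: "cl x = cl y \<longleftrightarrow> x - y \<in> B"
proof
  assume "cl x = cl y"
  moreover have "x \<in> cl x" by (simp add: mem_cl B_zero)
  ultimately show "x - y \<in> B" by (simp add: mem_cl)
next
  assume xy: "x - y \<in> B"
  have "z - x \<in> B \<longleftrightarrow> z - y \<in> B" for z
  proof
    assume "z - x \<in> B"
    then have "(z - x) + (x - y) \<in> B" using xy by (rule B_add)
    then show "z - y \<in> B" by simp
  next
    assume "z - y \<in> B"
    then have "(z - y) - (x - y) \<in> B" using xy by (rule B_diff)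
    then show "z - x \<in> B" by simp
  qed
  then show "cl x = cl y" by (auto simp: mem_cl)
qed

lemma coset_cl: "B +>\<^bsub>ambient\<^esub> z = cl z"
  by (auto simp: a_r_coset_def r_coset_def ambient_def cl_def)

lemma carrier_Q: "carrier Q = cl ` Z"
  unfolding Q_def quot_space_def A_RCOSETS_def RCOSETS_def
  by (simp add: coset_cl[unfolded a_r_coset_def]) (auto simp: ambient_def)

lemma zero_Q: "\<zero>\<^bsub>Q\<^esub> = cl 0"
  by (simp add: Q_def quot_space_def cl_def)

lemma add_Q: "cl x \<oplus>\<^bsub>Q\<^esub> cl y = cl (x + y)"
proof -
  have "cl x \<oplus>\<^bsub>Q\<^esub> cl y = (\<Union>p\<in>cl x. \<Union>q\<in>cl y. {p + q})"
    by (simp add: Q_def quot_space_def set_add_def set_mult_def ambient_def)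
  also have "\<dots> = cl (x + y)"
  proof (rule subset_antisym; rule subsetI)
    fix z assume "z \<in> (\<Union>p\<in>cl x. \<Union>q\<in>cl y. {p + q})"
    then obtain p q where "p - x \<in> B" "q - y \<in> B" "z = p + q" by (auto simp: mem_cl)
    moreover have "(p - x) + (q - y) \<in> B" using \<open>p - x \<in> B\<close> \<open>q - y \<in> B\<close> by (rule B_add)
    ultimately show "z \<in> cl (x + y)" by (simp add: mem_cl algebra_simps)
  next
    fix z assume "z \<in> cl (x + y)"
    then have "z - y \<in> cl x" by (simp add: mem_cl algebra_simps)
    moreover have "y \<in> cl y" by (simp add: mem_cl B_zero)
    moreover have "z = (z - y) + y" by simp
    ultimately show "z \<in> (\<Union>p\<in>cl x. \<Union>q\<in>cl y. {p + q})" by blast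
  qed
  finally show ?thesis .
qed

lemma smult_Q: "a \<odot>\<^bsub>Q\<^esub> cl x = cl (smul a x)"
proof -
  have "a \<odot>\<^bsub>Q\<^esub> cl x = (\<Union>p\<in>cl x. cl (smul a p))"
    by (simp add: Q_def quot_space_def coset_cl) (simp add: ambient_def)
  moreover have "cl (smul a p) = cl (smul a x)" if "p \<in> cl x" for p
    using that B_smul[of "p - x" a] by (simp add: mem_cl cl_eq_iff smul_distribs)
  moreover have "x \<in> cl x" by (simp add: mem_cl B_zero)
  ultimately show ?thesis by blast
qed

lemma abelian_monoid_Q: "abelian_monoid Q"
  by (rule abelian_monoidI) (use Z_add Z_zero in \<open>auto simp: carrier_Q zero_Q add_Q simp: ac_simps\<close>)

lemma finsum_Q:
  assumes "finite A" "\<And>i. i \<in> A \<Longrightarrow> r i \<in> Z"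
  shows "(\<Oplus>\<^bsub>Q\<^esub>i\<in>A. a i \<odot>\<^bsub>Q\<^esub> cl (r i)) = cl (\<Sum>i\<in>A. smul (a i) (r i))"
proof -
  interpret abelian_monoid Q by (rule abelian_monoid_Q)
  show ?thesis using assms
  proof (induction A rule: finite_induct)
    case empty
    then show ?case by (simp add: zero_Q)
  next
    case (insert j A)
    then show ?case
      by (subst finsum_insert) (auto simp: smult_Q carrier_Q Z_smul add_Q)
  qed
qed

definition basis_family :: "'i set \<Rightarrow> ('i \<Rightarrow> ('x \<Rightarrow>\<^sub>0 'd)) \<Rightarrow> bool" where
  "basis_family I r \<longleftrightarrow> finite I \<and> (\<forall>i\<in>I. r i \<in> Z) \<and>
    (\<forall>a. (\<Sum>i\<in>I. smul (a i) (r i)) \<in> B \<longrightarrow> (\<forall>i\<in>I. a i = 0)) \<and>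
    (\<forall>z\<in>Z. \<exists>a. z - (\<Sum>i\<in>I. smul (a i) (r i)) \<in> B)"

lemma independent_card_le:
  assumes J: "finite J" "\<And>a. (\<Sum>j\<in>J. smul (a j) (s j)) \<in> B \<Longrightarrow> \<forall>j\<in>J. a j = 0"
    and I: "finite I" "\<And>j. j \<in> J \<Longrightarrow> \<exists>a. s j - (\<Sum>i\<in>I. smul (a i) (r i)) \<in> B"
  shows "card J \<le> card I"
proof (rule ccontr)
  assume "\<not> card J \<le> card I"
  then have less: "card I < card J" by simp
  obtain m where m: "\<And>j. j \<in> J \<Longrightarrow> s j - (\<Sum>i\<in>I. smul (m j i) (r i)) \<in> B" using I(2) by metis
  obtain c where c: "\<exists>j\<in>J. c j \<noteq> 0" "\<forall>i\<in>I. (\<Sum>j\<in>J. c j * m j i) = 0"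
    using homogeneous_system[OF I(1) J(1) less, of m] by blast
  have smul_sum_left: "(\<Sum>j\<in>J. smul (f j) x) = smul (\<Sum>j\<in>J. f j) x" for f and x :: "'x \<Rightarrow>\<^sub>0 'd"
    by (rule poly_mapping_eqI) (simp add: lookup_sum sum_distrib_right)
  have "(\<Sum>j\<in>J. smul (c j) (s j - (\<Sum>i\<in>I. smul (m j i) (r i)))) \<in> B"
    using m by (intro B_sum B_smul)
  also have "(\<Sum>j\<in>J. smul (c j) (s j - (\<Sum>i\<in>I. smul (m j i) (r i))))
    = (\<Sum>j\<in>J. smul (c j) (s j)) - (\<Sum>i\<in>I. \<Sum>j\<in>J. smul (c j * m j i) (r i))"
    by (simp add: smul_distribs smul_sum sum_subtractf sum.swap[of _ J I])
  also have "(\<Sum>i\<in>I. \<Sum>j\<in>J. smul (c j * m j i) (r i)) = 0"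
  proof (rule sum.neutral, rule ballI)
    fix i assume "i \<in> I"
    then show "(\<Sum>j\<in>J. smul (c j * m j i) (r i)) = 0"
      unfolding smul_sum_left using c(2) by simp
  qed
  finally have "\<forall>j\<in>J. c j = 0" using J(2) by simp
  then show False using c(1) by blast
qed

lemma basis_family_card:
  assumes "basis_family I r" "basis_family J s"
  shows "card I = card J"
  using independent_card_le[of J s I r] independent_card_le[of I r J s] assms
  by (intro antisym) (auto simp: basis_family_def)

lemma vs_basis_if_family:
  assumes r: "basis_family I r"
  shows "vs_basis Q ((\<lambda>i. cl (r i)) ` I)" "card ((\<lambda>i. cl (r i)) ` I) = card I" "finite ((\<lambda>i. cl (r i)) ` I)"
proof -
  have fin: "finite I" and rZ: "\<And>i. i \<in> I \<Longrightarrow> r i \<in> Z"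
    and ind: "\<And>a. (\<Sum>i\<in>I. smul (a i) (r i)) \<in> B \<Longrightarrow> \<forall>i\<in>I. a i = 0"
    and span: "\<And>z. z \<in> Z \<Longrightarrow> \<exists>a. z - (\<Sum>i\<in>I. smul (a i) (r i)) \<in> B"
    using r by (auto simp: basis_family_def)
  let ?c = "\<lambda>i. cl (r i)"
  have inj: "inj_on ?c I"
  proof (rule inj_onI, rule ccontr)
    fix i j assume ij: "i \<in> I" "j \<in> I" "?c i = ?c j" "i \<noteq> j"
    let ?a = "\<lambda>k. if k = i then 1 else if k = j then - 1 else (0 :: 'd)"
    have "(\<Sum>k\<in>I. smul (?a k) (r k)) = (\<Sum>k\<in>{i, j}. smul (?a k) (r k))"
      using ij fin by (intro sum.mono_neutral_right) auto
    also have "\<dots> = r i - r j" using ij(4) by simp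
    finally have "(\<Sum>k\<in>I. smul (?a k) (r k)) \<in> B" using ij(3) by (simp add: cl_eq_iff)
    then have "?a i = 0" using ind[of ?a] ij(1) by blast
    then show False by simp
  qed
  show "card (?c ` I) = card I" using inj by (rule card_image)
  show "finite (?c ` I)" using fin by simp
  have sum_image: "(\<Oplus>\<^bsub>Q\<^esub>b\<in>?c ` A. d b \<odot>\<^bsub>Q\<^esub> b) = cl (\<Sum>i\<in>A. smul (d (?c i)) (r i))" if A: "A \<subseteq> I" for A d
  proof -
    interpret abelian_monoid Q by (rule abelian_monoid_Q)
    have "(\<Oplus>\<^bsub>Q\<^esub>b\<in>?c ` A. d b \<odot>\<^bsub>Q\<^esub> b) = (\<Oplus>\<^bsub>Q\<^esub>i\<in>A. d (?c i) \<odot>\<^bsub>Q\<^esub> ?c i)"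
      using A rZ inj by (intro finsum_reindex) (auto simp: smult_Q carrier_Q Z_smul inj_on_subset)
    also have "\<dots> = cl (\<Sum>i\<in>A. smul (d (?c i)) (r i))"
      using A rZ fin by (intro finsum_Q[of A r "\<lambda>i. d (?c i)"]) (auto intro: finite_subset)
    finally show ?thesis .
  qed
  show "vs_basis Q (?c ` I)"
    unfolding vs_basis_def
  proof (intro conjI allI impI ballI)
    show "?c ` I \<subseteq> carrier Q" using rZ by (auto simp: carrier_Q)
    fix A d b assume "finite A \<and> A \<subseteq> ?c ` I \<and> (\<Oplus>\<^bsub>Q\<^esub> b\<in>A. d b \<odot>\<^bsub>Q\<^esub> b) = \<zero>\<^bsub>Q\<^esub>" and b: "b \<in> A"
    then have A: "A \<subseteq> ?c ` I" "(\<Oplus>\<^bsub>Q\<^esub> b\<in>A. d b \<odot>\<^bsub>Q\<^esub> b) = \<zero>\<^bsub>Q\<^esub>" by blast+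
    from A(1) have "\<exists>A'. A' \<subseteq> I \<and> A = ?c ` A'" unfolding subset_image_iff .
    then obtain A' where A': "A' \<subseteq> I" "A = ?c ` A'" "(\<Oplus>\<^bsub>Q\<^esub> b\<in>A. d b \<odot>\<^bsub>Q\<^esub> b) = \<zero>\<^bsub>Q\<^esub>"
      using A(2) by blast
    let ?a = "\<lambda>i. if i \<in> A' then d (?c i) else 0"
    have "cl (\<Sum>i\<in>A'. smul (d (?c i)) (r i)) = cl 0"
      using A'(3) unfolding A'(2) sum_image[OF A'(1)] by (simp add: zero_Q)
    then have "(\<Sum>i\<in>A'. smul (d (?c i)) (r i)) \<in> B" by (simp add: cl_eq_iff)
    also have "(\<Sum>i\<in>A'. smul (d (?c i)) (r i)) = (\<Sum>i\<in>I. smul (?a i) (r i))"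
      using A'(1) fin by (intro sum.mono_neutral_cong_left) auto
    finally have "\<forall>i\<in>I. ?a i = 0" by (rule ind)
    then show "d b = 0" using b A' by force
  next
    fix x assume "x \<in> carrier Q"
    then obtain z where z: "z \<in> Z" "x = cl z" by (auto simp: carrier_Q)
    then obtain a where a: "z - (\<Sum>i\<in>I. smul (a i) (r i)) \<in> B" using span by blast
    let ?d = "\<lambda>b. a (inv_into I ?c b)"
    have "(\<Oplus>\<^bsub>Q\<^esub> b\<in>?c ` I. ?d b \<odot>\<^bsub>Q\<^esub> b) = cl (\<Sum>i\<in>I. smul (a i) (r i))"
      using inv_into_f_f[OF inj] by (subst sum_image) (auto intro!: arg_cong[where f = cl] sum.cong)
    also have "\<dots> = x" using a B_uminus[OF a] by (simp add: z(2) cl_eq_iff)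
    finally show "\<exists>A c. finite A \<and> A \<subseteq> ?c ` I \<and> x = (\<Oplus>\<^bsub>Q\<^esub> b\<in>A. c b \<odot>\<^bsub>Q\<^esub> b)"
      using fin by (intro exI[of _ "?c ` I"] exI[of _ ?d]) auto
  qed
qed

lemma family_if_vs_basis:
  assumes \<beta>: "vs_basis Q \<beta>" "finite \<beta>"
  shows "basis_family \<beta> (\<lambda>P. SOME z. z \<in> Z \<and> cl z = P)"
proof -
  define r where "r = (\<lambda>P. SOME z. z \<in> Z \<and> cl z = P)"
  have "\<exists>z. z \<in> Z \<and> cl z = P" if "P \<in> \<beta>" for P
    using that \<beta> by (auto simp: vs_basis_def carrier_Q)
  then have r: "r P \<in> Z" "cl (r P) = P" if "P \<in> \<beta>" for P
    using that someI_ex[of "\<lambda>z. z \<in> Z \<and> cl z = P"] unfolding r_def by blast+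
  interpret abelian_monoid Q by (rule abelian_monoid_Q)
  have sum: "(\<Oplus>\<^bsub>Q\<^esub> b\<in>A. a b \<odot>\<^bsub>Q\<^esub> b) = cl (\<Sum>b\<in>A. smul (a b) (r b))" if A: "A \<subseteq> \<beta>" for A a
  proof -
    have "(\<Oplus>\<^bsub>Q\<^esub> b\<in>A. a b \<odot>\<^bsub>Q\<^esub> b) = (\<Oplus>\<^bsub>Q\<^esub> b\<in>A. a b \<odot>\<^bsub>Q\<^esub> cl (r b))"
      using A r by (intro finsum_cong') (auto simp: smult_Q carrier_Q Z_smul subset_iff)
    also have "\<dots> = cl (\<Sum>b\<in>A. smul (a b) (r b))"
      using A r \<beta>(2) by (intro finsum_Q) (auto intro: finite_subset)
    finally show ?thesis .
  qed
  have ind: "\<forall>b\<in>\<beta>. a b = 0" if "(\<Sum>b\<in>\<beta>. smul (a b) (r b)) \<in> B" for a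
  proof -
    have "(\<Oplus>\<^bsub>Q\<^esub> b\<in>\<beta>. a b \<odot>\<^bsub>Q\<^esub> b) = \<zero>\<^bsub>Q\<^esub>"
      using that by (simp add: sum zero_Q cl_eq_iff)
    then have "finite \<beta> \<and> \<beta> \<subseteq> \<beta> \<and> (\<Oplus>\<^bsub>Q\<^esub> b\<in>\<beta>. a b \<odot>\<^bsub>Q\<^esub> b) = \<zero>\<^bsub>Q\<^esub>" using \<beta>(2) by simp
    moreover have "\<forall>A c. finite A \<and> A \<subseteq> \<beta> \<and> (\<Oplus>\<^bsub>Q\<^esub> b\<in>A. c b \<odot>\<^bsub>Q\<^esub> b) = \<zero>\<^bsub>Q\<^esub> \<longrightarrow> (\<forall>b\<in>A. c b = 0)"
      using \<beta>(1) unfolding vs_basis_def by (elim conjE)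
    ultimately show ?thesis by (elim allE[of _ \<beta>] allE[of _ a] mp)
  qed
  have span: "\<exists>a. z - (\<Sum>b\<in>\<beta>. smul (a b) (r b)) \<in> B" if z: "z \<in> Z" for z
  proof -
    have "cl z \<in> carrier Q" using z by (simp add: carrier_Q)
    then obtain A c where A: "finite A" "A \<subseteq> \<beta>" "cl z = (\<Oplus>\<^bsub>Q\<^esub> b\<in>A. c b \<odot>\<^bsub>Q\<^esub> b)"
      using conjunct2[OF conjunct2[OF \<beta>(1)[unfolded vs_basis_def]]] by (elim ballE exE conjE) auto
    then have "z - (\<Sum>b\<in>A. smul (c b) (r b)) \<in> B" by (simp add: sum cl_eq_iff)
    also have "(\<Sum>b\<in>A. smul (c b) (r b)) = (\<Sum>b\<in>\<beta>. smul (if b \<in> A then c b else 0) (r b))"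
      using A(2) \<beta>(2) by (intro sum.mono_neutral_cong_left) auto
    finally show ?thesis by (rule exI[of _ "\<lambda>b. if b \<in> A then c b else 0"])
  qed
  show ?thesis using \<beta>(2) r ind span unfolding basis_family_def r_def[symmetric] by blast
qed

text \<open>
  The dimension refers to an arbitrarily chosen finite basis of the quotient; lifting that basis to \<open>Z\<close> makes it
  comparable with the given family.
\<close>

lemma vs_dim_Q:
  assumes r: "basis_family I r"
  shows "vs_dim Q = enat (card I)"
proof -
  let ?P = "\<lambda>\<beta>. finite \<beta> \<and> vs_basis Q \<beta>"
  have ex: "\<exists>\<beta>. ?P \<beta>" using vs_basis_if_family[OF r] by blast
  then have "?P (SOME \<beta>. ?P \<beta>)" by (rule someI_ex)
  then have "card (SOME \<beta>. ?P \<beta>) = card I"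
    using basis_family_card[OF family_if_vs_basis r] by blast
  then show ?thesis using ex by (simp add: vs_dim_def)
qed

text \<open>
  The size of an independent family is bounded by the rank of the ambient free space, so there is a largest
  one, and it spans.
\<close>

lemma basis_family_ex:
  assumes S: "finite S" "Z \<subseteq> supported S"
  shows "\<exists>R. basis_family R (\<lambda>z. z)"
proof -
  let ?ind = "\<lambda>R. finite R \<and> R \<subseteq> Z \<and> (\<forall>a. (\<Sum>z\<in>R. smul (a z) z) \<in> B \<longrightarrow> (\<forall>z\<in>R. a z = 0))"
  have bound: "card R \<le> card S" if R: "?ind R" for R
  proof (rule independent_card_le[of R "\<lambda>z. z" S gen])
    fix z assume "z \<in> R"
    then have "z \<in> supported S" using R S by auto
    then have "z = (\<Sum>x\<in>S. smul (Poly_Mapping.lookup z x) (gen x))"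
      using lin_extend_superset[OF S(1), of z gen] by (simp add: supported_def lin_extend_gen)
    then have "z - (\<Sum>x\<in>S. smul (Poly_Mapping.lookup z x) (gen x)) = 0" by (rule eq_iff_diff_eq_0[THEN iffD1])
    then have "z - (\<Sum>x\<in>S. smul (Poly_Mapping.lookup z x) (gen x)) \<in> B" by (simp only: B_zero)
    then show "\<exists>a. z - (\<Sum>x\<in>S. smul (a x) (gen x)) \<in> B" by (rule exI[of _ "Poly_Mapping.lookup z"])
  next
    show "finite R" "finite S" using R S by simp_all
    show "\<forall>z\<in>R. a z = 0" if "(\<Sum>z\<in>R. smul (a z) z) \<in> B" for a using R that by blast
  qed
  have "?ind {}" by simp
  moreover have "\<forall>R. ?ind R \<longrightarrow> card R < Suc (card S)"
  proof (intro allI impI)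
    fix R assume "?ind R"
    then have "card R \<le> card S" by (rule bound)
    then show "card R < Suc (card S)" by simp
  qed
  ultimately have "\<exists>R. ?ind R \<and> (\<forall>R'. ?ind R' \<longrightarrow> card R' \<le> card R)"
    by (rule Lattices_Big.ex_has_greatest_nat[of ?ind "{}" card "Suc (card S)"])
  then obtain R where R: "?ind R" "\<And>R'. ?ind R' \<Longrightarrow> card R' \<le> card R" by blast
  have "\<exists>a. z - (\<Sum>x\<in>R. smul (a x) x) \<in> B" if z: "z \<in> Z" for z
  proof (rule ccontr)
    assume no: "\<not> (\<exists>a. z - (\<Sum>x\<in>R. smul (a x) x) \<in> B)"
    have zR: "z \<notin> R"
    proof
      assume zR: "z \<in> R"
      have "(\<Sum>x\<in>R. smul (if x = z then 1 else 0) x) = (\<Sum>x\<in>{z}. smul (if x = z then 1 else (0::'d)) x)"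
        using zR R(1) by (intro sum.mono_neutral_right) auto
      then have "z - (\<Sum>x\<in>R. smul (if x = z then 1 else 0) x) = 0" by simp
      then have "z - (\<Sum>x\<in>R. smul (if x = z then 1 else 0) x) \<in> B" by (simp only: B_zero)
      then have "\<exists>a. z - (\<Sum>x\<in>R. smul (a x) x) \<in> B" by (rule exI[of _ "\<lambda>x. if x = z then 1 else 0"])
      then show False using no by (rule notE[rotated])
    qed
    have "?ind (insert z R)"
    proof (intro conjI allI impI)
      show "finite (insert z R)" "insert z R \<subseteq> Z" using R z by auto
      fix a assume a: "(\<Sum>x\<in>insert z R. smul (a x) x) \<in> B"
      then have a': "smul (a z) z + (\<Sum>x\<in>R. smul (a x) x) \<in> B" using R zR by simp
      have "a z = 0"
      proof (rule ccontr)
        assume nz: "a z \<noteq> 0"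
        have "smul (inverse (a z)) (smul (a z) z + (\<Sum>x\<in>R. smul (a x) x)) \<in> B" using a' by (rule B_smul)
        also have "smul (inverse (a z)) (smul (a z) z + (\<Sum>x\<in>R. smul (a x) x))
          = z - (\<Sum>x\<in>R. smul (- (inverse (a z) * a x)) x)"
          using nz by (simp add: smul_distribs smul_sum smul_uminus sum_negf)
        finally have "\<exists>a. z - (\<Sum>x\<in>R. smul (a x) x) \<in> B" by (rule exI[of _ "\<lambda>x. - (inverse (a z) * a x)"])
        then show False using no by (rule notE[rotated])
      qed
      moreover from this have "(\<Sum>x\<in>R. smul (a x) x) \<in> B" using a' by simp
      ultimately show "\<forall>x\<in>insert z R. a x = 0" using R(1) by blast
    qed
    then have "card (insert z R) \<le> card R" by (rule R(2))
    then show False using zR R(1) by simp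
  qed
  then show ?thesis using R(1) unfolding basis_family_def by blast
qed

end

text \<open>
  A linear map that induces an isomorphism of subquotients, again in terms of representatives.
\<close>

locale subquotient_map = A: subquotient Z B + A': subquotient Z' B'
  for Z B :: "('x \<Rightarrow>\<^sub>0 'd::division_ring) set" and Z' B' :: "('y \<Rightarrow>\<^sub>0 'd) set" +
  fixes f :: "'x \<Rightarrow> ('y \<Rightarrow>\<^sub>0 'd)"
  assumes f_Z: "\<And>z. z \<in> Z \<Longrightarrow> lin_extend f z \<in> Z'" and f_B: "\<And>z. z \<in> B \<Longrightarrow> lin_extend f z \<in> B'"
    and f_inj: "\<And>z. z \<in> Z \<Longrightarrow> lin_extend f z \<in> B' \<Longrightarrow> z \<in> B"
    and f_surj: "\<And>z'. z' \<in> Z' \<Longrightarrow> \<exists>z\<in>Z. z' - lin_extend f z \<in> B'"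
begin

lemma vs_iso_Q: "vs_iso A'.Q A.Q"
proof -
  define k where "k = (\<lambda>P. SOME z. z \<in> Z \<and> A'.cl (lin_extend f z) = P)"
  have k: "k P \<in> Z" "A'.cl (lin_extend f (k P)) = P" if Pc: "P \<in> carrier A'.Q" for P
  proof -
    obtain z' where z': "z' \<in> Z'" "P = A'.cl z'" using Pc by (auto simp: A'.carrier_Q)
    obtain z where "z \<in> Z" "z' - lin_extend f z \<in> B'" using f_surj[OF z'(1)] by blast
    then have "z \<in> Z \<and> A'.cl (lin_extend f z) = P" using A'.cl_eq_iff z'(2) by metis
    then have "k P \<in> Z \<and> A'.cl (lin_extend f (k P)) = P" unfolding k_def by (rule someI)
    then show "k P \<in> Z" "A'.cl (lin_extend f (k P)) = P" by auto
  qed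
  have eq: "A.cl x = A.cl y \<longleftrightarrow> A'.cl (lin_extend f x) = A'.cl (lin_extend f y)" if "x \<in> Z" "y \<in> Z" for x y
    using that f_inj[OF A.Z_diff[OF that]] f_B[of "x - y"]
    by (auto simp: A.cl_eq_iff A'.cl_eq_iff lin_extend_diff)
  have closed: "P \<oplus>\<^bsub>A'.Q\<^esub> R \<in> carrier A'.Q" "a \<odot>\<^bsub>A'.Q\<^esub> P \<in> carrier A'.Q"
    if "P \<in> carrier A'.Q" "R \<in> carrier A'.Q" for P R a
    using that by (auto simp: A'.carrier_Q A'.add_Q A'.smult_Q A'.Z_add A'.Z_smul)
  show ?thesis
    unfolding vs_iso_def
  proof (intro exI[of _ "\<lambda>P. A.cl (k P)"] conjI ballI allI)
    show "bij_betw (\<lambda>P. A.cl (k P)) (carrier A'.Q) (carrier A.Q)"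
      unfolding bij_betw_def
    proof
      show "inj_on (\<lambda>P. A.cl (k P)) (carrier A'.Q)"
        by (rule inj_onI) (metis eq k)
      show "(\<lambda>P. A.cl (k P)) ` carrier A'.Q = carrier A.Q"
      proof (rule subset_antisym; rule subsetI)
        fix P assume "P \<in> (\<lambda>P. A.cl (k P)) ` carrier A'.Q"
        then show "P \<in> carrier A.Q" using k by (auto simp: A.carrier_Q)
      next
        fix P assume "P \<in> carrier A.Q"
        then obtain z where z: "z \<in> Z" "P = A.cl z" by (auto simp: A.carrier_Q)
        have c: "A'.cl (lin_extend f z) \<in> carrier A'.Q" using f_Z z by (simp add: A'.carrier_Q)
        have "A.cl (k (A'.cl (lin_extend f z))) = P" using eq[OF k(1)[OF c] z(1)] k(2)[OF c] z(2) by simp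
        then show "P \<in> (\<lambda>P. A.cl (k P)) ` carrier A'.Q" using c by blast
      qed
    qed
    fix P R assume PR: "P \<in> carrier A'.Q" "R \<in> carrier A'.Q"
    have "A'.cl (lin_extend f (k (P \<oplus>\<^bsub>A'.Q\<^esub> R))) = A'.cl (lin_extend f (k P + k R))"
      using k(2)[OF closed(1)[OF PR]] k(2)[OF PR(1)] k(2)[OF PR(2)]
      by (simp add: lin_extend_add flip: A'.add_Q)
    then show "A.cl (k (P \<oplus>\<^bsub>A'.Q\<^esub> R)) = A.cl (k P) \<oplus>\<^bsub>A.Q\<^esub> A.cl (k R)"
      unfolding A.add_Q
      using eq[OF k(1)[OF closed(1)[OF PR]] A.Z_add[OF k(1)[OF PR(1)] k(1)[OF PR(2)]]] by (simp only:)
  next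
    fix a P assume P: "P \<in> carrier A'.Q"
    have "A'.cl (lin_extend f (k (a \<odot>\<^bsub>A'.Q\<^esub> P))) = A'.cl (lin_extend f (smul a (k P)))"
      using k(2)[OF closed(2)[OF P P]] k(2)[OF P] by (simp add: lin_extend_smul flip: A'.smult_Q)
    then show "A.cl (k (a \<odot>\<^bsub>A'.Q\<^esub> P)) = a \<odot>\<^bsub>A.Q\<^esub> A.cl (k P)"
      unfolding A.smult_Q
      using eq[OF k(1)[OF closed(2)[OF P P]] A.Z_smul[OF k(1)[OF P]]] by (simp only:)
  qed
qed

lemma basis_family_map:
  assumes r: "A.basis_family I r"
  shows "A'.basis_family I (\<lambda>i. lin_extend f (r i))"
proof -
  have fin: "finite I" and rZ: "\<And>i. i \<in> I \<Longrightarrow> r i \<in> Z"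
    and ind: "\<And>a. (\<Sum>i\<in>I. smul (a i) (r i)) \<in> B \<Longrightarrow> \<forall>i\<in>I. a i = 0"
    and span: "\<And>z. z \<in> Z \<Longrightarrow> \<exists>a. z - (\<Sum>i\<in>I. smul (a i) (r i)) \<in> B"
    using r by (auto simp: A.basis_family_def)
  have sum: "(\<Sum>i\<in>I. smul (a i) (lin_extend f (r i))) = lin_extend f (\<Sum>i\<in>I. smul (a i) (r i))" for a
    by (simp add: lin_extend_linear)
  have sZ: "(\<Sum>i\<in>I. smul (a i) (r i)) \<in> Z" for a using rZ by (intro A.Z_sum A.Z_smul)
  show ?thesis
    unfolding A'.basis_family_def sum
  proof (intro conjI ballI allI impI)
    show "finite I" by (rule fin)
    show "lin_extend f (r i) \<in> Z'" if "i \<in> I" for i using f_Z rZ that by blast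
    show "a i = 0" if "lin_extend f (\<Sum>i\<in>I. smul (a i) (r i)) \<in> B'" "i \<in> I" for a i
      using ind f_inj[OF sZ that(1)] that(2) by blast
    fix z' assume "z' \<in> Z'"
    then obtain z where z: "z \<in> Z" "z' - lin_extend f z \<in> B'" using f_surj by blast
    obtain a where "z - (\<Sum>i\<in>I. smul (a i) (r i)) \<in> B" using span[OF z(1)] by blast
    then have "lin_extend f (z - (\<Sum>i\<in>I. smul (a i) (r i))) \<in> B'" by (rule f_B)
    then have "(z' - lin_extend f z) + lin_extend f (z - (\<Sum>i\<in>I. smul (a i) (r i))) \<in> B'"
      using A'.B_add z(2) by blast
    then show "\<exists>a. z' - lin_extend f (\<Sum>i\<in>I. smul (a i) (r i)) \<in> B'"
      by (auto simp: lin_extend_diff)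
  qed
qed

end


section \<open>Extension of scalars\<close>

text \<open>
  A homomorphism of skew fields. It makes \<open>'d\<close> a right vector space over \<open>'f\<close>.
\<close>

locale scalar_extension =
  fixes j :: "'f::division_ring \<Rightarrow> 'd::division_ring"
  assumes j_add: "j (a + b) = j a + j b" and j_mult: "j (a * b) = j a * j b" and j_one: "j 1 = 1"
begin

lemma j_zero [simp]: "j 0 = 0" using j_add[of 0 0] by simp
lemma j_uminus: "j (- a) = - j a" using j_add[of a "- a"] by (simp add: eq_neg_iff_add_eq_0 add.commute)
lemma j_eq_0 [simp]: "j a = 0 \<longleftrightarrow> a = 0"
proof
  assume "j a = 0"
  then have "j (a * inverse a) = 0" by (simp add: j_mult)
  then show "a = 0" using j_one by (cases "a = 0") auto
qed simp
lemma j_sum: "j (\<Sum>i\<in>A. f i) = (\<Sum>i\<in>A. j (f i))"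
  by (induction A rule: infinite_finite_induct) (simp_all add: j_add)

text \<open>
  Independence in the right vector space \<open>'d\<close> over \<open>'f\<close>.
\<close>

definition independent :: "'d set \<Rightarrow> bool" where
  "independent E \<longleftrightarrow> finite E \<and> (\<forall>g. (\<Sum>e\<in>E. e * j (g e)) = 0 \<longrightarrow> (\<forall>e\<in>E. g e = 0))"

lemma independent_spanning_ex:
  assumes "finite T"
  shows "\<exists>E. independent E \<and> (\<forall>t\<in>T. \<exists>g. t = (\<Sum>e\<in>E. e * j (g e)))"
  using assms
proof (induction T rule: finite_induct)
  case empty
  then show ?case by (intro exI[of _ "{}"]) (simp add: independent_def)
next
  case (insert t T)
  then obtain E where E: "independent E" "\<forall>t\<in>T. \<exists>g. t = (\<Sum>e\<in>E. e * j (g e))" by blast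
  have fin: "finite E" using E(1) by (simp add: independent_def)
  show ?case
  proof (cases "\<exists>g. t = (\<Sum>e\<in>E. e * j (g e))")
    case True
    then show ?thesis using E by (intro exI[of _ E]) auto
  next
    case False
    have sing: "(\<Sum>e\<in>A. e * j (if e = x then 1 else 0)) = x" if "finite A" "x \<in> A" for A x
    proof -
      have "(\<Sum>e\<in>A. e * j (if e = x then 1 else 0)) = (\<Sum>e\<in>{x}. e * j (if e = x then 1 else 0))"
        using that by (intro sum.mono_neutral_right) auto
      then show ?thesis by (simp add: j_one)
    qed
    have tE: "t \<notin> E" using False sing[OF fin] by metis
    have "independent (insert t E)"
      unfolding independent_def
    proof (intro conjI allI impI)
      show "finite (insert t E)" using fin by simp
      fix g assume g: "(\<Sum>e\<in>insert t E. e * j (g e)) = 0"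
      then have g': "t * j (g t) + (\<Sum>e\<in>E. e * j (g e)) = 0" using fin tE by simp
      have gt: "g t = 0"
      proof (rule ccontr)
        assume nz: "g t \<noteq> 0"
        have "t = t * j (g t) * j (inverse (g t))" using nz by (simp add: mult.assoc j_one flip: j_mult)
        also have "t * j (g t) = - (\<Sum>e\<in>E. e * j (g e))" using g' by (simp add: eq_neg_iff_add_eq_0)
        also have "\<dots> * j (inverse (g t)) = (\<Sum>e\<in>E. e * j (- (g e * inverse (g t))))"
          by (simp add: sum_distrib_right sum_negf j_uminus j_mult mult.assoc)
        finally have "\<exists>g. t = (\<Sum>e\<in>E. e * j (g e))" by (rule exI[of _ "\<lambda>e. - (g e * inverse (g t))"])
        then show False using False by (rule notE[rotated])
      qed
      then have "(\<Sum>e\<in>E. e * j (g e)) = 0" using g' by simp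
      then show "\<forall>e\<in>insert t E. g e = 0" using E(1) gt by (auto simp: independent_def)
    qed
    moreover have "\<exists>g. s = (\<Sum>e\<in>insert t E. e * j (g e))" if s: "s \<in> insert t T" for s
    proof (cases "s = t")
      case True
      then have "s = (\<Sum>e\<in>insert t E. e * j (if e = t then 1 else 0))"
        using sing[of "insert t E" t] fin by simp
      then show ?thesis by (rule exI[of _ "\<lambda>e. if e = t then 1 else 0"])
    next
      case False
      then obtain g where g: "s = (\<Sum>e\<in>E. e * j (g e))" using E(2) s by blast
      have "(\<Sum>e\<in>insert t E. e * j ((g(t := 0)) e)) = (\<Sum>e\<in>E. e * j (g e))"
        using fin tE by (simp add: sum.insert) (auto intro!: sum.cong)
      then have "s = (\<Sum>e\<in>insert t E. e * j ((g(t := 0)) e))" using g by (simp only:)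
      then show ?thesis by (rule exI[of _ "g(t := 0)"])
    qed
    ultimately show ?thesis by blast
  qed
qed

abbreviation ext :: "('x \<Rightarrow>\<^sub>0 'f) \<Rightarrow> ('x \<Rightarrow>\<^sub>0 'd)" where "ext \<equiv> Poly_Mapping.map j"

lemma lookup_ext [simp]: "Poly_Mapping.lookup (ext c) x = j (Poly_Mapping.lookup c x)"
  by (simp add: Poly_Mapping.map.rep_eq when_def)

lemma ext_simps: "ext (c + c') = ext c + ext c'" "ext (- c) = - ext c" "ext (c - c') = ext c - ext c'"
  "ext (smul a c) = smul (j a) (ext c)" "ext 0 = 0"
proof -
  show *: "ext (c + c') = ext c + ext c'" "ext (- c) = - ext c" for c c'
    by (rule poly_mapping_eqI; simp add: lookup_add j_add j_uminus)+
  show "ext (c - c') = ext c - ext c'" using *(1)[of c "- c'"] *(2)[of c'] by simp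
  show "ext (smul a c) = smul (j a) (ext c)" "ext 0 = 0" by (rule poly_mapping_eqI; simp add: j_mult)+
qed

lemma ext_sum: "ext (\<Sum>i\<in>A. f i) = (\<Sum>i\<in>A. ext (f i))"
  by (induction A rule: infinite_finite_induct) (simp_all add: ext_simps)

lemma keys_ext [simp]: "Poly_Mapping.keys (ext c) = Poly_Mapping.keys c"
  by (auto simp: in_keys_iff)

lemma ext_supported [simp]: "ext c \<in> supported S \<longleftrightarrow> c \<in> supported S"
  by (simp add: supported_def)

lemma ext_lin_extend:
  assumes "\<And>x. x \<in> Poly_Mapping.keys c \<Longrightarrow> b' x = ext (b x)"
  shows "lin_extend b' (ext c) = ext (lin_extend b c)"
  using assms by (simp add: lin_extend_def ext_sum ext_simps)

lemma independent_ext_zero: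
  assumes "independent E" "(\<Sum>e\<in>E. smul e (ext (u e))) = 0" "e \<in> E"
  shows "u e = 0"
proof (rule poly_mapping_eqI)
  fix x
  have "(\<Sum>e\<in>E. e * j (Poly_Mapping.lookup (u e) x)) = Poly_Mapping.lookup (\<Sum>e\<in>E. smul e (ext (u e))) x"
    by (simp add: lookup_sum)
  then have "(\<Sum>e\<in>E. e * j (Poly_Mapping.lookup (u e) x)) = 0" using assms(2) by simp
  then have "\<forall>e\<in>E. Poly_Mapping.lookup (u e) x = 0"
    using conjunct2[OF assms(1)[unfolded independent_def]] by (elim allE[of _ "\<lambda>e. Poly_Mapping.lookup (u e) x"] mp)
  then show "Poly_Mapping.lookup (u e) x = Poly_Mapping.lookup 0 x" using assms(3) by simp
qed

text \<open>
  A chain over \<open>'d\<close> has finitely many coefficients; they are right combinations of a finite set \<open>E\<close>, which splits the chain into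
  chains over \<open>'f\<close>.
\<close>

lemma decompose:
  assumes E: "\<And>t. t \<in> Poly_Mapping.lookup c ` Poly_Mapping.keys c \<Longrightarrow> \<exists>g. t = (\<Sum>e\<in>E. e * j (g e))"
    and c: "c \<in> supported S"
  shows "\<exists>u. (\<forall>e. u e \<in> supported S) \<and> c = (\<Sum>e\<in>E. smul e (ext (u e)))"
proof -
  have "\<exists>g. \<forall>x\<in>Poly_Mapping.keys c. Poly_Mapping.lookup c x = (\<Sum>e\<in>E. e * j (g x e))"
    using E by (intro bchoice) blast
  then obtain g where g: "\<And>x. x \<in> Poly_Mapping.keys c \<Longrightarrow> Poly_Mapping.lookup c x = (\<Sum>e\<in>E. e * j (g x e))" by blast
  define u where "u = (\<lambda>e. \<Sum>x\<in>Poly_Mapping.keys c. Poly_Mapping.single x (g x e))"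
  have lu: "Poly_Mapping.lookup (u e) x = (if x \<in> Poly_Mapping.keys c then g x e else 0)" for e x
    by (simp add: u_def lookup_sum lookup_single when_def)
  have "c = (\<Sum>e\<in>E. smul e (ext (u e)))"
  proof (rule poly_mapping_eqI)
    fix x
    show "Poly_Mapping.lookup c x = Poly_Mapping.lookup (\<Sum>e\<in>E. smul e (ext (u e))) x"
      using g[of x] by (cases "x \<in> Poly_Mapping.keys c") (auto simp: lookup_sum lu in_keys_iff)
  qed
  moreover have "u e \<in> supported S" for e
    unfolding u_def using c by (intro supported_sum) (auto simp: supported_def)
  ultimately show ?thesis by blast
qed

text \<open>
  Extension of scalars is exact. Concretely, the coefficients involved in one relation over \<open>'d\<close> are right combinations of a family \<open>E\<close>
  that is independent over \<open>'f\<close>. The boundary has coefficients in \<open>'f\<close>, so it respects the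
  decomposition of chains along \<open>E\<close>, and every relation over \<open>'d\<close> splits into relations over \<open>'f\<close>.
\<close>

lemma homology_basis_ext:
  fixes b :: "'x \<Rightarrow> ('x \<Rightarrow>\<^sub>0 'f)" and b' :: "'x \<Rightarrow> ('x \<Rightarrow>\<^sub>0 'd)"
  assumes b': "\<And>x. b' x = ext (b x)"
    and sq: "subquotient {c\<in>supported S. lin_extend b c = 0} (lin_extend b ` supported T)"
    and sq': "subquotient {c\<in>supported S. lin_extend b' c = 0} (lin_extend b' ` supported T)"
    and r: "subquotient.basis_family {c\<in>supported S. lin_extend b c = 0} (lin_extend b ` supported T) I r"
  shows "subquotient.basis_family {c\<in>supported S. lin_extend b' c = 0} (lin_extend b' ` supported T) I (\<lambda>i. ext (r i))"
proof -
  let ?Z = "{c\<in>supported S. lin_extend b c = 0}" and ?B = "lin_extend b ` supported T"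
  let ?Z' = "{c\<in>supported S. lin_extend b' c = 0}" and ?B' = "lin_extend b' ` supported T"
  interpret A: subquotient ?Z ?B by (rule sq)
  interpret A': subquotient ?Z' ?B' by (rule sq')
  have fin: "finite I" and rZ: "\<And>i. i \<in> I \<Longrightarrow> r i \<in> ?Z"
    and ind: "\<And>a. (\<Sum>i\<in>I. smul (a i) (r i)) \<in> ?B \<Longrightarrow> \<forall>i\<in>I. a i = 0"
    and span: "\<And>z. z \<in> ?Z \<Longrightarrow> \<exists>a. z - (\<Sum>i\<in>I. smul (a i) (r i)) \<in> ?B"
    using r unfolding A.basis_family_def by blast+
  have bext: "lin_extend b' (ext c) = ext (lin_extend b c)" for c
    by (rule ext_lin_extend) (rule b')
  have bsum: "lin_extend b' (\<Sum>e\<in>E. smul e (ext (u e))) = (\<Sum>e\<in>E. smul e (ext (lin_extend b (u e))))" for E u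
    by (simp add: lin_extend_linear bext)
  have comb: "(\<Sum>i\<in>I. smul (\<Sum>e\<in>E. e * j (\<alpha> i e)) (ext (r i))) = (\<Sum>e\<in>E. smul e (ext (\<Sum>i\<in>I. smul (\<alpha> i e) (r i))))" for E \<alpha>
  proof (rule poly_mapping_eqI)
    fix x
    show "Poly_Mapping.lookup (\<Sum>i\<in>I. smul (\<Sum>e\<in>E. e * j (\<alpha> i e)) (ext (r i))) x
      = Poly_Mapping.lookup (\<Sum>e\<in>E. smul e (ext (\<Sum>i\<in>I. smul (\<alpha> i e) (r i)))) x"
      by (simp add: lookup_sum j_sum j_mult sum_distrib_left sum_distrib_right mult.assoc sum.swap[of _ I E])
  qed
  show ?thesis
    unfolding A'.basis_family_def
  proof (intro conjI allI impI ballI)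
    show "finite I" by (rule fin)
    show "ext (r i) \<in> ?Z'" if "i \<in> I" for i using rZ[OF that] by (simp add: bext ext_simps)
  next
    fix a i assume "(\<Sum>i\<in>I. smul (a i) (ext (r i))) \<in> ?B'" and i: "i \<in> I"
    then obtain w where w: "w \<in> supported T" "(\<Sum>i\<in>I. smul (a i) (ext (r i))) = lin_extend b' w" by blast
    have "finite (a ` I \<union> Poly_Mapping.lookup w ` Poly_Mapping.keys w)" using fin by simp
    then obtain E where E: "independent E"
      "\<forall>t\<in>a ` I \<union> Poly_Mapping.lookup w ` Poly_Mapping.keys w. \<exists>g. t = (\<Sum>e\<in>E. e * j (g e))"
      using independent_spanning_ex by blast
    have "\<exists>\<alpha>. \<forall>i\<in>I. a i = (\<Sum>e\<in>E. e * j (\<alpha> i e))" using E(2) by (intro bchoice) blast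
    then obtain \<alpha> where \<alpha>: "\<And>i. i \<in> I \<Longrightarrow> a i = (\<Sum>e\<in>E. e * j (\<alpha> i e))" by blast
    obtain u where u: "\<forall>e. u e \<in> supported T" "w = (\<Sum>e\<in>E. smul e (ext (u e)))"
      using decompose[OF _ w(1), of E] E(2) by blast
    have "(\<Sum>i\<in>I. smul (a i) (ext (r i))) = (\<Sum>i\<in>I. smul (\<Sum>e\<in>E. e * j (\<alpha> i e)) (ext (r i)))"
      using \<alpha> by (intro sum.cong) auto
    also have "\<dots> = (\<Sum>e\<in>E. smul e (ext (\<Sum>i\<in>I. smul (\<alpha> i e) (r i))))" by (rule comb)
    finally have "(\<Sum>e\<in>E. smul e (ext (\<Sum>i\<in>I. smul (\<alpha> i e) (r i)))) - (\<Sum>e\<in>E. smul e (ext (lin_extend b (u e)))) = 0"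
      using w(2) u(2) bsum by simp
    then have "(\<Sum>e\<in>E. smul e (ext ((\<Sum>i\<in>I. smul (\<alpha> i e) (r i)) - lin_extend b (u e)))) = 0"
      by (simp add: ext_simps smul_distribs sum_subtractf)
    then have "(\<Sum>i\<in>I. smul (\<alpha> i e) (r i)) - lin_extend b (u e) = 0" if "e \<in> E" for e
      using independent_ext_zero[OF E(1), of "\<lambda>e. (\<Sum>i\<in>I. smul (\<alpha> i e) (r i)) - lin_extend b (u e)"] that by simp
    then have "(\<Sum>i\<in>I. smul (\<alpha> i e) (r i)) \<in> ?B" if "e \<in> E" for e using that u(1) by auto
    then have "\<alpha> i e = 0" if "e \<in> E" for e using bspec[OF ind[of "\<lambda>i. \<alpha> i e"] i] that by simp
    then show "a i = 0" using \<alpha>[OF i] by simp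
  next
    fix z assume z: "z \<in> ?Z'"
    obtain E where E: "independent E"
      "\<forall>t\<in>Poly_Mapping.lookup z ` Poly_Mapping.keys z. \<exists>g. t = (\<Sum>e\<in>E. e * j (g e))"
      using independent_spanning_ex[of "Poly_Mapping.lookup z ` Poly_Mapping.keys z"] by auto
    obtain u where u: "\<forall>e. u e \<in> supported S" "z = (\<Sum>e\<in>E. smul e (ext (u e)))"
      using decompose[of z E S] E(2) z by blast
    have "(\<Sum>e\<in>E. smul e (ext (lin_extend b (u e)))) = 0"
    proof -
      have "lin_extend b' z = 0" using z by simp
      then show ?thesis by (simp only: u(2) bsum)
    qed
    then have uZ: "u e \<in> ?Z" if "e \<in> E" for e
      using independent_ext_zero[OF E(1), of "\<lambda>e. lin_extend b (u e)"] that u(1) by simp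
    have "\<forall>e\<in>E. \<exists>p. snd p \<in> supported T \<and> u e - (\<Sum>i\<in>I. smul (fst p i) (r i)) = lin_extend b (snd p)"
    proof
      fix e assume "e \<in> E"
      then obtain a w where "w \<in> supported T" "u e - (\<Sum>i\<in>I. smul (a i) (r i)) = lin_extend b w"
        using span[OF uZ] by blast
      then show "\<exists>p. snd p \<in> supported T \<and> u e - (\<Sum>i\<in>I. smul (fst p i) (r i)) = lin_extend b (snd p)"
        by (intro exI[of _ "(a, w)"]) simp
    qed
    from bchoice[OF this] obtain p where
      p: "\<forall>e\<in>E. snd (p e) \<in> supported T \<and> u e - (\<Sum>i\<in>I. smul (fst (p e) i) (r i)) = lin_extend b (snd (p e))"
      by (elim exE)
    define \<alpha> where "\<alpha> = (\<lambda>i e. fst (p e) i)"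
    define w where "w = (\<lambda>e. snd (p e))"
    have w: "w e \<in> supported T" "u e - (\<Sum>i\<in>I. smul (\<alpha> i e) (r i)) = lin_extend b (w e)" if "e \<in> E" for e
      using p that by (auto simp: \<alpha>_def w_def)
    have "z - (\<Sum>i\<in>I. smul (\<Sum>e\<in>E. e * j (\<alpha> i e)) (ext (r i)))
      = (\<Sum>e\<in>E. smul e (ext (u e - (\<Sum>i\<in>I. smul (\<alpha> i e) (r i)))))"
      unfolding comb by (simp add: u(2) ext_simps smul_distribs sum_subtractf)
    also have "\<dots> = lin_extend b' (\<Sum>e\<in>E. smul e (ext (w e)))"
      unfolding bsum using w(2) by (intro sum.cong) auto
    also have "\<dots> \<in> ?B'" using w(1) by (intro imageI supported_sum supported_smul) simp
    finally show "\<exists>a. z - (\<Sum>i\<in>I. smul (a i) (ext (r i))) \<in> ?B'"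
      by (rule exI[of _ "\<lambda>i. \<Sum>e\<in>E. e * j (\<alpha> i e)"])
  qed
qed

end

section \<open>The simplicial chain complex\<close>

text \<open>
  Adding a new smallest vertex is a cone, with the same recursion as \<open>list_bd\<close>; inductions over a finite set in the order
  of decreasing vertices then need no signs.
\<close>

lemma simplex_boundary_insert:
  fixes v :: "'v::linorder"
  assumes fin: "finite \<tau>" and less: "\<And>w. w \<in> \<tau> \<Longrightarrow> v < w"
  shows "(simplex_boundary (insert v \<tau>) :: _ \<Rightarrow>\<^sub>0 'd::division_ring) = gen \<tau> - push (insert v) (simplex_boundary \<tau>)"
proof -
  have v: "v \<notin> \<tau>" using less by auto
  let ?t = "\<lambda>\<sigma> w. Poly_Mapping.single (\<sigma> - {w}) ((- 1) ^ card {u\<in>\<sigma>. u < w}) :: _ \<Rightarrow>\<^sub>0 'd"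
  have "simplex_boundary (insert v \<tau>) = ?t (insert v \<tau>) v + (\<Sum>w\<in>\<tau>. ?t (insert v \<tau>) w)"
    using fin v by (simp add: simplex_boundary_def)
  also have "?t (insert v \<tau>) v = gen \<tau>"
  proof -
    have "{u \<in> insert v \<tau>. u < v} = {}" using less by fastforce
    then have "card {u \<in> insert v \<tau>. u < v} = 0" by (simp only: card.empty)
    then show ?thesis using v by (simp only:) simp
  qed
  also have "(\<Sum>w\<in>\<tau>. ?t (insert v \<tau>) w) = (\<Sum>w\<in>\<tau>. - push (insert v) (?t \<tau> w))"
  proof (rule sum.cong)
    fix w assume w: "w \<in> \<tau>"
    have "{u \<in> insert v \<tau>. u < w} = insert v {u \<in> \<tau>. u < w}" using less w by auto
    then have "card {u \<in> insert v \<tau>. u < w} = Suc (card {u \<in> \<tau>. u < w})" using fin v by simp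
    moreover have "insert v \<tau> - {w} = insert v (\<tau> - {w})" using less w by auto
    ultimately show "?t (insert v \<tau>) w = - push (insert v) (?t \<tau> w)" by (simp only:) (simp add: single_uminus)
  qed simp
  also have "\<dots> = - push (insert v) (simplex_boundary \<tau>)"
    by (simp add: simplex_boundary_def push_linear sum_negf)
  finally show ?thesis by simp
qed

lemma simplex_boundary_supported:
  "(simplex_boundary \<sigma> :: _ \<Rightarrow>\<^sub>0 'd::division_ring) \<in> supported {\<sigma> - {v} | v. v \<in> \<sigma>}"
  unfolding simplex_boundary_def by (intro supported_sum) auto

lemma simplex_boundary_empty [simp]: "simplex_boundary {} = 0"
  by (simp add: simplex_boundary_def)

lemma simplex_boundary_boundary:
  fixes \<sigma> :: "'v::linorder set"
  assumes "finite \<sigma>"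
  shows "lin_extend simplex_boundary (simplex_boundary \<sigma> :: _ \<Rightarrow>\<^sub>0 'd::division_ring) = 0"
  using assms
proof (induction \<sigma> rule: finite_linorder_min_induct)
  case empty
  then show ?case by simp
next
  case (insert v \<tau>)
  let ?c = "simplex_boundary \<tau> :: _ \<Rightarrow>\<^sub>0 'd"
  have "lin_extend simplex_boundary (push (insert v) ?c) = lin_extend (\<lambda>\<rho>. gen \<rho> - push (insert v) (simplex_boundary \<rho>)) ?c"
    unfolding lin_extend_push using simplex_boundary_supported
  proof (rule lin_extend_cong_supported)
    fix \<rho> assume "\<rho> \<in> {\<tau> - {w} | w. w \<in> \<tau>}"
    then show "(simplex_boundary (insert v \<rho>) :: _ \<Rightarrow>\<^sub>0 'd) = gen \<rho> - push (insert v) (simplex_boundary \<rho>)"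
      using insert by (intro simplex_boundary_insert) auto
  qed
  also have "\<dots> = ?c - push (insert v) (lin_extend simplex_boundary ?c)"
    by (simp add: lin_extend_fun_diff lin_extend_gen push_lin_extend)
  finally have "lin_extend simplex_boundary (push (insert v) ?c) = ?c" using insert by simp
  moreover have "(simplex_boundary (insert v \<tau>) :: _ \<Rightarrow>\<^sub>0 'd) = gen \<tau> - push (insert v) ?c"
    using insert by (intro simplex_boundary_insert) auto
  ultimately show ?case by (simp add: lin_extend_diff)
qed

lemma (in scalar_extension) simplex_boundary_ext:
  "simplex_boundary \<sigma> = ext (simplex_boundary \<sigma>)"
proof (rule poly_mapping_eqI)
  fix \<tau>
  have p: "j ((- 1) ^ n) = (- 1) ^ n" for n by (induction n) (simp_all add: j_one j_uminus)
  show "Poly_Mapping.lookup (simplex_boundary \<sigma>) \<tau> = Poly_Mapping.lookup (ext (simplex_boundary \<sigma>)) \<tau>"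
    by (auto simp: simplex_boundary_def lookup_sum lookup_single when_def j_sum p intro!: sum.cong)
qed

text \<open>
  The apex \<open>v\<close> may lie anywhere in the order of the vertices, so adding it produces signs. They are controlled by filtering by the part of
  a simplex that is different from \<open>v\<close>: each block consists of \<open>\<tau>\<close> and \<open>insert v \<tau>\<close>, with \<open>\<tau>\<close> the boundary
  of the other up to sign.
\<close>

lemma cone_exact:
  fixes v :: "'v::linorder"
  assumes fin: "\<And>\<sigma>. \<sigma> \<in> L \<Longrightarrow> finite \<sigma>" and down: "\<And>\<sigma> \<tau>. \<sigma> \<in> L \<Longrightarrow> \<tau> \<subseteq> \<sigma> \<Longrightarrow> \<tau> \<in> L"
    and cone: "\<And>\<sigma>. \<sigma> \<in> L \<Longrightarrow> insert v \<sigma> \<in> L"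
  shows "exact_on (simplex_boundary :: _ \<Rightarrow> _ \<Rightarrow>\<^sub>0 'd::division_ring) L"
proof -
  define e :: "'v set \<Rightarrow> 'd" where "e = (\<lambda>\<sigma>. (- 1) ^ card {u\<in>\<sigma>. u < v})"
  define top :: "'v set \<Rightarrow> _ \<Rightarrow>\<^sub>0 'd" where "top = (\<lambda>\<sigma>. if v \<in> \<sigma> then Poly_Mapping.single (\<sigma> - {v}) (e \<sigma>) else 0)"
  have ee: "e \<sigma> * e \<sigma> = 1" for \<sigma> by (simp add: e_def flip: power_add mult_2)
  show ?thesis
  proof (rule exact_on_filtered[where \<kappa> = "\<lambda>\<sigma>. \<sigma> - {v}" and r = card and b_top = top])
    fix \<sigma> assume \<sigma>: "\<sigma> \<in> L"
    show "simplex_boundary \<sigma> \<in> (supported L :: (_ \<Rightarrow>\<^sub>0 'd) set)"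
      by (rule supported_mono[OF simplex_boundary_supported]) (use down[OF \<sigma>] in auto)
    show "lin_extend simplex_boundary (simplex_boundary \<sigma>) = (0 :: _ \<Rightarrow>\<^sub>0 'd)"
      by (rule simplex_boundary_boundary[OF fin[OF \<sigma>]])
    show "top \<sigma> \<in> supported {\<tau>\<in>L. \<tau> - {v} = \<sigma> - {v}}"
      using down[OF \<sigma>] by (auto simp: top_def)
    have "simplex_boundary \<sigma> - top \<sigma>
      = (\<Sum>w\<in>\<sigma> - {v}. Poly_Mapping.single (\<sigma> - {w}) ((- 1) ^ card {u\<in>\<sigma>. u < w}))"
      using fin[OF \<sigma>] by (cases "v \<in> \<sigma>") (simp_all add: simplex_boundary_def top_def e_def sum.remove)
    also have "\<dots> \<in> supported {\<tau>\<in>L. card (\<tau> - {v}) < card (\<sigma> - {v})}"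
    proof (rule supported_sum)
      fix w assume w: "w \<in> \<sigma> - {v}"
      have "\<sigma> - {w} - {v} \<subset> \<sigma> - {v}" using w by auto
      then have "card (\<sigma> - {w} - {v}) < card (\<sigma> - {v})" using fin[OF \<sigma>] by (intro psubset_card_mono) auto
      then show "Poly_Mapping.single (\<sigma> - {w}) ((- 1) ^ card {u\<in>\<sigma>. u < w}) \<in> supported {\<tau>\<in>L. card (\<tau> - {v}) < card (\<sigma> - {v})}"
        using down[OF \<sigma>] by auto
    qed
    finally show "simplex_boundary \<sigma> - top \<sigma> \<in> supported {\<tau>\<in>L. card (\<tau> - {v}) < card (\<sigma> - {v})}" .
  next
    fix k
    show "exact_on top {\<sigma>\<in>L. \<sigma> - {v} = k}"
    proof (rule exact_on_contraction[where s = "\<lambda>\<sigma>. if v \<in> \<sigma> then 0 else Poly_Mapping.single (insert v \<sigma>) (e (insert v \<sigma>))"])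
      fix \<sigma> assume \<sigma>: "\<sigma> \<in> {\<sigma>\<in>L. \<sigma> - {v} = k}"
      show "(if v \<in> \<sigma> then 0 else Poly_Mapping.single (insert v \<sigma>) (e (insert v \<sigma>))) \<in> supported {\<sigma>\<in>L. \<sigma> - {v} = k}"
        using \<sigma> cone by auto
      show "lin_extend top (if v \<in> \<sigma> then 0 else Poly_Mapping.single (insert v \<sigma>) (e (insert v \<sigma>)))
        + lin_extend (\<lambda>\<sigma>. if v \<in> \<sigma> then 0 else Poly_Mapping.single (insert v \<sigma>) (e (insert v \<sigma>))) (top \<sigma>) = gen \<sigma>"
        by (cases "v \<in> \<sigma>") (auto simp: top_def ee insert_absorb)
    qed
  qed
qed


section \<open>Complexes and homology\<close>

lemma (in twist) bar_boundary_boundary: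
  fixes \<phi> :: "('g \<Rightarrow>\<^sub>0 'f::division_ring) \<Rightarrow> 'd"
  assumes chi: "\<And>g. g \<in> carrier G \<Longrightarrow> \<phi> (gen g) = \<chi> g" and xs: "set xs \<subseteq> carrier G"
  shows "lin_extend (bar_boundary G \<phi>) (bar_boundary G \<phi> xs) = 0"
proof -
  let ?p = "push (partial_products \<one>) :: ('g list \<Rightarrow>\<^sub>0 'd) \<Rightarrow> _"
  have sup: "bar_boundary G \<phi> ys \<in> supported (lists (carrier G))" if "ys \<in> lists (carrier G)" for ys
    by (rule supported_mono[OF bar_boundary_supported[OF subgroup_self]])
      (use that in \<open>auto simp: in_lists_conv_set\<close>)
  have chain: "?p (lin_extend (bar_boundary G \<phi>) c) = lin_extend tuple_codiff (?p c)"
    if "c \<in> supported (lists (carrier G))" for c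
    unfolding push_lin_extend lin_extend_push using that
    by (rule lin_extend_cong_supported) (auto intro!: push_bar_boundary[OF chi])
  have xs': "xs \<in> lists (carrier G)" using xs by auto
  have pT: "partial_products \<one> xs \<in> tuples (carrier G)"
    using bij_partial_products[OF subgroup_self] xs' by (auto simp: bij_betw_def ntuples_def)
  have "?p (lin_extend (bar_boundary G \<phi>) (bar_boundary G \<phi> xs)) = lin_extend tuple_codiff (tuple_codiff (partial_products \<one> xs))"
    using chain[OF sup[OF xs']] push_bar_boundary[OF chi xs] by simp
  also have "\<dots> = 0"
    using codiff_codiff[OF free_action_tuples equivariant_tuple_bd pT] tuple_bd_tuple_bd by blast
  finally have "?p (lin_extend (bar_boundary G \<phi>) (bar_boundary G \<phi> xs)) = 0" .
  moreover have "lin_extend (bar_boundary G \<phi>) (bar_boundary G \<phi> xs) \<in> supported (lists (carrier G))"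
    using sup[OF xs'] sup by (rule supported_lin_extend)
  ultimately show ?thesis
    using push_inj_on_eq_0 bij_partial_products[OF subgroup_self] unfolding bij_betw_def by blast
qed

lemma subquotient_homology:
  fixes b :: "'x \<Rightarrow> ('x \<Rightarrow>\<^sub>0 'd::division_ring)"
  assumes "\<And>x. x \<in> T \<Longrightarrow> b x \<in> supported S" "\<And>x. x \<in> T \<Longrightarrow> lin_extend b (b x) = 0"
  shows "subquotient {c\<in>supported S. lin_extend b c = 0} (lin_extend b ` supported T)"
proof
  fix x y a assume "x \<in> lin_extend b ` supported T"
  then obtain u where u: "u \<in> supported T" "x = lin_extend b u" by blast
  show "smul a x \<in> lin_extend b ` supported T"
    using u by (intro image_eqI[of _ _ "smul a u"]) (auto simp: lin_extend_smul supported_smul)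
  assume "y \<in> lin_extend b ` supported T"
  then obtain w where w: "w \<in> supported T" "y = lin_extend b w" by blast
  show "x + y \<in> lin_extend b ` supported T"
    using u w by (intro image_eqI[of _ _ "u + w"]) (auto simp: lin_extend_add supported_add)
next
  show "0 \<in> lin_extend b ` supported T" by (intro image_eqI[of _ _ 0]) auto
  show "lin_extend b ` supported T \<subseteq> {c\<in>supported S. lin_extend b c = 0}"
    using assms supported_lin_extend[of _ T b S] lin_extend_eq_zero[of _ T "\<lambda>x. lin_extend b (b x)"]
    by (auto simp: lin_extend_compose)
qed (auto simp: lin_extend_add lin_extend_smul supported_add supported_smul)

lemma complex_homology_Q:
  assumes "subquotient {c\<in>supported (S n). lin_extend b c = 0} (lin_extend b ` supported (S (n + 1)))"
  shows "complex_homology (\<lambda>n. free_space (S n)) (lin_extend b) n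
    = subquotient.Q {c\<in>supported (S n). lin_extend b c = 0} (lin_extend b ` supported (S (n + 1)))"
proof -
  interpret subquotient "{c\<in>supported (S n). lin_extend b c = 0}" "lin_extend b ` supported (S (n + 1))" by fact
  show ?thesis unfolding Q_def ambient_def complex_homology_def free_space_def by (simp add: supported_def)
qed

lemma restr_lin_extend_degree:
  assumes c: "c \<in> supported S"
    and eq: "\<And>x. x \<in> S \<Longrightarrow> x \<in> P \<Longrightarrow> f x \<in> supported R"
    and ne: "\<And>x. x \<in> S \<Longrightarrow> x \<notin> P \<Longrightarrow> f x \<in> supported (- R)"
  shows "restr R (lin_extend f c) = lin_extend f (restr P c)"
  unfolding restr_lin_extend lin_extend_restr using c
proof (rule lin_extend_cong_supported)
  fix x assume x: "x \<in> S"
  show "restr R (f x) = (if x \<in> P then f x else 0)"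
    using eq[OF x] ne[OF x] by (auto simp: restr_ident intro: restr_eq_0)
qed

text \<open>
  Exactness in every degree gives exactness of the total complex, as the bar boundary is homogeneous.
\<close>

lemma exact_on_bar_if_homology_trivial:
  fixes \<phi> :: "('g \<Rightarrow>\<^sub>0 'f::division_ring) \<Rightarrow> 'd::division_ring"
  assumes tw: "twist G \<chi>" and chi: "\<And>g. g \<in> carrier G \<Longrightarrow> \<phi> (gen g) = \<chi> g"
    and triv: "\<And>n. carrier (group_homology G \<phi> n) = {\<zero>\<^bsub>group_homology G \<phi> n\<^esub>}"
  shows "exact_on (bar_boundary G \<phi>) (lists (carrier G))"
proof (rule exact_on_graded[where deg = length])
  interpret twist G \<chi> by (rule tw)
  let ?b = "bar_boundary G \<phi>"
  let ?S = "\<lambda>n::int. {gs. set gs \<subseteq> carrier G \<and> int (length gs) = n}"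
  fix xs ys assume "xs \<in> lists (carrier G)" "ys \<in> Poly_Mapping.keys (?b xs)"
  then show "length xs = Suc (length ys)"
    using bar_boundary_supported[OF subgroup_self, of xs \<phi>] by (auto simp: supported_def in_lists_conv_set subset_iff)
next
  interpret twist G \<chi> by (rule tw)
  let ?b = "bar_boundary G \<phi>"
  let ?S = "\<lambda>n::int. {gs. set gs \<subseteq> carrier G \<and> int (length gs) = n}"
  fix n c assume c: "c \<in> supported {xs\<in>lists (carrier G). length xs = n}" "lin_extend ?b c = 0"
  have sq: "subquotient {c\<in>supported (?S (int n)). lin_extend ?b c = 0} (lin_extend ?b ` supported (?S (int n + 1)))"
  proof (rule subquotient_homology)
    fix xs assume xs: "xs \<in> ?S (int n + 1)"
    show "?b xs \<in> supported (?S (int n))"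
      by (rule supported_mono[OF bar_boundary_supported[OF subgroup_self]]) (use xs in auto)
    show "lin_extend ?b (?b xs) = 0" using xs by (intro bar_boundary_boundary[OF chi]) auto
  qed
  interpret Q: subquotient "{c\<in>supported (?S (int n)). lin_extend ?b c = 0}" "lin_extend ?b ` supported (?S (int n + 1))"
    by (rule sq)
  have H: "group_homology G \<phi> (int n) = Q.Q"
    unfolding group_homology_def bar_chains_def[abs_def] by (rule complex_homology_Q[OF sq])
  have "c \<in> supported (?S (int n))" by (rule supported_mono[OF c(1)]) auto
  then have "Q.cl c \<in> carrier Q.Q" unfolding Q.carrier_Q using c(2) by blast
  also have "carrier Q.Q = {Q.cl 0}" using triv[of "int n"] unfolding H Q.zero_Q .
  finally have "Q.cl c = Q.cl 0" by blast
  then have "c \<in> lin_extend ?b ` supported (?S (int n + 1))" unfolding Q.cl_eq_iff by (simp only: diff_zero)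
  then obtain u where "u \<in> supported (?S (int n + 1))" "c = lin_extend ?b u" by blast
  moreover from this have "u \<in> supported (lists (carrier G))" by (auto intro: supported_mono)
  ultimately show "\<exists>u\<in>supported (lists (carrier G)). c = lin_extend ?b u" by blast
qed


section \<open>Comparison of the two complexes\<close>

locale acyclic_graph_product = graph_product_family V \<Gamma> K
  for V :: "'i::linorder set" and \<Gamma> :: "'i \<Rightarrow> ('g, 'b) monoid_scheme" and K :: "'i set set" +
  fixes \<phi> :: "(('i \<times> 'g) list set set \<Rightarrow>\<^sub>0 'f::division_ring) \<Rightarrow> 'd::division_ring"
  assumes finite_V: "finite V" and complex: "simplicial_complex V K" and flag: "flag V K"
    and agrarian: "agrarian_map (graph_product V K \<Gamma>) \<phi>"
    and acyclic: "\<And>i n. i \<in> V \<Longrightarrow> carrier (group_homology (\<Gamma> i) (vertex_restrict V K \<Gamma> \<phi> i) n)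
      = {\<zero>\<^bsub>group_homology (\<Gamma> i) (vertex_restrict V K \<Gamma> \<phi> i) n\<^esub>}"
begin

definition \<chi> :: "('i \<times> 'g) list set set \<Rightarrow> 'd" where "\<chi> x = \<phi> (gen x)"

abbreviation bar :: "('i \<times> 'g) list set set list \<Rightarrow> (('i \<times> 'g) list set set list \<Rightarrow>\<^sub>0 'd)" where
  "bar \<equiv> bar_boundary GP \<phi>"

lemma twist_GP: "twist GP \<chi>"
proof -
  have hom: "\<phi> \<in> ring_hom (group_ring GP) ring_of_type_algebra" using agrarian by (simp add: agrarian_map_def)
  have "\<chi> \<one>\<^bsub>GP\<^esub> = 1"
    using ring_hom_one[OF hom] by (simp add: \<chi>_def group_ring_def ring_of_type_algebra_def)
  moreover have "\<chi> (x \<otimes>\<^bsub>GP\<^esub> y) = \<chi> x * \<chi> y" if "x \<in> carrier GP" "y \<in> carrier GP" for x y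
    using ring_hom_mult[OF hom, of "gen x" "gen y"] that
    by (simp add: \<chi>_def group_ring_def ring_of_type_algebra_def)
  ultimately show ?thesis using Q.is_group by (simp add: twist_def twist_axioms_def)
qed

lemma scalar_extension: "scalar_extension (\<lambda>a. \<phi> (Poly_Mapping.single \<one>\<^bsub>GP\<^esub> a))"
proof
  have hom: "\<phi> \<in> ring_hom (group_ring GP) ring_of_type_algebra" using agrarian by (simp add: agrarian_map_def)
  have car: "Poly_Mapping.single \<one>\<^bsub>GP\<^esub> a \<in> carrier (group_ring GP)" for a :: 'f
    by (simp add: group_ring_def)
  fix a b :: 'f
  show "\<phi> (Poly_Mapping.single \<one>\<^bsub>GP\<^esub> (a + b)) = \<phi> (Poly_Mapping.single \<one>\<^bsub>GP\<^esub> a) + \<phi> (Poly_Mapping.single \<one>\<^bsub>GP\<^esub> b)"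
    using ring_hom_add[OF hom car car, of a b] by (simp add: group_ring_def ring_of_type_algebra_def single_add)
  have "Poly_Mapping.single \<one>\<^bsub>GP\<^esub> a \<otimes>\<^bsub>group_ring GP\<^esub> Poly_Mapping.single \<one>\<^bsub>GP\<^esub> b = Poly_Mapping.single \<one>\<^bsub>GP\<^esub> (a * b)"
    by (cases "a = 0"; cases "b = 0") (simp_all add: group_ring_def)
  then show "\<phi> (Poly_Mapping.single \<one>\<^bsub>GP\<^esub> (a * b)) = \<phi> (Poly_Mapping.single \<one>\<^bsub>GP\<^esub> a) * \<phi> (Poly_Mapping.single \<one>\<^bsub>GP\<^esub> b)"
    using ring_hom_mult[OF hom car car, of a b] by (simp add: ring_of_type_algebra_def)
  show "\<phi> (gen \<one>\<^bsub>GP\<^esub>) = 1"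
    using ring_hom_one[OF hom] by (simp add: group_ring_def ring_of_type_algebra_def)
qed

text \<open>
  The bar boundary uses only the multiplication, so a subgroup shares it with the ambient group.
\<close>

lemma bar_restrict: "bar_boundary (GP\<lparr>carrier := H\<rparr>) \<phi> = bar"
  by (rule ext) (simp add: bar_boundary_def)

lemma twist_sub: "twist (GP\<lparr>carrier := sub W\<rparr>) \<chi>"
  by (rule twist_subgroup[OF twist_GP subgroup_sub])

lemma bar_supported:
  assumes "xs \<in> lists (sub W)"
  shows "bar xs \<in> supported {ys\<in>lists (sub W). Suc (length ys) = length xs}"
proof -
  interpret tw: twist GP \<chi> by (rule twist_GP)
  show ?thesis
    by (rule supported_mono[OF tw.bar_boundary_supported[OF subgroup_sub]]) (use assms in auto)
qed

lemma bar_bar: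
  assumes "xs \<in> lists (sub W)"
  shows "lin_extend bar (bar xs) = 0"
proof -
  interpret tw: twist GP \<chi> by (rule twist_GP)
  show ?thesis
    using assms subgroup.mem_carrier[OF subgroup_sub]
    by (intro tw.bar_boundary_boundary) (auto simp: \<chi>_def)
qed

text \<open>
  The hypothesis concerns the abstract group \<open>\<Gamma> v\<close>; the injective inclusion of \<open>\<Gamma> v\<close> identifies its bar complex with that
  of \<open>sub {v}\<close>.
\<close>

lemma bar_exact_vertex:
  assumes v: "v \<in> V"
  shows "exact_on bar (lists (sub {v}))"
proof -
  interpret tw: twist GP \<chi> by (rule twist_GP)
  interpret h: group_hom "\<Gamma> v" GP "\<iota> v" by (rule incl_group_hom[OF v])
  let ?r = "vertex_restrict V K \<Gamma> \<phi> v" and ?\<chi> = "\<lambda>g. \<chi> (\<iota> v g)"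
  have twv: "twist (\<Gamma> v) ?\<chi>"
    using family[OF v] tw.chi_one tw.chi_mult by (auto simp: twist_def twist_axioms_def)
  interpret v: twist "\<Gamma> v" ?\<chi> by (rule twv)
  have r: "?r (gen g) = ?\<chi> g" for g
    by (simp add: vertex_restrict_def group_ring_map_def \<chi>_def)
  have ex: "exact_on (bar_boundary (\<Gamma> v) ?r) (lists (carrier (\<Gamma> v)))"
    by (rule exact_on_bar_if_homology_trivial[OF twv r acyclic[OF v]])
  have "exact_on bar (map (\<iota> v) ` lists (carrier (\<Gamma> v)))"
  proof (rule exact_on_image[where e = 1, OF ex])
    show "inj_on (map (\<iota> v)) (lists (carrier (\<Gamma> v)))"
      using incl_inj[OF v] by (rule inj_on_map_lists)
    fix xs assume xs: "xs \<in> lists (carrier (\<Gamma> v))"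
    show "bar_boundary (\<Gamma> v) ?r xs \<in> supported (lists (carrier (\<Gamma> v)))"
      by (rule supported_mono[OF v.bar_boundary_supported[OF group.subgroup_self[OF family[OF v]]]]) (use xs in auto)
    have rest: "tw.bar_rest (map (\<iota> v) ys) = push (map (\<iota> v)) (v.bar_rest ys)" if "ys \<in> lists (carrier (\<Gamma> v))" for ys
      using that
    proof (induction ys rule: v.bar_rest.induct)
      case (3 x y ys)
      have 1: "tw.bar_rest (map (\<iota> v) (y # ys)) = push (map (\<iota> v)) (v.bar_rest (y # ys))"
        using 3 by simp
      have "\<iota> v (x \<otimes>\<^bsub>\<Gamma> v\<^esub> y) = \<iota> v x \<otimes>\<^bsub>GP\<^esub> \<iota> v y" using 3 by simp
      then show ?case using 1 by (simp add: push_linear push_push)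
    qed (simp_all add: push_linear)
    show "bar (map (\<iota> v) xs) = smul 1 (push (map (\<iota> v)) (bar_boundary (\<Gamma> v) ?r xs))"
    proof (cases xs)
      case Nil
      then show ?thesis by (simp add: bar_boundary_def)
    next
      case (Cons x ys)
      then show ?thesis using rest[OF xs]
        by (simp add: tw.bar_boundary_Cons v.bar_boundary_Cons push_linear r) (simp add: \<chi>_def)
    qed
  qed simp
  moreover have "map (\<iota> v) ` lists (carrier (\<Gamma> v)) = lists (sub {v})"
    by (simp add: sub_singleton[OF v] lists_image)
  ultimately show ?thesis by simp
qed

text \<open>
  Here \<open>sub W\<close> is the direct product of \<open>sub (W - {v})\<close> and \<open>sub {v}\<close>, the projections being the
  retractions, and the second factor has an exact bar complex.
\<close>

lemma bar_exact_cone: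
  assumes W: "W \<subseteq> V" and v: "v \<in> W" and adj: "\<And>w. w \<in> W \<Longrightarrow> w \<noteq> v \<Longrightarrow> adjacent K v w"
  shows "exact_on bar (lists (sub W))"
proof -
  let ?G = "GP\<lparr>carrier := sub W\<rparr>" and ?C = "sub (W - {v})" and ?N = "sub {v}"
  interpret tw: twist ?G \<chi> by (rule twist_sub)
  have vV: "v \<in> V" using W v by auto
  have chi: "\<phi> (gen g) = \<chi> g" for g by (simp add: \<chi>_def)
  have CW: "?C \<subseteq> sub W" and NW: "?N \<subseteq> sub W" using v by (auto intro!: sub_mono)
  have sgC: "subgroup ?C ?G" by (rule Q.subgroup_incl[OF subgroup_sub subgroup_sub CW])
  have sgN: "subgroup ?N ?G" by (rule Q.subgroup_incl[OF subgroup_sub subgroup_sub NW])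
  have hom: "ret U \<in> hom ?G ?G" for U
  proof (rule homI)
    fix x y assume x: "x \<in> carrier ?G" and y: "y \<in> carrier ?G"
    show "ret U x \<in> carrier ?G" using ret_sub[of x W U] x sub_mono[of "W \<inter> U" W] by auto
    show "ret U (x \<otimes>\<^bsub>?G\<^esub> y) = ret U x \<otimes>\<^bsub>?G\<^esub> ret U y" using ret_mult[of x W y U] x y by simp
  qed
  have comm: "c \<otimes>\<^bsub>GP\<^esub> n = n \<otimes>\<^bsub>GP\<^esub> c" if "c \<in> ?C" "n \<in> ?N" for c n
    using sub_commute[OF vV _ that(2,1)] adj by blast
  have retC: "ret (W - {v}) x \<in> ?C" if "x \<in> sub W" for x
    using ret_sub[OF that, of "W - {v}"] sub_mono[of "W \<inter> (W - {v})" "W - {v}"] by auto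
  have retN: "ret {v} x \<in> ?N" if "x \<in> sub W" for x
    using ret_sub[OF that, of "{v}"] sub_mono[of "W \<inter> {v}" "{v}"] by auto
  have decomp: "g = ret (W - {v}) g \<otimes>\<^bsub>GP\<^esub> ret {v} g" if "g \<in> sub W" for g
    using that
  proof (induction rule: sub_induct)
    case one
    then show ?case by (simp add: ret_one)
  next
    case (gen i g)
    then show ?case using incl_closed by (cases "i = v") (auto simp: ret_incl)
  next
    case (mult x y)
    let ?cx = "ret (W - {v}) x" and ?cy = "ret (W - {v}) y" and ?nx = "ret {v} x" and ?ny = "ret {v} y"
    note mem = retC[OF mult(1)] retC[OF mult(2)] retN[OF mult(1)] retN[OF mult(2)]
    have G: "?cx \<in> carrier GP" "?cy \<in> carrier GP" "?nx \<in> carrier GP" "?ny \<in> carrier GP"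
      using mem subgroup.mem_carrier[OF subgroup_sub] by blast+
    have "x \<otimes>\<^bsub>GP\<^esub> y = (?cx \<otimes>\<^bsub>GP\<^esub> ?nx) \<otimes>\<^bsub>GP\<^esub> (?cy \<otimes>\<^bsub>GP\<^esub> ?ny)" using mult(3,4) by simp
    also have "\<dots> = ?cx \<otimes>\<^bsub>GP\<^esub> (?nx \<otimes>\<^bsub>GP\<^esub> ?cy) \<otimes>\<^bsub>GP\<^esub> ?ny" using G by (simp add: Q.m_assoc)
    also have "?nx \<otimes>\<^bsub>GP\<^esub> ?cy = ?cy \<otimes>\<^bsub>GP\<^esub> ?nx" using comm mem by simp
    also have "?cx \<otimes>\<^bsub>GP\<^esub> (?cy \<otimes>\<^bsub>GP\<^esub> ?nx) \<otimes>\<^bsub>GP\<^esub> ?ny = (?cx \<otimes>\<^bsub>GP\<^esub> ?cy) \<otimes>\<^bsub>GP\<^esub> (?nx \<otimes>\<^bsub>GP\<^esub> ?ny)"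
      using G by (simp add: Q.m_assoc)
    finally show ?case unfolding ret_mult[OF mult(1,2)] .
  qed
  have "exact_on (bar_boundary ?G \<phi>) (lists ?N)" using bar_exact_vertex[OF vV] by (simp add: bar_restrict)
  then have exN: "exact_on tw.tuple_codiff (tw.ntuples ?N)"
    using tw.exact_bar_iff[OF chi sgN] by simp
  have "exact_on tw.tuple_codiff (tw.ntuples (carrier ?G))"
  proof (rule tw.direct_product_exact[OF sgC sgN hom _ _ hom _ _ _ _ exN])
    show "ret (W - {v}) ` carrier ?G \<subseteq> ?C" "ret {v} ` carrier ?G \<subseteq> ?N" using retC retN by auto
    show "ret (W - {v}) c = c" if "c \<in> ?C" for c using that by (rule ret_ident)
    show "ret {v} n = n" if "n \<in> ?N" for n using that by (rule ret_ident)
    show "c \<otimes>\<^bsub>?G\<^esub> n = n \<otimes>\<^bsub>?G\<^esub> c" if "c \<in> ?C" "n \<in> ?N" for c n using comm[OF that] by simp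
    show "g = ret (W - {v}) g \<otimes>\<^bsub>?G\<^esub> ret {v} g" if "g \<in> carrier ?G" for g using decomp[of g] that by simp
  qed
  then have "exact_on (bar_boundary ?G \<phi>) (lists (carrier ?G))"
    using tw.exact_bar_iff[OF chi tw.subgroup_self] by simp
  then show ?thesis by (simp add: bar_restrict)
qed

text \<open>
  This is \<open>amalgam_relative\<close> in bar notation, for \<open>sub W\<close> as the amalgam of \<open>sub (W - {v})\<close> and
  \<open>sub (insert v L)\<close>.
\<close>

lemma bar_amalgam:
  assumes W: "W \<subseteq> V" and v: "v \<in> W"
  defines "L \<equiv> {w\<in>W. adjacent K v w}"
  assumes y: "y \<in> supported (lists (sub W))"
    and dy: "lin_extend bar y \<in> supported (lists (sub (W - {v})) \<union> lists (sub (insert v L)))"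
  shows "\<exists>u\<in>supported (lists (sub W)). y - lin_extend bar u \<in> supported (lists (sub (W - {v})) \<union> lists (sub (insert v L)))"
proof -
  let ?G = "GP\<lparr>carrier := sub W\<rparr>" and ?A = "sub (W - {v})" and ?B = "sub (insert v L)"
  interpret tw: twist ?G \<chi> by (rule twist_sub)
  have vV: "v \<in> V" using W v by auto
  have chi: "\<phi> (gen g) = \<chi> g" for g by (simp add: \<chi>_def)
  have AW: "?A \<subseteq> sub W" and BW: "?B \<subseteq> sub W" using v by (auto intro!: sub_mono simp: L_def)
  have sgA: "subgroup ?A ?G" by (rule Q.subgroup_incl[OF subgroup_sub subgroup_sub AW])
  have sgB: "subgroup ?B ?G" by (rule Q.subgroup_incl[OF subgroup_sub subgroup_sub BW])
  have gen: "generate ?G (?A \<union> ?B) = carrier ?G"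
  proof -
    have "generate GP (?A \<union> ?B) = generate ?G (?A \<union> ?B)"
      by (rule Q.generate_consistent[symmetric]) (use AW BW subgroup_sub in auto)
    moreover have "generate GP (?A \<union> ?B) \<subseteq> sub W"
      by (rule Q.generate_subgroup_incl) (use AW BW subgroup_sub in auto)
    moreover have "sub W \<subseteq> generate GP (?A \<union> ?B)"
      unfolding sub_def[of W]
    proof (rule Q.mono_generate)
      show "gens W \<subseteq> ?A \<union> ?B"
        using incl_sub[of _ "W - {v}"] incl_sub[of v "insert v L"] by (auto simp: gens_def)
    qed
    ultimately show ?thesis by simp
  qed
  have tree: "tw.tree_like ?A ?B"
    using tree_like_sub[OF vV v twist_sub] unfolding L_def by simp
  let ?p = "tw.partial_products \<one>\<^bsub>?G\<^esub>"
  have bij: "bij_betw ?p (lists H) (tw.ntuples H)" if "subgroup H ?G" for H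
    by (rule tw.bij_partial_products[OF that])
  have bijW: "bij_betw ?p (lists (sub W)) (tw.ntuples (sub W))" using bij[OF tw.subgroup_self] by simp
  have ntAB: "?p ` (lists ?A \<union> lists ?B) = tw.ntuples ?A \<union> tw.ntuples ?B"
    using bij[OF sgA] bij[OF sgB] by (simp add: bij_betw_def image_Un)
  have push_bar: "push ?p (lin_extend bar c) = lin_extend tw.tuple_codiff (push ?p c)" if "c \<in> supported (lists (sub W))" for c
    unfolding push_lin_extend lin_extend_push using that
    by (rule lin_extend_cong_supported)
      (use tw.push_bar_boundary[OF chi] in \<open>auto simp: bar_restrict\<close>)
  have py: "push ?p y \<in> supported (tw.ntuples (carrier ?G))"
    using y by (rule supported_push) (use bijW in \<open>auto simp: bij_betw_def\<close>)
  have "push ?p (lin_extend bar y) \<in> supported (tw.ntuples ?A \<union> tw.ntuples ?B)"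
    using dy by (rule supported_push) (use ntAB in blast)
  then have pdy: "lin_extend tw.tuple_codiff (push ?p y) \<in> supported (tw.ntuples ?A \<union> tw.ntuples ?B)"
    by (simp only: push_bar[OF y])
  obtain t where t: "t \<in> supported (tw.ntuples (carrier ?G))"
    "push ?p y - lin_extend tw.tuple_codiff t \<in> supported (tw.ntuples ?A \<union> tw.ntuples ?B)"
    using tw.amalgam_relative[OF sgA sgB gen tree py pdy] by blast
  let ?q = "inv_into (lists (sub W)) ?p"
  have qp: "?q (?p xs) = xs" if "xs \<in> lists (sub W)" for xs using bijW that by (rule bij_betw_inv_into_left)
  have pq: "?p (?q xs) = xs" if "xs \<in> tw.ntuples (sub W)" for xs using bijW that by (rule bij_betw_inv_into_right)
  have qt: "push ?q t \<in> supported (lists (sub W))"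
    using t(1) by (rule supported_push) (use bij_betw_apply[OF bij_betw_inv_into[OF bijW]] in simp)
  have pqt: "push ?p (push ?q t) = t"
    unfolding push_push using t(1) by (rule push_ident) (use pq in simp)
  have diff: "y - lin_extend bar (push ?q t) \<in> supported (lists (sub W))"
    using y qt by (intro supported_diff supported_lin_extend[OF qt])
      (auto intro: supported_mono[OF bar_supported])
  have "push ?p (y - lin_extend bar (push ?q t)) = push ?p y - lin_extend tw.tuple_codiff t"
    using push_bar[OF qt] pqt by (simp add: push_linear)
  then have "push ?q (push ?p (y - lin_extend bar (push ?q t))) \<in> supported (lists ?A \<union> lists ?B)"
    using t(2)
  proof (elim ssubst, intro supported_push)
    fix xs assume "xs \<in> tw.ntuples ?A \<union> tw.ntuples ?B"
    then obtain zs where zs: "zs \<in> lists ?A \<union> lists ?B" "xs = ?p zs" using ntAB by blast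
    moreover have "zs \<in> lists (sub W)" using zs(1) AW BW by auto
    ultimately show "?q xs \<in> lists ?A \<union> lists ?B" using qp by simp
  qed
  also have "push ?q (push ?p (y - lin_extend bar (push ?q t))) = y - lin_extend bar (push ?q t)"
    unfolding push_push using diff qp by (rule push_ident)
  finally show ?thesis using qt by blast
qed

lemma K_facts: "\<sigma> \<in> K \<Longrightarrow> finite \<sigma>" "\<sigma> \<in> K \<Longrightarrow> \<sigma> \<subseteq> V" "\<sigma> \<in> K \<Longrightarrow> \<tau> \<subseteq> \<sigma> \<Longrightarrow> \<tau> \<in> K" "{} \<in> K"
  using complex unfolding simplicial_complex_def by blast+

lemma adjacent_simplex: "\<sigma> \<in> K \<Longrightarrow> v \<in> \<sigma> \<Longrightarrow> w \<in> \<sigma> \<Longrightarrow> w \<noteq> v \<Longrightarrow> adjacent K v w"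
  using K_facts(3)[of \<sigma> "{v, w}"] by (auto simp: adjacent_def)

lemma bar_restr_length:
  assumes c: "c \<in> supported (lists (sub W))"
  shows "restr {gs. Suc (length gs) = n} (lin_extend bar c) = lin_extend bar (restr {gs. length gs = n} c)"
  using c by (rule restr_lin_extend_degree) (auto intro: supported_mono[OF bar_supported])

text \<open>
  The first argument is the number of vertices; it is there for the sake of the recursion, since the chain
  of a simplex is chosen in terms of those of its faces.
\<close>

primrec simplex_chain_at :: "nat \<Rightarrow> 'i set \<Rightarrow> (('i \<times> 'g) list set set list \<Rightarrow>\<^sub>0 'd)" where
  "simplex_chain_at 0 \<sigma> = gen []"
| "simplex_chain_at (Suc n) \<sigma> = (SOME z. z \<in> supported {gs\<in>lists (sub \<sigma>). length gs = Suc n} \<and>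
     lin_extend bar z = lin_extend (simplex_chain_at n) (simplex_boundary \<sigma>))"

definition simplex_chain :: "'i set \<Rightarrow> (('i \<times> 'g) list set set list \<Rightarrow>\<^sub>0 'd)" where
  "simplex_chain \<sigma> = simplex_chain_at (card \<sigma>) \<sigma>"

lemma simplex_chain_eq:
  assumes "\<sigma> \<in> K" "card \<sigma> = Suc n"
  shows "lin_extend (simplex_chain_at n) (simplex_boundary \<sigma>) = lin_extend simplex_chain (simplex_boundary \<sigma>)"
  using simplex_boundary_supported
proof (rule lin_extend_cong_supported)
  fix \<tau> assume "\<tau> \<in> {\<sigma> - {v} | v. v \<in> \<sigma>}"
  then have "card \<tau> = n" using assms K_facts(1) by auto
  then show "simplex_chain_at n \<tau> = simplex_chain \<tau>" by (simp add: simplex_chain_def)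
qed

text \<open>
  Simplices are cliques, so \<open>bar_exact_cone\<close> applies to any of their vertices and the choice in \<open>simplex_chain_at\<close> can be
  made.
\<close>

lemma simplex_chain:
  assumes "\<sigma> \<in> K"
  shows "simplex_chain \<sigma> \<in> supported {gs\<in>lists (sub \<sigma>). length gs = card \<sigma>} \<and>
    lin_extend bar (simplex_chain \<sigma>) = lin_extend simplex_chain (simplex_boundary \<sigma>)"
  using assms
proof (induction "card \<sigma>" arbitrary: \<sigma>)
  case 0
  then have "\<sigma> = {}" using K_facts(1) by auto
  then show ?case by (simp add: simplex_chain_def bar_boundary_def)
next
  case (Suc n)
  have fin: "finite \<sigma>" and \<sigma>V: "\<sigma> \<subseteq> V" using K_facts Suc by auto
  then obtain v where v: "v \<in> \<sigma>" using Suc.hyps(2) by fastforce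
  let ?z = "simplex_chain" and ?e = "lin_extend simplex_chain (simplex_boundary \<sigma>)"
  have face: "\<tau> \<in> K \<and> card \<tau> = n \<and> \<tau> \<subseteq> \<sigma>" if "\<tau> \<in> {\<sigma> - {v} | v. v \<in> \<sigma>}" for \<tau>
    using that Suc.hyps(2) Suc.prems fin K_facts(3) by auto
  have e: "?e \<in> supported {gs\<in>lists (sub \<sigma>). length gs = n}"
    using simplex_boundary_supported
  proof (rule supported_lin_extend)
    fix \<tau> assume "\<tau> \<in> {\<sigma> - {v} | v. v \<in> \<sigma>}"
    note f = face[OF this]
    have "?z \<tau> \<in> supported {gs\<in>lists (sub \<tau>). length gs = card \<tau>}" using Suc.hyps(1)[of \<tau>] f by simp
    then show "?z \<tau> \<in> supported {gs\<in>lists (sub \<sigma>). length gs = n}"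
      by (rule supported_mono) (use f sub_mono[of \<tau> \<sigma>] in auto)
  qed
  then have e': "?e \<in> supported (lists (sub \<sigma>))" by (rule supported_mono) auto
  have "lin_extend bar ?e = lin_extend (\<lambda>\<tau>. lin_extend ?z (simplex_boundary \<tau>)) (simplex_boundary \<sigma>)"
    unfolding lin_extend_compose using simplex_boundary_supported
  proof (rule lin_extend_cong_supported)
    fix \<tau> assume "\<tau> \<in> {\<sigma> - {v} | v. v \<in> \<sigma>}"
    note f = face[OF this]
    show "lin_extend bar (?z \<tau>) = lin_extend ?z (simplex_boundary \<tau>)" using Suc.hyps(1)[of \<tau>] f by simp
  qed
  also have "\<dots> = 0" using simplex_boundary_boundary[OF fin, where 'd = 'd] by (simp flip: lin_extend_compose)
  finally have "lin_extend bar ?e = 0" .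
  moreover have "exact_on bar (lists (sub \<sigma>))"
    by (rule bar_exact_cone[OF \<sigma>V v]) (use adjacent_simplex Suc.prems v in blast)
  ultimately obtain u where u: "u \<in> supported (lists (sub \<sigma>))" "?e = lin_extend bar u"
    using exact_onD e' by metis
  let ?u = "restr {gs. length gs = Suc n} u"
  have "lin_extend bar ?u = restr {gs. Suc (length gs) = Suc n} ?e" using bar_restr_length[OF u(1), of "Suc n"] u(2) by simp
  also have "\<dots> = ?e" by (rule restr_ident[OF supported_mono[OF e]]) auto
  finally have "lin_extend bar ?u = ?e" .
  moreover have "?u \<in> supported {gs\<in>lists (sub \<sigma>). length gs = Suc n}"
    by (rule supported_mono[OF supported_restr[OF u(1)]]) auto
  ultimately have ex: "\<exists>z. z \<in> supported {gs\<in>lists (sub \<sigma>). length gs = Suc n} \<and>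
     lin_extend bar z = lin_extend (simplex_chain_at n) (simplex_boundary \<sigma>)"
    using simplex_chain_eq[OF Suc.prems] Suc.hyps(2) by auto
  have z: "simplex_chain \<sigma> = (SOME z. z \<in> supported {gs\<in>lists (sub \<sigma>). length gs = Suc n} \<and>
     lin_extend bar z = lin_extend (simplex_chain_at n) (simplex_boundary \<sigma>))"
    unfolding simplex_chain_def Suc.hyps(2)[symmetric] by simp
  show ?case using someI_ex[OF ex] simplex_chain_eq[OF Suc.prems] Suc.hyps(2)
    unfolding z[symmetric] by simp
qed

text \<open>
  The differential of the mapping cone of \<open>simplex_chain\<close>.
\<close>

fun cone_bd :: "'i set + ('i \<times> 'g) list set set list \<Rightarrow> (('i set + ('i \<times> 'g) list set set list) \<Rightarrow>\<^sub>0 'd)" where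
  "cone_bd (Inl \<sigma>) = push Inl (simplex_boundary \<sigma>) + push Inr (simplex_chain \<sigma>)"
| "cone_bd (Inr gs) = - push Inr (bar gs)"

definition cone_cells :: "'i set \<Rightarrow> ('i set + ('i \<times> 'g) list set set list) set" where
  "cone_cells W = Inl ` {\<sigma>\<in>K. \<sigma> \<subseteq> W} \<union> Inr ` lists (sub W)"

lemma cone_cells_iff [simp]:
  "Inl \<sigma> \<in> cone_cells W \<longleftrightarrow> \<sigma> \<in> K \<and> \<sigma> \<subseteq> W" "Inr gs \<in> cone_cells W \<longleftrightarrow> set gs \<subseteq> sub W"
  by (auto simp: cone_cells_def image_iff)

lemma cone_bd_Inr: "lin_extend cone_bd (push Inr c) = - push Inr (lin_extend bar c)"
  by (simp add: lin_extend_push lin_extend_fun_uminus push_lin_extend)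

lemma cone_bd_Inl: "lin_extend cone_bd (push Inl c) = push Inl (lin_extend simplex_boundary c) + push Inr (lin_extend simplex_chain c)"
  by (simp add: lin_extend_push lin_extend_fun_add push_lin_extend)

lemma cone_bd_total:
  "lin_extend cone_bd (push Inl a + push Inr y)
    = push Inl (lin_extend simplex_boundary a) + push Inr (lin_extend simplex_chain a - lin_extend bar y)"
  by (simp add: lin_extend_add cone_bd_Inl cone_bd_Inr push_linear)

lemma face_closed: "\<sigma> \<in> K \<Longrightarrow> (simplex_boundary \<sigma> :: _ \<Rightarrow>\<^sub>0 'd) \<in> supported {\<tau>\<in>K. \<tau> \<subseteq> \<sigma>}"
  by (rule supported_mono[OF simplex_boundary_supported]) (auto intro: K_facts(3))

lemma cone_bd_closed: "x \<in> cone_cells W \<Longrightarrow> cone_bd x \<in> supported (cone_cells W)"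
proof (cases x)
  case (Inl \<sigma>)
  assume "x \<in> cone_cells W"
  then have \<sigma>: "\<sigma> \<in> K" "\<sigma> \<subseteq> W" using Inl by (auto)
  have "push Inl (simplex_boundary \<sigma>) \<in> (supported (cone_cells W) :: (_ \<Rightarrow>\<^sub>0 'd) set)"
    using face_closed[OF \<sigma>(1)] by (rule supported_push) (use \<sigma> in \<open>auto\<close>)
  moreover have "push Inr (simplex_chain \<sigma>) \<in> supported (cone_cells W)"
    by (rule supported_push[OF conjunct1[OF simplex_chain[OF \<sigma>(1)]]])
      (use sub_mono[OF \<sigma>(2)] in \<open>auto\<close>)
  ultimately show ?thesis using Inl by (simp add: supported_add)
next
  case (Inr gs)
  assume "x \<in> cone_cells W"
  then have gs: "gs \<in> lists (sub W)" using Inr by (auto)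
  have "push Inr (bar gs) \<in> supported (cone_cells W)"
    by (rule supported_push[OF bar_supported[OF gs]]) (auto)
  then show ?thesis using Inr by simp
qed

lemma cone_bd_cone_bd: "x \<in> cone_cells W \<Longrightarrow> lin_extend cone_bd (cone_bd x) = 0"
proof (cases x)
  case (Inl \<sigma>)
  assume "x \<in> cone_cells W"
  then have \<sigma>: "\<sigma> \<in> K" using Inl by (auto)
  show ?thesis
    using simplex_chain[OF \<sigma>] simplex_boundary_boundary[OF K_facts(1)[OF \<sigma>], where 'd = 'd] Inl
    by (simp add: lin_extend_add cone_bd_Inl cone_bd_Inr)
next
  case (Inr gs)
  assume "x \<in> cone_cells W"
  then have "gs \<in> lists (sub W)" using Inr by (auto)
  then show ?thesis using Inr by (simp add: lin_extend_uminus cone_bd_Inr bar_bar del: in_lists_conv_set)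
qed

lemma cone_split:
  fixes c :: "_ \<Rightarrow>\<^sub>0 'd"
  assumes c: "c \<in> supported (cone_cells W)"
  obtains a y where "a \<in> supported {\<sigma>\<in>K. \<sigma> \<subseteq> W}" "y \<in> supported (lists (sub W))" "c = push Inl a + push Inr y"
proof
  define a where "a = lin_extend (\<lambda>x. case x of Inl \<sigma> \<Rightarrow> gen \<sigma> | Inr _ \<Rightarrow> 0) c"
  define y where "y = lin_extend (\<lambda>x. case x of Inl _ \<Rightarrow> 0 | Inr gs \<Rightarrow> gen gs) c"
  show "a \<in> supported {\<sigma>\<in>K. \<sigma> \<subseteq> W}"
    unfolding a_def using c by (rule supported_lin_extend) (auto simp: cone_cells_def)
  show "y \<in> supported (lists (sub W))"
    unfolding y_def using c by (rule supported_lin_extend) (auto simp: cone_cells_def)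
  have "push Inl a + push Inr y = lin_extend gen c"
    unfolding a_def y_def push_lin_extend lin_extend_fun_add[symmetric]
    by (rule lin_extend_cong) (auto split: sum.split)
  then show "c = push Inl a + push Inr y" by (simp add: lin_extend_gen)
qed

lemma cone_eq:
  fixes a a' :: "'x \<Rightarrow>\<^sub>0 'd" and y y' :: "'y \<Rightarrow>\<^sub>0 'd"
  assumes "push Inl a + push Inr y = push Inl a' + push Inr y'"
  shows "a = a'" "y = y'"
proof -
  let ?l = "lin_extend (case_sum gen (\<lambda>_. 0)) :: ('x + 'y \<Rightarrow>\<^sub>0 'd) \<Rightarrow> _"
  let ?r = "lin_extend (case_sum (\<lambda>_. 0) gen) :: ('x + 'y \<Rightarrow>\<^sub>0 'd) \<Rightarrow> _"
  have "?l (push Inl a + push Inr y) = a" "?r (push Inl a + push Inr y) = y" for a y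
    by (simp_all add: lin_extend_add lin_extend_push lin_extend_gen)
  then show "a = a'" "y = y'" using assms by metis+
qed


text \<open>
  The group is trivial, and the only simplex is the empty one, whose chain is \<open>[]\<close>. The bar complex of the trivial group is contracted
  by adding a unit in front, except in degree \<open>0\<close>, where \<open>[]\<close> is not a boundary of bar chains but the boundary of
  the empty simplex in the cone.
\<close>

lemma cone_cells_exact_empty: "exact_on cone_bd (cone_cells {})"
proof -
  interpret tw: twist GP \<chi> by (rule twist_GP)
  let ?e = "\<one>\<^bsub>GP\<^esub>"
  define s :: "'i set + _ \<Rightarrow> ('i set + _ \<Rightarrow>\<^sub>0 'd)" where
    "s = case_sum (\<lambda>_ :: 'i set. 0) (\<lambda>gs. if gs = [] then gen (Inl {}) else - gen (Inr (?e # gs)))"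
  have chi_one: "\<phi> (gen ?e) = 1" using tw.chi_one by (simp add: \<chi>_def)
  have lists1: "lists (sub {}) = lists {?e}" by (simp add: sub_empty)
  have bar2: "bar (?e # ?e # gs) = - push ((#) ?e) (tw.bar_rest (?e # gs))" for gs
    by (simp add: tw.bar_boundary_Cons chi_one)
  have cells: "cone_cells {} = insert (Inl {}) (Inr ` lists {?e})"
    using K_facts(4) by (auto simp: cone_cells_def lists1 simp del: in_lists_conv_set)
  show ?thesis
  proof (rule exact_on_contraction[where s = s])
    fix x assume x: "x \<in> cone_cells {}"
    then consider "x = Inl {}" | "x = Inr []" | gs where "x = Inr (?e # gs)" "gs \<in> lists {?e}"
    proof -
      have "x = Inl {} \<or> (\<exists>gs\<in>lists {?e}. x = Inr gs)" using x unfolding cells by blast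
      moreover have "gs = [] \<or> (\<exists>hs\<in>lists {?e}. gs = ?e # hs)" if "gs \<in> lists {?e}" for gs
        using that by (cases gs) auto
      ultimately show thesis using that by blast
    qed
    then have "s x \<in> supported (cone_cells {}) \<and> lin_extend cone_bd (s x) + lin_extend s (cone_bd x) = gen x"
    proof cases
      case 1
      then show ?thesis by (simp add: s_def simplex_chain_def)
    next
      case 2
      have "lin_extend cone_bd (s x) = gen (Inr [])" using 2 by (simp add: s_def simplex_chain_def)
      moreover have "cone_bd x = 0" using 2 by (simp add: bar_boundary_def)
      ultimately show ?thesis using 2 by (simp add: s_def cells)
    next
      case 3
      let ?g = "?e # gs"
      have "s x = - gen (Inr (?e # ?g))" using 3 by (simp add: s_def)
      then have d: "lin_extend cone_bd (s x) = - push Inr (push ((#) ?e) (tw.bar_rest ?g))"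
        by (simp add: lin_extend_uminus bar2 push_linear)
      have b: "bar ?g = gen gs + tw.bar_rest ?g" by (simp add: tw.bar_boundary_Cons chi_one)
      have "lin_extend s (cone_bd x) = push Inr (push ((#) ?e) (gen gs + tw.bar_rest ?g))"
      proof (cases "gs = []")
        case True
        then have "bar ?g = 0" unfolding b by simp
        then show ?thesis using 3 True by (simp add: push_linear)
      next
        case False
        have gL: "?g \<in> lists (sub {})" using 3 by (simp add: sub_empty)
        have "lin_extend s (push Inr (bar ?g)) = lin_extend (\<lambda>hs. - gen (Inr (?e # hs))) (bar ?g)"
          unfolding lin_extend_push using bar_supported[OF gL]
          by (rule lin_extend_cong_supported) (use False in \<open>auto simp: s_def\<close>)
        also have "\<dots> = - push Inr (push ((#) ?e) (bar ?g))"
          unfolding push_push by (simp add: lin_extend_fun_uminus push_def)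
        finally show ?thesis using 3 b by (simp add: lin_extend_uminus)
      qed
      then show ?thesis using d 3 by (simp add: push_linear s_def cells)
    qed
    then show "s x \<in> supported (cone_cells {})" "lin_extend cone_bd (s x) + lin_extend s (cone_bd x) = gen x"
      by blast+
  qed
qed

text \<open>
  By flagness the simplices in \<open>W\<close> form a cone with apex \<open>v\<close>. So the simplicial and the bar part of the mapping cone are
  both exact.
\<close>

lemma cone_cells_exact_cone:
  assumes W: "W \<subseteq> V" and v: "v \<in> W" and adj: "\<And>w. w \<in> W \<Longrightarrow> w \<noteq> v \<Longrightarrow> adjacent K v w"
  shows "exact_on cone_bd (cone_cells W)"
proof -
  have bar_ex: "exact_on bar (lists (sub W))" by (rule bar_exact_cone[OF W v adj])
  have exI: "exact_on cone_bd (Inr ` lists (sub W))"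
  proof (rule exact_on_image[where e = "- 1", OF bar_ex])
    show "bar xs \<in> supported (lists (sub W))" if "xs \<in> lists (sub W)" for xs
      by (rule supported_mono[OF bar_supported[OF that]]) auto
  qed (auto intro: inj_onI)
  have sx: "exact_on (simplex_boundary :: _ \<Rightarrow> _ \<Rightarrow>\<^sub>0 'd) {\<sigma>\<in>K. \<sigma> \<subseteq> W}"
  proof (rule cone_exact[of _ v])
    fix \<sigma> assume \<sigma>: "\<sigma> \<in> {\<sigma>\<in>K. \<sigma> \<subseteq> W}"
    show "finite \<sigma>" using \<sigma> K_facts(1) by auto
    show "\<tau> \<in> {\<sigma>\<in>K. \<sigma> \<subseteq> W}" if "\<tau> \<subseteq> \<sigma>" for \<tau> using \<sigma> K_facts(3) that by auto
    have sym: "adjacent K x y \<Longrightarrow> adjacent K y x" for x y by (auto simp: adjacent_def insert_commute)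
    have "adjacent K x y" if "x \<in> insert v \<sigma>" "y \<in> insert v \<sigma>" "x \<noteq> y" for x y
      using that \<sigma> adjacent_simplex[of \<sigma> x y] adj[of x] adj[of y] sym by blast
    then have "insert v \<sigma> \<in> K"
      using flag \<sigma> W v K_facts(1) unfolding flag_def by (metis finite_insert insert_subset mem_Collect_eq subset_trans)
    then show "insert v \<sigma> \<in> {\<sigma>\<in>K. \<sigma> \<subseteq> W}" using \<sigma> v by auto
  qed
  show ?thesis
  proof (rule exact_on_if_relative[OF exI])
    show "Inr ` lists (sub W) \<subseteq> cone_cells W" by (auto)
    show "lin_extend cone_bd (cone_bd x) = 0" if "x \<in> cone_cells W" for x using that by (rule cone_bd_cone_bd)
    fix c assume c: "c \<in> supported (cone_cells W)" "lin_extend cone_bd c = 0"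
    obtain a y where ay: "a \<in> supported {\<sigma>\<in>K. \<sigma> \<subseteq> W}" "y \<in> supported (lists (sub W))" "c = push Inl a + push Inr y"
      by (rule cone_split[OF c(1)])
    have "push Inl (lin_extend simplex_boundary a) + push Inr (lin_extend simplex_chain a - lin_extend bar y) = push Inl 0 + push Inr 0"
      using c(2) unfolding ay(3) cone_bd_total by simp
    then have "lin_extend simplex_boundary a = 0" by (rule cone_eq)
    then obtain u where u: "u \<in> supported {\<sigma>\<in>K. \<sigma> \<subseteq> W}" "a = lin_extend simplex_boundary u"
      using exact_onD[OF sx ay(1)] by blast
    have "c - lin_extend cone_bd (push Inl u) = push Inr (y - lin_extend simplex_chain u)"
      by (simp add: ay(3) u(2) cone_bd_Inl push_linear)
    moreover have "lin_extend simplex_chain u \<in> supported (lists (sub W))"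
      using u(1)
    proof (rule supported_lin_extend)
      fix \<sigma> assume "\<sigma> \<in> {\<sigma>\<in>K. \<sigma> \<subseteq> W}"
      then have \<sigma>: "\<sigma> \<in> K" "\<sigma> \<subseteq> W" by auto
      show "simplex_chain \<sigma> \<in> supported (lists (sub W))"
        by (rule supported_mono[OF conjunct1[OF simplex_chain[OF \<sigma>(1)]]]) (use sub_mono[OF \<sigma>(2)] in auto)
    qed
    then have "push Inr (y - lin_extend simplex_chain u) \<in> supported (Inr ` lists (sub W))"
      using ay(2) by (intro supported_push[OF supported_diff]) auto
    moreover have "push Inl u \<in> supported (cone_cells W)"
      using u(1) by (rule supported_push) (auto)
    ultimately show "\<exists>u\<in>supported (cone_cells W). c - lin_extend cone_bd u \<in> supported (Inr ` lists (sub W))"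
      by (intro bexI[of _ "push Inl u"]) simp_all
  qed
qed

text \<open>
  The cones of \<open>W - {v}\<close> and \<open>insert v L\<close> intersect in the cone of \<open>L\<close> and contain all simplices of \<open>W\<close>; what is
  missing in their union are bar chains of \<open>sub W\<close>, and \<open>bar_amalgam\<close> moves them there.
\<close>

lemma cone_cells_exact_amalgam:
  assumes W: "W \<subseteq> V" and v: "v \<in> W"
  defines "L \<equiv> {w\<in>W. adjacent K v w}"
  assumes exA: "exact_on cone_bd (cone_cells (W - {v}))" and exB: "exact_on cone_bd (cone_cells (insert v L))"
    and exL: "exact_on cone_bd (cone_cells L)"
  shows "exact_on cone_bd (cone_cells W)"
proof -
  let ?A = "W - {v}" and ?B = "insert v L"
  let ?T = "cone_cells ?A \<union> cone_cells ?B"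
  have int: "?A \<inter> ?B = L" by (auto simp: L_def adjacent_def)
  have cells_int: "cone_cells ?A \<inter> cone_cells ?B = cone_cells L"
  proof -
    have "lists (sub ?A) \<inter> lists (sub ?B) = lists (sub L)"
      using sub_Int[of ?A ?B] unfolding int by (simp only: lists_Int_eq[symmetric])
    moreover have "{\<sigma>\<in>K. \<sigma> \<subseteq> ?A} \<inter> {\<sigma>\<in>K. \<sigma> \<subseteq> ?B} = {\<sigma>\<in>K. \<sigma> \<subseteq> L}" using int by blast
    moreover have "(Inl ` P \<union> Inr ` Q) \<inter> (Inl ` P' \<union> Inr ` Q') = Inl ` (P \<inter> P') \<union> Inr ` (Q \<inter> Q')"
      for P P' :: "'i set set" and Q Q' :: "('i \<times> 'g) list set set list set" by auto
    ultimately show ?thesis unfolding cone_cells_def by simp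
  qed
  have exT: "exact_on cone_bd ?T"
    by (rule exact_on_union[OF exA exB exL[folded cells_int] cone_bd_closed cone_bd_closed cone_bd_cone_bd])
  have sub: "sub ?A \<subseteq> sub W" "sub ?B \<subseteq> sub W" using v by (auto intro!: sub_mono simp: L_def)
  have TS: "?T \<subseteq> cone_cells W"
    using sub v by (auto simp: cone_cells_def L_def simp del: in_lists_conv_set dest: subsetD[OF lists_mono])
  have simplices: "Inl \<sigma> \<in> ?T" if "\<sigma> \<in> K" "\<sigma> \<subseteq> W" for \<sigma>
  proof (cases "v \<in> \<sigma>")
    case True
    then have "\<sigma> \<subseteq> ?B" using that adjacent_simplex[of \<sigma> v] by (auto simp: L_def)
    then show ?thesis using that by (auto)
  qed (use that in \<open>auto\<close>)
  show ?thesis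
  proof (rule exact_on_if_relative[OF exT TS])
    show "lin_extend cone_bd (cone_bd x) = 0" if "x \<in> cone_cells W" for x using that by (rule cone_bd_cone_bd)
    fix c assume c: "c \<in> supported (cone_cells W)" "lin_extend cone_bd c = 0"
    obtain a y where ay: "a \<in> supported {\<sigma>\<in>K. \<sigma> \<subseteq> W}" "y \<in> supported (lists (sub W))" "c = push Inl a + push Inr y"
      by (rule cone_split[OF c(1)])
    have aT: "push Inl a \<in> supported ?T" using ay(1) by (rule supported_push) (use simplices in auto)
    have Tb: "cone_bd x \<in> supported ?T" if "x \<in> ?T" for x
      using that cone_bd_closed[of x ?A] cone_bd_closed[of x ?B] by (auto intro: supported_mono)
    have "push Inr (lin_extend bar y) = lin_extend cone_bd (push Inl a)"
      using c(2) unfolding ay(3) lin_extend_add cone_bd_Inr by simp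
    also have "\<dots> \<in> supported ?T" using aT Tb by (rule supported_lin_extend)
    finally have "push Inr (lin_extend bar y) \<in> supported ?T" .
    then have "lin_extend bar y \<in> supported (lists (sub ?A) \<union> lists (sub ?B))"
    proof -
      assume *: "push Inr (lin_extend bar y) \<in> supported ?T"
      have "lin_extend (case_sum (\<lambda>_ :: 'i set. 0) gen) (push Inr (lin_extend bar y)) \<in> (supported (lists (sub ?A) \<union> lists (sub ?B)) :: (_ \<Rightarrow>\<^sub>0 'd) set)"
        using * by (rule supported_lin_extend) (auto simp: cone_cells_def simp del: in_lists_conv_set)
      then show ?thesis by (simp add: lin_extend_push lin_extend_gen)
    qed
    then obtain u where u: "u \<in> supported (lists (sub W))" "y - lin_extend bar u \<in> supported (lists (sub ?A) \<union> lists (sub ?B))"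
      using bar_amalgam[OF W v ay(2)] unfolding L_def by blast
    have "c - lin_extend cone_bd (- push Inr u) = push Inl a + push Inr (y - lin_extend bar u)"
      by (simp add: ay(3) cone_bd_Inr push_linear lin_extend_uminus)
    moreover have "push Inr (y - lin_extend bar u) \<in> supported ?T"
      using u(2) by (rule supported_push) (auto)
    ultimately have "c - lin_extend cone_bd (- push Inr u) \<in> supported ?T" using aT by (simp add: supported_add)
    moreover have "- push Inr u \<in> supported (cone_cells W)"
    proof -
      have "push Inr u \<in> supported (cone_cells W)"
        using u(1) by (rule supported_push) (auto)
      then show ?thesis by simp
    qed
    ultimately show "\<exists>u\<in>supported (cone_cells W). c - lin_extend cone_bd u \<in> supported ?T" by blast
  qed
qed

lemma cone_cells_exact: "W \<subseteq> V \<Longrightarrow> exact_on cone_bd (cone_cells W)"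
proof (induction "card W" arbitrary: W rule: less_induct)
  case less
  have fin: "finite W" using less.prems finite_V by (rule finite_subset)
  show ?case
  proof (cases "W = {}")
    case True
    then show ?thesis using cone_cells_exact_empty by simp
  next
    case False
    then obtain v where v: "v \<in> W" by blast
    define L where "L = {w\<in>W. adjacent K v w}"
    show ?thesis
    proof (cases "insert v L = W")
      case True
      show ?thesis
        by (rule cone_cells_exact_cone[OF less.prems v]) (use True L_def in blast)
    next
      case nc: False
      have LW: "L \<subseteq> W" "v \<notin> L" by (auto simp: L_def adjacent_def)
      have sub: "W - {v} \<subset> W" "insert v L \<subset> W" "L \<subset> W" using v nc LW by auto
      have "exact_on cone_bd (cone_cells U)" if "U \<subset> W" for U
        using less.hyps[OF psubset_card_mono[OF fin that]] that less.prems by blast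
      then show ?thesis
        using cone_cells_exact_amalgam[OF less.prems v] sub unfolding L_def by blast
    qed
  qed
qed

text \<open>
  A cycle of the mapping cone is a pair \<open>(c, y)\<close> with \<open>\<partial> c = 0\<close> and \<open>z(c) = bar y\<close>. If \<open>z(c)\<close> is a boundary, exactness of the cone
  makes \<open>c\<close> a boundary; for \<open>c = 0\<close>, exactness says that every cycle \<open>y\<close> is \<open>z(a)\<close> for a cycle \<open>a\<close>, up to a
  boundary. The cone is ungraded, so the bounding chains have to be cut down to the right degree.
\<close>

lemma homology_map:
  fixes p :: int
  shows "subquotient_map
    {c\<in>supported {\<sigma>\<in>K. int (card \<sigma>) = p}. lin_extend simplex_boundary c = 0}
    (lin_extend simplex_boundary ` supported {\<sigma>\<in>K. int (card \<sigma>) = p + 1})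
    {c\<in>supported {gs. set gs \<subseteq> carrier GP \<and> int (length gs) = p}. lin_extend bar c = 0}
    (lin_extend bar ` supported {gs. set gs \<subseteq> carrier GP \<and> int (length gs) = p + 1})
    simplex_chain"
proof -
  let ?S = "\<lambda>q. {\<sigma>\<in>K. int (card \<sigma>) = q}" and ?T = "\<lambda>q. {gs. set gs \<subseteq> carrier GP \<and> int (length gs) = q}"
  let ?b = "simplex_boundary :: _ \<Rightarrow> _ \<Rightarrow>\<^sub>0 'd"
  have all: "\<sigma> \<subseteq> V" if "\<sigma> \<in> K" for \<sigma> using K_facts(2) that by auto
  have TL: "?T q \<subseteq> lists (sub V)" for q by (auto simp: sub_carrier)
  have bS: "?b \<sigma> \<in> supported (?S (q - 1))" if "\<sigma> \<in> ?S q" for \<sigma> q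
  proof (rule supported_mono[OF simplex_boundary_supported], clarify)
    fix v assume v: "v \<in> \<sigma>"
    have "finite \<sigma>" using that K_facts(1) by auto
    then have "card \<sigma> = Suc (card (\<sigma> - {v}))" using v by (rule card.remove)
    then show "\<sigma> - {v} \<in> K \<and> int (card (\<sigma> - {v})) = q - 1" using that K_facts(3)[of \<sigma>] by auto
  qed
  have bT: "bar gs \<in> supported (?T (q - 1))" if "gs \<in> ?T q" for gs q
    by (rule supported_mono[OF bar_supported[of gs V]]) (use that in \<open>auto simp: sub_carrier\<close>)
  have z: "simplex_chain \<sigma> \<in> supported (?T q)" "lin_extend bar (simplex_chain \<sigma>) = lin_extend simplex_chain (?b \<sigma>)"
    if "\<sigma> \<in> ?S q" for \<sigma> q
  proof -
    have \<sigma>: "\<sigma> \<in> K" using that by simp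
    show "simplex_chain \<sigma> \<in> supported (?T q)"
      by (rule supported_mono[OF conjunct1[OF simplex_chain[OF \<sigma>]]])
        (use that sub_mono[OF all[OF \<sigma>]] in \<open>auto simp: sub_carrier\<close>)
    show "lin_extend bar (simplex_chain \<sigma>) = lin_extend simplex_chain (?b \<sigma>)" using simplex_chain[OF \<sigma>] by simp
  qed
  have zc: "lin_extend bar (lin_extend simplex_chain c) = lin_extend simplex_chain (lin_extend ?b c)"
    if "c \<in> supported (?S q)" for c q
    unfolding lin_extend_compose using that by (rule lin_extend_cong_supported) (rule z(2))
  have zT: "lin_extend simplex_chain c \<in> supported (?T q)" if "c \<in> supported (?S q)" for c q
    using that z(1) by (rule supported_lin_extend)
  have sqS: "subquotient {c\<in>supported (?S p). lin_extend ?b c = 0} (lin_extend ?b ` supported (?S (p + 1)))"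
    using bS[of _ "p + 1"] simplex_boundary_boundary K_facts(1) by (intro subquotient_homology) auto
  have sqT: "subquotient {c\<in>supported (?T p). lin_extend bar c = 0} (lin_extend bar ` supported (?T (p + 1)))"
  proof (rule subquotient_homology)
    fix gs assume gs: "gs \<in> ?T (p + 1)"
    show "bar gs \<in> supported (?T p)" using bT[OF gs] by simp
    show "lin_extend bar (bar gs) = 0" using gs TL by (intro bar_bar[of _ V]) blast
  qed
  have restr_S: "restr {\<sigma>. int (card \<sigma>) = q - 1} (lin_extend ?b c) = lin_extend ?b (restr {\<sigma>. int (card \<sigma>) = q} c)"
    if "c \<in> supported {\<sigma>\<in>K. \<sigma> \<subseteq> V}" for c q
    using that
  proof (rule restr_lin_extend_degree)
    fix \<sigma> assume \<sigma>: "\<sigma> \<in> {\<sigma>\<in>K. \<sigma> \<subseteq> V}"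
    have *: "?b \<sigma> \<in> supported (?S (int (card \<sigma>) - 1))" using bS[of \<sigma> "int (card \<sigma>)"] \<sigma> by simp
    show "?b \<sigma> \<in> supported {\<sigma>. int (card \<sigma>) = q - 1}" if "\<sigma> \<in> {\<sigma>. int (card \<sigma>) = q}"
      by (rule supported_mono[OF *]) (use that in auto)
    show "?b \<sigma> \<in> supported (- {\<sigma>. int (card \<sigma>) = q - 1})" if "\<sigma> \<notin> {\<sigma>. int (card \<sigma>) = q}"
      by (rule supported_mono[OF *]) (use that in auto)
  qed
  have restr_T: "restr {gs. int (length gs) = q - 1} (lin_extend bar c) = lin_extend bar (restr {gs. int (length gs) = q} c)"
    if "c \<in> supported (lists (sub V))" for c q
    using that
  proof (rule restr_lin_extend_degree)
    fix gs assume gs: "gs \<in> lists (sub V)"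
    note * = bar_supported[OF gs]
    show "bar gs \<in> supported {gs. int (length gs) = q - 1}" if "gs \<in> {gs. int (length gs) = q}"
      by (rule supported_mono[OF *]) (use that in auto)
    show "bar gs \<in> supported (- {gs. int (length gs) = q - 1})" if "gs \<notin> {gs. int (length gs) = q}"
      by (rule supported_mono[OF *]) (use that in auto)
  qed
  have restr_z: "restr {gs. int (length gs) = q} (lin_extend simplex_chain c) = lin_extend simplex_chain (restr {\<sigma>. int (card \<sigma>) = q} c)"
    if "c \<in> supported {\<sigma>\<in>K. \<sigma> \<subseteq> V}" for c q
    using that
  proof (rule restr_lin_extend_degree)
    fix \<sigma> assume \<sigma>: "\<sigma> \<in> {\<sigma>\<in>K. \<sigma> \<subseteq> V}"
    have *: "simplex_chain \<sigma> \<in> supported (?T (int (card \<sigma>)))" using z(1)[of \<sigma> "int (card \<sigma>)"] \<sigma> by simp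
    show "simplex_chain \<sigma> \<in> supported {gs. int (length gs) = q}" if "\<sigma> \<in> {\<sigma>. int (card \<sigma>) = q}"
      by (rule supported_mono[OF *]) (use that in auto)
    show "simplex_chain \<sigma> \<in> supported (- {gs. int (length gs) = q})" if "\<sigma> \<notin> {\<sigma>. int (card \<sigma>) = q}"
      by (rule supported_mono[OF *]) (use that in auto)
  qed
  have bound: "\<exists>a w. a \<in> supported {\<sigma>\<in>K. \<sigma> \<subseteq> V} \<and> w \<in> supported (lists (sub V)) \<and>
      c = lin_extend ?b a \<and> y = lin_extend simplex_chain a - lin_extend bar w"
    if c: "c \<in> supported (?S q)" "lin_extend ?b c = 0" and y: "y \<in> supported (?T q')"
      and eq: "lin_extend simplex_chain c = lin_extend bar y" for c y q q'
  proof -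
    have "push Inl c \<in> supported (cone_cells V)"
      using c(1) by (rule supported_push) (use all in \<open>auto\<close>)
    moreover have "push Inr y \<in> supported (cone_cells V)"
      using y by (rule supported_push) (use TL in \<open>auto simp: sub_carrier\<close>)
    ultimately have "push Inl c + push Inr y \<in> supported (cone_cells V)" by (rule supported_add)
    moreover have "lin_extend cone_bd (push Inl c + push Inr y) = 0"
      unfolding cone_bd_total c(2) eq by simp
    ultimately obtain u where u: "u \<in> supported (cone_cells V)" "push Inl c + push Inr y = lin_extend cone_bd u"
      using exact_onD[OF cone_cells_exact[OF subset_refl]] by blast
    obtain a w where aw: "a \<in> supported {\<sigma>\<in>K. \<sigma> \<subseteq> V}" "w \<in> supported (lists (sub V))" "u = push Inl a + push Inr w"
      by (rule cone_split[OF u(1)])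
    have "push Inl c + push Inr y = push Inl (lin_extend ?b a) + push Inr (lin_extend simplex_chain a - lin_extend bar w)"
      using u(2) unfolding aw(3) cone_bd_total .
    then have "c = lin_extend ?b a" "y = lin_extend simplex_chain a - lin_extend bar w" by (rule cone_eq)+
    then show ?thesis using aw by blast
  qed
  interpret A: subquotient "{c\<in>supported (?S p). lin_extend ?b c = 0}" "lin_extend ?b ` supported (?S (p + 1))" by (rule sqS)
  interpret A': subquotient "{c\<in>supported (?T p). lin_extend bar c = 0}" "lin_extend bar ` supported (?T (p + 1))" by (rule sqT)
  show ?thesis
  proof unfold_locales
    show "lin_extend simplex_chain c \<in> {c\<in>supported (?T p). lin_extend bar c = 0}"
      if "c \<in> {c\<in>supported (?S p). lin_extend ?b c = 0}" for c
      using that zT[of c p] zc[of c p] by simp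
    show "lin_extend simplex_chain c \<in> lin_extend bar ` supported (?T (p + 1))"
      if cB: "c \<in> lin_extend ?b ` supported (?S (p + 1))" for c
    proof -
      obtain w where w: "w \<in> supported (?S (p + 1))" "c = lin_extend ?b w" using cB by blast
      then have "lin_extend simplex_chain c = lin_extend bar (lin_extend simplex_chain w)" using zc[OF w(1)] by simp
      then show ?thesis using zT[OF w(1)] by blast
    qed
    fix c assume c: "c \<in> {c\<in>supported (?S p). lin_extend ?b c = 0}"
      and "lin_extend simplex_chain c \<in> lin_extend bar ` supported (?T (p + 1))"
    then obtain y where y: "y \<in> supported (?T (p + 1))" "lin_extend simplex_chain c = lin_extend bar y" by blast
    obtain a where a: "a \<in> supported {\<sigma>\<in>K. \<sigma> \<subseteq> V}" "c = lin_extend ?b a"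
      using bound[of c p y "p + 1"] c y by blast
    have "lin_extend ?b (restr {\<sigma>. int (card \<sigma>) = p + 1} a) = restr {\<sigma>. int (card \<sigma>) = p} c"
      using restr_S[OF a(1), of "p + 1"] a(2) by simp
    also have "\<dots> = c" by (rule restr_ident[OF supported_mono]) (use c in auto)
    finally have "c = lin_extend ?b (restr {\<sigma>. int (card \<sigma>) = p + 1} a)" by simp
    moreover have "restr {\<sigma>. int (card \<sigma>) = p + 1} a \<in> supported (?S (p + 1))"
      by (rule supported_mono[OF supported_restr[OF a(1)]]) auto
    ultimately show "c \<in> lin_extend ?b ` supported (?S (p + 1))" by blast
  next
    fix y assume y: "y \<in> {c\<in>supported (?T p). lin_extend bar c = 0}"
    obtain a w where aw: "a \<in> supported {\<sigma>\<in>K. \<sigma> \<subseteq> V}" "w \<in> supported (lists (sub V))"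
      "0 = lin_extend ?b a" "y = lin_extend simplex_chain a - lin_extend bar w"
      using bound[of 0 p y p] y by auto
    let ?a = "restr {\<sigma>. int (card \<sigma>) = p} a" and ?w = "restr {gs. int (length gs) = p + 1} w"
    have "y = restr {gs. int (length gs) = p} y"
      by (rule restr_ident[OF supported_mono, symmetric]) (use y in auto)
    also have "\<dots> = lin_extend simplex_chain ?a - lin_extend bar ?w"
      unfolding aw(4) using restr_z[OF aw(1), of p] restr_T[OF aw(2), of "p + 1"] by (simp add: restr_linear)
    finally have "y - lin_extend simplex_chain ?a = lin_extend bar (- ?w)" by (simp add: lin_extend_uminus)
    moreover have "- ?w \<in> supported (?T (p + 1))"
    proof -
      have "?w \<in> supported (?T (p + 1))"
        by (rule supported_mono[OF supported_restr[OF aw(2)]]) (auto simp: sub_carrier)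
      then show ?thesis by simp
    qed
    ultimately have "y - lin_extend simplex_chain ?a \<in> lin_extend bar ` supported (?T (p + 1))" by blast
    moreover have "?a \<in> {c\<in>supported (?S p). lin_extend ?b c = 0}"
    proof -
      have "?a \<in> supported (?S p)" by (rule supported_mono[OF supported_restr[OF aw(1)]]) auto
      moreover have "lin_extend ?b ?a = 0" using restr_S[OF aw(1), of p] aw(3) by simp
      ultimately show ?thesis by blast
    qed
    ultimately show "\<exists>c\<in>{c\<in>supported (?S p). lin_extend ?b c = 0}.
        y - lin_extend simplex_chain c \<in> lin_extend bar ` supported (?T (p + 1))" by blast
  qed
qed

lemma simplicial_subquotient:
  "subquotient {c\<in>supported {\<sigma>\<in>K. int (card \<sigma>) = p}. lin_extend (simplex_boundary :: _ \<Rightarrow> _ \<Rightarrow>\<^sub>0 'k::division_ring) c = 0}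
    (lin_extend simplex_boundary ` supported {\<sigma>\<in>K. int (card \<sigma>) = p + 1})"
proof (rule subquotient_homology)
  fix \<sigma> assume \<sigma>: "\<sigma> \<in> {\<sigma>\<in>K. int (card \<sigma>) = p + 1}"
  then have fin: "finite \<sigma>" using K_facts(1) by auto
  show "lin_extend simplex_boundary (simplex_boundary \<sigma>) = (0 :: _ \<Rightarrow>\<^sub>0 'k)"
    by (rule simplex_boundary_boundary[OF fin])
  show "simplex_boundary \<sigma> \<in> (supported {\<sigma>\<in>K. int (card \<sigma>) = p} :: (_ \<Rightarrow>\<^sub>0 'k) set)"
  proof (rule supported_mono[OF simplex_boundary_supported], clarify)
    fix v assume v: "v \<in> \<sigma>"
    have "card \<sigma> = Suc (card (\<sigma> - {v}))" using fin v by (rule card.remove)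
    then show "\<sigma> - {v} \<in> K \<and> int (card (\<sigma> - {v})) = p" using \<sigma> K_facts(3)[of \<sigma>] by auto
  qed
qed

lemma simplicial_homology_Q:
  "reduced_simplicial_homology K (p - 1) =
    subquotient.Q {c\<in>supported {\<sigma>\<in>K. int (card \<sigma>) = p}. lin_extend (simplex_boundary :: _ \<Rightarrow> _ \<Rightarrow>\<^sub>0 'k::division_ring) c = 0}
    (lin_extend simplex_boundary ` supported {\<sigma>\<in>K. int (card \<sigma>) = p + 1})"
  unfolding reduced_simplicial_homology_def simplicial_chains_def[abs_def]
  using complex_homology_Q[of "\<lambda>q. {\<sigma>\<in>K. int (card \<sigma>) = q + 1}" "p - 1" "simplex_boundary :: _ \<Rightarrow> _ \<Rightarrow>\<^sub>0 'k"]
    simplicial_subquotient[of p, where 'k = 'k]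
  by simp

lemma homology_graph_product:
  "vs_iso (group_homology GP \<phi> p) (reduced_simplicial_homology K (p - 1) :: ('d, ('i set \<Rightarrow>\<^sub>0 'd) set) module) \<and>
   vs_dim (group_homology GP \<phi> p) = vs_dim (reduced_simplicial_homology K (p - 1) :: ('f, ('i set \<Rightarrow>\<^sub>0 'f) set) module)"
proof -
  let ?bF = "simplex_boundary :: 'i set \<Rightarrow> ('i set \<Rightarrow>\<^sub>0 'f)" and ?bD = "simplex_boundary :: 'i set \<Rightarrow> ('i set \<Rightarrow>\<^sub>0 'd)"
  let ?S = "{\<sigma>\<in>K. int (card \<sigma>) = p}" and ?S' = "{\<sigma>\<in>K. int (card \<sigma>) = p + 1}"
  interpret m: subquotient_map "{c\<in>supported ?S. lin_extend ?bD c = 0}" "lin_extend ?bD ` supported ?S'"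
    "{c\<in>supported {gs. set gs \<subseteq> carrier GP \<and> int (length gs) = p}. lin_extend bar c = 0}"
    "lin_extend bar ` supported {gs. set gs \<subseteq> carrier GP \<and> int (length gs) = p + 1}" simplex_chain
    by (rule homology_map)
  interpret QF: subquotient "{c\<in>supported ?S. lin_extend ?bF c = 0}" "lin_extend ?bF ` supported ?S'"
    by (rule simplicial_subquotient)
  interpret j: scalar_extension "\<lambda>a. \<phi> (Poly_Mapping.single \<one>\<^bsub>GP\<^esub> a)" by (rule scalar_extension)
  have HG: "group_homology GP \<phi> p = m.A'.Q"
    unfolding group_homology_def bar_chains_def[abs_def] by (rule complex_homology_Q[OF m.A'.subquotient_axioms])
  have HD: "reduced_simplicial_homology K (p - 1) = m.A.Q" by (rule simplicial_homology_Q)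
  have HF: "reduced_simplicial_homology K (p - 1) = QF.Q" by (rule simplicial_homology_Q)
  have "K \<subseteq> Pow V" using K_facts(2) by blast
  then have "finite ?S" using finite_V by (metis (no_types, lifting) finite_Pow_iff finite_subset mem_Collect_eq subsetI)
  then obtain R where R: "QF.basis_family R (\<lambda>z. z)" using QF.basis_family_ex[of ?S] by blast
  (* A basis over 'f is extended to 'd and then carried to the group homology; all three bases are indexed by R. *)
  have "m.A.basis_family R (\<lambda>z. j.ext z)"
    by (rule j.homology_basis_ext[OF j.simplex_boundary_ext QF.subquotient_axioms m.A.subquotient_axioms R])
  then have "m.A'.basis_family R (\<lambda>z. lin_extend simplex_chain (j.ext z))" by (rule m.basis_family_map)
  then have "vs_dim m.A'.Q = enat (card R)" by (rule m.A'.vs_dim_Q)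
  moreover have "vs_dim QF.Q = enat (card R)" using R by (rule QF.vs_dim_Q)
  ultimately show ?thesis unfolding HG HD HF using m.vs_iso_Q by simp
qed

end

theorem theorem3p15:
  fixes m :: nat
    and K :: "nat set set"
    and \<Gamma> :: "nat \<Rightarrow> 'g monoid"
    and \<phi> :: "((nat \<times> 'g) list set set \<Rightarrow>\<^sub>0 'f::division_ring) \<Rightarrow> 'd::division_ring"
  assumes "simplicial_complex {1..m} K"
    and "flag {1..m} K"
    and "\<And>i. i \<in> {1..m} \<Longrightarrow> group (\<Gamma> i)"
    and "agrarian_map (graph_product {1..m} K \<Gamma>) \<phi>"
    and "\<And>i n. i \<in> {1..m} \<Longrightarrow>
      carrier (group_homology (\<Gamma> i) (vertex_restrict {1..m} K \<Gamma> \<phi> i) n)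
        = {\<zero>\<^bsub>group_homology (\<Gamma> i) (vertex_restrict {1..m} K \<Gamma> \<phi> i) n\<^esub>}"
  shows "\<forall>p::int.
    vs_iso (group_homology (graph_product {1..m} K \<Gamma>) \<phi> p)
      (reduced_simplicial_homology K (p - 1) :: ('d, (nat set \<Rightarrow>\<^sub>0 'd) set) module) \<and>
    vs_dim (group_homology (graph_product {1..m} K \<Gamma>) \<phi> p)
      = vs_dim (reduced_simplicial_homology K (p - 1) :: ('f, (nat set \<Rightarrow>\<^sub>0 'f) set) module)"
proof
  interpret acyclic_graph_product "{1..m}" \<Gamma> K \<phi>
    by (intro acyclic_graph_product.intro graph_product_family.intro group_family.intro
        acyclic_graph_product_axioms.intro) (rule assms finite_atLeastAtMost | assumption)+
  show "vs_iso (group_homology (graph_product {1..m} K \<Gamma>) \<phi> p)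
      (reduced_simplicial_homology K (p - 1) :: ('d, (nat set \<Rightarrow>\<^sub>0 'd) set) module) \<and>
    vs_dim (group_homology (graph_product {1..m} K \<Gamma>) \<phi> p)
      = vs_dim (reduced_simplicial_homology K (p - 1) :: ('f, (nat set \<Rightarrow>\<^sub>0 'f) set) module)" for p
    by (rule homology_graph_product)
qed

end
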